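(* For each $\gamma \in (0,\infty)$ and $a > 1$, the infimum of the values of $s > 0$ for which $$\lim_{t \rightarrow 0} P^t_{a,\gamma} f(x) = 2\pi f(x) \quad \text{for almost every } x \in \mathbb{R}, \text{ whenever } f \in H^s(\mathbb{R}),$$ is $$\min\left(\frac{1}{4}\, a \left(1 - \frac{1}{\gamma}\right)^{+},\ \frac{1}{4}\right).$$ Moreover, this almost everywhere convergence also occurs for all $f \in L^2(\mathbb{R})$ when $\gamma \in (0,1]$, and for all $f \in H^{\frac{1}{4}}(\mathbb{R})$ when $\gamma \in \left[\frac{a}{a-1}, \infty\right)$.
   Context: The Fourier transform is normalised as $\widehat{f}(\xi) = \int_{\mathbb{R}} f(x) e^{-ix\xi}\, dx$ (extended to $L^2(\mathbb{R})$ in the usual way), and $H^s(\mathbb{R})$ is the Sobolev space with norm $\Vert f \Vert_{H^s(\mathbb{R})} = \left(\int_{\mathbb{R}} (1+\xi^2)^s |\widehat{f}(\xi)|^2 \, d\xi\right)^{1/2}$. For $a > 1$, $\gamma > 0$, $t > 0$ and $x \in \mathbb{R}$, define $$P^t_{a,\gamma} f(x) = \int_{\mathbb{R}} \widehat{f}(\xi)\, e^{it|\xi|^a} e^{-t^{\gamma}|\xi|^a} e^{ix\xi}\, d\xi,$$ an absolutely convergent integral for every $f \in L^2(\mathbb{R})$. The limit $t \to 0$ is taken through $t > 0$. For $y \in \mathbb{R}$, $y^{+} = \max(0,y)$. *)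

theory Defs
  imports "HOL-Analysis.Analysis"
begin

text \<open>
  Elements of \<open>L\<^sup>2(\<real>)\<close> are represented by actual functions rather than classes modulo null sets;
  none of the notions below depends on the representative.
\<close>

definition L2 :: "(real \<Rightarrow> complex) set" where
  "L2 = {f. f \<in> borel_measurable lebesgue \<and> integrable lebesgue (\<lambda>x. (cmod (f x))\<^sup>2)}"

definition fourier_integral :: "(real \<Rightarrow> complex) \<Rightarrow> real \<Rightarrow> complex" where
  "fourier_integral f \<xi> = (\<integral>x. f x * exp (- (\<i> * complex_of_real (x * \<xi>))) \<partial>lebesgue)"

text \<open>
  Extension of the Fourier transform to \<open>L\<^sup>2(\<real>)\<close>: the \<open>L\<^sup>2\<close>-limit of the Fourier integrals of the
  truncations of \<open>f\<close> to \<open>[-n, n]\<close>, which belong to \<open>L\<^sup>1 \<inter> L\<^sup>2\<close>.  For \<open>f \<in> L\<^sup>2\<close> the limit exists by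
  Plancherel's theorem, and is unique up to a null set.  The \<open>L\<^sup>2\<close>-distance is a nonnegative
  integral, so that a divergent integral is \<open>\<infinity>\<close> and not \<open>0\<close>.
\<close>

definition is_L2_fourier :: "(real \<Rightarrow> complex) \<Rightarrow> (real \<Rightarrow> complex) \<Rightarrow> bool" where
  "is_L2_fourier f g \<longleftrightarrow> g \<in> L2 \<and>
     (\<lambda>n::nat. \<integral>\<^sup>+\<xi>. ennreal ((cmod (fourier_integral
          (\<lambda>x. indicator {- real n..real n} x * f x) \<xi> - g \<xi>))\<^sup>2) \<partial>lebesgue) \<longlonglongrightarrow> 0"

definition fourier :: "(real \<Rightarrow> complex) \<Rightarrow> real \<Rightarrow> complex" where
  "fourier f = (SOME g. is_L2_fourier f g)"

text \<open>Only for \<open>s \<ge> 0\<close>, where \<open>H\<^sup>s(\<real>)\<close> is contained in \<open>L\<^sup>2(\<real>)\<close>.\<close>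

definition sobolev :: "real \<Rightarrow> (real \<Rightarrow> complex) set" where
  "sobolev s = {f \<in> L2. integrable lebesgue (\<lambda>\<xi>. (1 + \<xi>\<^sup>2) powr s * (cmod (fourier f \<xi>))\<^sup>2)}"

definition P :: "real \<Rightarrow> real \<Rightarrow> real \<Rightarrow> (real \<Rightarrow> complex) \<Rightarrow> real \<Rightarrow> complex" where
  "P a \<gamma> t f x =
     (\<integral>\<xi>. fourier f \<xi> * exp (\<i> * complex_of_real (t * \<bar>\<xi>\<bar> powr a))
        * complex_of_real (exp (- (t powr \<gamma>) * \<bar>\<xi>\<bar> powr a))
        * exp (\<i> * complex_of_real (x * \<xi>)) \<partial>lebesgue)"

definition ae_convergent :: "real \<Rightarrow> real \<Rightarrow> (real \<Rightarrow> complex) \<Rightarrow> bool" where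
  "ae_convergent a \<gamma> f \<longleftrightarrow>
     (AE x in lebesgue. ((\<lambda>t. P a \<gamma> t f x) \<longlongrightarrow> 2 * complex_of_real pi * f x) (at_right 0))"

definition convergence_exponents :: "real \<Rightarrow> real \<Rightarrow> real set" where
  "convergence_exponents a \<gamma> = {s. s > 0 \<and> (\<forall>f \<in> sobolev s. ae_convergent a \<gamma> f)}"

end

theory Submission imports Defs "HOL-Probability.Probability" begin

text \<open>
  \<^bold>\<open>Positive results.\<close>  If the Fourier transform of \<open>f\<close> has compact support, there is convergence
  everywhere, so that a local \<open>L\<^sup>2\<close> bound for the maximal function over \<open>t > 0\<close> suffices.  Linearise it by a measurable
  choice of the time \<open>\<tau>(x)\<close> and use \<open>TT\<^sup>*\<close> with the weight \<open>\<bar>\<xi>\<bar> powr - (2 * s)\<close>: the kernel is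
  an oscillatory integral with phase \<open>u * \<xi> + v * \<bar>\<xi>\<bar> powr a\<close>, where \<open>u = x - y\<close> and \<open>v = \<tau>(x) - \<tau>(y)\<close>, and
  with damping \<open>exp (- w * \<bar>\<xi>\<bar> powr a)\<close>, where \<open>w \<ge> \<bar>v\<bar> powr \<gamma>\<close>.  Van der Corput's lemma bounds the contribution
  of the stationary point \<open>\<xi>\<^sub>0\<close>, with \<open>\<xi>\<^sub>0 powr (a - 1) = u / (a * \<bar>v\<bar>)\<close>, by
  \<open>u powr - (1/2) * \<xi>\<^sub>0 powr (1/2 - 2 * s) * exp (- w * (\<xi>\<^sub>0 / 2) powr a)\<close>.  Uniformly in \<open>v\<close> and \<open>w\<close> this is locally
  integrable in \<open>u\<close> if \<open>s = 1/4\<close>, and also for smaller \<open>s\<close> above the stated exponent, because there the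
  damping prevails for large \<open>\<xi>\<^sub>0\<close>.
  If \<open>\<gamma> \<le> 1\<close>, the damping dominates the oscillation, the multiplier has a Fourier transform bounded by a
  dilated Cauchy kernel, and there is convergence at every Lebesgue point.

  \<^bold>\<open>Sharpness.\<close>  Let \<open>q = max (a / \<gamma>) (a - 1)\<close>.  For \<open>t\<close> of order \<open>N powr - q\<close> the damping is harmless at frequency
  \<open>N\<close>, and a wave packet with frequencies in \<open>[N, N + W]\<close>, \<open>W = N powr ((2 - a + q) / 2)\<close>, moves a distance of
  order \<open>l = N powr (a - 1 - q)\<close> without dispersing.  The sum of its translates by the multiples of \<open>l\<close> attains
  at every \<open>x\<close> in \<open>[0, 1]\<close>, at a suitable time, the height of a single packet, whereas the translates are
  almost orthogonal.  Below the exponent the height exceeds every multiple of the Sobolev norm as \<open>N\<close> grows.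
  A lacunary sum of such functions diverges on \<open>[0, 1]\<close>: at the times of the \<open>k\<close>-th term the later terms
  are damped away and the earlier ones are bounded.
\<close>

section \<open>The \<open>TT\<^sup>*\<close> bound\<close>

text \<open>Both halves are power counts, and they meet at the same exponent. At a stationary point
  \<open>x0\<close> one has \<open>\<bar>v\<bar> = u / (a * x0 powr (a - 1))\<close>, so
  \<open>w \<ge> \<bar>v\<bar> powr \<gamma>\<close> makes the damping exponent at least a constant
  times \<open>u powr \<gamma> * x0 powr (a - \<gamma> * (a - 1))\<close>. This grows with
  \<open>x0\<close> exactly when \<open>\<gamma> < a / (a - 1)\<close>; maximising the damped power
  \<open>x0 powr (1/2 - 2 * s)\<close> then leaves a power of \<open>u\<close> that is integrable at
  0 exactly when \<open>s > a * (1 - 1/\<gamma>) / 4\<close>. On the other side, about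
  \<open>1 / l\<close> translates of a packet of height \<open>A\<close> have squared Sobolev norm
  of order \<open>N powr (2 * s) * A\<^sup>2 / (l * W)\<close>, and \<open>l * W\<close> is of order
  \<open>N powr ((a - q) / 2)\<close>; this is small against \<open>A\<^sup>2\<close> exactly when
  \<open>s < (a - q) / 4\<close>. The two entries of the maximum \<open>q\<close> produce the two
  entries of the minimum in the theorem.\<close>

lemma measurable_cis [measurable]: "cis \<in> borel_measurable borel"
  by (intro borel_measurable_continuous_onI continuous_intros)

lemma measurable_cnj [measurable]: "cnj \<in> borel_measurable borel"
  by (intro borel_measurable_continuous_onI continuous_intros)

text \<open>The squared \<open>L2\<close> norm as a nonnegative integral, so that
  \<open>nsq f < \<infinity>\<close> is a meaningful test. The analysis is carried out with Borel
  functions on \<open>lborel\<close>; the last section transfers it to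
  \<open>lebesgue\<close>.\<close>

definition nsq :: "(real \<Rightarrow> complex) \<Rightarrow> ennreal" where
  "nsq f = (\<integral>\<^sup>+x. ennreal ((cmod (f x))\<^sup>2) \<partial>lborel)"

definition FI :: "(real \<Rightarrow> complex) \<Rightarrow> real \<Rightarrow> complex" where
  "FI f \<xi> = (\<integral>x. f x * cis (- (x * \<xi>)) \<partial>lborel)"

lemma nn_integral_translate:
  fixes \<kappa> :: "real \<Rightarrow> ennreal"
  assumes [measurable]: "\<kappa> \<in> borel_measurable borel"
  shows "(\<integral>\<^sup>+y. \<kappa> (y - x) \<partial>lborel) = (\<integral>\<^sup>+y. \<kappa> y \<partial>lborel)"
    and "(\<integral>\<^sup>+y. \<kappa> (x - y) \<partial>lborel) = (\<integral>\<^sup>+y. \<kappa> y \<partial>lborel)"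
  using nn_integral_real_affine[of \<kappa> 1 "-x"] nn_integral_real_affine[of \<kappa> "-1" x]
  by (simp_all add: algebra_simps)

text \<open>Schur's test: the square expands by Fubini into a double integral over \<open>x\<close>
  and \<open>y\<close> whose inner integral is at most \<open>\<kappa> (x - y)\<close>, and
  \<open>\<kappa>\<close> then acts as a convolution kernel. Since \<open>bound\<close> is asked
  only where \<open>h\<close> does not vanish, a kernel cut off to a bounded interval is admissible
  when \<open>h\<close> has bounded support. The lemma serves the Plancherel bound as well as the
  maximal estimate.\<close>

lemma TTstar_bound:
  fixes h :: "real \<Rightarrow> complex" and k :: "real \<Rightarrow> real \<Rightarrow> complex" and \<mu> \<kappa> :: "real \<Rightarrow> real"
  assumes h: "integrable lborel h"
    and k [measurable]: "case_prod k \<in> borel_measurable (borel \<Otimes>\<^sub>M borel)"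
    and k1: "\<And>x \<xi>. cmod (k x \<xi>) \<le> 1"
    and \<mu>: "integrable lborel \<mu>" "\<And>\<xi>. \<mu> \<xi> \<ge> 0"
    and \<kappa> [measurable]: "\<kappa> \<in> borel_measurable borel" and \<kappa>0: "\<And>u. \<kappa> u \<ge> 0"
    and bound: "\<And>x y. h x \<noteq> 0 \<Longrightarrow> h y \<noteq> 0 \<Longrightarrow>
      cmod (\<integral>\<xi>. of_real (\<mu> \<xi>) * (k x \<xi> * cnj (k y \<xi>)) \<partial>lborel) \<le> \<kappa> (x - y)"
  shows "(\<integral>\<^sup>+\<xi>. ennreal (\<mu> \<xi> * (cmod (\<integral>x. h x * k x \<xi> \<partial>lborel))\<^sup>2) \<partial>lborel)
    \<le> (\<integral>\<^sup>+u. ennreal (\<kappa> u) \<partial>lborel) * nsq h"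
proof -
  have [measurable]: "h \<in> borel_measurable borel" "\<mu> \<in> borel_measurable borel"
    using h \<mu>(1) by (auto dest: borel_measurable_integrable)
  have [measurable]: "k x \<in> borel_measurable borel" for x
    using measurable_Pair2[OF k, of x] by simp
  have [measurable]: "(\<lambda>x. k x \<xi>) \<in> borel_measurable borel" for \<xi>
    using measurable_Pair1[OF k, of \<xi>] by simp
  interpret P2: pair_sigma_finite "lborel :: real measure" "lborel \<Otimes>\<^sub>M lborel :: (real \<times> real) measure" ..
  \<comment> \<open>The expanded integrand. Integrability of \<open>\<mu>\<close> and
    \<open>h\<close> together with \<open>cmod (k x \<xi>) \<le> 1\<close> makes it integrable in
    all three variables, as Fubini requires.\<close>
  define \<Phi> where "\<Phi> \<xi> p = of_real (\<mu> \<xi>) * (h (fst p) * k (fst p) \<xi> * cnj (h (snd p) * k (snd p) \<xi>))"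
    for \<xi> and p :: "real \<times> real"
  have [measurable]: "case_prod \<Phi> \<in> borel_measurable (lborel \<Otimes>\<^sub>M (lborel \<Otimes>\<^sub>M lborel))"
    unfolding \<Phi>_def case_prod_beta' by measurable
  have bd: "cmod (\<Phi> \<xi> p) \<le> \<mu> \<xi> * (cmod (h (fst p)) * cmod (h (snd p)))" for \<xi> p
  proof -
    have "cmod (\<Phi> \<xi> p) = \<mu> \<xi> * (cmod (h (fst p)) * cmod (h (snd p))) * (cmod (k (fst p) \<xi>) * cmod (k (snd p) \<xi>))"
      using \<mu>(2) by (simp add: \<Phi>_def norm_mult)
    also have "\<dots> \<le> \<mu> \<xi> * (cmod (h (fst p)) * cmod (h (snd p))) * (1 * 1)"
      using \<mu>(2) by (intro mult_left_mono mult_mono k1) auto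
    finally show ?thesis by simp
  qed
  have fin: "(\<integral>\<^sup>+x. ennreal (cmod (h x)) \<partial>lborel) < \<infinity>" "(\<integral>\<^sup>+x. ennreal (\<mu> x) \<partial>lborel) < \<infinity>"
    using h \<mu> by (auto simp: integrable_iff_bounded)
  have int\<Phi>: "integrable (lborel \<Otimes>\<^sub>M (lborel \<Otimes>\<^sub>M lborel)) (case_prod \<Phi>)"
  proof (rule integrableI_bounded)
    have "(\<integral>\<^sup>+z. ennreal (cmod (case_prod \<Phi> z)) \<partial>(lborel \<Otimes>\<^sub>M (lborel \<Otimes>\<^sub>M lborel)))
      \<le> (\<integral>\<^sup>+z. ennreal (\<mu> (fst z)) * (ennreal (cmod (h (fst (snd z)))) * ennreal (cmod (h (snd (snd z)))))
            \<partial>(lborel \<Otimes>\<^sub>M (lborel \<Otimes>\<^sub>M lborel)))"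
      by (intro nn_integral_mono)
         (use bd \<mu>(2) in \<open>auto simp: ennreal_mult[symmetric] case_prod_beta intro!: ennreal_leI\<close>)
    also have "\<dots> = (\<integral>\<^sup>+x. ennreal (\<mu> x) \<partial>lborel) * ((\<integral>\<^sup>+x. ennreal (cmod (h x)) \<partial>lborel) * (\<integral>\<^sup>+x. ennreal (cmod (h x)) \<partial>lborel))"
      by (subst lborel_pair.P.nn_integral_fst[symmetric], measurable)
         (simp add: nn_integral_cmult nn_integral_multc lborel.nn_integral_fst[symmetric])
    also have "\<dots> < \<infinity>"
      using fin by (auto simp: ennreal_mult_less_top)
    finally show "(\<integral>\<^sup>+z. ennreal (cmod (case_prod \<Phi> z)) \<partial>(lborel \<Otimes>\<^sub>M (lborel \<Otimes>\<^sub>M lborel))) < \<infinity>" .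
  qed measurable
  define H where "H \<xi> = (\<integral>x. h x * k x \<xi> \<partial>lborel)" for \<xi>
  have [measurable]: "H \<in> borel_measurable borel"
    unfolding H_def by measurable
  have inth: "integrable lborel (\<lambda>x. h x * k x \<xi>)" for \<xi>
    by (rule Bochner_Integration.integrable_bound[OF h]) (auto simp: norm_mult mult_left_le k1)
  have \<Phi>1: "(\<integral>p. \<Phi> \<xi> p \<partial>(lborel \<Otimes>\<^sub>M lborel)) = of_real (\<mu> \<xi> * (cmod (H \<xi>))\<^sup>2)" for \<xi>
  proof -
    have i: "integrable (lborel \<Otimes>\<^sub>M lborel) (\<lambda>(x,y). of_real (\<mu> \<xi>) * (h x * k x \<xi> * cnj (h y * k y \<xi>)))"
    proof (rule lborel_pair.Fubini_integrable)
      show "integrable lborel (\<lambda>x. \<integral>y. norm (case (x, y) of (x, y) \<Rightarrow> of_real (\<mu> \<xi>) * (h x * k x \<xi> * cnj (h y * k y \<xi>))) \<partial>lborel)"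
        using inth[of \<xi>, THEN integrable_norm] \<mu>(2) by (simp add: norm_mult)
    qed (use inth in \<open>auto simp del: complex_cnj_mult\<close>)
    have "(\<integral>p. \<Phi> \<xi> p \<partial>(lborel \<Otimes>\<^sub>M lborel)) = (\<integral>x. \<integral>y. of_real (\<mu> \<xi>) * (h x * k x \<xi> * cnj (h y * k y \<xi>)) \<partial>lborel \<partial>lborel)"
      using lborel_pair.integral_fst[OF i] unfolding \<Phi>_def case_prod_beta' by (rule sym)
    also have "\<dots> = of_real (\<mu> \<xi>) * (H \<xi> * cnj (H \<xi>))"
      by (simp add: H_def del: complex_cnj_mult)
    finally show ?thesis by (simp only: of_real_mult complex_norm_square)
  qed
  have i1: "integrable lborel (\<lambda>\<xi>. \<mu> \<xi> * (cmod (H \<xi>))\<^sup>2)"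
    using P2.integrable_fst[OF int\<Phi>] unfolding \<Phi>1 by (simp only: complex_of_real_integrable_eq)
  have "(\<integral>\<^sup>+\<xi>. ennreal (\<mu> \<xi> * (cmod (H \<xi>))\<^sup>2) \<partial>lborel) = ennreal (\<integral>\<xi>. \<mu> \<xi> * (cmod (H \<xi>))\<^sup>2 \<partial>lborel)"
    by (rule nn_integral_eq_integral[OF i1]) (simp add: \<mu>(2))
  also have "\<dots> \<le> ennreal (cmod (\<integral>\<xi>. complex_of_real (\<mu> \<xi> * (cmod (H \<xi>))\<^sup>2) \<partial>lborel))"
    unfolding integral_complex_of_real norm_of_real by (intro ennreal_leI) simp
  also have "(\<integral>\<xi>. complex_of_real (\<mu> \<xi> * (cmod (H \<xi>))\<^sup>2) \<partial>lborel) = (\<integral>p. \<integral>\<xi>. \<Phi> \<xi> p \<partial>lborel \<partial>(lborel \<Otimes>\<^sub>M lborel))"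
    using P2.Fubini_integral[OF int\<Phi>] by (simp add: \<Phi>1)
  also have "ennreal (cmod \<dots>) \<le> (\<integral>\<^sup>+p. ennreal (cmod (\<integral>\<xi>. \<Phi> \<xi> p \<partial>lborel)) \<partial>(lborel \<Otimes>\<^sub>M lborel))"
    by (intro integral_norm_bound_ennreal P2.integrable_snd[OF int\<Phi>])
  \<comment> \<open>The product of the two values of \<open>h\<close> is split by the
    arithmetic-geometric mean inequality. Each half contains only one of them, and integrating out
    the other variable yields the mass of \<open>\<kappa>\<close>.\<close>
  also have "\<dots> \<le> (\<integral>\<^sup>+p. ennreal ((cmod (h (fst p)))\<^sup>2 / 2 * \<kappa> (fst p - snd p)) + ennreal ((cmod (h (snd p)))\<^sup>2 / 2 * \<kappa> (fst p - snd p)) \<partial>(lborel \<Otimes>\<^sub>M lborel))"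
  proof (rule nn_integral_mono)
    fix p :: "real \<times> real"
    let ?a = "cmod (h (fst p))" and ?b = "cmod (h (snd p))"
    have "(\<integral>\<xi>. \<Phi> \<xi> p \<partial>lborel) = (\<integral>\<xi>. (h (fst p) * cnj (h (snd p))) * (of_real (\<mu> \<xi>) * (k (fst p) \<xi> * cnj (k (snd p) \<xi>))) \<partial>lborel)"
      by (simp add: \<Phi>_def mult_ac)
    also have "\<dots> = h (fst p) * cnj (h (snd p)) * (\<integral>\<xi>. of_real (\<mu> \<xi>) * (k (fst p) \<xi> * cnj (k (snd p) \<xi>)) \<partial>lborel)"
      by (rule integral_mult_right_zero)
    also have "cmod \<dots> \<le> ?a * ?b * \<kappa> (fst p - snd p)"
      using mult_left_mono[OF bound[of "fst p" "snd p"], of "?a * ?b"]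
      by (cases "h (fst p) = 0 \<or> h (snd p) = 0") (auto simp: norm_mult)
    also have "\<dots> \<le> (?a\<^sup>2 / 2 + ?b\<^sup>2 / 2) * \<kappa> (fst p - snd p)"
      using sum_squares_bound[of ?a ?b] by (intro mult_right_mono \<kappa>0) (simp add: field_simps)
    finally show "ennreal (cmod (\<integral>\<xi>. \<Phi> \<xi> p \<partial>lborel)) \<le> ennreal (?a\<^sup>2 / 2 * \<kappa> (fst p - snd p)) + ennreal (?b\<^sup>2 / 2 * \<kappa> (fst p - snd p))"
      using \<kappa>0 by (simp add: ennreal_plus[symmetric] algebra_simps del: ennreal_plus) 
  qed
  also have "\<dots> = (\<integral>\<^sup>+p. ennreal ((cmod (h (fst p)))\<^sup>2 / 2 * \<kappa> (fst p - snd p)) \<partial>(lborel \<Otimes>\<^sub>M lborel)) + (\<integral>\<^sup>+p. ennreal ((cmod (h (snd p)))\<^sup>2 / 2 * \<kappa> (fst p - snd p)) \<partial>(lborel \<Otimes>\<^sub>M lborel))"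
    by (rule nn_integral_add) measurable
  also have "\<dots> = (\<integral>\<^sup>+x. ennreal ((cmod (h x))\<^sup>2 / 2) \<partial>lborel) * (\<integral>\<^sup>+u. ennreal (\<kappa> u) \<partial>lborel) + (\<integral>\<^sup>+x. ennreal ((cmod (h x))\<^sup>2 / 2) \<partial>lborel) * (\<integral>\<^sup>+u. ennreal (\<kappa> u) \<partial>lborel)"
    using nn_integral_translate[of "\<lambda>u. ennreal (\<kappa> u)"] \<kappa>0
    by (subst lborel.nn_integral_fst[symmetric], measurable, subst lborel_pair.nn_integral_snd[symmetric], measurable)
       (simp add: ennreal_mult nn_integral_cmult nn_integral_multc del: times_divide_eq_left)
  also have "\<dots> = (\<integral>\<^sup>+u. ennreal (\<kappa> u) \<partial>lborel) * ((\<integral>\<^sup>+x. ennreal ((cmod (h x))\<^sup>2 / 2) \<partial>lborel) + (\<integral>\<^sup>+x. ennreal ((cmod (h x))\<^sup>2 / 2) \<partial>lborel))"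
    by (simp add: algebra_simps)
  also have "(\<integral>\<^sup>+x. ennreal ((cmod (h x))\<^sup>2 / 2) \<partial>lborel) + (\<integral>\<^sup>+x. ennreal ((cmod (h x))\<^sup>2 / 2) \<partial>lborel) = nsq h"
    unfolding nsq_def by (subst nn_integral_add[symmetric], measurable) (simp flip: ennreal_plus)
  finally show ?thesis unfolding H_def .
qed

section \<open>Gaussian integrals and the square mean bound for Fourier integrals\<close>

lemma nn_integral_Fatou_bound:
  fixes u :: "nat \<Rightarrow> 'a \<Rightarrow> ennreal"
  assumes [measurable]: "\<And>n. u n \<in> borel_measurable M"
    and lim: "AE x in M. (\<lambda>n. u n x) \<longlonglongrightarrow> v x"
    and le: "\<And>n. (\<integral>\<^sup>+x. u n x \<partial>M) \<le> c n" and c: "c \<longlonglongrightarrow> C"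
  shows "(\<integral>\<^sup>+x. v x \<partial>M) \<le> C"
proof -
  have "(\<integral>\<^sup>+x. v x \<partial>M) = (\<integral>\<^sup>+x. liminf (\<lambda>n. u n x) \<partial>M)"
    using lim by (intro nn_integral_cong_AE) (auto dest!: lim_imp_Liminf[rotated])
  also have "\<dots> \<le> liminf (\<lambda>n. \<integral>\<^sup>+x. u n x \<partial>M)"
    by (rule nn_integral_liminf) measurable
  also have "\<dots> \<le> liminf c"
    by (intro Liminf_mono always_eventually allI le)
  also have "\<dots> = C" using c by (intro lim_imp_Liminf) auto
  finally show ?thesis .
qed

text \<open>Read off from the characteristic function of the standard normal distribution by a
  linear substitution.\<close>

lemma gaussian_fourier:
  fixes \<epsilon> u :: real
  assumes "\<epsilon> > 0"
  shows gaussian_integrable: "integrable lborel (\<lambda>\<xi>. exp (- \<epsilon> * \<xi>\<^sup>2))"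
    and "(\<integral>\<xi>. of_real (exp (- \<epsilon> * \<xi>\<^sup>2)) * cis (u * \<xi>) \<partial>lborel) = of_real (sqrt (pi / \<epsilon>) * exp (- u\<^sup>2 / (4 * \<epsilon>)))"
proof -
  \<comment> \<open>With \<open>c\<^sup>2 = 2 * \<epsilon>\<close> the substitution
    \<open>x = c * \<xi>\<close> turns \<open>x\<^sup>2 / 2\<close> into
    \<open>\<epsilon> * \<xi>\<^sup>2\<close>.\<close>
  define c where "c = sqrt (2 * \<epsilon>)"
  have c: "c > 0" "c\<^sup>2 = 2 * \<epsilon>" using assms by (auto simp: c_def)
  have e: "\<epsilon> * \<xi>\<^sup>2 = (c * \<xi>)\<^sup>2 / 2" for \<xi> using c by (simp add: power_mult_distrib)
  have "integrable lborel std_normal_density"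
    by simp
  then have "integrable lborel (\<lambda>x. sqrt (2 * pi) * std_normal_density (0 + c * x))"
    using c by (intro integrable_mult_right) (simp only: lborel_integrable_real_affine_iff)
  then show "integrable lborel (\<lambda>\<xi>. exp (- \<epsilon> * \<xi>\<^sup>2))"
    by (simp add: std_normal_density_def e)
  have "complex_of_real (exp (- (u / c)\<^sup>2 / 2)) = char std_normal_distribution (u / c)"
    by (simp add: char_std_normal_distribution)
  also have "\<dots> = (\<integral>x. std_normal_density x *\<^sub>R cis (u / c * x) \<partial>lborel)"
    unfolding char_def by (subst integral_density) (auto simp: cis_conv_exp mult_ac normal_density_nonneg)
  also have "\<dots> = c *\<^sub>R (\<integral>\<xi>. std_normal_density (0 + c * \<xi>) *\<^sub>R cis (u / c * (0 + c * \<xi>)) \<partial>lborel)"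
    using c by (subst lborel_integral_real_affine[where c = c and t = 0]) auto
  also have "\<dots> = (c / sqrt (2 * pi)) * (\<integral>\<xi>. of_real (exp (- \<epsilon> * \<xi>\<^sup>2)) * cis (u * \<xi>) \<partial>lborel)"
    using c by (simp add: std_normal_density_def e scaleR_conv_of_real mult.assoc)
  finally have "(\<integral>\<xi>. of_real (exp (- \<epsilon> * \<xi>\<^sup>2)) * cis (u * \<xi>) \<partial>lborel)
      = of_real (sqrt (2 * pi) / c) * of_real (exp (- (u / c)\<^sup>2 / 2))"
    using c by (simp add: field_simps)
  moreover have "sqrt (2 * pi) / c = sqrt (pi / \<epsilon>)"
    by (simp add: c_def real_sqrt_divide[symmetric])
  moreover have "(u / c)\<^sup>2 / 2 = u\<^sup>2 / (4 * \<epsilon>)"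
    using c by (simp add: power_divide)
  ultimately show "(\<integral>\<xi>. of_real (exp (- \<epsilon> * \<xi>\<^sup>2)) * cis (u * \<xi>) \<partial>lborel) = of_real (sqrt (pi / \<epsilon>) * exp (- u\<^sup>2 / (4 * \<epsilon>)))"
    by simp
qed

lemma gaussian_integral:
  fixes \<epsilon> :: real
  assumes "\<epsilon> > 0"
  shows "(\<integral>\<xi>. exp (- \<epsilon> * \<xi>\<^sup>2) \<partial>lborel) = sqrt (pi / \<epsilon>)"
proof -
  have "complex_of_real (\<integral>\<xi>. exp (- \<epsilon> * \<xi>\<^sup>2) \<partial>lborel) = of_real (sqrt (pi / \<epsilon>))"
    using gaussian_fourier(2)[OF assms, of 0] by (simp flip: integral_complex_of_real)
  then show ?thesis by (simp only: of_real_eq_iff)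
qed

text \<open>The mass \<open>2 * pi\<close> is the same for every \<open>\<epsilon>\<close>; it
  becomes the constant in the Plancherel bound and in Fourier inversion.\<close>

lemma gaussian_transform_integral:
  fixes \<epsilon> :: real
  assumes "\<epsilon> > 0"
  shows "integrable lborel (\<lambda>u. sqrt (pi / \<epsilon>) * exp (- u\<^sup>2 / (4 * \<epsilon>)))"
    "(\<integral>u. sqrt (pi / \<epsilon>) * exp (- u\<^sup>2 / (4 * \<epsilon>)) \<partial>lborel) = 2 * pi"
proof -
  have e: "- u\<^sup>2 / (4 * \<epsilon>) = - (1 / (4 * \<epsilon>)) * u\<^sup>2" for u by simp
  have p: "1 / (4 * \<epsilon>) > 0" using assms by simp
  show "integrable lborel (\<lambda>u. sqrt (pi / \<epsilon>) * exp (- u\<^sup>2 / (4 * \<epsilon>)))"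
    unfolding e by (intro integrable_mult_right gaussian_integrable p)
  have "sqrt (pi / \<epsilon>) * sqrt (pi / (1 / (4 * \<epsilon>))) = sqrt ((2 * pi)\<^sup>2)"
    unfolding real_sqrt_mult[symmetric] using assms by (simp add: field_simps power2_eq_square)
  also have "\<dots> = 2 * pi" by (subst real_sqrt_abs) simp
  finally show "(\<integral>u. sqrt (pi / \<epsilon>) * exp (- u\<^sup>2 / (4 * \<epsilon>)) \<partial>lborel) = 2 * pi"
    unfolding e integral_mult_right_zero gaussian_integral[OF p] .
qed

lemma measurable_FI [measurable]:
  assumes [measurable]: "f \<in> borel_measurable borel"
  shows "FI f \<in> borel_measurable borel"
  unfolding FI_def[abs_def] by measurable

text \<open>The inequality half of Plancherel's theorem. With the weight
  \<open>exp (- \<epsilon> * \<xi>\<^sup>2)\<close> the kernel in \<open>TTstar_bound\<close> is a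
  Gaussian of mass \<open>2 * pi\<close>, whatever \<open>\<epsilon>\<close> is, and Fatou's lemma
  removes the weight as \<open>\<epsilon>\<close> tends to 0.\<close>

lemma nsq_FI_le:
  assumes h: "integrable lborel h"
  shows "nsq (FI h) \<le> ennreal (2 * pi) * nsq h"
proof -
  have [measurable]: "h \<in> borel_measurable borel"
    using h by (auto dest: borel_measurable_integrable)
  define \<epsilon> where "\<epsilon> n = 1 / (real n + 1)" for n
  have \<epsilon>: "\<epsilon> n > 0" for n by (simp add: \<epsilon>_def)
  have \<epsilon>lim: "\<epsilon> \<longlonglongrightarrow> 0" unfolding \<epsilon>_def by real_asymp
  show ?thesis unfolding nsq_def[of "FI h"]
  proof (rule nn_integral_Fatou_bound[where u = "\<lambda>n \<xi>. ennreal (exp (- \<epsilon> n * \<xi>\<^sup>2) * (cmod (FI h \<xi>))\<^sup>2)" and c = "\<lambda>n. ennreal (2 * pi) * nsq h"])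
    show "AE \<xi> in lborel. (\<lambda>n. ennreal (exp (- \<epsilon> n * \<xi>\<^sup>2) * (cmod (FI h \<xi>))\<^sup>2)) \<longlonglongrightarrow> ennreal ((cmod (FI h \<xi>))\<^sup>2)"
    proof (intro AE_I2 tendsto_ennrealI)
      fix \<xi> :: real
      have "(\<lambda>n. exp (- \<epsilon> n * \<xi>\<^sup>2) * (cmod (FI h \<xi>))\<^sup>2) \<longlonglongrightarrow> exp (- 0 * \<xi>\<^sup>2) * (cmod (FI h \<xi>))\<^sup>2"
        by (intro tendsto_intros \<epsilon>lim)
      then show "(\<lambda>n. exp (- \<epsilon> n * \<xi>\<^sup>2) * (cmod (FI h \<xi>))\<^sup>2) \<longlonglongrightarrow> (cmod (FI h \<xi>))\<^sup>2" by simp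
    qed
    fix n
    let ?\<kappa> = "\<lambda>u. sqrt (pi / \<epsilon> n) * exp (- u\<^sup>2 / (4 * \<epsilon> n))"
    have "(\<integral>\<^sup>+\<xi>. ennreal (exp (- \<epsilon> n * \<xi>\<^sup>2) * (cmod (\<integral>x. h x * cis (- (x * \<xi>)) \<partial>lborel))\<^sup>2) \<partial>lborel)
      \<le> (\<integral>\<^sup>+u. ennreal (?\<kappa> u) \<partial>lborel) * nsq h"
    proof (rule TTstar_bound[OF h])
      fix x y :: real
      have "(\<integral>\<xi>. of_real (exp (- \<epsilon> n * \<xi>\<^sup>2)) * (cis (- (x * \<xi>)) * cnj (cis (- (y * \<xi>)))) \<partial>lborel)
        = (\<integral>\<xi>. of_real (exp (- \<epsilon> n * \<xi>\<^sup>2)) * cis ((y - x) * \<xi>) \<partial>lborel)"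
        by (simp add: cis_cnj cis_mult algebra_simps)
      also have "\<dots> = of_real (?\<kappa> (x - y))"
        by (subst gaussian_fourier(2)[OF \<epsilon>]) (simp add: power2_commute)
      finally show "cmod (\<integral>\<xi>. of_real (exp (- \<epsilon> n * \<xi>\<^sup>2)) * (cis (- (x * \<xi>)) * cnj (cis (- (y * \<xi>)))) \<partial>lborel) \<le> ?\<kappa> (x - y)"
        using \<epsilon>[of n] by (simp add: norm_mult del: of_real_mult)
    qed (use \<epsilon>[of n] gaussian_integrable[OF \<epsilon>] in \<open>auto simp: less_imp_le\<close>)
    also have "(\<integral>\<^sup>+u. ennreal (?\<kappa> u) \<partial>lborel) = ennreal (2 * pi)"
      using gaussian_transform_integral[OF \<epsilon>[of n]] \<epsilon>[of n]
      by (subst nn_integral_eq_integral) (auto simp: less_imp_le)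
    finally show "(\<integral>\<^sup>+\<xi>. ennreal (exp (- \<epsilon> n * \<xi>\<^sup>2) * (cmod (FI h \<xi>))\<^sup>2) \<partial>lborel) \<le> ennreal (2 * pi) * nsq h"
      by (simp add: FI_def)
  qed auto
qed

section \<open>Square integrable functions: elementary inequalities and completeness\<close>

lemma nsq_add_le:
  assumes [measurable]: "f \<in> borel_measurable borel" "g \<in> borel_measurable borel"
  shows "nsq (\<lambda>x. f x + g x) \<le> 2 * nsq f + 2 * nsq g"
proof -
  have "(cmod (f x + g x))\<^sup>2 \<le> 2 * (cmod (f x))\<^sup>2 + 2 * (cmod (g x))\<^sup>2" for x
  proof -
    have "(cmod (f x + g x))\<^sup>2 \<le> (cmod (f x) + cmod (g x))\<^sup>2"
      by (intro power_mono norm_triangle_ineq) auto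
    also have "\<dots> \<le> 2 * (cmod (f x))\<^sup>2 + 2 * (cmod (g x))\<^sup>2"
      using sum_squares_bound[of "cmod (f x)" "cmod (g x)"] by (simp add: power2_sum)
    finally show ?thesis .
  qed
  then have "nsq (\<lambda>x. f x + g x) \<le> (\<integral>\<^sup>+x. ennreal (2 * (cmod (f x))\<^sup>2 + 2 * (cmod (g x))\<^sup>2) \<partial>lborel)"
    unfolding nsq_def by (intro nn_integral_mono ennreal_leI)
  also have "\<dots> = 2 * nsq f + 2 * nsq g"
    by (simp add: ennreal_plus ennreal_mult nn_integral_add nn_integral_cmult nsq_def)
  finally show ?thesis .
qed

lemma nsq_uminus: "nsq (\<lambda>x. - f x) = nsq f"
  by (simp add: nsq_def)

lemma nsq_commute: "nsq (\<lambda>x. f x - g x) = nsq (\<lambda>x. g x - f x)"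
  by (simp add: nsq_def norm_minus_commute)

lemma nsq_diff_le:
  assumes [measurable]: "f \<in> borel_measurable borel" "g \<in> borel_measurable borel"
  shows "nsq (\<lambda>x. f x - g x) \<le> 2 * nsq f + 2 * nsq g"
  using nsq_add_le[of f "\<lambda>x. - g x"] by (simp add: nsq_uminus)

lemma integrable_mult_nsq:
  assumes [measurable]: "f \<in> borel_measurable borel" "g \<in> borel_measurable borel"
    and "nsq f < \<infinity>" "nsq g < \<infinity>"
  shows "integrable lborel (\<lambda>x. f x * g x)"
proof (rule integrableI_bounded)
  have "(\<integral>\<^sup>+x. ennreal (cmod (f x * g x)) \<partial>lborel) \<le> (\<integral>\<^sup>+x. ennreal ((cmod (f x))\<^sup>2) + ennreal ((cmod (g x))\<^sup>2) \<partial>lborel)"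
  proof (rule nn_integral_mono)
    fix x
    have "cmod (f x) * cmod (g x) \<le> (cmod (f x))\<^sup>2 + (cmod (g x))\<^sup>2"
      using sum_squares_bound[of "cmod (f x)" "cmod (g x)"] mult_nonneg_nonneg[OF norm_ge_zero norm_ge_zero, of "f x" "g x"] by linarith
    then show "ennreal (cmod (f x * g x)) \<le> ennreal ((cmod (f x))\<^sup>2) + ennreal ((cmod (g x))\<^sup>2)"
      by (simp add: norm_mult flip: ennreal_plus)
  qed
  also have "\<dots> = nsq f + nsq g" by (simp add: nn_integral_add nsq_def)
  also have "\<dots> < \<infinity>" using assms by simp
  finally show "(\<integral>\<^sup>+x. ennreal (cmod (f x * g x)) \<partial>lborel) < \<infinity>" .
qed measurable

lemma norm_integral_mult_le:
  assumes [measurable]: "f \<in> borel_measurable borel" "g \<in> borel_measurable borel"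
  shows "ennreal ((cmod (\<integral>x. f x * g x \<partial>lborel))\<^sup>2) \<le> nsq f * nsq g"
\<comment> \<open>If the product is not integrable, its Bochner integral is 0 by convention and the
  bound is trivial.\<close>
proof (cases "integrable lborel (\<lambda>x. f x * g x)")
  case True
  have "ennreal ((cmod (\<integral>x. f x * g x \<partial>lborel))\<^sup>2) = (ennreal (cmod (\<integral>x. f x * g x \<partial>lborel)))\<^sup>2"
    by (simp add: ennreal_power)
  also have "\<dots> \<le> (\<integral>\<^sup>+x. ennreal (cmod (f x * g x)) \<partial>lborel)\<^sup>2"
    using integral_norm_bound_ennreal[OF True] by (intro power_mono) auto
  also have "\<dots> = (\<integral>\<^sup>+x. ennreal (cmod (f x)) * ennreal (cmod (g x)) \<partial>lborel)\<^sup>2"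
    by (simp add: norm_mult ennreal_mult)
  also have "\<dots> \<le> (\<integral>\<^sup>+x. (ennreal (cmod (f x)))\<^sup>2 \<partial>lborel) * (\<integral>\<^sup>+x. (ennreal (cmod (g x)))\<^sup>2 \<partial>lborel)"
    by (rule Cauchy_Schwarz_nn_integral) measurable
  also have "\<dots> = nsq f * nsq g" by (simp add: nsq_def ennreal_power)
  finally show ?thesis .
qed (simp add: not_integrable_integral_eq)

lemma tendsto_integral_mult_nsq:
  assumes [measurable]: "\<And>n. F n \<in> borel_measurable borel" "g \<in> borel_measurable borel" "h \<in> borel_measurable borel"
    and lim: "(\<lambda>n. nsq (\<lambda>x. F n x - g x)) \<longlonglongrightarrow> 0" and h: "nsq h < \<infinity>"
    and i: "\<And>n. integrable lborel (\<lambda>x. F n x * h x)" "integrable lborel (\<lambda>x. g x * h x)"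
  shows "(\<lambda>n. \<integral>x. F n x * h x \<partial>lborel) \<longlonglongrightarrow> (\<integral>x. g x * h x \<partial>lborel)"
proof -
  let ?d = "\<lambda>n. (\<integral>x. F n x * h x \<partial>lborel) - (\<integral>x. g x * h x \<partial>lborel)"
  have le: "ennreal ((cmod (?d n))\<^sup>2) \<le> nsq (\<lambda>x. F n x - g x) * nsq h" for n
    using norm_integral_mult_le[of "\<lambda>x. F n x - g x" h] i by (simp add: algebra_simps)
  have "(\<lambda>n. nsq (\<lambda>x. F n x - g x) * nsq h) \<longlonglongrightarrow> 0 * nsq h"
    using h by (intro tendsto_mult_ennreal lim tendsto_const) auto
  then have "(\<lambda>n. nsq (\<lambda>x. F n x - g x) * nsq h) \<longlonglongrightarrow> 0" by simp
  then have "(\<lambda>n. ennreal ((cmod (?d n))\<^sup>2)) \<longlonglongrightarrow> 0"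
    by (rule tendsto_sandwich[OF _ _ tendsto_const, rotated 2]) (use le in auto)
  then have "(\<lambda>n. (cmod (?d n))\<^sup>2) \<longlonglongrightarrow> 0"
    by (subst (asm) ennreal_0[symmetric], subst (asm) tendsto_ennreal_iff) auto
  then have "(\<lambda>n. sqrt ((cmod (?d n))\<^sup>2)) \<longlonglongrightarrow> sqrt 0"
    by (rule tendsto_real_sqrt)
  then have "(\<lambda>n. cmod (?d n)) \<longlonglongrightarrow> 0" by simp
  then show ?thesis by (simp add: tendsto_norm_zero_iff LIM_zero_iff)
qed

text \<open>Riesz-Fischer: a subsequence whose steps decay geometrically converges almost
  everywhere, and Fatou's lemma along it turns the Cauchy bound \<open>c n\<close> into a bound for
  the distance from \<open>F n\<close> to the limit, for every \<open>n\<close>.\<close>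

lemma nsq_complete:
  fixes F :: "nat \<Rightarrow> real \<Rightarrow> complex" and c :: "nat \<Rightarrow> ennreal"
  assumes [measurable]: "\<And>n. F n \<in> borel_measurable borel"
    and cauchy: "\<And>m n. n \<le> m \<Longrightarrow> nsq (\<lambda>x. F m x - F n x) \<le> c n" and c: "c \<longlonglongrightarrow> 0"
  shows "\<exists>g \<in> borel_measurable borel. (\<lambda>n. nsq (\<lambda>x. F n x - g x)) \<longlonglongrightarrow> 0"
proof -
  \<comment> \<open>The rate \<open>(1/8) ^ k\<close> leaves room twice: weighted by
    \<open>4 ^ k\<close> the squared steps still have summable integrals, and where the weighted sum
    is finite the steps themselves are at most a multiple of \<open>(1/2) ^ k\<close>.\<close>
  have "\<exists>N. \<forall>n\<ge>N. c n < ennreal ((1/8) ^ k)" for k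
    using order_tendstoD(2)[OF c, of "ennreal ((1/8) ^ k)"] by (auto simp: eventually_sequentially)
  then obtain N where N: "\<And>k n. n \<ge> N k \<Longrightarrow> c n < ennreal ((1/8) ^ k)" by metis
  \<comment> \<open>The sum makes \<open>r\<close> nondecreasing and at least \<open>N k\<close>;
    the summand \<open>k\<close> makes it tend to infinity.\<close>
  define r where "r k = (\<Sum>i\<le>k. N i) + k" for k
  have rN: "r k \<ge> N k" for k
    unfolding r_def by (rule trans_le_add1) (rule member_le_sum; simp)
  have rSuc: "r k \<le> r (Suc k)" and rk: "k \<le> r k" for k by (auto simp: r_def)
  define D where "D k x = F (r (Suc k)) x - F (r k) x" for k x
  have [measurable]: "D k \<in> borel_measurable borel" for k unfolding D_def by measurable
  have Dk: "nsq (D k) \<le> ennreal ((1/8) ^ k)" for k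
    unfolding D_def using cauchy[OF rSuc, of k] N[OF rN, of k] by (meson order.trans less_imp_le)
  define S where "S x = (\<Sum>k. ennreal (4 ^ k * (cmod (D k x))\<^sup>2))" for x
  have [measurable]: "S \<in> borel_measurable borel" unfolding S_def by measurable
  have "(\<integral>\<^sup>+x. S x \<partial>lborel) = (\<integral>\<^sup>+x. (\<Sum>k. ennreal (4 ^ k * (cmod (D k x))\<^sup>2)) \<partial>lborel)" by (simp only: S_def)
  also have "\<dots> = (\<Sum>k. ennreal (4 ^ k) * nsq (D k))"
    by (subst nn_integral_suminf, measurable) (simp add: ennreal_mult nn_integral_cmult nsq_def)
  also have "\<dots> \<le> (\<Sum>k. ennreal ((1/2) ^ k))"
  proof (intro suminf_le)
    fix k
    have "ennreal (4 ^ k) * nsq (D k) \<le> ennreal (4 ^ k) * ennreal ((1/8) ^ k)"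
      by (intro mult_left_mono Dk) simp
    also have "\<dots> = ennreal ((1/2) ^ k)"
      by (simp add: ennreal_mult[symmetric] power_mult_distrib[symmetric])
    finally show "ennreal (4 ^ k) * nsq (D k) \<le> ennreal ((1/2) ^ k)" .
  qed auto
  also have "\<dots> < \<infinity>"
    by (subst suminf_ennreal2) (auto intro!: summable_geometric)
  finally have fin: "(\<integral>\<^sup>+x. S x \<partial>lborel) < \<infinity>" .
  have AEfin: "AE x in lborel. S x \<noteq> \<infinity>"
    by (rule nn_integral_PInf_AE[OF _ less_imp_neq[OF fin]]) measurable
  have pw: "convergent (\<lambda>k. F (r k) x)" if elim: "S x \<noteq> \<infinity>" for x
  proof -
    obtain B where B0: "B \<ge> 0" and SB: "S x = ennreal B"
      using elim by (cases "S x" rule: ennreal_cases) auto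
    have B: "4 ^ k * (cmod (D k x))\<^sup>2 \<le> B" for k
    proof -
      have "sum (\<lambda>k. ennreal (4 ^ k * (cmod (D k x))\<^sup>2)) {k} \<le> ennreal B"
        unfolding SB[symmetric] S_def by (rule sum_le_suminf) auto
      then have "ennreal (4 ^ k * (cmod (D k x))\<^sup>2) \<le> ennreal B" by (simp only: sum.insert sum.empty finite.emptyI empty_iff not_False_eq_True add_0_right)
      then show ?thesis using ennreal_le_iff[OF B0] by (rule iffD1[rotated])
    qed
    have "cmod (D k x) \<le> sqrt B * (1/2) ^ k" for k
    proof -
      have "(2::real) * 2 = 4" by simp
      then have e: "((2::real) ^ k)\<^sup>2 = 4 ^ k"
        by (simp only: power2_eq_square power_mult_distrib[symmetric])
      have "(2 ^ k * cmod (D k x))\<^sup>2 \<le> B" using B[of k] by (simp only: power_mult_distrib e)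
      then have "2 ^ k * cmod (D k x) \<le> sqrt B" by (rule real_le_rsqrt)
      then have "(1/2) ^ k * (2 ^ k * cmod (D k x)) \<le> (1/2) ^ k * sqrt B" by (rule mult_left_mono) simp
      moreover have "(1/2) ^ k * 2 ^ k = (1::real)" by (simp only: power_mult_distrib[symmetric]) simp
      ultimately show ?thesis by (simp only: mult.assoc[symmetric] mult_1_left mult.commute[of "sqrt B"])
    qed
    then have "summable (\<lambda>k. D k x)"
      by (intro summable_comparison_test'[OF summable_mult[OF summable_geometric]]) auto
    then have "convergent (\<lambda>n. (\<Sum>k<n. D k x) + F (r 0) x)"
      by (intro convergent_add convergent_const) (simp add: summable_iff_convergent)
    then show ?thesis
      unfolding D_def by (subst (asm) sum_lessThan_telescope[of "\<lambda>k. F (r k) x"]) simp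
  qed
  have conv: "AE x in lborel. convergent (\<lambda>k. F (r k) x)"
    using AEfin by (rule eventually_mono) (rule pw)
  define g where "g x = lim (\<lambda>k. F (r k) x)" for x
  have [measurable]: "g \<in> borel_measurable borel"
    unfolding g_def by (rule borel_measurable_lim_metric) measurable
  have "nsq (\<lambda>x. F n x - g x) \<le> c n" for n
    unfolding nsq_def
  proof (rule nn_integral_Fatou_bound[where u = "\<lambda>k x. ennreal ((cmod (F n x - F (r (k + n)) x))\<^sup>2)" and c = "\<lambda>_. c n"])
    show "AE x in lborel. (\<lambda>k. ennreal ((cmod (F n x - F (r (k + n)) x))\<^sup>2)) \<longlonglongrightarrow> ennreal ((cmod (F n x - g x))\<^sup>2)"
      using conv
    proof eventually_elim
      case (elim x)
      then have "(\<lambda>k. F (r k) x) \<longlonglongrightarrow> g x" by (simp add: g_def convergent_LIMSEQ_iff)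
      then have "(\<lambda>k. F (r (k + n)) x) \<longlonglongrightarrow> g x" by (rule LIMSEQ_ignore_initial_segment)
      then show ?case by (intro tendsto_intros tendsto_ennrealI)
    qed
    show "(\<integral>\<^sup>+x. ennreal ((cmod (F n x - F (r (k + n)) x))\<^sup>2) \<partial>lborel) \<le> c n" for k
      using cauchy[of n "r (k + n)"] rk[of "k + n"] by (simp add: nsq_def norm_minus_commute)
  qed auto
  then have "(\<lambda>n. nsq (\<lambda>x. F n x - g x)) \<longlonglongrightarrow> 0"
    by (intro tendsto_sandwich[OF _ _ tendsto_const c] always_eventually allI) auto
  then show ?thesis by (intro bexI[of _ g]) auto
qed

section \<open>The Fourier transform on square integrable functions\<close>

definition trunc :: "nat \<Rightarrow> (real \<Rightarrow> complex) \<Rightarrow> real \<Rightarrow> complex" where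
  "trunc n f x = indicator {- real n..real n} x * f x"

text \<open>Counterpart of \<open>is_L2_fourier\<close> for Borel functions. It is a relation
  because the transform is determined only up to a null set.\<close>

definition FT :: "(real \<Rightarrow> complex) \<Rightarrow> (real \<Rightarrow> complex) \<Rightarrow> bool" where
  "FT f g \<longleftrightarrow> g \<in> borel_measurable borel \<and> (\<lambda>n. nsq (\<lambda>\<xi>. FI (trunc n f) \<xi> - g \<xi>)) \<longlonglongrightarrow> 0"

lemma nsq_mono: "(\<And>x. cmod (f x) \<le> cmod (g x)) \<Longrightarrow> nsq f \<le> nsq g"
  unfolding nsq_def by (intro nn_integral_mono ennreal_leI power_mono) auto

lemma measurable_trunc [measurable]:
  assumes [measurable]: "f \<in> borel_measurable borel"
  shows "trunc n f \<in> borel_measurable borel"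
  unfolding trunc_def[abs_def] by measurable

lemma cmod_trunc_le: "cmod (trunc n f x) \<le> cmod (f x)"
  by (simp add: trunc_def indicator_def)

lemma nsq_trunc_le: "nsq (trunc n f) \<le> nsq f"
  by (intro nsq_mono cmod_trunc_le)

lemma integrable_trunc:
  assumes [measurable]: "f \<in> borel_measurable borel" and f: "nsq f < \<infinity>"
  shows "integrable lborel (trunc n f)"
  unfolding trunc_def
proof (rule integrable_mult_nsq[OF _ _ _ f])
  have "nsq (indicator {- real n..real n}) = (\<integral>\<^sup>+x. indicator {- real n..real n} x \<partial>lborel)"
    unfolding nsq_def by (intro nn_integral_cong) (auto simp: indicator_def)
  then show "nsq (indicator {- real n..real n}) < \<infinity>" by simp
qed measurable

lemma nsq_trunc_diff_tendsto:
  assumes [measurable]: "f \<in> borel_measurable borel" and f: "nsq f < \<infinity>"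
  shows "(\<lambda>n. nsq (\<lambda>x. f x - trunc n f x)) \<longlonglongrightarrow> 0"
proof -
  have "(\<lambda>n. \<integral>\<^sup>+x. ennreal ((cmod (f x - trunc n f x))\<^sup>2) \<partial>lborel) \<longlonglongrightarrow> (\<integral>\<^sup>+x. 0 \<partial>(lborel :: real measure))"
  proof (rule nn_integral_dominated_convergence[where w = "\<lambda>x. ennreal ((cmod (f x))\<^sup>2)"])
    show "AE x in lborel. (\<lambda>n. ennreal ((cmod (f x - trunc n f x))\<^sup>2)) \<longlonglongrightarrow> 0"
    proof (intro AE_I2 tendsto_eventually)
      fix x :: real
      obtain N :: nat where "\<bar>x\<bar> \<le> real N" using real_arch_simple by blast
      then show "\<forall>\<^sub>F n in sequentially. ennreal ((cmod (f x - trunc n f x))\<^sup>2) = 0"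
        by (intro eventually_sequentiallyI[of N]) (auto simp: trunc_def indicator_def)
    qed
    show "AE x in lborel. ennreal ((cmod (f x - trunc n f x))\<^sup>2) \<le> ennreal ((cmod (f x))\<^sup>2)" for n
      by (auto simp: trunc_def indicator_def)
  qed (use f in \<open>auto simp: nsq_def\<close>)
  then show ?thesis by (simp add: nsq_def)
qed

lemma FI_diff:
  assumes "integrable lborel f" "integrable lborel g"
  shows "FI (\<lambda>x. f x - g x) \<xi> = FI f \<xi> - FI g \<xi>"
proof -
  have i: "integrable lborel (\<lambda>x. h x * cis (- (x * \<xi>)))" if h: "integrable lborel h" for h
    by (rule Bochner_Integration.integrable_bound[OF h])
       (use borel_measurable_integrable[OF h] in \<open>auto simp: norm_mult\<close>)
  show ?thesis
    unfolding FI_def left_diff_distrib by (intro Bochner_Integration.integral_diff i assms)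
qed

text \<open>By \<open>nsq_FI_le\<close> the transforms of the truncations inherit the Cauchy
  property from the truncations, with the tail of \<open>f\<close> beyond \<open>n\<close> as
  modulus.\<close>

lemma FT_exists:
  assumes [measurable]: "f \<in> borel_measurable borel" and f: "nsq f < \<infinity>"
  shows "\<exists>g. FT f g"
proof -
  have lim: "(\<lambda>n. ennreal (2 * pi) * nsq (\<lambda>x. f x - trunc n f x)) \<longlonglongrightarrow> ennreal (2 * pi) * 0"
    by (intro tendsto_mult_ennreal tendsto_const nsq_trunc_diff_tendsto f) auto
  note it = integrable_trunc[OF assms(1) f]
  have "\<exists>g \<in> borel_measurable borel. (\<lambda>n. nsq (\<lambda>x. FI (trunc n f) x - g x)) \<longlonglongrightarrow> 0"
  proof (rule nsq_complete)
    fix m n :: nat assume mn: "n \<le> m"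
    have "nsq (\<lambda>x. FI (trunc m f) x - FI (trunc n f) x) = nsq (FI (\<lambda>x. trunc m f x - trunc n f x))"
      by (rule arg_cong[of _ _ nsq], rule ext) (simp only: FI_diff[OF it it])
    also have "\<dots> \<le> ennreal (2 * pi) * nsq (\<lambda>x. trunc m f x - trunc n f x)"
      by (intro nsq_FI_le Bochner_Integration.integrable_diff integrable_trunc f) measurable
    also have "\<dots> \<le> ennreal (2 * pi) * nsq (\<lambda>x. f x - trunc n f x)"
      by (intro mult_left_mono nsq_mono) (use mn in \<open>auto simp: trunc_def indicator_def\<close>)
    finally show "nsq (\<lambda>x. FI (trunc m f) x - FI (trunc n f) x) \<le> ennreal (2 * pi) * nsq (\<lambda>x. f x - trunc n f x)" .
  qed (use lim in auto)
  then show ?thesis by (auto simp: FT_def)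
qed

lemma FT_nsq_finite:
  assumes [measurable]: "f \<in> borel_measurable borel" and f: "nsq f < \<infinity>" and g: "FT f g"
  shows "nsq g < \<infinity>"
proof -
  have [measurable]: "g \<in> borel_measurable borel"
    and lim: "(\<lambda>n. nsq (\<lambda>\<xi>. FI (trunc n f) \<xi> - g \<xi>)) \<longlonglongrightarrow> 0"
    using g by (auto simp: FT_def)
  from order_tendstoD(2)[OF lim, of 1] obtain n where n: "nsq (\<lambda>\<xi>. FI (trunc n f) \<xi> - g \<xi>) < 1"
    by (auto simp: eventually_sequentially)
  have "nsq g = nsq (\<lambda>\<xi>. FI (trunc n f) \<xi> - (FI (trunc n f) \<xi> - g \<xi>))" by simp
  also have "\<dots> \<le> 2 * nsq (FI (trunc n f)) + 2 * nsq (\<lambda>\<xi>. FI (trunc n f) \<xi> - g \<xi>)"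
    by (rule nsq_diff_le) measurable
  also have "\<dots> \<le> 2 * (ennreal (2 * pi) * nsq f) + 2 * 1"
  proof (intro add_mono mult_left_mono)
    have "nsq (FI (trunc n f)) \<le> ennreal (2 * pi) * nsq (trunc n f)"
      by (intro nsq_FI_le integrable_trunc f) measurable
    also have "\<dots> \<le> ennreal (2 * pi) * nsq f"
      by (intro mult_left_mono nsq_trunc_le) auto
    finally show "nsq (FI (trunc n f)) \<le> ennreal (2 * pi) * nsq f" .
  qed (use n in auto)
  also have "\<dots> < \<infinity>" using f by (auto simp: ennreal_mult_less_top)
  finally show ?thesis .
qed

lemma FT_unique:
  assumes [measurable]: "f \<in> borel_measurable borel" and "FT f g" "FT f g'"
  shows "AE \<xi> in lborel. g \<xi> = g' \<xi>"
proof -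
  have [measurable]: "g \<in> borel_measurable borel" "g' \<in> borel_measurable borel"
    and lim: "(\<lambda>n. nsq (\<lambda>\<xi>. FI (trunc n f) \<xi> - g \<xi>)) \<longlonglongrightarrow> 0" "(\<lambda>n. nsq (\<lambda>\<xi>. FI (trunc n f) \<xi> - g' \<xi>)) \<longlonglongrightarrow> 0"
    using assms by (auto simp: FT_def)
  have "(\<lambda>n. 2 * nsq (\<lambda>\<xi>. FI (trunc n f) \<xi> - g' \<xi>) + 2 * nsq (\<lambda>\<xi>. FI (trunc n f) \<xi> - g \<xi>)) \<longlonglongrightarrow> 2 * 0 + 2 * 0"
    by (intro tendsto_add tendsto_mult_ennreal tendsto_const lim) auto
  moreover have "nsq (\<lambda>\<xi>. g \<xi> - g' \<xi>) \<le> 2 * nsq (\<lambda>\<xi>. FI (trunc n f) \<xi> - g' \<xi>) + 2 * nsq (\<lambda>\<xi>. FI (trunc n f) \<xi> - g \<xi>)" for n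
    using nsq_diff_le[of "\<lambda>\<xi>. FI (trunc n f) \<xi> - g' \<xi>" "\<lambda>\<xi>. FI (trunc n f) \<xi> - g \<xi>"] by simp
  ultimately have "nsq (\<lambda>\<xi>. g \<xi> - g' \<xi>) \<le> 2 * 0 + 2 * 0"
    by (intro LIMSEQ_le_const) auto
  then have "(\<integral>\<^sup>+\<xi>. ennreal ((cmod (g \<xi> - g' \<xi>))\<^sup>2) \<partial>lborel) = 0" by (simp add: nsq_def)
  then have "AE \<xi> in lborel. ennreal ((cmod (g \<xi> - g' \<xi>))\<^sup>2) = 0"
    by (subst (asm) nn_integral_0_iff_AE) auto
  then show ?thesis by eventually_elim simp
qed

lemma lborel_mult_formula:
  assumes F: "integrable lborel F" and h: "integrable lborel h"
  shows "(\<integral>\<xi>. FI F \<xi> * h \<xi> \<partial>lborel) = (\<integral>x. F x * FI h x \<partial>lborel)"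
proof -
  have [measurable]: "F \<in> borel_measurable borel" "h \<in> borel_measurable borel"
    using F h by (auto dest: borel_measurable_integrable)
  have ih: "integrable lborel (\<lambda>\<xi>. F x * (h \<xi> * cis (- (\<xi> * x))))" for x
    by (intro integrable_mult_right Bochner_Integration.integrable_bound[OF h]) (auto simp: norm_mult)
  have i: "integrable (lborel \<Otimes>\<^sub>M lborel) (\<lambda>(x, \<xi>). F x * (h \<xi> * cis (- (\<xi> * x))))"
  proof (rule lborel_pair.Fubini_integrable)
    show "integrable lborel (\<lambda>x. \<integral>\<xi>. norm (case (x, \<xi>) of (x, \<xi>) \<Rightarrow> F x * (h \<xi> * cis (- (\<xi> * x)))) \<partial>lborel)"
      using F by (simp add: norm_mult)
  qed (use ih in auto)
  have "(\<integral>\<xi>. FI F \<xi> * h \<xi> \<partial>lborel) = (\<integral>\<xi>. \<integral>x. F x * (h \<xi> * cis (- (\<xi> * x))) \<partial>lborel \<partial>lborel)"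
    unfolding FI_def integral_mult_left_zero[symmetric] by (simp add: mult_ac)
  also have "\<dots> = (\<integral>x. \<integral>\<xi>. F x * (h \<xi> * cis (- (\<xi> * x))) \<partial>lborel \<partial>lborel)"
    by (rule lborel_pair.Fubini_integral[OF i])
  also have "\<dots> = (\<integral>x. F x * FI h x \<partial>lborel)"
    by (simp add: FI_def)
  finally show ?thesis .
qed

text \<open>The multiplication formula survives the limit: by Cauchy-Schwarz both sides converge
  along the truncations of \<open>f\<close>.\<close>

lemma FT_mult_formula:
  assumes [measurable]: "f \<in> borel_measurable borel" and f: "nsq f < \<infinity>" and g: "FT f g"
    and h: "integrable lborel h" "nsq h < \<infinity>"
  shows "(\<integral>\<xi>. g \<xi> * h \<xi> \<partial>lborel) = (\<integral>x. f x * FI h x \<partial>lborel)"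
proof -
  have [measurable]: "g \<in> borel_measurable borel" "h \<in> borel_measurable borel"
    and lim: "(\<lambda>n. nsq (\<lambda>\<xi>. FI (trunc n f) \<xi> - g \<xi>)) \<longlonglongrightarrow> 0"
    using g h by (auto simp: FT_def)
  have FIh: "nsq (FI h) < \<infinity>"
    using nsq_FI_le[OF h(1)] h(2) by (auto intro: le_less_trans simp: ennreal_mult_less_top)
  have tr: "nsq (trunc n f) < \<infinity>" for n using nsq_trunc_le[of n f] f by (rule le_less_trans)
  have FItr: "nsq (FI (trunc n f)) < \<infinity>" for n
    using nsq_FI_le[OF integrable_trunc[OF _ f], of n] tr[of n] by (auto intro: le_less_trans simp: ennreal_mult_less_top)
  have "(\<lambda>n. \<integral>\<xi>. FI (trunc n f) \<xi> * h \<xi> \<partial>lborel) \<longlonglongrightarrow> (\<integral>\<xi>. g \<xi> * h \<xi> \<partial>lborel)"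
    by (intro tendsto_integral_mult_nsq lim h integrable_mult_nsq FItr FT_nsq_finite[OF _ f g]) measurable
  moreover have "(\<lambda>n. \<integral>x. trunc n f x * FI h x \<partial>lborel) \<longlonglongrightarrow> (\<integral>x. f x * FI h x \<partial>lborel)"
  proof (intro tendsto_integral_mult_nsq FIh integrable_mult_nsq tr f)
    show "(\<lambda>n. nsq (\<lambda>x. trunc n f x - f x)) \<longlonglongrightarrow> 0"
      using nsq_trunc_diff_tendsto[OF _ f] by (simp add: nsq_commute[of "trunc _ f"])
  qed measurable
  moreover have "(\<integral>\<xi>. FI (trunc n f) \<xi> * h \<xi> \<partial>lborel) = (\<integral>x. trunc n f x * FI h x \<partial>lborel)" for n
    by (intro lborel_mult_formula integrable_trunc f h) measurable
  ultimately show ?thesis by (simp add: LIMSEQ_unique)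
qed

text \<open>Turns a Fourier multiplier \<open>\<phi>\<close> into an average of \<open>f\<close>
  around \<open>x\<close> with kernel \<open>FI \<phi>\<close>. This is the form in which
  convergence can be studied at Lebesgue points.\<close>

lemma FT_modulated:
  assumes [measurable]: "f \<in> borel_measurable borel" and f: "nsq f < \<infinity>" and g: "FT f g"
    and \<phi>: "integrable lborel \<phi>" "nsq \<phi> < \<infinity>"
  shows "(\<integral>\<xi>. g \<xi> * (\<phi> \<xi> * cis (x * \<xi>)) \<partial>lborel) = (\<integral>z. f (x + z) * FI \<phi> z \<partial>lborel)"
proof -
  have [measurable]: "\<phi> \<in> borel_measurable borel" using \<phi> by (auto dest: borel_measurable_integrable)
  have i: "integrable lborel (\<lambda>\<xi>. \<phi> \<xi> * cis (x * \<xi>))"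
    by (rule Bochner_Integration.integrable_bound[OF \<phi>(1)]) (auto simp: norm_mult)
  have n: "nsq (\<lambda>\<xi>. \<phi> \<xi> * cis (x * \<xi>)) < \<infinity>" using \<phi>(2) by (simp add: nsq_def norm_mult)
  have FI: "FI (\<lambda>\<xi>. \<phi> \<xi> * cis (x * \<xi>)) y = FI \<phi> (y - x)" for y
    by (simp add: FI_def cis_mult algebra_simps)
  have "(\<integral>\<xi>. g \<xi> * (\<phi> \<xi> * cis (x * \<xi>)) \<partial>lborel) = (\<integral>y. f y * FI \<phi> (y - x) \<partial>lborel)"
    unfolding FT_mult_formula[OF _ f g i n, simplified] FI ..
  also have "\<dots> = (\<integral>z. f (x + z) * FI \<phi> z \<partial>lborel)"
    by (subst lborel_integral_real_affine[where c = 1 and t = x]) auto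
  finally show ?thesis .
qed

section \<open>Lebesgue points and approximate identities\<close>

lemma AE_right_average:
  fixes G :: "real \<Rightarrow> real"
  assumes [measurable]: "G \<in> borel_measurable borel" and G0: "\<And>x. G x \<ge> 0"
    and i: "\<And>a b. integrable lborel (\<lambda>x. indicator {a..b} x *\<^sub>R G x)"
  shows "AE x in lborel. \<forall>e>0. \<exists>d>0. \<forall>h. 0 < h \<and> h < d \<longrightarrow>
    (\<integral>\<^sup>+y. indicator {x..x + h} y * ennreal (G y) \<partial>lborel) \<le> ennreal (h * (G x + e))"
proof -
  have "G integrable_on cbox a b" for a b
    using set_borel_integral_eq_integral(1)[of "cbox a b" G] i[of a b] by (simp add: set_integrable_def)
  then obtain N where N: "negligible N" and lim: "\<And>x e. x \<notin> N \<Longrightarrow> 0 < e \<Longrightarrow>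
      \<exists>d>0. \<forall>h. 0 < h \<and> h < d \<longrightarrow> norm (integral (cbox x (x + h *\<^sub>R One)) G /\<^sub>R h ^ DIM(real) - G x) < e"
    using integrable_ccontinuous_explicit[of G] by metis
  have "\<exists>d>0. \<forall>h. 0 < h \<and> h < d \<longrightarrow> (\<integral>\<^sup>+y. indicator {x..x + h} y * ennreal (G y) \<partial>lborel) \<le> ennreal (h * (G x + e))"
    if x: "x \<notin> N" and e: "e > 0" for x e
  proof -
    obtain d where d: "d > 0" "\<And>h. 0 < h \<Longrightarrow> h < d \<Longrightarrow> norm (integral (cbox x (x + h *\<^sub>R One)) G /\<^sub>R h ^ DIM(real) - G x) < e"
      using lim[OF x e] by blast
    have "(\<integral>\<^sup>+y. indicator {x..x + h} y * ennreal (G y) \<partial>lborel) \<le> ennreal (h * (G x + e))" if h: "0 < h" "h < d" for h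
    proof -
      have "(\<integral>\<^sup>+y. indicator {x..x + h} y * ennreal (G y) \<partial>lborel) = (\<integral>\<^sup>+y. ennreal (indicator {x..x + h} y *\<^sub>R G y) \<partial>lborel)"
        by (intro nn_integral_cong) (auto simp: indicator_def)
      also have "\<dots> = ennreal (\<integral>y. indicator {x..x + h} y *\<^sub>R G y \<partial>lborel)"
        by (intro nn_integral_eq_integral i) (auto simp: G0)
      also have "(\<integral>y. indicator {x..x + h} y *\<^sub>R G y \<partial>lborel) = integral {x..x + h} G"
        using set_borel_integral_eq_integral(2)[of "{x..x + h}" G] i[of x "x + h"]
        by (simp add: set_integrable_def set_lebesgue_integral_def)
      also have "\<dots> \<le> h * (G x + e)"
      proof -
        have "\<bar>integral {x..x + h} G / h - G x\<bar> < e" using d(2)[OF h] by (simp add: divide_inverse mult.commute)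
        then have "integral {x..x + h} G / h \<le> G x + e" by linarith
        then show ?thesis using h by (simp add: field_simps)
      qed
      finally show ?thesis by (simp add: ennreal_leI)
    qed
    then show ?thesis using d(1) by blast
  qed
  moreover have "AE x in lebesgue. x \<notin> N"
    using N by (simp add: AE_not_in negligible_iff_null_sets)
  ultimately have "AE x in lebesgue. \<forall>e>0. \<exists>d>0. \<forall>h. 0 < h \<and> h < d \<longrightarrow>
    (\<integral>\<^sup>+y. indicator {x..x + h} y * ennreal (G y) \<partial>lborel) \<le> ennreal (h * (G x + e))"
    by (auto elim!: eventually_mono)
  then show ?thesis by (simp only: AE_completion_iff)
qed

lemma AE_lborel_uminus:
  fixes Q :: "real \<Rightarrow> bool"
  assumes "AE x in lborel. Q x"
  shows "AE x in lborel. Q (- x)"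
proof -
  have "AE x in lebesgue. Q x" using assms by (rule AE_completion)
  then obtain N where N: "N \<in> null_sets lebesgue" "{x. \<not> Q x} \<subseteq> N"
    by (auto simp: eventually_ae_filter)
  then have "negligible (uminus ` N)"
    by (intro negligible_differentiable_image_negligible) (auto simp: negligible_iff_null_sets intro!: derivative_intros)
  then have "uminus ` N \<in> null_sets lebesgue" by (simp add: negligible_iff_null_sets)
  moreover have "{x. \<not> Q (- x)} \<subseteq> uminus ` N"
    using N(2) by (force simp: image_iff intro: bexI[of _ "- x" for x])
  ultimately have "AE x in lebesgue. Q (- x)" by (intro AE_I') auto
  then show ?thesis by (simp only: AE_completion_iff)
qed

text \<open>The left half of the interval is a right half for the reflected function.\<close>

lemma AE_centred_average:
  fixes G :: "real \<Rightarrow> real"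
  assumes [measurable]: "G \<in> borel_measurable borel" and G0: "\<And>x. G x \<ge> 0"
    and i: "\<And>a b. integrable lborel (\<lambda>x. indicator {a..b} x *\<^sub>R G x)"
  shows "AE x in lborel. \<forall>e>0. \<exists>d>0. \<forall>h. 0 < h \<and> h < d \<longrightarrow>
    (\<integral>\<^sup>+y. indicator {x - h..x + h} y * ennreal (G y) \<partial>lborel) \<le> ennreal (2 * h * (G x + e))"
proof -
  let ?A = "\<lambda>G x. \<forall>e>0. \<exists>d>0. \<forall>h. 0 < h \<and> h < d \<longrightarrow>
    (\<integral>\<^sup>+y. indicator {x..x + h} y * ennreal (G y) \<partial>lborel) \<le> ennreal (h * (G x + e))"
  have AE1: "AE x in lborel. ?A G x"
    by (rule AE_right_average[OF assms(1) G0 i])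
  have "AE x in lborel. ?A (\<lambda>x. G (- x)) x"
  proof (rule AE_right_average)
    fix a b
    have "integrable lborel (\<lambda>x. indicator {- b..- a} (0 + (-1) * x) *\<^sub>R G (0 + (-1) * x))"
      by (rule lborel_integrable_real_affine[OF i]) simp
    moreover have "indicator {- b..- a} (0 + (-1) * x) = (indicator {a..b} x :: real)" for x :: real
      by (auto simp: indicator_def)
    ultimately show "integrable lborel (\<lambda>x. indicator {a..b} x *\<^sub>R G (- x))" by simp
  qed (auto intro: G0)
  then have AE2: "AE x in lborel. ?A (\<lambda>x. G (- x)) (- x)" by (rule AE_lborel_uminus)
  show ?thesis using AE1 AE2
  proof eventually_elim
    case (elim x)
    show ?case
    proof (intro allI impI)
      fix e :: real assume e: "e > 0"
      from elim(1) e obtain d1 where d1: "d1 > 0" "\<And>h. 0 < h \<Longrightarrow> h < d1 \<Longrightarrow>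
        (\<integral>\<^sup>+y. indicator {x..x + h} y * ennreal (G y) \<partial>lborel) \<le> ennreal (h * (G x + e))" by meson
      from elim(2) e obtain d2 where d2: "d2 > 0" "\<And>h. 0 < h \<Longrightarrow> h < d2 \<Longrightarrow>
        (\<integral>\<^sup>+y. indicator {-x..-x + h} y * ennreal (G (- y)) \<partial>lborel) \<le> ennreal (h * (G (- (- x)) + e))" by meson
      have "(\<integral>\<^sup>+y. indicator {x - h..x + h} y * ennreal (G y) \<partial>lborel) \<le> ennreal (2 * h * (G x + e))" if h: "0 < h" "h < min d1 d2" for h
      proof -
        have "(\<integral>\<^sup>+y. indicator {x - h..x + h} y * ennreal (G y) \<partial>lborel)
          \<le> (\<integral>\<^sup>+y. indicator {x..x + h} y * ennreal (G y) + indicator {x - h..x} y * ennreal (G y) \<partial>lborel)"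
          by (intro nn_integral_mono) (auto simp: indicator_def)
        also have "\<dots> = (\<integral>\<^sup>+y. indicator {x..x + h} y * ennreal (G y) \<partial>lborel) + (\<integral>\<^sup>+y. indicator {x - h..x} y * ennreal (G y) \<partial>lborel)"
          by (rule nn_integral_add) measurable
        also have "(\<integral>\<^sup>+y. indicator {x - h..x} y * ennreal (G y) \<partial>lborel) = (\<integral>\<^sup>+y. indicator {-x..-x + h} y * ennreal (G (- y)) \<partial>lborel)"
          by (subst nn_integral_real_affine[where c = "-1" and t = 0]) (auto intro!: nn_integral_cong simp: indicator_def)
        also have "(\<integral>\<^sup>+y. indicator {x..x + h} y * ennreal (G y) \<partial>lborel) + \<dots> \<le> ennreal (h * (G x + e)) + ennreal (h * (G x + e))"
          using d1(2)[of h] d2(2)[of h] h by (intro add_mono) auto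
        also have "\<dots> = ennreal (2 * h * (G x + e))"
          using h e G0[of x] by (simp flip: ennreal_plus)
        finally show ?thesis .
      qed
      then show "\<exists>d>0. \<forall>h. 0 < h \<and> h < d \<longrightarrow> (\<integral>\<^sup>+y. indicator {x - h..x + h} y * ennreal (G y) \<partial>lborel) \<le> ennreal (2 * h * (G x + e))"
        using d1(1) d2(1) by (intro exI[of _ "min d1 d2"]) auto
    qed
  qed
qed

text \<open>The averages of \<open>cmod (f y - q)\<close> are controlled simultaneously for all
  \<open>q\<close> in a countable dense set, off a single null set; then \<open>q\<close> is taken
  close to \<open>f x\<close>.\<close>

lemma AE_Lebesgue_point:
  assumes [measurable]: "f \<in> borel_measurable borel" and f: "nsq f < \<infinity>"
  shows "AE x in lborel. \<forall>e>0. \<exists>d>0. \<forall>h. 0 < h \<and> h < d \<longrightarrow>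
    (\<integral>\<^sup>+z. indicator {- h..h} z * ennreal (cmod (f (x + z) - f x)) \<partial>lborel) \<le> ennreal (h * e)"
proof -
  obtain D :: "complex set" where D: "countable D" "\<And>X. open X \<Longrightarrow> X \<noteq> {} \<Longrightarrow> \<exists>d\<in>D. d \<in> X"
    by (metis countable_dense_exists)
  have i: "integrable lborel (\<lambda>x. indicator {a..b} x *\<^sub>R cmod (f x - q))" for a b q
  proof -
    have "integrable lborel (\<lambda>x. indicator {a..b} x * f x)"
    proof (rule integrable_mult_nsq[OF _ _ _ f])
      have "nsq (indicator {a..b}) = (\<integral>\<^sup>+x. indicator {a..b} x \<partial>lborel)"
        unfolding nsq_def by (intro nn_integral_cong) (auto simp: indicator_def)
      then show "nsq (indicator {a..b}) < \<infinity>" by (simp add: emeasure_lborel_Icc_eq)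
    qed measurable
    moreover have "integrable lborel (\<lambda>x. indicator {a..b} x *\<^sub>R q)"
      by (intro integrable_scaleR_left) (auto simp: emeasure_lborel_Icc_eq intro!: integrable_real_indicator)
    ultimately have "integrable lborel (\<lambda>x. cmod (indicator {a..b} x * f x - indicator {a..b} x *\<^sub>R q))"
      by (intro integrable_norm Bochner_Integration.integrable_diff)
    then show ?thesis
      by (rule Bochner_Integration.integrable_bound) (auto simp: indicator_def)
  qed
  have "AE x in lborel. \<forall>q\<in>D. \<forall>e>0. \<exists>d>0. \<forall>h. 0 < h \<and> h < d \<longrightarrow>
    (\<integral>\<^sup>+y. indicator {x - h..x + h} y * ennreal (cmod (f y - q)) \<partial>lborel) \<le> ennreal (2 * h * (cmod (f x - q) + e))"
    unfolding AE_ball_countable[OF D(1)] by (intro ballI AE_centred_average i) auto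
  then show ?thesis
  proof eventually_elim
    case (elim x)
    show ?case
    proof (intro allI impI)
      fix e :: real assume e: "e > 0"
      \<comment> \<open>With \<open>e / 8\<close> the errors add up to at most
        \<open>2 * h * (e / 8 + e / 4)\<close>, which is below \<open>h * e\<close>.\<close>
      obtain q where q: "q \<in> D" "cmod (f x - q) < e / 8"
        using D(2)[of "ball (f x) (e / 8)"] e by (auto simp: dist_norm)
      have "e / 8 > 0" using e by simp
      with elim q(1) obtain d where d: "d > 0" "\<And>h. 0 < h \<Longrightarrow> h < d \<Longrightarrow>
        (\<integral>\<^sup>+y. indicator {x - h..x + h} y * ennreal (cmod (f y - q)) \<partial>lborel) \<le> ennreal (2 * h * (cmod (f x - q) + e / 8))"
        by blast
      have "(\<integral>\<^sup>+z. indicator {- h..h} z * ennreal (cmod (f (x + z) - f x)) \<partial>lborel) \<le> ennreal (h * e)" if h: "0 < h" "h < d" for h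
      proof -
        have "(\<integral>\<^sup>+z. indicator {- h..h} z * ennreal (cmod (f (x + z) - f x)) \<partial>lborel)
            = (\<integral>\<^sup>+y. indicator {x - h..x + h} y * ennreal (cmod (f y - f x)) \<partial>lborel)"
          by (subst nn_integral_real_affine[where c = 1 and t = x and f = "\<lambda>y. indicator {x - h..x + h} y * ennreal (cmod (f y - f x))"])
             (auto intro!: nn_integral_cong simp: indicator_def)
        also have "\<dots> \<le> (\<integral>\<^sup>+y. indicator {x - h..x + h} y * ennreal (cmod (f y - q)) + indicator {x - h..x + h} y * ennreal (e / 8) \<partial>lborel)"
        proof (intro nn_integral_mono)
          fix y
          have "cmod (f y - f x) \<le> cmod (f y - q) + cmod (f x - q)"
            using norm_triangle_ineq[of "f y - q" "q - f x"] by (simp add: norm_minus_commute)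
          then have "cmod (f y - f x) \<le> cmod (f y - q) + e / 8" using q by simp
          then show "indicator {x - h..x + h} y * ennreal (cmod (f y - f x)) \<le> indicator {x - h..x + h} y * ennreal (cmod (f y - q)) + indicator {x - h..x + h} y * ennreal (e / 8)"
            using e by (auto simp: indicator_def ennreal_plus[symmetric] simp del: ennreal_plus intro: ennreal_leI)
        qed
        also have "\<dots> = (\<integral>\<^sup>+y. indicator {x - h..x + h} y * ennreal (cmod (f y - q)) \<partial>lborel) + ennreal (2 * h) * ennreal (e / 8)"
          using h by (simp add: nn_integral_add nn_integral_multc)
        also have "\<dots> \<le> ennreal (2 * h * (cmod (f x - q) + e / 8)) + ennreal (2 * h) * ennreal (e / 8)"
          using d(2)[OF h] by (rule add_right_mono)
        also have "\<dots> = ennreal (2 * h * (cmod (f x - q) + e / 4))"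
          using h e by (simp add: ennreal_mult[symmetric] ennreal_plus[symmetric] field_simps del: ennreal_plus)
        also have "\<dots> \<le> ennreal (h * e)"
        proof (intro ennreal_leI)
          have "2 * h * (cmod (f x - q) + e / 4) \<le> 2 * h * (e / 8 + e / 4)"
            using q h by (intro mult_left_mono) auto
          also have "\<dots> \<le> h * e" using h e by (simp add: field_simps)
          finally show "2 * h * (cmod (f x - q) + e / 4) \<le> h * e" .
        qed
        finally show ?thesis .
      qed
      then show "\<exists>d>0. \<forall>h. 0 < h \<and> h < d \<longrightarrow>
        (\<integral>\<^sup>+z. indicator {- h..h} z * ennreal (cmod (f (x + z) - f x)) \<partial>lborel) \<le> ennreal (h * e)"
        using d(1) by (intro exI[of _ d]) simp
    qed
  qed
qed

text \<open>If \<open>k\<close> is least with \<open>\<bar>z\<bar> \<le> 2 ^ k * r\<close>, the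
  Cauchy kernel at \<open>z\<close> is at most \<open>4 * (1/4) ^ k / r\<close>. Hence the average
  is at most the sum of \<open>4 * (1/2) ^ k * b (2 ^ k * r)\<close>, where \<open>b h\<close> is
  \<open>A h / h\<close>. Each term tends to 0 by \<open>small\<close>, and \<open>large\<close>
  bounds \<open>b\<close> at all scales, so that Tannery's theorem applies.\<close>

lemma Cauchy_kernel_average_tendsto:
  fixes F :: "real \<Rightarrow> real"
  defines "A \<equiv> \<lambda>h. \<integral>\<^sup>+z. indicator {- h..h} z * ennreal (F z) \<partial>lborel"
  assumes [measurable]: "F \<in> borel_measurable borel" and F0: "\<And>z. F z \<ge> 0"
    and small: "\<And>e. e > 0 \<Longrightarrow> \<exists>d>0. \<forall>h. 0 < h \<and> h < d \<longrightarrow> A h \<le> ennreal (h * e)"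
    and large: "\<And>h. h > 0 \<Longrightarrow> A h \<le> ennreal (h * C)"
  shows "((\<lambda>r. \<integral>\<^sup>+z. ennreal (F z * (r / (r\<^sup>2 + z\<^sup>2))) \<partial>lborel) \<longlongrightarrow> 0) (at_right 0)"
proof -
  define C' where "C' = max C 0"
  have large': "A h \<le> ennreal (h * C')" if "h > 0" for h
    using large[OF that] that unfolding C'_def
    by (meson ennreal_leI le_max_iff_disj mult_le_cancel_left_pos order.refl order.trans)
  define b where "b h = enn2real (A h) / h" for h
  have Ab: "A h = ennreal (h * b h)" if "h > 0" for h
    using large'[OF that] that by (simp add: b_def) (metis ennreal_enn2real ennreal_less_top le_less_trans)
  have b0: "b h \<ge> 0" if "h > 0" for h using that by (simp add: b_def)
  have bC: "b h \<le> C'" if "h > 0" for h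
    using large'[OF that] that Ab[OF that] by (simp add: C'_def)
  have blim: "(b \<longlongrightarrow> 0) (at_right 0)"
  proof (rule tendstoI)
    fix e :: real assume e: "e > 0"
    obtain d where d: "d > 0" "\<And>h. 0 < h \<Longrightarrow> h < d \<Longrightarrow> A h \<le> ennreal (h * (e / 2))"
      using small[of "e / 2"] e by auto
    have "dist (b h) 0 < e" if "0 < h" "h < d" for h
    proof -
      have "h * b h \<le> h * (e / 2)" using d(2)[OF that] Ab[OF that(1)] e that by simp
      then show ?thesis using that b0[OF that(1)] e by simp
    qed
    then show "\<forall>\<^sub>F h in at_right 0. dist (b h) 0 < e"
      using d(1) by (auto simp: eventually_at_right_field)
  qed
  define S where "S r = (\<Sum>k. 4 * (1/2) ^ k * b (2 ^ k * r))" for r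
  have "((\<lambda>r. \<Sum>k. 4 * (1/2) ^ k * b (2 ^ k * r)) \<longlongrightarrow> (\<Sum>k::nat. 0)) (at_right 0)"
  proof (rule tannerys_theorem[THEN conjunct2, THEN conjunct2])
    fix k :: nat
    have "filterlim (\<lambda>r::real. 2 ^ k * r) (at_right 0) (at_right 0)"
      unfolding filterlim_at
      by (auto simp: eventually_at_right_field intro!: tendsto_eq_intros exI[of _ 1])
    then have "((\<lambda>r. b (2 ^ k * r)) \<longlongrightarrow> 0) (at_right 0)"
      by (rule filterlim_compose[OF blim])
    then show "((\<lambda>r. 4 * (1/2) ^ k * b (2 ^ k * r)) \<longlongrightarrow> 0) (at_right 0)"
      by (rule tendsto_mult_right_zero)
    show "\<forall>\<^sub>F (k, r) in at_top \<times>\<^sub>F at_right 0. norm (4 * (1/2) ^ k * b (2 ^ k * r)) \<le> 4 * (1/2) ^ k * C'"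
    proof -
      have "\<forall>\<^sub>F r in at_right (0::real). r > 0" by (rule eventually_at_right_less)
      then have "\<forall>\<^sub>F x in (at_top :: nat filter) \<times>\<^sub>F at_right (0::real). snd x > 0"
        unfolding eventually_prod_filter
        by (intro exI[of _ "\<lambda>_. True"] exI[of _ "\<lambda>r. r > 0"]) auto
      then show ?thesis
      proof eventually_elim
        case (elim x)
        have "b (2 ^ fst x * snd x) \<le> C'" "b (2 ^ fst x * snd x) \<ge> 0"
          using elim by (intro bC b0; simp)+
        then show ?case by (auto simp: case_prod_beta abs_mult intro!: mult_left_mono)
      qed
    qed
    show "summable (\<lambda>k. 4 * (1/2) ^ k * C')"
      by (intro summable_mult summable_mult2 summable_geometric) auto
  qed simp
  then have Slim: "(S \<longlongrightarrow> 0) (at_right 0)" by (simp add: S_def[abs_def])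
  have le: "(\<integral>\<^sup>+z. ennreal (F z * (r / (r\<^sup>2 + z\<^sup>2))) \<partial>lborel) \<le> ennreal (S r)" if r: "r > 0" for r
  proof -
    have "(\<integral>\<^sup>+z. ennreal (F z * (r / (r\<^sup>2 + z\<^sup>2))) \<partial>lborel)
      \<le> (\<integral>\<^sup>+z. (\<Sum>k. ennreal (4 * (1/4) ^ k / r) * (indicator {- (2 ^ k * r)..2 ^ k * r} z * ennreal (F z))) \<partial>lborel)"
    proof (rule nn_integral_mono)
      fix z :: real
      let ?t = "\<lambda>k. ennreal (4 * (1/4) ^ k / r) * (indicator {- (2 ^ k * r)..2 ^ k * r} z * ennreal (F z))"
      obtain k where k: "\<bar>z\<bar> \<le> 2 ^ k * r" "r / (r\<^sup>2 + z\<^sup>2) \<le> 4 * (1/4) ^ k / r"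
      proof -
        obtain n :: nat where "\<bar>z\<bar> / r < 2 ^ n" using real_arch_pow[of 2 "\<bar>z\<bar> / r"] by auto
        then have ex: "\<bar>z\<bar> \<le> 2 ^ n * r" using r by (simp add: field_simps)
        define k where "k = (LEAST k. \<bar>z\<bar> \<le> 2 ^ k * r)"
        have k: "\<bar>z\<bar> \<le> 2 ^ k * r" unfolding k_def using ex by (rule LeastI)
        have "r / (r\<^sup>2 + z\<^sup>2) \<le> 4 * (1/4) ^ k / r"
        proof (cases k)
          case 0
          have "r / (r\<^sup>2 + z\<^sup>2) \<le> r / r\<^sup>2" using r by (intro divide_left_mono) (auto intro!: mult_pos_pos add_pos_nonneg)
          also have "\<dots> \<le> 4 / r" using r by (simp add: power2_eq_square field_simps)
          finally show ?thesis using 0 by simp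
        next
          case (Suc j)
          have "\<not> \<bar>z\<bar> \<le> 2 ^ j * r" using not_less_Least[of j "\<lambda>k. \<bar>z\<bar> \<le> 2 ^ k * r"] Suc by (simp add: k_def)
          then have "(2 ^ j * r)\<^sup>2 \<le> \<bar>z\<bar>\<^sup>2" using r by (intro power_mono) auto
          moreover have "(2::real) * 2 = 4" by simp
          then have "((2::real) ^ j)\<^sup>2 = 4 ^ j"
            by (simp only: power2_eq_square power_mult_distrib[symmetric])
          ultimately have z: "4 ^ j * r\<^sup>2 \<le> z\<^sup>2" by (simp only: power_mult_distrib power2_abs)
          have "r / (r\<^sup>2 + z\<^sup>2) \<le> r / (4 ^ j * r\<^sup>2)" using r z by (intro divide_left_mono) (auto intro!: mult_pos_pos add_pos_nonneg add_increasing)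
          also have "\<dots> = 4 * (1/4) ^ k / r" using r Suc by (simp add: power2_eq_square field_simps power_divide)
          finally show ?thesis .
        qed
        with k show thesis by (rule that)
      qed
      have "ennreal (F z * (r / (r\<^sup>2 + z\<^sup>2))) \<le> ennreal (F z * (4 * (1/4) ^ k / r))"
        by (intro ennreal_leI mult_left_mono k F0)
      also have "\<dots> = ?t k" using k(1) r F0 by (auto simp: indicator_def ennreal_mult[symmetric] mult_ac abs_le_iff)
      also have "\<dots> = sum ?t {k}" by simp
      also have "\<dots> \<le> (\<Sum>k. ?t k)" by (rule sum_le_suminf) auto
      finally show "ennreal (F z * (r / (r\<^sup>2 + z\<^sup>2))) \<le> (\<Sum>k. ?t k)" .
    qed
    also have "\<dots> = (\<Sum>k. ennreal (4 * (1/4) ^ k / r) * A (2 ^ k * r))"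
      unfolding A_def by (subst nn_integral_suminf, measurable) (intro suminf_cong nn_integral_cmult, measurable)
    also have "\<dots> = (\<Sum>k. ennreal (4 * (1/2) ^ k * b (2 ^ k * r)))"
    proof (intro suminf_cong)
      fix k :: nat
      have p: "2 ^ k * r > 0" using r by simp
      have "(1/4::real) ^ k * 2 ^ k = (1/2) ^ k" by (simp only: power_mult_distrib[symmetric]) simp
      then have "4 * (1/4) ^ k / r * (2 ^ k * r * b (2 ^ k * r)) = 4 * (1/2) ^ k * b (2 ^ k * r)"
        using r by (simp add: field_simps)
      then show "ennreal (4 * (1/4) ^ k / r) * A (2 ^ k * r) = ennreal (4 * (1/2) ^ k * b (2 ^ k * r))"
        unfolding Ab[OF p] using r b0[OF p] by (subst ennreal_mult[symmetric]) auto
    qed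
    also have "\<dots> = ennreal (S r)"
      unfolding S_def
    proof (rule suminf_ennreal2)
      show "summable (\<lambda>k. 4 * (1/2) ^ k * b (2 ^ k * r))"
      proof (rule summable_comparison_test')
        show "summable (\<lambda>k. 4 * (1/2) ^ k * C')"
          by (intro summable_mult summable_mult2 summable_geometric) auto
        show "norm (4 * (1/2) ^ k * b (2 ^ k * r)) \<le> 4 * (1/2) ^ k * C'" for k
          using bC[of "2 ^ k * r"] b0[of "2 ^ k * r"] r by (simp add: abs_mult)
      qed
      show "0 \<le> 4 * (1/2) ^ k * b (2 ^ k * r)" for k using b0[of "2 ^ k * r"] r by simp
    qed
    finally show ?thesis .
  qed
  have "((\<lambda>r. ennreal (S r)) \<longlongrightarrow> ennreal 0) (at_right 0)"
    by (intro tendsto_ennrealI Slim)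
  then have "((\<lambda>r. ennreal (S r)) \<longlongrightarrow> 0) (at_right 0)" by simp
  then show ?thesis
    by (rule tendsto_sandwich[OF _ _ tendsto_const, rotated 2])
       (auto simp: eventually_at_right_field simp del: times_divide_eq_right intro!: exI[of _ 1] le)
qed

definition Lebesgue_point :: "(real \<Rightarrow> complex) \<Rightarrow> real \<Rightarrow> bool" where
  "Lebesgue_point f x \<longleftrightarrow> (\<forall>e>0. \<exists>d>0. \<forall>h. 0 < h \<and> h < d \<longrightarrow>
    (\<integral>\<^sup>+z. indicator {- h..h} z * ennreal (cmod (f (x + z) - f x)) \<partial>lborel) \<le> ennreal (h * e))"

text \<open>The kernels share the mass \<open>L\<close>, so \<open>f x\<close> can be subtracted
  from \<open>f (x + z)\<close>; domination by Cauchy kernels of width \<open>r i\<close> reduces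
  the claim to \<open>Cauchy_kernel_average_tendsto\<close>.\<close>

lemma Lebesgue_point_approximate_identity:
  assumes [measurable]: "f \<in> borel_measurable borel" and f: "nsq f < \<infinity>" and x: "Lebesgue_point f x"
    and K: "\<And>i. integrable lborel (K i)" "\<And>i. (\<integral>z. K i z \<partial>lborel) = of_real L"
    and Kb: "\<And>i z. cmod (K i z) \<le> C * (r i / ((r i)\<^sup>2 + z\<^sup>2))"
    and r: "\<And>i. r i > 0" "r \<longlonglongrightarrow> 0"
  shows "(\<lambda>i. \<integral>z. f (x + z) * K i z \<partial>lborel) \<longlonglongrightarrow> L * f x"
proof -
  have [measurable]: "K i \<in> borel_measurable borel" for i using K(1)[of i] by (auto dest: borel_measurable_integrable)
  define J where "J s = (\<integral>\<^sup>+z. ennreal (cmod (f (x + z) - f x) * (s / (s\<^sup>2 + z\<^sup>2))) \<partial>lborel)" for s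
  have C: "C \<ge> 0"
  proof -
    have "0 \<le> C * (r 0 / ((r 0)\<^sup>2 + 0\<^sup>2))" using Kb[of 0 0] by (meson norm_ge_zero order.trans)
    then show ?thesis using r(1)[of 0] by (simp add: zero_le_mult_iff zero_le_divide_iff)
  qed
  obtain d where d: "d > 0" "\<And>h. 0 < h \<Longrightarrow> h < d \<Longrightarrow>
      (\<integral>\<^sup>+z. indicator {- h..h} z * ennreal (cmod (f (x + z) - f x)) \<partial>lborel) \<le> ennreal (h * 1)"
    using x unfolding Lebesgue_point_def by (meson zero_less_one)
  define N where "N = enn2real (nsq f)"
  have N: "nsq f = ennreal N" "N \<ge> 0" using f by (auto simp: N_def)
  \<comment> \<open>Beyond the radius \<open>d\<close> supplied by the Lebesgue point,
    \<open>cmod (f (x + z)) \<le> (cmod (f (x + z)))\<^sup>2 + 1\<close> brings in the total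
    \<open>N\<close>, and \<open>N \<le> h * (N / d)\<close> because
    \<open>h \<ge> d\<close>.\<close>
  have large: "(\<integral>\<^sup>+z. indicator {- h..h} z * ennreal (cmod (f (x + z) - f x)) \<partial>lborel)
      \<le> ennreal (h * (3 + N / d + 2 * cmod (f x)))" if h: "h > 0" for h
  proof (cases "h < d")
    case True
    have "h * 1 \<le> h * (3 + N / d + 2 * cmod (f x))"
      using h N d(1) by (intro mult_left_mono) (auto intro: add_increasing2)
    then show ?thesis using d(2)[OF h True] by (meson ennreal_leI order.trans)
  next
    case False
    have "(\<integral>\<^sup>+z. indicator {- h..h} z * ennreal (cmod (f (x + z) - f x)) \<partial>lborel)
      \<le> (\<integral>\<^sup>+z. ennreal ((cmod (f (x + z)))\<^sup>2) + ennreal (1 + cmod (f x)) * indicator {- h..h} z \<partial>lborel)"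
    proof (rule nn_integral_mono)
      fix z
      have "cmod (f (x + z) - f x) \<le> cmod (f (x + z)) + cmod (f x)" by (rule norm_triangle_ineq4)
      also have "cmod (f (x + z)) \<le> (cmod (f (x + z)))\<^sup>2 + 1"
        using sum_squares_bound[of "cmod (f (x + z))" 1, simplified] norm_ge_zero[of "f (x + z)"] by linarith
      finally have "cmod (f (x + z) - f x) \<le> (cmod (f (x + z)))\<^sup>2 + (1 + cmod (f x))" by simp
      then show "indicator {- h..h} z * ennreal (cmod (f (x + z) - f x)) \<le> ennreal ((cmod (f (x + z)))\<^sup>2) + ennreal (1 + cmod (f x)) * indicator {- h..h} z"
        by (auto simp: indicator_def ennreal_plus[symmetric] simp del: ennreal_plus intro: ennreal_leI)
    qed
    also have "\<dots> = (\<integral>\<^sup>+z. ennreal ((cmod (f (x + z)))\<^sup>2) \<partial>lborel) + ennreal (1 + cmod (f x)) * ennreal (2 * h)"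
      using h by (simp add: nn_integral_add nn_integral_cmult)
    also have "(\<integral>\<^sup>+z. ennreal ((cmod (f (x + z)))\<^sup>2) \<partial>lborel) = ennreal N"
      using nn_integral_real_affine[of "\<lambda>z. ennreal ((cmod (f z))\<^sup>2)" 1 x] N by (simp add: nsq_def)
    also have "ennreal N + ennreal (1 + cmod (f x)) * ennreal (2 * h) = ennreal (N + (1 + cmod (f x)) * (2 * h))"
      using h N by (simp add: ennreal_mult[symmetric] ennreal_plus[symmetric] del: ennreal_plus)
    also have "\<dots> \<le> ennreal (h * (3 + N / d + 2 * cmod (f x)))"
    proof (intro ennreal_leI)
      have "N * d \<le> N * h" using False N by (intro mult_left_mono) auto
      then have "N \<le> h * (N / d)" using d(1) by (simp add: field_simps)
      then show "N + (1 + cmod (f x)) * (2 * h) \<le> h * (3 + N / d + 2 * cmod (f x))"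
        using h by (simp add: algebra_simps)
    qed
    finally show ?thesis .
  qed
  have Jlim: "(J \<longlongrightarrow> 0) (at_right 0)"
    unfolding J_def
    by (rule Cauchy_kernel_average_tendsto[OF _ _ _ large]) (use x in \<open>auto simp: Lebesgue_point_def\<close>)
  have "filterlim r (at_right 0) sequentially"
    using r(2) by (auto simp: filterlim_at r(1) r(1)[THEN less_imp_neq, symmetric])
  then have Jr: "(\<lambda>i. J (r i)) \<longlonglongrightarrow> 0" by (rule filterlim_compose[OF Jlim])
  have CJ: "(\<lambda>i. ennreal C * J (r i)) \<longlonglongrightarrow> 0"
    using tendsto_mult_ennreal[OF tendsto_const Jr, of "ennreal C"] by simp
  \<comment> \<open>Finiteness of \<open>J (r i)\<close> makes the product with the kernel
    integrable, so that the integral may be split.\<close>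
  have fin: "\<forall>\<^sub>F i in sequentially. J (r i) < 1"
    using order_tendstoD(2)[OF Jr, of 1] by simp
  have "\<forall>\<^sub>F i in sequentially. ennreal (cmod ((\<integral>z. f (x + z) * K i z \<partial>lborel) - L * f x)) \<le> ennreal C * J (r i)"
    using fin
  proof eventually_elim
    case (elim i)
    have le: "(\<integral>\<^sup>+z. ennreal (cmod ((f (x + z) - f x) * K i z)) \<partial>lborel) \<le> ennreal C * J (r i)"
    proof -
      have "(\<integral>\<^sup>+z. ennreal (cmod ((f (x + z) - f x) * K i z)) \<partial>lborel)
        \<le> (\<integral>\<^sup>+z. ennreal C * ennreal (cmod (f (x + z) - f x) * (r i / ((r i)\<^sup>2 + z\<^sup>2))) \<partial>lborel)"
      proof (rule nn_integral_mono)
        fix z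
        have "cmod ((f (x + z) - f x) * K i z) \<le> cmod (f (x + z) - f x) * (C * (r i / ((r i)\<^sup>2 + z\<^sup>2)))"
          unfolding norm_mult by (intro mult_left_mono Kb) auto
        then show "ennreal (cmod ((f (x + z) - f x) * K i z)) \<le> ennreal C * ennreal (cmod (f (x + z) - f x) * (r i / ((r i)\<^sup>2 + z\<^sup>2)))"
          using C r(1)[of i] by (subst ennreal_mult[symmetric]) (auto simp: mult_ac intro!: ennreal_leI)
      qed
      also have "\<dots> = ennreal C * J (r i)" unfolding J_def by (rule nn_integral_cmult) measurable
      finally show ?thesis .
    qed
    have i1: "integrable lborel (\<lambda>z. (f (x + z) - f x) * K i z)"
    proof (rule integrableI_bounded)
      have "J (r i) < \<infinity>" using elim by (rule less_trans) simp
      then have "ennreal C * J (r i) < \<infinity>" by (simp add: ennreal_mult_less_top)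
      then show "(\<integral>\<^sup>+z. ennreal (cmod ((f (x + z) - f x) * K i z)) \<partial>lborel) < \<infinity>" using le by (rule le_less_trans[rotated])
    qed measurable
    have i2: "integrable lborel (\<lambda>z. f x * K i z)" by (intro integrable_mult_right K)
    have "(\<integral>z. f (x + z) * K i z \<partial>lborel) = (\<integral>z. (f (x + z) - f x) * K i z + f x * K i z \<partial>lborel)"
      by (simp add: algebra_simps)
    also have "\<dots> = (\<integral>z. (f (x + z) - f x) * K i z \<partial>lborel) + (\<integral>z. f x * K i z \<partial>lborel)"
      by (rule Bochner_Integration.integral_add[OF i1 i2])
    also have "(\<integral>z. f x * K i z \<partial>lborel) = L * f x"
      using K(2)[of i] by simp
    finally have "(\<integral>z. f (x + z) * K i z \<partial>lborel) - L * f x = (\<integral>z. (f (x + z) - f x) * K i z \<partial>lborel)" by simp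
    then have "ennreal (cmod ((\<integral>z. f (x + z) * K i z \<partial>lborel) - L * f x)) \<le> (\<integral>\<^sup>+z. ennreal (cmod ((f (x + z) - f x) * K i z)) \<partial>lborel)"
      using integral_norm_bound_ennreal[OF i1] by simp
    then show ?case using le by (rule order.trans)
  qed
  then have "(\<lambda>i. ennreal (cmod ((\<integral>z. f (x + z) * K i z \<partial>lborel) - L * f x))) \<longlonglongrightarrow> 0"
    by (rule tendsto_sandwich[OF _ _ tendsto_const CJ, rotated]) auto
  then have "(\<lambda>i. cmod ((\<integral>z. f (x + z) * K i z \<partial>lborel) - L * f x)) \<longlonglongrightarrow> 0"
    by (subst (asm) ennreal_0[symmetric], subst (asm) tendsto_ennreal_iff) auto
  then show ?thesis by (simp add: tendsto_norm_zero_iff LIM_zero_iff)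
qed

section \<open>Fourier inversion by Gaussian means\<close>

lemma nsq_gaussian: "\<epsilon> > 0 \<Longrightarrow> nsq (\<lambda>\<xi>. of_real (exp (- \<epsilon> * \<xi>\<^sup>2))) < \<infinity>"
  using gaussian_integrable[of "2 * \<epsilon>"]
  by (simp add: nsq_def integrable_iff_bounded power2_eq_square[of "exp _"] exp_add[symmetric] algebra_simps)

lemma FI_gaussian: "\<epsilon> > 0 \<Longrightarrow> FI (\<lambda>\<xi>. of_real (exp (- \<epsilon> * \<xi>\<^sup>2))) u = of_real (sqrt (pi / \<epsilon>) * exp (- u\<^sup>2 / (4 * \<epsilon>)))"
  using gaussian_fourier(2)[of \<epsilon> "- u"] by (simp add: FI_def mult.commute)

text \<open>Since \<open>exp (- y) \<le> 1 / (1 + y)\<close>, the Gaussian kernel is dominated by a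
  Cauchy kernel of width \<open>sqrt (\<epsilon> n)\<close>, and the means converge at every
  Lebesgue point.\<close>

lemma gaussian_inversion_AE:
  fixes f :: "real \<Rightarrow> complex"
  assumes [measurable]: "f \<in> borel_measurable borel" and f: "nsq f < \<infinity>" and g: "FT f g"
    and \<epsilon>: "\<And>n. \<epsilon> n > 0" "\<epsilon> \<longlonglongrightarrow> 0"
  shows "AE x in lborel. (\<lambda>n. \<integral>\<xi>. g \<xi> * (of_real (exp (- \<epsilon> n * \<xi>\<^sup>2)) * cis (x * \<xi>)) \<partial>lborel) \<longlonglongrightarrow> 2 * pi * f x"
proof -
  have "AE x in lborel. Lebesgue_point f x"
    unfolding Lebesgue_point_def by (rule AE_Lebesgue_point[OF assms(1) f])
  then show ?thesis
  proof eventually_elim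
    case (elim x)
    have "(\<integral>\<xi>. g \<xi> * (of_real (exp (- \<epsilon> n * \<xi>\<^sup>2)) * cis (x * \<xi>)) \<partial>lborel)
        = (\<integral>z. f (x + z) * of_real (sqrt (pi / \<epsilon> n) * exp (- z\<^sup>2 / (4 * \<epsilon> n))) \<partial>lborel)" for n
      using FT_modulated[OF _ f g _ nsq_gaussian[OF \<epsilon>(1)], of n x] gaussian_integrable[OF \<epsilon>(1), of n]
      by (simp only: assms(1) FI_gaussian[OF \<epsilon>(1)] complex_of_real_integrable_eq)
    moreover have "(\<lambda>n. \<integral>z. f (x + z) * of_real (sqrt (pi / \<epsilon> n) * exp (- z\<^sup>2 / (4 * \<epsilon> n))) \<partial>lborel) \<longlonglongrightarrow> complex_of_real (2 * pi) * f x"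
    proof (rule Lebesgue_point_approximate_identity[OF _ f elim])
      fix n
      show "integrable lborel (\<lambda>z. complex_of_real (sqrt (pi / \<epsilon> n) * exp (- z\<^sup>2 / (4 * \<epsilon> n))))"
        using gaussian_transform_integral(1)[OF \<epsilon>(1), of n] by (simp only: complex_of_real_integrable_eq)
      show "(\<integral>z. complex_of_real (sqrt (pi / \<epsilon> n) * exp (- z\<^sup>2 / (4 * \<epsilon> n))) \<partial>lborel) = complex_of_real (2 * pi)"
        using gaussian_transform_integral(2)[OF \<epsilon>(1), of n] by (simp only: integral_complex_of_real)
      fix z :: real
      define s where "s = sqrt (\<epsilon> n)"
      have s: "s > 0" "\<epsilon> n = s\<^sup>2" using \<epsilon>(1)[of n] by (auto simp: s_def)
      have "exp (- z\<^sup>2 / (4 * \<epsilon> n)) = 1 / exp (z\<^sup>2 / (4 * s\<^sup>2))" by (simp add: exp_minus s field_simps)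
      also have "\<dots> \<le> 1 / (1 + z\<^sup>2 / (4 * s\<^sup>2))"
        using exp_ge_add_one_self[of "z\<^sup>2 / (4 * s\<^sup>2)"] s by (intro divide_left_mono) (auto intro!: mult_pos_pos add_pos_nonneg)
      also have "\<dots> = 4 * s\<^sup>2 / (4 * s\<^sup>2 + z\<^sup>2)" using s by (simp add: field_simps)
      also have "\<dots> \<le> 4 * s\<^sup>2 / (s\<^sup>2 + z\<^sup>2)" using s by (intro divide_left_mono) (auto intro!: mult_pos_pos add_pos_nonneg)
      finally have e: "exp (- z\<^sup>2 / (4 * \<epsilon> n)) \<le> 4 * s\<^sup>2 / (s\<^sup>2 + z\<^sup>2)" .
      have "sqrt (pi / \<epsilon> n) = sqrt pi / s" using s by (simp add: real_sqrt_divide)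
      then have "cmod (complex_of_real (sqrt (pi / \<epsilon> n) * exp (- z\<^sup>2 / (4 * \<epsilon> n)))) = sqrt pi / s * exp (- z\<^sup>2 / (4 * \<epsilon> n))"
        using s by (simp only: norm_of_real) (simp add: abs_mult)
      also have "\<dots> \<le> sqrt pi / s * (4 * s\<^sup>2 / (s\<^sup>2 + z\<^sup>2))" using s by (intro mult_left_mono e) auto
      also have "\<dots> = 4 * sqrt pi * (s / (s\<^sup>2 + z\<^sup>2))" using s by (simp add: field_simps power2_eq_square)
      finally show "cmod (complex_of_real (sqrt (pi / \<epsilon> n) * exp (- z\<^sup>2 / (4 * \<epsilon> n)))) \<le> 4 * sqrt pi * (sqrt (\<epsilon> n) / ((sqrt (\<epsilon> n))\<^sup>2 + z\<^sup>2))"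
        by (simp only: s_def)
    next
      show "(\<lambda>n. sqrt (\<epsilon> n)) \<longlonglongrightarrow> 0" using tendsto_real_sqrt[OF \<epsilon>(2)] by simp
    qed (use \<epsilon>(1) in auto)
    ultimately show ?case by simp
  qed
qed

lemma nsq_reflect:
  assumes [measurable]: "f \<in> borel_measurable borel"
  shows "nsq (\<lambda>x. f (- x)) = nsq f"
  using nn_integral_real_affine[of "\<lambda>x. ennreal ((cmod (f x))\<^sup>2)" "-1" 0] by (simp add: nsq_def)

lemma FI_reflect: "FI F (- x) = (\<integral>\<xi>. F \<xi> * cis (x * \<xi>) \<partial>lborel)"
  by (simp add: FI_def mult.commute)

text \<open>Inversion with an error controlled by the tail of \<open>g\<close>. The Gaussian means
  converge to \<open>2 * pi * f\<close> almost everywhere, and their difference from the truncated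
  inverse is a reflected Fourier integral of \<open>G n\<close>, to which \<open>nsq_FI_le\<close>
  applies; Fatou's lemma passes to the limit.\<close>

lemma FT_inversion:
  fixes f :: "real \<Rightarrow> complex"
  assumes [measurable]: "f \<in> borel_measurable borel" and f: "nsq f < \<infinity>" and g: "FT f g"
  shows "nsq (\<lambda>x. 2 * pi * f x - FI (trunc k g) (- x)) \<le> ennreal (2 * pi) * nsq (\<lambda>\<xi>. g \<xi> - trunc k g \<xi>)"
proof -
  have gm [measurable]: "g \<in> borel_measurable borel" using g by (simp add: FT_def)
  have gf: "nsq g < \<infinity>" by (rule FT_nsq_finite[OF assms(1) f g])
  define \<epsilon> where "\<epsilon> n = 1 / (real n + 1)" for n
  have \<epsilon>: "\<epsilon> n > 0" for n by (simp add: \<epsilon>_def)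
  have \<epsilon>lim: "\<epsilon> \<longlonglongrightarrow> 0" unfolding \<epsilon>_def by real_asymp
  define G where "G n \<xi> = g \<xi> * of_real (exp (- \<epsilon> n * \<xi>\<^sup>2)) - trunc k g \<xi>" for n \<xi>
  have [measurable]: "G n \<in> borel_measurable borel" for n unfolding G_def by measurable
  have i1: "integrable lborel (\<lambda>\<xi>. g \<xi> * of_real (exp (- \<epsilon> n * \<xi>\<^sup>2)))" for n
    by (intro integrable_mult_nsq gf nsq_gaussian[OF \<epsilon>]) measurable
  have it: "integrable lborel (trunc k g)" by (rule integrable_trunc[OF gm gf])
  have FIG: "FI (G n) (- x) = (\<integral>\<xi>. g \<xi> * (of_real (exp (- \<epsilon> n * \<xi>\<^sup>2)) * cis (x * \<xi>)) \<partial>lborel) - FI (trunc k g) (- x)" for n x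
    unfolding G_def FI_diff[OF i1 it] by (simp add: FI_reflect mult_ac)
  have e1: "exp (- \<epsilon> n * \<xi>\<^sup>2) \<le> 1" for n \<xi> using \<epsilon>[of n] by simp
  have elim1: "(\<lambda>n. exp (- \<epsilon> n * \<xi>\<^sup>2)) \<longlonglongrightarrow> 1" for \<xi>
  proof -
    have "(\<lambda>n. exp (- \<epsilon> n * \<xi>\<^sup>2)) \<longlonglongrightarrow> exp (- 0 * \<xi>\<^sup>2)" by (intro tendsto_intros \<epsilon>lim)
    then show ?thesis by simp
  qed
  have Glim: "(\<lambda>n. nsq (G n)) \<longlonglongrightarrow> nsq (\<lambda>\<xi>. g \<xi> - trunc k g \<xi>)"
    unfolding nsq_def
  proof (rule nn_integral_dominated_convergence[where w = "\<lambda>\<xi>. 4 * ennreal ((cmod (g \<xi>))\<^sup>2)"])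
    show "AE \<xi> in lborel. (\<lambda>n. ennreal ((cmod (G n \<xi>))\<^sup>2)) \<longlonglongrightarrow> ennreal ((cmod (g \<xi> - trunc k g \<xi>))\<^sup>2)"
    proof (intro AE_I2 tendsto_ennrealI)
      fix \<xi>
      have "(\<lambda>n. (cmod (G n \<xi>))\<^sup>2) \<longlonglongrightarrow> (cmod (g \<xi> * of_real 1 - trunc k g \<xi>))\<^sup>2"
        unfolding G_def by (intro tendsto_intros elim1)
      then show "(\<lambda>n. (cmod (G n \<xi>))\<^sup>2) \<longlonglongrightarrow> (cmod (g \<xi> - trunc k g \<xi>))\<^sup>2" by simp
    qed
    show "AE \<xi> in lborel. ennreal ((cmod (G n \<xi>))\<^sup>2) \<le> 4 * ennreal ((cmod (g \<xi>))\<^sup>2)" for n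
    proof (rule AE_I2)
      fix \<xi>
      have "cmod (G n \<xi>) \<le> cmod (g \<xi> * of_real (exp (- \<epsilon> n * \<xi>\<^sup>2))) + cmod (trunc k g \<xi>)"
        unfolding G_def by (rule norm_triangle_ineq4)
      also have "\<dots> \<le> cmod (g \<xi>) * 1 + cmod (g \<xi>)"
        unfolding norm_mult using e1[of n \<xi>] by (intro add_mono mult_left_mono cmod_trunc_le) auto
      finally have "(cmod (G n \<xi>))\<^sup>2 \<le> (2 * cmod (g \<xi>))\<^sup>2" by (intro power_mono) auto
      then have "ennreal ((cmod (G n \<xi>))\<^sup>2) \<le> ennreal (4 * (cmod (g \<xi>))\<^sup>2)" by (intro ennreal_leI) (simp add: power_mult_distrib)
      then show "ennreal ((cmod (G n \<xi>))\<^sup>2) \<le> 4 * ennreal ((cmod (g \<xi>))\<^sup>2)" by (simp add: ennreal_mult)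
    qed
    show "(\<integral>\<^sup>+\<xi>. 4 * ennreal ((cmod (g \<xi>))\<^sup>2) \<partial>lborel) < \<infinity>"
      using gf by (simp add: nn_integral_cmult nsq_def ennreal_mult_less_top)
  qed measurable
  show ?thesis
    unfolding nsq_def[of "\<lambda>x. 2 * pi * f x - FI (trunc k g) (- x)"]
  proof (rule nn_integral_Fatou_bound[where u = "\<lambda>n x. ennreal ((cmod (FI (G n) (- x)))\<^sup>2)" and c = "\<lambda>n. ennreal (2 * pi) * nsq (G n)"])
    show "(\<lambda>n. ennreal (2 * pi) * nsq (G n)) \<longlonglongrightarrow> ennreal (2 * pi) * nsq (\<lambda>\<xi>. g \<xi> - trunc k g \<xi>)"
      by (intro ennreal_tendsto_cmult Glim) auto
    show "AE x in lborel. (\<lambda>n. ennreal ((cmod (FI (G n) (- x)))\<^sup>2)) \<longlonglongrightarrow> ennreal ((cmod (2 * pi * f x - FI (trunc k g) (- x)))\<^sup>2)"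
      using gaussian_inversion_AE[OF assms(1) f g \<epsilon> \<epsilon>lim]
    proof eventually_elim
      case (elim x)
      then show ?case unfolding FIG by (intro tendsto_ennrealI tendsto_intros)
    qed
    fix n
    have "(\<integral>\<^sup>+x. ennreal ((cmod (FI (G n) (- x)))\<^sup>2) \<partial>lborel) = nsq (FI (G n))"
      using nsq_reflect[of "FI (G n)"] by (simp add: nsq_def)
    also have "\<dots> \<le> ennreal (2 * pi) * nsq (G n)"
      unfolding G_def by (intro nsq_FI_le Bochner_Integration.integrable_diff i1 it)
    finally show "(\<integral>\<^sup>+x. ennreal ((cmod (FI (G n) (- x)))\<^sup>2) \<partial>lborel) \<le> ennreal (2 * pi) * nsq (G n)" .
  qed measurable
qed

text \<open>The preimage of \<open>g\<close> is its reflected transform divided by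
  \<open>2 * pi\<close>, and \<open>FT_inversion\<close> applied to \<open>g\<close> is the
  convergence that \<open>FT\<close> demands. This allows the divergent example to be built on the
  frequency side.\<close>

lemma FT_surj:
  assumes [measurable]: "g \<in> borel_measurable borel" and g: "nsq g < \<infinity>"
  shows "\<exists>f \<in> borel_measurable borel. nsq f < \<infinity> \<and> FT f g"
proof -
  obtain G where G: "FT g G" using FT_exists[OF assms] by blast
  then have [measurable]: "G \<in> borel_measurable borel" by (simp add: FT_def)
  have Gf: "nsq G < \<infinity>" by (rule FT_nsq_finite[OF assms G])
  define f where "f y = G (- y) / (2 * pi)" for y
  have [measurable]: "f \<in> borel_measurable borel" unfolding f_def by measurable
  have "nsq f \<le> nsq (\<lambda>y. G (- y))"
  proof (rule nsq_mono)
    fix x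
    have "cmod (G (- x)) / (2 * pi) \<le> cmod (G (- x)) / 1"
      using pi_gt3 by (intro divide_left_mono) auto
    then show "cmod (f x) \<le> cmod (G (- x))" by (simp add: f_def norm_divide norm_mult)
  qed
  also have "\<dots> < \<infinity>" using Gf by (simp add: nsq_reflect)
  finally have ff: "nsq f < \<infinity>" .
  have FIf: "FI (trunc n f) \<xi> = FI (trunc n G) (- \<xi>) / (2 * pi)" for n \<xi>
  proof -
    have "FI (trunc n f) \<xi> = (\<integral>y. (trunc n G (- y) * cis (- (y * \<xi>))) / (2 * pi) \<partial>lborel)"
      unfolding FI_def by (intro Bochner_Integration.integral_cong) (auto simp: trunc_def f_def indicator_def)
    also have "\<dots> = (\<integral>y. trunc n G (- y) * cis (- (y * \<xi>)) \<partial>lborel) / (2 * pi)"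
      by (rule integral_divide_zero)
    also have "(\<integral>y. trunc n G (- y) * cis (- (y * \<xi>)) \<partial>lborel) = FI (trunc n G) (- \<xi>)"
      unfolding FI_def by (subst lborel_integral_real_affine[where c = "-1" and t = 0]) auto
    finally show ?thesis .
  qed
  have le: "nsq (\<lambda>\<xi>. FI (trunc n f) \<xi> - g \<xi>) \<le> ennreal (2 * pi) * nsq (\<lambda>\<xi>. G \<xi> - trunc n G \<xi>)" for n
  proof -
    have "nsq (\<lambda>\<xi>. FI (trunc n f) \<xi> - g \<xi>) \<le> nsq (\<lambda>\<xi>. 2 * pi * g \<xi> - FI (trunc n G) (- \<xi>))"
    proof (rule nsq_mono)
      fix \<xi>
      have "FI (trunc n f) \<xi> - g \<xi> = - ((2 * pi * g \<xi> - FI (trunc n G) (- \<xi>)) / (2 * pi))"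
        unfolding FIf by (simp add: field_simps)
      then have "cmod (FI (trunc n f) \<xi> - g \<xi>) = cmod (2 * pi * g \<xi> - FI (trunc n G) (- \<xi>)) / (2 * pi)"
        by (simp add: norm_divide norm_mult)
      also have "\<dots> \<le> cmod (2 * pi * g \<xi> - FI (trunc n G) (- \<xi>)) / 1"
        using pi_gt3 by (intro divide_left_mono) auto
      finally show "cmod (FI (trunc n f) \<xi> - g \<xi>) \<le> cmod (2 * pi * g \<xi> - FI (trunc n G) (- \<xi>))" by simp
    qed
    also have "\<dots> \<le> ennreal (2 * pi) * nsq (\<lambda>\<xi>. G \<xi> - trunc n G \<xi>)"
      by (rule FT_inversion[OF assms G])
    finally show ?thesis .
  qed
  have "(\<lambda>n. ennreal (2 * pi) * nsq (\<lambda>\<xi>. G \<xi> - trunc n G \<xi>)) \<longlonglongrightarrow> ennreal (2 * pi) * 0"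
    by (intro ennreal_tendsto_cmult nsq_trunc_diff_tendsto Gf) auto
  then have lim: "(\<lambda>n. ennreal (2 * pi) * nsq (\<lambda>\<xi>. G \<xi> - trunc n G \<xi>)) \<longlonglongrightarrow> 0" by simp
  have "(\<lambda>n. nsq (\<lambda>\<xi>. FI (trunc n f) \<xi> - g \<xi>)) \<longlonglongrightarrow> 0"
    by (rule tendsto_sandwich[OF _ _ tendsto_const lim]) (auto intro!: always_eventually le)
  then have "FT f g" by (simp add: FT_def)
  then show ?thesis using ff by (intro bexI[of _ f]) auto
qed

section \<open>Kernels of the damped multiplier and the case \<open>\<gamma> \<le> 1\<close>\<close>

lemma powr_mult_exp_le:
  fixes y q w :: real
  assumes "y > 0" "q > 0" "w > 0"
  shows "y powr q * exp (- w * y) \<le> (q / w) powr q"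
proof -
  \<comment> \<open>The maximum lies at \<open>y = q / w\<close>. With \<open>z = w * y / q\<close>
    the bound follows from \<open>ln z \<le> z\<close>, at the cost of a factor
    \<open>exp (- q)\<close>.\<close>
  have "y = (q / w) * (w * y / q)" using assms by simp
  then have "ln y = ln (q / w) + ln (w * y / q)"
    using assms by (metis ln_mult_pos divide_pos_pos mult_pos_pos)
  also have "ln (w * y / q) \<le> w * y / q"
    using ln_le_minus_one[of "w * y / q"] assms by auto
  finally have "q * ln y \<le> q * (ln (q / w) + w * y / q)" using assms by (intro mult_left_mono) auto
  then have "q * ln y + - w * y \<le> q * ln (q / w)" using assms by (simp add: algebra_simps)
  then have "exp (q * ln y) * exp (- w * y) \<le> exp (q * ln (q / w))"
    by (simp only: exp_add[symmetric] exp_le_cancel_iff)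
  then show ?thesis using assms by (simp add: powr_def)
qed

lemma integrable_lborel_of_has_integral:
  fixes f :: "real \<Rightarrow> real"
  assumes [measurable]: "f \<in> borel_measurable borel" "S \<in> sets borel"
    and f0: "\<And>x. x \<in> S \<Longrightarrow> f x \<ge> 0" and I: "(f has_integral I) S"
  shows "integrable lborel (\<lambda>x. indicator S x * f x)"
proof (rule integrableI_nonneg)
  have eq: "(if x \<in> S then f x else 0) = indicator S x * f x" for x by (simp add: indicator_def)
  have "((\<lambda>x. indicator S x * f x) has_integral I) UNIV"
    using I unfolding has_integral_restrict_UNIV[symmetric, of f] eq .
  then have "integral\<^sup>N lborel (\<lambda>x. indicator S x * f x) = I"
    by (intro nn_integral_has_integral_lborel) (auto simp: indicator_def f0)
  then show "(\<integral>\<^sup>+x. ennreal (indicator S x * f x) \<partial>lborel) < \<infinity>" by simp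
qed (auto simp: indicator_def f0)

lemma integrable_powr_exp:
  fixes p a w :: real
  assumes p: "p > -1" and a: "a > 0" and w: "w > 0"
  shows "integrable lborel (\<lambda>x. indicator {0<..} x * (x powr p * exp (- w * x powr a)))"
proof -
  \<comment> \<open>Chosen with \<open>a * q = \<bar>p\<bar> + 2\<close>, so that the exponential
    absorbs \<open>x powr \<bar>p\<bar>\<close> and leaves the integrable \<open>x powr (-2)\<close>
    beyond 1.\<close>
  define q where "q = (\<bar>p\<bar> + 2) / a"
  have q: "q > 0" using a by (simp add: q_def)
  define C where "C = (q / w) powr q"
  have "integrable lborel (\<lambda>x::real. indicator {0..1} x * x powr p)"
    by (rule integrable_lborel_of_has_integral[OF _ _ _ has_integral_powr_from_0[OF p]]) auto
  moreover have "integrable lborel (\<lambda>x::real. C * (indicator {1..} x * x powr (-2)))"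
    by (intro integrable_mult_right integrable_lborel_of_has_integral[OF _ _ _ has_integral_powr_to_inf]) auto
  ultimately have "integrable lborel (\<lambda>x::real. indicator {0..1} x * x powr p + C * (indicator {1..} x * x powr (-2)))"
    by (rule Bochner_Integration.integrable_add)
  then show ?thesis
  proof (rule Bochner_Integration.integrable_bound)
    have "norm (indicator {0<..} x * (x powr p * exp (- w * x powr a)))
        \<le> norm (indicator {0..1} x * x powr p + C * (indicator {1..} x * x powr (-2)))" for x :: real
    proof (cases "x > 0")
      case True
      have C: "C \<ge> 0" by (simp add: C_def)
      show ?thesis
      proof (cases "x \<le> 1")
        case True
        have "x powr p * exp (- w * x powr a) \<le> x powr p * 1"
          using w by (intro mult_left_mono) auto
        also have "\<dots> \<le> x powr p + C * (indicator {1..} x * x powr (-2))" using C by (simp add: indicator_def)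
        finally show ?thesis using True \<open>x > 0\<close> C by (simp add: abs_mult)
      next
        case False
        have "x powr p * exp (- w * x powr a) \<le> x powr \<bar>p\<bar> * exp (- w * x powr a)"
          using False by (intro mult_right_mono powr_mono) auto
        also have "x powr \<bar>p\<bar> = x powr (a * q + (-2))" using a by (simp add: q_def)
        also have "\<dots> = x powr (-2) * (x powr a) powr q" unfolding powr_add powr_powr by simp
        also have "x powr (-2) * (x powr a) powr q * exp (- w * x powr a) = x powr (-2) * ((x powr a) powr q * exp (- w * x powr a))"
          by (simp add: mult_ac)
        also have "\<dots> \<le> x powr (-2) * C"
          unfolding C_def using q w \<open>x > 0\<close> by (intro mult_left_mono powr_mult_exp_le) auto
        finally show ?thesis using False C by (simp add: abs_mult mult_ac)
      qed
    qed (simp add: indicator_def)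
    then show "AE x in lborel. norm (indicator {0<..} x * (x powr p * exp (- w * x powr a)))
        \<le> norm (indicator {0..1} x * x powr p + C * (indicator {1..} x * x powr (-2)))" by simp
  qed simp
qed

lemma AE_lborel_neq: "AE x in lborel. x \<noteq> (c::real)"
  by (rule AE_lborel_singleton)

lemma integral_half_line:
  fixes F :: "real \<Rightarrow> 'b::{banach, second_countable_topology}"
  assumes F: "integrable lborel F"
  shows "(\<integral>x. F x \<partial>lborel) = (\<integral>x. indicator {0<..} x *\<^sub>R (F x + F (- x)) \<partial>lborel)"
proof -
  have [measurable]: "F \<in> borel_measurable borel" using F by (auto dest: borel_measurable_integrable)
  have F': "integrable lborel (\<lambda>x. F (- x))" using lborel_integrable_real_affine[OF F, of "-1" 0] by simp
  have i: "integrable lborel (\<lambda>x. indicator {0<..} x *\<^sub>R F x)" "integrable lborel (\<lambda>x. indicator {..<0} x *\<^sub>R F x)"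
      "integrable lborel (\<lambda>x. indicator {0<..} x *\<^sub>R F (- x))"
    by (intro integrable_mult_indicator F F'; simp)+
  have "(\<integral>x. F x \<partial>lborel) = (\<integral>x. indicator {0<..} x *\<^sub>R F x + indicator {..<0} x *\<^sub>R F x \<partial>lborel)"
    using AE_lborel_neq[of 0] by (intro integral_cong_AE) (auto elim!: eventually_mono simp: indicator_def)
  also have "\<dots> = (\<integral>x. indicator {0<..} x *\<^sub>R F x \<partial>lborel) + (\<integral>x. indicator {..<0} x *\<^sub>R F x \<partial>lborel)"
    by (intro Bochner_Integration.integral_add i)
  also have "(\<integral>x. indicator {..<0} x *\<^sub>R F x \<partial>lborel) = (\<integral>x. indicator {0<..} x *\<^sub>R F (- x) \<partial>lborel)"
    by (subst lborel_integral_real_affine[where c = "-1" and t = 0]) (auto intro!: Bochner_Integration.integral_cong simp: indicator_def)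
  also have "(\<integral>x. indicator {0<..} x *\<^sub>R F x \<partial>lborel) + \<dots> = (\<integral>x. indicator {0<..} x *\<^sub>R F x + indicator {0<..} x *\<^sub>R F (- x) \<partial>lborel)"
    by (intro Bochner_Integration.integral_add[symmetric] i)
  finally show ?thesis by (simp add: scaleR_add_right)
qed

lemma integrable_abs_arg:
  fixes h :: "real \<Rightarrow> real"
  assumes [measurable]: "h \<in> borel_measurable borel" and h: "integrable lborel (\<lambda>x. indicator {0<..} x * h x)"
  shows "integrable lborel (\<lambda>x. h \<bar>x\<bar>)"
proof -
  have "integrable lborel (\<lambda>x. indicator {0<..} x * h x + indicator {0<..} (- x) * h (- x))"
    using lborel_integrable_real_affine[OF h, of "-1" 0] h by (intro Bochner_Integration.integrable_add) auto
  then show ?thesis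
    using AE_lborel_neq[of 0] by (subst integrable_cong_AE[where g = "\<lambda>x. indicator {0<..} x * h x + indicator {0<..} (- x) * h (- x)"])
      (auto elim!: eventually_mono simp: indicator_def)
qed

lemma integrable_abs_powr_exp:
  fixes p a w :: real
  assumes "p > -1" "a > 0" "w > 0"
  shows "integrable lborel (\<lambda>x. \<bar>x\<bar> powr p * exp (- w * \<bar>x\<bar> powr a))"
  by (rule integrable_abs_arg[of "\<lambda>x. x powr p * exp (- w * x powr a)"]) (use integrable_powr_exp[OF assms] in simp_all)

lemma integrable_exp_powr:
  fixes a w :: real
  assumes "a > 0" "w > 0"
  shows "integrable lborel (\<lambda>x. exp (- w * \<bar>x\<bar> powr a))"
proof -
  have "integrable lborel (\<lambda>x. \<bar>x\<bar> powr 0 * exp (- w * \<bar>x\<bar> powr a))"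
    by (rule integrable_abs_powr_exp) (use assms in auto)
  \<comment> \<open>At the origin \<open>\<bar>x\<bar> powr 0\<close> is 0, so the two integrands
    agree only almost everywhere.\<close>
  then show ?thesis
    using AE_lborel_neq[of 0] by (subst integrable_cong_AE[where g = "\<lambda>x. \<bar>x\<bar> powr 0 * exp (- w * \<bar>x\<bar> powr a)"])
      (auto elim!: eventually_mono)
qed

text \<open>Two integrations by parts; the second derivative of the amplitude is of order \<open>x powr (a - 2)\<close>
  at the origin, which is integrable because \<open>a > 1\<close>.\<close>

lemma cosine_transform_decay:
  fixes a :: real
  assumes a: "a > 1"
  shows "\<exists>C\<ge>0. \<forall>l \<theta> v. 0 \<le> l \<longrightarrow> l \<le> 1 \<longrightarrow> v \<noteq> 0 \<longrightarrow>
    \<bar>\<integral>x. indicator {0<..} x * (exp (- (x powr a)) * cos (l * x powr a + \<theta>) * cos (v * x)) \<partial>lborel\<bar> \<le> C / v\<^sup>2"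
proof -
  define m where "m x = 4 * a\<^sup>2 * (x powr (2 * a - 2) * exp (- 1 * x powr a)) + 2 * (a * (a - 1)) * (x powr (a - 2) * exp (- 1 * x powr a))" for x :: real
  have m_int: "integrable lborel (\<lambda>x. indicator {0<..} x * m x)"
  proof -
    have "integrable lborel (\<lambda>x. 4 * a\<^sup>2 * (indicator {0<..} x * (x powr (2 * a - 2) * exp (- 1 * x powr a)))
        + 2 * (a * (a - 1)) * (indicator {0<..} x * (x powr (a - 2) * exp (- 1 * x powr a))))"
      by (intro Bochner_Integration.integrable_add integrable_mult_right integrable_powr_exp) (use a in auto)
    then show ?thesis by (simp add: m_def algebra_simps)
  qed
  have m0: "m x \<ge> 0" for x using a by (simp add: m_def)
  define C where "C = (\<integral>x. indicator {0<..} x * m x \<partial>lborel)"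
  have C0: "C \<ge> 0" unfolding C_def using m0 by (intro integral_nonneg_AE) auto
  have "\<bar>\<integral>x. indicator {0<..} x * (exp (- (x powr a)) * cos (l * x powr a + \<theta>) * cos (v * x)) \<partial>lborel\<bar> \<le> C / v\<^sup>2"
    if l: "0 \<le> l" "l \<le> 1" and v: "v \<noteq> 0" for l \<theta> v
  proof -
    \<comment> \<open>The amplitude as a function of \<open>y = x powr a\<close>. The free phase
      \<open>\<theta>\<close> covers the real and the imaginary part of the transform at
      once.\<close>
    define u where "u y = exp (- y) * cos (l * y + \<theta>)" for y
    define u1 where "u1 y = - exp (- y) * (cos (l * y + \<theta>) + l * sin (l * y + \<theta>))" for y
    define u2 where "u2 y = exp (- y) * ((1 - l\<^sup>2) * cos (l * y + \<theta>) + 2 * l * sin (l * y + \<theta>))" for y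
    have du: "(u has_real_derivative u1 y) (at y)" for y
      unfolding u_def u1_def by (auto intro!: derivative_eq_intros simp: algebra_simps)
    have du1: "(u1 has_real_derivative u2 y) (at y)" for y
      unfolding u1_def u2_def by (auto intro!: derivative_eq_intros simp: algebra_simps power2_eq_square)
    have u_le: "\<bar>u y\<bar> \<le> exp (- y)" for y
      unfolding u_def by (simp add: abs_mult mult_left_le)
    have ls: "\<bar>l * sin z\<bar> \<le> 1" for z
      using l mult_mono[of "\<bar>l\<bar>" 1 "\<bar>sin z\<bar>" 1] by (simp add: abs_mult)
    have u1_le: "\<bar>u1 y\<bar> \<le> 2 * exp (- y)" for y
    proof -
      have "\<bar>u1 y\<bar> = exp (- y) * \<bar>cos (l * y + \<theta>) + l * sin (l * y + \<theta>)\<bar>" by (simp add: u1_def abs_mult)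
      also have "\<dots> \<le> exp (- y) * 2"
        using ls[of "l * y + \<theta>"] abs_cos_le_one[of "l * y + \<theta>"] by (intro mult_left_mono) (linarith, simp)
      finally show ?thesis by simp
    qed
    have u2_le: "\<bar>u2 y\<bar> \<le> 4 * exp (- y)" for y
    proof -
      have l2: "0 \<le> 1 - l\<^sup>2" "1 - l\<^sup>2 \<le> 1" using l by (auto simp: power_le_one)
      have "\<bar>(1 - l\<^sup>2) * cos (l * y + \<theta>)\<bar> \<le> 1"
        using l2 mult_mono[of "\<bar>1 - l\<^sup>2\<bar>" 1 "\<bar>cos (l * y + \<theta>)\<bar>" 1] by (simp add: abs_mult)
      then have "\<bar>(1 - l\<^sup>2) * cos (l * y + \<theta>) + 2 * l * sin (l * y + \<theta>)\<bar> \<le> 4"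
        using ls[of "l * y + \<theta>"] by linarith
      then have "exp (- y) * \<bar>(1 - l\<^sup>2) * cos (l * y + \<theta>) + 2 * l * sin (l * y + \<theta>)\<bar> \<le> exp (- y) * 4"
        by (intro mult_left_mono) auto
      then show ?thesis by (simp add: u2_def abs_mult)
    qed
    define \<psi>1 where "\<psi>1 x = u1 (x powr a) * (a * x powr (a - 1))" for x
    define \<psi>2 where "\<psi>2 x = u2 (x powr a) * (a\<^sup>2 * x powr (2 * a - 2)) + u1 (x powr a) * (a * ((a - 1) * x powr (a - 2)))" for x
    have d0: "((\<lambda>x. u (x powr a)) has_real_derivative \<psi>1 x) (at x)" if "x > 0" for x
      unfolding \<psi>1_def by (rule DERIV_chain2[OF du has_real_derivative_powr[OF that]])
    have d1: "(\<psi>1 has_real_derivative \<psi>2 x) (at x)" if "x > 0" for x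
    proof -
      have "((\<lambda>x. u1 (x powr a) * (a * x powr (a - 1))) has_real_derivative
        u2 (x powr a) * (a * x powr (a - 1)) * (a * x powr (a - 1)) + a * ((a - 1) * x powr (a - 1 - 1)) * u1 (x powr a)) (at x)"
        by (intro DERIV_mult DERIV_chain2[OF du1] DERIV_cmult has_real_derivative_powr that)
      moreover have "x powr (a - 1) * x powr (a - 1) = x powr (2 * a - 2)" by (simp flip: powr_add)
      then have e1: "u2 (x powr a) * (a * x powr (a - 1)) * (a * x powr (a - 1)) = u2 (x powr a) * (a\<^sup>2 * x powr (2 * a - 2))"
        by (simp add: power2_eq_square mult_ac)
      have e2: "a - 1 - 1 = a - 2" by simp
      have "u2 (x powr a) * (a * x powr (a - 1)) * (a * x powr (a - 1)) + a * ((a - 1) * x powr (a - 1 - 1)) * u1 (x powr a) = \<psi>2 x"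
        unfolding \<psi>2_def e1 e2 by (simp only: mult_ac)
      ultimately show ?thesis unfolding \<psi>1_def[abs_def] by simp
    qed
    have \<psi>2_le: "\<bar>\<psi>2 x\<bar> \<le> m x" for x
    proof -
      have "\<bar>\<psi>2 x\<bar> \<le> \<bar>u2 (x powr a)\<bar> * (a\<^sup>2 * x powr (2 * a - 2)) + \<bar>u1 (x powr a)\<bar> * (a * ((a - 1) * x powr (a - 2)))"
        unfolding \<psi>2_def using a by (intro order.trans[OF abs_triangle_ineq]) (simp add: abs_mult)
      also have "\<dots> \<le> (4 * exp (- (x powr a))) * (a\<^sup>2 * x powr (2 * a - 2)) + (2 * exp (- (x powr a))) * (a * ((a - 1) * x powr (a - 2)))"
        using a by (intro add_mono mult_right_mono u2_le u1_le) auto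
      also have "\<dots> = m x" by (simp add: m_def mult_ac)
      finally show ?thesis .
    qed
    have [measurable]: "\<psi>2 \<in> borel_measurable borel"
      unfolding \<psi>2_def u1_def u2_def by measurable
    have [measurable]: "u \<in> borel_measurable borel"
      unfolding u_def by measurable
    \<comment> \<open>\<open>F\<close> collects the boundary terms of both integrations by parts;
      its derivative is the integrand plus the remainder containing \<open>\<psi>2\<close>. It
      vanishes at both ends, at the origin because \<open>sin 0 = 0\<close> and because
      \<open>\<psi>1\<close> tends to 0 there when \<open>a > 1\<close>.\<close>
    define F where "F x = u (x powr a) * (sin (v * x) / v) + \<psi>1 x * (cos (v * x) / v\<^sup>2)" for x
    define f where "f x = u (x powr a) * cos (v * x) + \<psi>2 x * (cos (v * x) / v\<^sup>2)" for x
    have dF: "(F has_real_derivative f x) (at x)" if x: "x > 0" for x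
    proof -
      have "(F has_real_derivative (\<psi>1 x * (sin (v * x) / v) + cos (v * x) * u (x powr a)) + (\<psi>2 x * (cos (v * x) / v\<^sup>2) + (- sin (v * x) / v) * \<psi>1 x)) (at x)"
        unfolding F_def[abs_def]
        by (intro DERIV_add DERIV_mult d0[OF x] d1[OF x])
           (use v in \<open>auto intro!: derivative_eq_intros simp: power2_eq_square\<close>)
      then show ?thesis by (simp add: f_def algebra_simps)
    qed
    have i1: "integrable lborel (\<lambda>x. indicator {0<..} x * (u (x powr a) * cos (v * x)))"
    proof (rule Bochner_Integration.integrable_bound)
      show "integrable lborel (\<lambda>x. indicator {0<..} x * (x powr 0 * exp (- 1 * x powr a)))"
        by (rule integrable_powr_exp) (use a in auto)
      have "\<bar>u (x powr a) * cos (v * x)\<bar> \<le> exp (- (x powr a))" for x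
        using mult_mono[OF u_le abs_cos_le_one, of "x powr a" "v * x"] by (simp add: abs_mult)
      then show "AE x in lborel. norm (indicator {0<..} x * (u (x powr a) * cos (v * x))) \<le> norm (indicator {0<..} x * (x powr 0 * exp (- 1 * x powr a)))"
        by (auto simp: indicator_def)
    qed measurable
    have i2: "integrable lborel (\<lambda>x. indicator {0<..} x * (\<psi>2 x * (cos (v * x) / v\<^sup>2)))"
    proof (rule Bochner_Integration.integrable_bound)
      show "integrable lborel (\<lambda>x. indicator {0<..} x * m x / v\<^sup>2)"
        using m_int by simp
      have "\<bar>\<psi>2 x * (cos (v * x) / v\<^sup>2)\<bar> \<le> m x / v\<^sup>2" for x
        using mult_mono[OF \<psi>2_le abs_cos_le_one, of x "v * x"] m0[of x] v by (simp add: abs_mult divide_right_mono)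
      then show "AE x in lborel. norm (indicator {0<..} x * (\<psi>2 x * (cos (v * x) / v\<^sup>2))) \<le> norm (indicator {0<..} x * m x / v\<^sup>2)"
        using m0 by (auto simp: indicator_def)
    qed measurable
    have "(LBINT x=ereal 0..\<infinity>. f x) = 0 - 0"
    proof (rule interval_integral_FTC_integrable)
      show "(F has_vector_derivative f x) (at x)" if "ereal 0 < ereal x" for x
        using dF[of x] that by (simp add: has_real_derivative_iff_has_vector_derivative)
      show "isCont f x" if "ereal 0 < ereal x" for x
        using that v unfolding f_def u_def \<psi>2_def u2_def u1_def by (auto intro!: continuous_intros)
      show "set_integrable lborel (einterval (ereal 0) \<infinity>) f"
        using Bochner_Integration.integrable_add[OF i1 i2]
        by (simp add: set_integrable_def f_def distrib_left)
      have p0: "((\<lambda>x. x powr q) \<longlongrightarrow> 0) (at_right (0::real))" if "q > 0" for q :: real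
        using that by (intro tendsto_zero_powrI[where b = q]) (auto simp: eventually_at_right_field intro!: exI[of _ 1])
      have "(F \<longlongrightarrow> u 0 * (sin (v * 0) / v) + u1 0 * (a * 0) * (cos (v * 0) / v\<^sup>2)) (at_right 0)"
        unfolding F_def \<psi>1_def
        by (intro tendsto_intros p0 isCont_tendsto_compose[of _ u] isCont_tendsto_compose[of _ u1] DERIV_isCont[OF du] DERIV_isCont[OF du1])
           (use a v in auto)
      then show "((F \<circ> real_of_ereal) \<longlongrightarrow> 0) (at_right (ereal 0))"
        by (simp add: ereal_tendsto_simps)
      have "(F \<longlongrightarrow> 0) at_top"
      proof (rule Lim_null_comparison)
        show "((\<lambda>x. exp (- (x powr a)) / \<bar>v\<bar> + 2 * a * (x powr (a - 1) * exp (- (x powr a))) / v\<^sup>2) \<longlongrightarrow> 0) at_top"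
          using a v by real_asymp
        have "norm (F x) \<le> exp (- (x powr a)) / \<bar>v\<bar> + 2 * a * (x powr (a - 1) * exp (- (x powr a))) / v\<^sup>2" for x
        proof -
          have "\<bar>F x\<bar> \<le> \<bar>u (x powr a) * (sin (v * x) / v)\<bar> + \<bar>\<psi>1 x * (cos (v * x) / v\<^sup>2)\<bar>"
            unfolding F_def by (rule abs_triangle_ineq)
          also have "\<bar>u (x powr a) * (sin (v * x) / v)\<bar> = \<bar>u (x powr a)\<bar> * \<bar>sin (v * x)\<bar> / \<bar>v\<bar>" by (simp add: abs_mult)
          also have "\<dots> \<le> exp (- (x powr a)) * 1 / \<bar>v\<bar>"
            by (intro divide_right_mono mult_mono u_le) auto
          also have "\<bar>\<psi>1 x * (cos (v * x) / v\<^sup>2)\<bar> = \<bar>u1 (x powr a)\<bar> * (a * x powr (a - 1)) * \<bar>cos (v * x)\<bar> / v\<^sup>2"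
            using a by (simp add: \<psi>1_def abs_mult)
          also have "\<dots> \<le> 2 * exp (- (x powr a)) * (a * x powr (a - 1)) * 1 / v\<^sup>2"
            using a by (intro divide_right_mono mult_mono u1_le mult_nonneg_nonneg) auto
          finally show ?thesis by (simp add: mult_ac)
        qed
        then show "\<forall>\<^sub>F x in at_top. norm (F x) \<le> exp (- (x powr a)) / \<bar>v\<bar> + 2 * a * (x powr (a - 1) * exp (- (x powr a))) / v\<^sup>2"
          by simp
      qed
      then show "((F \<circ> real_of_ereal) \<longlongrightarrow> 0) (at_left \<infinity>)"
        by (simp add: ereal_tendsto_simps)
    qed simp
    then have "(\<integral>x. indicator {0<..} x * f x \<partial>lborel) = 0"
      by (simp add: interval_lebesgue_integral_def set_lebesgue_integral_def)
    moreover have "(\<integral>x. indicator {0<..} x * f x \<partial>lborel) = (\<integral>x. indicator {0<..} x * (u (x powr a) * cos (v * x)) \<partial>lborel)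
        + (\<integral>x. indicator {0<..} x * (\<psi>2 x * (cos (v * x) / v\<^sup>2)) \<partial>lborel)"
      unfolding f_def distrib_left by (rule Bochner_Integration.integral_add[OF i1 i2])
    ultimately have "\<bar>\<integral>x. indicator {0<..} x * (u (x powr a) * cos (v * x)) \<partial>lborel\<bar>
        = \<bar>\<integral>x. indicator {0<..} x * (\<psi>2 x * (cos (v * x) / v\<^sup>2)) \<partial>lborel\<bar>" by linarith
    also have "\<dots> \<le> (\<integral>x. indicator {0<..} x * m x / v\<^sup>2 \<partial>lborel)"
    proof (rule integral_abs_bound[THEN order.trans], rule integral_mono)
      show "integrable lborel (\<lambda>x. \<bar>indicator {0<..} x * (\<psi>2 x * (cos (v * x) / v\<^sup>2))\<bar>)" using i2 by (rule integrable_abs)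
      show "integrable lborel (\<lambda>x. indicator {0<..} x * m x / v\<^sup>2)" using m_int by simp
      fix x
      have "\<bar>\<psi>2 x * (cos (v * x) / v\<^sup>2)\<bar> \<le> m x / v\<^sup>2"
        using mult_mono[OF \<psi>2_le abs_cos_le_one, of x "v * x"] m0[of x] v by (simp add: abs_mult divide_right_mono)
      then show "\<bar>indicator {0<..} x * (\<psi>2 x * (cos (v * x) / v\<^sup>2))\<bar> \<le> indicator {0<..} x * m x / v\<^sup>2"
        by (auto simp: indicator_def)
    qed
    also have "\<dots> = C / v\<^sup>2" by (simp add: C_def)
    finally show ?thesis by (simp add: u_def)
  qed
  then show ?thesis using C0 by blast
qed

lemma integrable_Cauchy_kernel:
  fixes r :: real
  assumes "r > 0"
  shows "integrable lborel (\<lambda>z. r / (r\<^sup>2 + z\<^sup>2))"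
proof -
  have "integrable lborel (\<lambda>x::real. indicator {0<..} x * (1 / (1 + x\<^sup>2)))"
    using integrable_I0i_1_div_plus_square
    by (simp add: interval_lebesgue_integrable_def set_integrable_def zero_ereal_def)
  then have "integrable lborel (\<lambda>x::real. 1 / (1 + \<bar>x\<bar>\<^sup>2))"
    by (intro integrable_abs_arg[of "\<lambda>x. 1 / (1 + x\<^sup>2)"]) measurable
  then have i: "integrable lborel (\<lambda>x::real. 1 / (1 + x\<^sup>2))" by simp
  have "integrable lborel (\<lambda>z. 1 / r * (1 / (1 + (0 + 1 / r * z)\<^sup>2)))"
    by (intro integrable_mult_right lborel_integrable_real_affine[OF i]) (use assms in auto)
  moreover have "1 / r * (1 / (1 + (0 + 1 / r * z)\<^sup>2)) = r / (r\<^sup>2 + z\<^sup>2)" for z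
  proof -
    have "r * (1 + (0 + 1 / r * z)\<^sup>2) = (r\<^sup>2 + z\<^sup>2) / r"
      using assms by (simp add: power2_eq_square field_simps)
    moreover have "1 / r * (1 / (1 + (0 + 1 / r * z)\<^sup>2)) = 1 / (r * (1 + (0 + 1 / r * z)\<^sup>2))" by simp
    ultimately show ?thesis by simp
  qed
  ultimately show ?thesis by simp
qed

text \<open>Fourier inversion at the origin, with a Gaussian cut-off that makes the multiplication
  formula applicable. It computes the mass of the kernels \<open>FI (damped a w v)\<close>.\<close>

lemma integral_FI:
  fixes \<phi> :: "real \<Rightarrow> complex"
  assumes \<phi>: "integrable lborel \<phi>" and B: "\<And>x. cmod (\<phi> x) \<le> B" and cont: "isCont \<phi> 0"
    and i: "integrable lborel (FI \<phi>)"
  shows "(\<integral>y. FI \<phi> y \<partial>lborel) = 2 * pi * \<phi> 0"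
proof -
  have [measurable]: "\<phi> \<in> borel_measurable borel" using \<phi> by (auto dest: borel_measurable_integrable)
  \<comment> \<open>The cut-off \<open>exp (- (s n)\<^sup>2 * y\<^sup>2)\<close> is parametrised by
    the root so that the substitution \<open>x = 2 * s n * u\<close> produces a Gaussian free of
    \<open>n\<close>.\<close>
  define s where "s n = 1 / (real n + 1)" for n
  have s: "s n > 0" for n by (simp add: s_def)
  have slim: "s \<longlonglongrightarrow> 0" unfolding s_def by real_asymp
  have g: "integrable lborel (\<lambda>\<xi>. complex_of_real (exp (- (s n)\<^sup>2 * \<xi>\<^sup>2)))" for n
    unfolding complex_of_real_integrable_eq using s[of n] by (intro gaussian_integrable) simp
  have l1: "(\<lambda>n. \<integral>y. FI \<phi> y * of_real (exp (- (s n)\<^sup>2 * y\<^sup>2)) \<partial>lborel) \<longlonglongrightarrow> (\<integral>y. FI \<phi> y \<partial>lborel)"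
  proof (rule integral_dominated_convergence[where w = "\<lambda>y. cmod (FI \<phi> y)"])
    show "AE y in lborel. (\<lambda>n. FI \<phi> y * of_real (exp (- (s n)\<^sup>2 * y\<^sup>2))) \<longlonglongrightarrow> FI \<phi> y"
    proof (rule AE_I2)
      fix y
      have "(\<lambda>n. FI \<phi> y * of_real (exp (- (s n)\<^sup>2 * y\<^sup>2))) \<longlonglongrightarrow> FI \<phi> y * of_real (exp (- 0\<^sup>2 * y\<^sup>2))"
        by (intro tendsto_intros slim)
      then show "(\<lambda>n. FI \<phi> y * of_real (exp (- (s n)\<^sup>2 * y\<^sup>2))) \<longlonglongrightarrow> FI \<phi> y" by simp
    qed
    show "AE y in lborel. cmod (FI \<phi> y * of_real (exp (- (s n)\<^sup>2 * y\<^sup>2))) \<le> cmod (FI \<phi> y)" for n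
      by (auto simp: norm_mult intro!: mult_left_le)
  qed (use i in auto)
  have eq: "(\<integral>y. FI \<phi> y * of_real (exp (- (s n)\<^sup>2 * y\<^sup>2)) \<partial>lborel)
      = (\<integral>u. \<phi> (2 * s n * u) * of_real (2 * sqrt pi * exp (- 1 * u\<^sup>2)) \<partial>lborel)" for n
  proof -
    have "(\<integral>y. FI \<phi> y * of_real (exp (- (s n)\<^sup>2 * y\<^sup>2)) \<partial>lborel)
        = (\<integral>x. \<phi> x * of_real (sqrt (pi / (s n)\<^sup>2) * exp (- x\<^sup>2 / (4 * (s n)\<^sup>2))) \<partial>lborel)"
      using lborel_mult_formula[OF \<phi> g, of n] s[of n] by (simp only: FI_gaussian zero_less_power)
    also have "\<dots> = (2 * s n) *\<^sub>R (\<integral>u. \<phi> (2 * s n * u) * of_real (sqrt (pi / (s n)\<^sup>2) * exp (- (2 * s n * u)\<^sup>2 / (4 * (s n)\<^sup>2))) \<partial>lborel)"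
      using s[of n] by (subst lborel_integral_real_affine[where c = "2 * s n" and t = 0]) auto
    also have "\<dots> = (\<integral>u. \<phi> (2 * s n * u) * of_real (2 * sqrt pi * exp (- 1 * u\<^sup>2)) \<partial>lborel)"
    proof -
      have e: "- (2 * s n * u)\<^sup>2 / (4 * (s n)\<^sup>2) = - 1 * u\<^sup>2" for u
        using s[of n] by (simp add: power_mult_distrib)
      have q: "2 * s n * sqrt (pi / (s n)\<^sup>2) = 2 * sqrt pi"
        using s[of n] by (simp add: real_sqrt_divide)
      have "(2 * s n) *\<^sub>R (\<phi> (2 * s n * u) * of_real (sqrt (pi / (s n)\<^sup>2) * exp (- 1 * u\<^sup>2))) = \<phi> (2 * s n * u) * of_real (2 * s n * sqrt (pi / (s n)\<^sup>2) * exp (- 1 * u\<^sup>2))" for u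
        by (simp add: scaleR_conv_of_real)
      then show ?thesis unfolding e integral_scaleR_right[symmetric] q by simp
    qed
    finally show ?thesis .
  qed
  have l2: "(\<lambda>n. \<integral>u. \<phi> (2 * s n * u) * of_real (2 * sqrt pi * exp (- 1 * u\<^sup>2)) \<partial>lborel)
      \<longlonglongrightarrow> (\<integral>u. \<phi> 0 * of_real (2 * sqrt pi * exp (- 1 * u\<^sup>2)) \<partial>lborel)"
  proof (rule integral_dominated_convergence[where w = "\<lambda>u. B * (2 * sqrt pi * exp (- 1 * u\<^sup>2))"])
    show "AE u in lborel. (\<lambda>n. \<phi> (2 * s n * u) * of_real (2 * sqrt pi * exp (- 1 * u\<^sup>2))) \<longlonglongrightarrow> \<phi> 0 * of_real (2 * sqrt pi * exp (- 1 * u\<^sup>2))"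
    proof (rule AE_I2)
      fix u
      have "(\<lambda>n. 2 * s n * u) \<longlonglongrightarrow> 2 * 0 * u" by (intro tendsto_intros slim)
      then show "(\<lambda>n. \<phi> (2 * s n * u) * of_real (2 * sqrt pi * exp (- 1 * u\<^sup>2))) \<longlonglongrightarrow> \<phi> 0 * of_real (2 * sqrt pi * exp (- 1 * u\<^sup>2))"
        by (intro tendsto_intros isCont_tendsto_compose[OF cont]) simp
    qed
    show "integrable lborel (\<lambda>u. B * (2 * sqrt pi * exp (- 1 * u\<^sup>2)))"
      by (intro integrable_mult_right gaussian_integrable) simp
    show "AE u in lborel. cmod (\<phi> (2 * s n * u) * of_real (2 * sqrt pi * exp (- 1 * u\<^sup>2))) \<le> B * (2 * sqrt pi * exp (- 1 * u\<^sup>2))" for n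
      using B by (auto simp: norm_mult intro!: mult_right_mono)
  qed measurable
  have l3: "(\<integral>u. \<phi> 0 * of_real (2 * sqrt pi * exp (- 1 * u\<^sup>2)) \<partial>lborel) = 2 * pi * \<phi> 0"
  proof -
    have "(\<integral>u. 2 * sqrt pi * exp (- 1 * u\<^sup>2) \<partial>lborel) = 2 * pi"
      unfolding integral_mult_right_zero by (subst gaussian_integral) auto
    then have "(\<integral>u. complex_of_real (2 * sqrt pi * exp (- 1 * u\<^sup>2)) \<partial>lborel) = 2 * pi"
      by (simp only: integral_complex_of_real)
    then show ?thesis unfolding integral_mult_right_zero by simp
  qed
  show ?thesis using LIMSEQ_unique[OF l1[unfolded eq] l2] unfolding l3 .
qed

text \<open>Damping \<open>w\<close> and time \<open>v\<close> are separate parameters because in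
  \<open>TT\<^sup>*\<close> the dampings belonging to two points add while their times
  subtract.\<close>

definition damped :: "real \<Rightarrow> real \<Rightarrow> real \<Rightarrow> real \<Rightarrow> complex" where
  "damped a w v \<xi> = of_real (exp (- w * \<bar>\<xi>\<bar> powr a)) * cis (v * \<bar>\<xi>\<bar> powr a)"

lemma measurable_damped [measurable]: "damped a w v \<in> borel_measurable borel"
  unfolding damped_def[abs_def] by measurable

lemma cmod_damped: "cmod (damped a w v \<xi>) = exp (- w * \<bar>\<xi>\<bar> powr a)"
  by (simp add: damped_def norm_mult)

lemma damped_le_1: "w \<ge> 0 \<Longrightarrow> cmod (damped a w v \<xi>) \<le> 1"
  by (simp add: cmod_damped)

lemma integrable_damped: "a > 0 \<Longrightarrow> w > 0 \<Longrightarrow> integrable lborel (damped a w v)"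
  by (rule Bochner_Integration.integrable_bound[OF integrable_exp_powr[of a w]]) (auto simp: cmod_damped)

lemma nsq_damped:
  assumes "a > 0" "w > 0"
  shows "nsq (damped a w v) < \<infinity>"
proof -
  have "(cmod (damped a w v \<xi>))\<^sup>2 = exp (- (2 * w) * \<bar>\<xi>\<bar> powr a)" for \<xi>
    by (simp add: cmod_damped power2_eq_square exp_add[symmetric])
  then show ?thesis
    using integrable_exp_powr[of a "2 * w"] assms by (simp add: nsq_def integrable_iff_bounded)
qed

text \<open>The multiplier is even, so its transform is a cosine transform, with phase
  \<open>\<theta> = 0\<close> for the real part and \<open>\<theta> = - pi / 2\<close> for the
  imaginary part. The decay in \<open>v\<close> and the trivial bound \<open>M\<close> near
  \<open>v = 0\<close> combine to a Cauchy bound that is uniform in \<open>l\<close>.\<close>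

lemma FI_damped_decay:
  fixes a :: real
  assumes a: "a > 1"
  shows "\<exists>C\<ge>0. \<forall>l v. 0 \<le> l \<longrightarrow> l \<le> 1 \<longrightarrow> cmod (FI (damped a 1 l) v) \<le> C / (1 + v\<^sup>2)"
proof -
  obtain C where C: "C \<ge> 0" "\<And>l \<theta> v. 0 \<le> l \<Longrightarrow> l \<le> 1 \<Longrightarrow> v \<noteq> 0 \<Longrightarrow>
    \<bar>\<integral>x. indicator {0<..} x * (exp (- (x powr a)) * cos (l * x powr a + \<theta>) * cos (v * x)) \<partial>lborel\<bar> \<le> C / v\<^sup>2"
    using cosine_transform_decay[OF a] by blast
  define M where "M = (\<integral>x. exp (- 1 * \<bar>x\<bar> powr a) \<partial>lborel)"
  have M0: "M \<ge> 0" unfolding M_def by (intro integral_nonneg_AE) auto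
  have "cmod (FI (damped a 1 l) v) \<le> (M + 4 * C) / (1 + v\<^sup>2)" if l: "0 \<le> l" "l \<le> 1" for l v
  proof -
    have i: "integrable lborel (\<lambda>x. damped a 1 l x * cis (- (x * v)))"
      by (rule Bochner_Integration.integrable_bound[OF integrable_damped[of a 1 l]]) (use a in \<open>auto simp: norm_mult\<close>)
    have "cmod (FI (damped a 1 l) v) \<le> (\<integral>x. cmod (damped a 1 l x * cis (- (x * v))) \<partial>lborel)"
      unfolding FI_def by (rule integral_norm_bound)
    then have b1: "cmod (FI (damped a 1 l) v) \<le> M" by (simp add: norm_mult cmod_damped M_def)
    have b2: "cmod (FI (damped a 1 l) v) * v\<^sup>2 \<le> 4 * C"
    proof (cases "v = 0")
      case False
      define I where "I \<theta> = (\<integral>x. indicator {0<..} x * (exp (- (x powr a)) * cos (l * x powr a + \<theta>) * cos (v * x)) \<partial>lborel)" for \<theta>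
      define G where "G x = indicator {0<..} x *\<^sub>R (damped a 1 l x * cis (- (x * v)) + damped a 1 l (- x) * cis (- (- x * v)))" for x
      have iG: "integrable lborel G"
      proof -
        have "integrable lborel (\<lambda>x. damped a 1 l (- x) * cis (- (- x * v)))"
          using lborel_integrable_real_affine[OF i, of "-1" 0] by simp
        with i show ?thesis unfolding G_def by (intro integrable_mult_indicator Bochner_Integration.integrable_add) auto
      qed
      have Gx: "G x = indicator {0<..} x *\<^sub>R (2 * cos (v * x) * exp (- (x powr a))) *\<^sub>R cis (l * x powr a)" for x
      proof (cases "x > 0")
        case True
        have "cis (- (x * v)) + cis (- (- x * v)) = of_real (2 * cos (v * x))"
          by (simp add: complex_eq_iff mult.commute)
        then have "damped a 1 l x * cis (- (x * v)) + damped a 1 l (- x) * cis (- (- x * v)) = damped a 1 l x * of_real (2 * cos (v * x))"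
          by (simp only: damped_def abs_minus_cancel distrib_left[symmetric])
        then show ?thesis using True by (simp add: G_def damped_def scaleR_conv_of_real)
      qed (simp add: G_def)
      have FIG: "FI (damped a 1 l) v = (\<integral>x. G x \<partial>lborel)"
        unfolding FI_def G_def by (rule integral_half_line[OF i])
      have "Re (FI (damped a 1 l) v) = (\<integral>x. 2 * (indicator {0<..} x * (exp (- (x powr a)) * cos (l * x powr a + 0) * cos (v * x))) \<partial>lborel)"
        unfolding FIG integral_Re[OF iG, symmetric] Gx by (simp add: mult_ac)
      also have "\<dots> = 2 * I 0" unfolding I_def by (rule integral_mult_right_zero)
      finally have Re: "Re (FI (damped a 1 l) v) = 2 * I 0" .
      have "Im (FI (damped a 1 l) v) = (\<integral>x. 2 * (indicator {0<..} x * (exp (- (x powr a)) * cos (l * x powr a + (- pi / 2)) * cos (v * x))) \<partial>lborel)"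
        unfolding FIG integral_Im[OF iG, symmetric] Gx by (simp add: mult_ac cos_diff)
      also have "\<dots> = 2 * I (- pi / 2)" unfolding I_def by (rule integral_mult_right_zero)
      finally have Im: "Im (FI (damped a 1 l) v) = 2 * I (- pi / 2)" .
      have "cmod (FI (damped a 1 l) v) \<le> \<bar>2 * I 0\<bar> + \<bar>2 * I (- pi / 2)\<bar>"
        using cmod_le[of "FI (damped a 1 l) v"] unfolding Re Im .
      also have "\<dots> \<le> 4 * (C / v\<^sup>2)"
        using C(2)[OF l False, of 0] C(2)[OF l False, of "- pi / 2"] unfolding I_def[symmetric] by linarith
      finally show ?thesis using False by (simp add: field_simps)
    qed (simp add: C)
    have "cmod (FI (damped a 1 l) v) * (1 + v\<^sup>2) \<le> M + 4 * C"
      using b1 b2 by (simp add: algebra_simps)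
    then show ?thesis by (simp add: pos_le_divide_eq add_pos_nonneg)
  qed
  then show ?thesis using M0 C(1) by (intro exI[of _ "M + 4 * C"]) auto
qed

text \<open>Dilation by \<open>r t = t powr (\<gamma> / a)\<close> normalises the damping to 1 and
  leaves the oscillation \<open>l = t powr (1 - \<gamma>)\<close>, which lies in
  \<open>{0..1}\<close> for \<open>t < 1\<close> because \<open>\<gamma> \<le> 1\<close>. The
  kernels are therefore dominated by Cauchy kernels of width \<open>r t\<close>.\<close>

lemma small_gamma_convergence:
  fixes f :: "real \<Rightarrow> complex" and a \<gamma> :: real
  assumes a: "a > 1" and \<gamma>: "0 < \<gamma>" "\<gamma> \<le> 1"
    and [measurable]: "f \<in> borel_measurable borel" and f: "nsq f < \<infinity>" and g: "FT f g"
  shows "AE x in lborel. ((\<lambda>t. \<integral>\<xi>. g \<xi> * (damped a (t powr \<gamma>) t \<xi> * cis (x * \<xi>)) \<partial>lborel) \<longlongrightarrow> 2 * pi * f x) (at_right 0)"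
proof -
  obtain C where C: "C \<ge> 0" "\<And>l v. 0 \<le> l \<Longrightarrow> l \<le> 1 \<Longrightarrow> cmod (FI (damped a 1 l) v) \<le> C / (1 + v\<^sup>2)"
    using FI_damped_decay[OF a] by blast
  define r where "r t = t powr (\<gamma> / a)" for t
  have scale: "FI (damped a (t powr \<gamma>) t) z = FI (damped a 1 (t powr (1 - \<gamma>))) (z / r t) / r t" if t: "t > 0" for t z
  proof -
    have r: "r t > 0" using t by (simp add: r_def)
    have d: "damped a (t powr \<gamma>) t \<xi> = damped a 1 (t powr (1 - \<gamma>)) (r t * \<xi>)" for \<xi>
    proof -
      have ra: "(r t) powr a = t powr \<gamma>" using a by (simp add: r_def powr_powr)
      have e1: "\<bar>r t * \<xi>\<bar> powr a = t powr \<gamma> * \<bar>\<xi>\<bar> powr a"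
        using r ra by (simp add: abs_mult powr_mult)
      have "t powr (1 - \<gamma>) * t powr \<gamma> = t" using t by (simp flip: powr_add)
      then have e2: "t powr (1 - \<gamma>) * (t powr \<gamma> * \<bar>\<xi>\<bar> powr a) = t * \<bar>\<xi>\<bar> powr a" by (metis mult.assoc)
      show ?thesis unfolding damped_def e1 e2 by simp
    qed
    have "FI (damped a 1 (t powr (1 - \<gamma>))) (z / r t) = r t *\<^sub>R (\<integral>\<xi>. damped a 1 (t powr (1 - \<gamma>)) (r t * \<xi>) * cis (- (r t * \<xi> * (z / r t))) \<partial>lborel)"
      unfolding FI_def using r by (subst lborel_integral_real_affine[where c = "r t" and t = 0]) auto
    also have "(\<integral>\<xi>. damped a 1 (t powr (1 - \<gamma>)) (r t * \<xi>) * cis (- (r t * \<xi> * (z / r t))) \<partial>lborel) = FI (damped a (t powr \<gamma>) t) z"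
      unfolding FI_def d using r by simp
    finally show ?thesis using r by (simp add: scaleR_conv_of_real)
  qed
  have bound: "cmod (FI (damped a (t powr \<gamma>) t) z) \<le> C * (r t / ((r t)\<^sup>2 + z\<^sup>2))" if t: "0 < t" "t < 1" for t z
  proof -
    have r: "r t > 0" using t by (simp add: r_def)
    have l: "t powr (1 - \<gamma>) \<le> 1" using t \<gamma> by (simp add: powr_le1)
    have "cmod (FI (damped a (t powr \<gamma>) t) z) = cmod (FI (damped a 1 (t powr (1 - \<gamma>))) (z / r t)) / r t"
      unfolding scale[OF t(1)] using r by (simp add: norm_divide)
    also have "\<dots> \<le> C / (1 + (z / r t)\<^sup>2) / r t"
      using r l by (intro divide_right_mono C(2)) auto
    also have "\<dots> = C * (r t / ((r t)\<^sup>2 + z\<^sup>2))"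
    proof -
      have "(1 + (z / r t)\<^sup>2) * r t = ((r t)\<^sup>2 + z\<^sup>2) / r t"
        using r by (simp add: power2_eq_square field_simps)
      then show ?thesis by (simp add: field_simps)
    qed
    finally show ?thesis .
  qed
  have K: "integrable lborel (FI (damped a (t powr \<gamma>) t))" "(\<integral>z. FI (damped a (t powr \<gamma>) t) z \<partial>lborel) = of_real (2 * pi)" if t: "0 < t" "t < 1" for t
  proof -
    have r: "r t > 0" using t by (simp add: r_def)
    show i: "integrable lborel (FI (damped a (t powr \<gamma>) t))"
      by (rule Bochner_Integration.integrable_bound[OF integrable_mult_right[OF integrable_Cauchy_kernel[OF r], of C]])
         (use bound[OF t] C r in \<open>auto simp: abs_mult\<close>)
    have "continuous_on UNIV (damped a (t powr \<gamma>) t)"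
      unfolding damped_def[abs_def] by (intro continuous_intros continuous_on_powr') (use a in auto)
    then have c: "isCont (damped a (t powr \<gamma>) t) 0" by (simp add: continuous_on_eq_continuous_at)
    have "(\<integral>z. FI (damped a (t powr \<gamma>) t) z \<partial>lborel) = 2 * pi * damped a (t powr \<gamma>) t 0"
      by (rule integral_FI[where B = 1, OF _ _ c i]) (use t a in \<open>auto intro: integrable_damped damped_le_1\<close>)
    then show "(\<integral>z. FI (damped a (t powr \<gamma>) t) z \<partial>lborel) = of_real (2 * pi)"
      using a by (simp add: damped_def)
  qed
  have "AE x in lborel. Lebesgue_point f x"
    unfolding Lebesgue_point_def by (rule AE_Lebesgue_point[OF assms(4) f])
  then show ?thesis
  proof eventually_elim
    case (elim x)
    show ?case
    proof (rule tendsto_at_right_sequentially[of 0 1])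
      fix S :: "nat \<Rightarrow> real"
      assume S: "\<And>n. 0 < S n" "\<And>n. S n < 1" "S \<longlonglongrightarrow> 0"
      have "(\<lambda>n. \<integral>z. f (x + z) * FI (damped a (S n powr \<gamma>) (S n)) z \<partial>lborel) \<longlonglongrightarrow> complex_of_real (2 * pi) * f x"
      proof (rule Lebesgue_point_approximate_identity[OF _ f elim K(1)[OF S(1,2)] K(2)[OF S(1,2)] bound[OF S(1,2)]])
        show "r (S n) > 0" for n using S(1)[of n] by (simp add: r_def)
        show "(\<lambda>n. r (S n)) \<longlonglongrightarrow> 0"
          unfolding r_def using a \<gamma> S(1) by (intro tendsto_zero_powrI[where b = "\<gamma> / a"] S(3)) (auto simp: less_imp_le)
      qed measurable
      moreover have "(\<integral>\<xi>. g \<xi> * (damped a (S n powr \<gamma>) (S n) \<xi> * cis (x * \<xi>)) \<partial>lborel) = (\<integral>z. f (x + z) * FI (damped a (S n powr \<gamma>) (S n)) z \<partial>lborel)" for n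
        using a S(1)[of n] by (intro FT_modulated f g integrable_damped nsq_damped) auto
      ultimately show "(\<lambda>n. \<integral>\<xi>. g \<xi> * (damped a (S n powr \<gamma>) (S n) \<xi> * cis (x * \<xi>)) \<partial>lborel) \<longlonglongrightarrow> 2 * pi * f x"
        by simp
    qed simp
  qed
qed

section \<open>Oscillatory kernels\<close>

text \<open>The second mean value theorem writes the integral as the two end values of
  \<open>g\<close> times integrals of \<open>f\<close> over subintervals, hence the factor 2. A
  decreasing \<open>g\<close> is replaced by its negative.\<close>

lemma second_mean_value_bound:
  fixes f g :: "real \<Rightarrow> real"
  assumes ab: "a \<le> b" and f: "f integrable_on {a..b}"
    and mono: "(\<forall>x\<in>{a..b}. \<forall>y\<in>{a..b}. x \<le> y \<longrightarrow> g x \<le> g y) \<or> (\<forall>x\<in>{a..b}. \<forall>y\<in>{a..b}. x \<le> y \<longrightarrow> g y \<le> g x)"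
    and gM: "\<And>x. x \<in> {a..b} \<Longrightarrow> \<bar>g x\<bar> \<le> M"
    and B: "\<And>c d. a \<le> c \<Longrightarrow> c \<le> d \<Longrightarrow> d \<le> b \<Longrightarrow> \<bar>integral {c..d} f\<bar> \<le> B"
  shows "(\<lambda>x. g x * f x) integrable_on {a..b}" "\<bar>integral {a..b} (\<lambda>x. g x * f x)\<bar> \<le> 2 * M * B"
proof -
  have *: "(\<lambda>x. h x * f x) integrable_on {a..b} \<and> \<bar>integral {a..b} (\<lambda>x. h x * f x)\<bar> \<le> 2 * M * B"
    if h: "\<And>x y. a \<le> x \<Longrightarrow> x \<le> y \<Longrightarrow> y \<le> b \<Longrightarrow> h x \<le> h y" and hM: "\<And>x. x \<in> {a..b} \<Longrightarrow> \<bar>h x\<bar> \<le> M" for h :: "real \<Rightarrow> real"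
  proof -
    obtain c where c: "c \<in> {a..b}" and I: "((\<lambda>x. h x * f x) has_integral (h a * integral {a..c} f + h b * integral {c..b} f)) {a..b}"
      using second_mean_value_theorem_full[OF f ab, of h] h by blast
    have M: "M \<ge> 0" using hM[of a] ab by (meson abs_ge_zero atLeastAtMost_iff order.refl order.trans)
    have "\<bar>h a * integral {a..c} f + h b * integral {c..b} f\<bar> \<le> \<bar>h a\<bar> * \<bar>integral {a..c} f\<bar> + \<bar>h b\<bar> * \<bar>integral {c..b} f\<bar>"
      by (metis abs_mult abs_triangle_ineq)
    also have "\<dots> \<le> M * B + M * B"
      using c ab M by (intro add_mono mult_mono hM B) auto
    also have "\<dots> = 2 * M * B" by simp
    finally show ?thesis using I by (simp add: has_integral_integrable integral_unique)
  qed
  have "(\<lambda>x. g x * f x) integrable_on {a..b} \<and> \<bar>integral {a..b} (\<lambda>x. g x * f x)\<bar> \<le> 2 * M * B"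
    using mono
  proof
    assume "\<forall>x\<in>{a..b}. \<forall>y\<in>{a..b}. x \<le> y \<longrightarrow> g x \<le> g y"
    then show ?thesis by (intro * gM) auto
  next
    assume m: "\<forall>x\<in>{a..b}. \<forall>y\<in>{a..b}. x \<le> y \<longrightarrow> g y \<le> g x"
    have "(\<lambda>x. - g x * f x) integrable_on {a..b} \<and> \<bar>integral {a..b} (\<lambda>x. - g x * f x)\<bar> \<le> 2 * M * B"
      by (rule *) (use m gM in auto)
    then show ?thesis by (simp add: integrable_neg_iff)
  qed
  then show "(\<lambda>x. g x * f x) integrable_on {a..b}" "\<bar>integral {a..b} (\<lambda>x. g x * f x)\<bar> \<le> 2 * M * B" by auto
qed

text \<open>Van der Corput: \<open>cos \<phi> = (1 / \<phi>') (sin \<phi>)'\<close>, and the monotone factor \<open>1 / \<phi>'\<close> is removed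
  by the second mean value theorem.\<close>

lemma van_der_Corput_pos:
  fixes \<phi> \<phi>' :: "real \<Rightarrow> real"
  assumes ab: "a \<le> b" and d: "\<And>x. x \<in> {a..b} \<Longrightarrow> (\<phi> has_real_derivative \<phi>' x) (at x)"
    and l: "\<mu> > 0" "\<And>x. x \<in> {a..b} \<Longrightarrow> \<mu> \<le> \<phi>' x"
    and mono: "monotone_on {a..b} (\<le>) (\<le>) \<phi>' \<or> monotone_on {a..b} (\<le>) (\<ge>) \<phi>'"
  shows "\<bar>integral {a..b} (\<lambda>x. cos (\<phi> x))\<bar> \<le> 4 / \<mu>"
proof -
  have I: "((\<lambda>x. \<phi>' x * cos (\<phi> x)) has_integral (sin (\<phi> e) - sin (\<phi> c))) {c..e}" if "a \<le> c" "c \<le> e" "e \<le> b" for c e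
  proof (rule fundamental_theorem_of_calculus[OF that(2)])
    fix x assume "x \<in> {c..e}"
    then have "x \<in> {a..b}" using that by auto
    have "((\<lambda>x. sin (\<phi> x)) has_real_derivative cos (\<phi> x) * \<phi>' x) (at x)"
      by (rule DERIV_chain2[OF DERIV_sin d[OF \<open>x \<in> {a..b}\<close>]])
    then show "((\<lambda>x. sin (\<phi> x)) has_vector_derivative \<phi>' x * cos (\<phi> x)) (at x within {c..e})"
      unfolding has_real_derivative_iff_has_vector_derivative[symmetric]
      by (simp add: mult.commute has_field_derivative_at_within)
  qed
  have pos: "\<phi>' x > 0" if "x \<in> {a..b}" for x using l(1) l(2)[OF that] by linarith
  have "\<bar>integral {a..b} (\<lambda>x. (1 / \<phi>' x) * (\<phi>' x * cos (\<phi> x)))\<bar> \<le> 2 * (1 / \<mu>) * 2"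
  proof (rule second_mean_value_bound(2)[OF ab])
    show "(\<lambda>x. \<phi>' x * cos (\<phi> x)) integrable_on {a..b}" using I[of a b] ab by (auto simp: integrable_on_def)
    show "(\<forall>x\<in>{a..b}. \<forall>y\<in>{a..b}. x \<le> y \<longrightarrow> 1 / \<phi>' x \<le> 1 / \<phi>' y) \<or> (\<forall>x\<in>{a..b}. \<forall>y\<in>{a..b}. x \<le> y \<longrightarrow> 1 / \<phi>' y \<le> 1 / \<phi>' x)"
      using mono
    proof
      assume m: "monotone_on {a..b} (\<le>) (\<le>) \<phi>'"
      show ?thesis
        by (rule disjI2) (use pos monotone_onD[OF m] in \<open>auto intro!: divide_left_mono mult_pos_pos\<close>)
    next
      assume m: "monotone_on {a..b} (\<le>) (\<ge>) \<phi>'"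
      show ?thesis
        by (rule disjI1) (use pos monotone_onD[OF m] in \<open>auto intro!: divide_left_mono mult_pos_pos\<close>)
    qed
    show "\<bar>1 / \<phi>' x\<bar> \<le> 1 / \<mu>" if "x \<in> {a..b}" for x
      using l(1) l(2)[OF that] by (simp add: frac_le)
    show "\<bar>integral {c..e} (\<lambda>x. \<phi>' x * cos (\<phi> x))\<bar> \<le> 2" if "a \<le> c" "c \<le> e" "e \<le> b" for c e
      using integral_unique[OF I[OF that]] abs_sin_le_one[of "\<phi> e"] abs_sin_le_one[of "\<phi> c"] by linarith
  qed
  moreover have "integral {a..b} (\<lambda>x. (1 / \<phi>' x) * (\<phi>' x * cos (\<phi> x))) = integral {a..b} (\<lambda>x. cos (\<phi> x))"
    by (intro integral_cong) (use pos in \<open>force\<close>)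
  ultimately show ?thesis by simp
qed

text \<open>A second use of the second mean value theorem admits a decreasing amplitude, which is
  largest at the left end. A negative \<open>\<phi>'\<close> reduces to a positive one because the
  cosine is even.\<close>

lemma van_der_Corput:
  fixes \<phi> \<phi>' \<psi> :: "real \<Rightarrow> real"
  assumes ab: "a \<le> b" and d: "\<And>x. x \<in> {a..b} \<Longrightarrow> (\<phi> has_real_derivative \<phi>' x) (at x)"
    and l: "\<mu> > 0" "(\<forall>x\<in>{a..b}. \<mu> \<le> \<phi>' x) \<or> (\<forall>x\<in>{a..b}. \<phi>' x \<le> - \<mu>)"
    and mono: "monotone_on {a..b} (\<le>) (\<le>) \<phi>' \<or> monotone_on {a..b} (\<le>) (\<ge>) \<phi>'"
    and \<psi>: "\<And>x. x \<in> {a..b} \<Longrightarrow> 0 \<le> \<psi> x" "\<And>x y. x \<in> {a..b} \<Longrightarrow> y \<in> {a..b} \<Longrightarrow> x \<le> y \<Longrightarrow> \<psi> y \<le> \<psi> x"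
  shows "\<bar>integral {a..b} (\<lambda>x. \<psi> x * cos (\<phi> x))\<bar> \<le> 8 * \<psi> a / \<mu>"
proof -
  have sub: "monotone_on {c..e} (\<le>) (\<le>) \<phi>' \<or> monotone_on {c..e} (\<le>) (\<ge>) \<phi>'" if "a \<le> c" "e \<le> b" for c e
    using mono
  proof (elim disjE)
    assume "monotone_on {a..b} (\<le>) (\<le>) \<phi>'"
    from monotone_on_subset[OF this, of "{c..e}"] show ?thesis using that by auto
  next
    assume "monotone_on {a..b} (\<le>) (\<ge>) \<phi>'"
    from monotone_on_subset[OF this, of "{c..e}"] show ?thesis using that by auto
  qed
  have cosI: "\<bar>integral {c..e} (\<lambda>x. cos (\<phi> x))\<bar> \<le> 4 / \<mu>" if "a \<le> c" "c \<le> e" "e \<le> b" for c e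
    using l(2)
  proof
    assume "\<forall>x\<in>{a..b}. \<mu> \<le> \<phi>' x"
    then show ?thesis
      by (intro van_der_Corput_pos[where \<phi>' = \<phi>', OF that(2) _ l(1) _ sub[OF that(1,3)]] d) (use that in auto)
  next
    assume neg: "\<forall>x\<in>{a..b}. \<phi>' x \<le> - \<mu>"
    have "\<bar>integral {c..e} (\<lambda>x. cos (- \<phi> x))\<bar> \<le> 4 / \<mu>"
    proof (rule van_der_Corput_pos[where \<phi>' = "\<lambda>x. - \<phi>' x", OF that(2)])
      show "((\<lambda>x. - \<phi> x) has_real_derivative - \<phi>' x) (at x)" if "x \<in> {c..e}" for x
        using that \<open>a \<le> c\<close> \<open>e \<le> b\<close> by (intro DERIV_minus d) auto
      show "\<mu> \<le> - \<phi>' x" if "x \<in> {c..e}" for x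
      proof -
        have "x \<in> {a..b}" using that \<open>a \<le> c\<close> \<open>e \<le> b\<close> by auto
        then have "\<phi>' x \<le> - \<mu>" using neg by blast
        then show ?thesis by linarith
      qed
      show "monotone_on {c..e} (\<le>) (\<le>) (\<lambda>x. - \<phi>' x) \<or> monotone_on {c..e} (\<le>) (\<ge>) (\<lambda>x. - \<phi>' x)"
        using sub[OF that(1,3)] unfolding monotone_on_def by (simp only: neg_le_iff_le) blast
    qed (rule l)
    then show ?thesis by simp
  qed
  have cont: "continuous_on {a..b} (\<lambda>x. cos (\<phi> x))"
    by (intro continuous_intros continuous_at_imp_continuous_on ballI DERIV_isCont[OF d])
  have "\<bar>integral {a..b} (\<lambda>x. \<psi> x * cos (\<phi> x))\<bar> \<le> 2 * \<psi> a * (4 / \<mu>)"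
  proof (rule second_mean_value_bound(2)[OF ab _ _ _ cosI])
    show "(\<lambda>x. cos (\<phi> x)) integrable_on {a..b}" by (rule integrable_continuous_real[OF cont])
    show "(\<forall>x\<in>{a..b}. \<forall>y\<in>{a..b}. x \<le> y \<longrightarrow> \<psi> x \<le> \<psi> y) \<or> (\<forall>x\<in>{a..b}. \<forall>y\<in>{a..b}. x \<le> y \<longrightarrow> \<psi> y \<le> \<psi> x)"
      using \<psi>(2) by blast
    show "\<bar>\<psi> x\<bar> \<le> \<psi> a" if "x \<in> {a..b}" for x
      using \<psi>(1)[OF that] \<psi>(2)[of a x] that ab by auto
  qed
  then show ?thesis by simp
qed

text \<open>Supplies the lower bound for the phase derivative at relative distance
  \<open>\<epsilon>\<close> from the stationary point \<open>x0\<close>, where that derivative is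
  proportional to \<open>1 - (x / x0) powr b\<close>.\<close>

lemma powr_one_plus_minus_bounds:
  fixes b :: real
  assumes b: "b > 0"
  shows "\<exists>c>0. \<forall>\<epsilon>. 0 \<le> \<epsilon> \<longrightarrow> \<epsilon> \<le> 1 \<longrightarrow> c * \<epsilon> \<le> 1 - (1 - \<epsilon>) powr b \<and> c * \<epsilon> \<le> (1 + \<epsilon>) powr b - 1"
proof -
  \<comment> \<open>At most \<open>b / (1 + b)\<close>, as needed with
    \<open>exp (- b * \<epsilon>) \<le> 1 / (1 + b * \<epsilon>)\<close>; at most
    \<open>b / 2\<close>, as needed with \<open>ln (1 + \<epsilon>) \<ge> \<epsilon> / 2\<close>;
    and at most 1, for the end \<open>\<epsilon> = 1\<close>.\<close>
  define c where "c = b / (2 * (1 + b))"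
  have c: "c > 0" "c \<le> b / (1 + b)" "c \<le> b / 2" "c \<le> 1" using b by (auto simp: c_def field_simps)
  have "c * \<epsilon> \<le> 1 - (1 - \<epsilon>) powr b \<and> c * \<epsilon> \<le> (1 + \<epsilon>) powr b - 1" if \<epsilon>: "0 \<le> \<epsilon>" "\<epsilon> \<le> 1" for \<epsilon>
  proof
    show "c * \<epsilon> \<le> 1 - (1 - \<epsilon>) powr b"
    proof (cases "\<epsilon> = 1")
      case False
      then have "\<epsilon> < 1" using \<epsilon> by simp
      have "b * ln (1 - \<epsilon>) \<le> b * (- \<epsilon>)"
        using ln_le_minus_one[of "1 - \<epsilon>"] \<open>\<epsilon> < 1\<close> b by (intro mult_left_mono) auto
      then have "exp (b * ln (1 - \<epsilon>)) \<le> exp (- (b * \<epsilon>))" by simp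
      then have "(1 - \<epsilon>) powr b \<le> inverse (exp (b * \<epsilon>))" using \<open>\<epsilon> < 1\<close> by (simp add: powr_def exp_minus)
      also have "\<dots> \<le> inverse (1 + b * \<epsilon>)"
        using exp_ge_add_one_self[of "b * \<epsilon>"] b \<epsilon> by (intro le_imp_inverse_le add_pos_nonneg) auto
      also have "\<dots> = 1 / (1 + b * \<epsilon>)" by (simp add: inverse_eq_divide)
      finally have "1 - (1 - \<epsilon>) powr b \<ge> 1 - 1 / (1 + b * \<epsilon>)" by simp
      moreover have "1 - 1 / (1 + b * \<epsilon>) = b * \<epsilon> / (1 + b * \<epsilon>)"
      proof -
        have "1 + b * \<epsilon> > 0" using b \<epsilon> by (simp add: add_pos_nonneg)
        then show ?thesis by (simp add: field_simps)
      qed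
      moreover have "b * \<epsilon> / (1 + b * \<epsilon>) \<ge> b * \<epsilon> / (1 + b)"
        using b \<epsilon> by (intro divide_left_mono) (auto intro!: mult_pos_pos add_pos_nonneg mult_left_le)
      moreover have "c * \<epsilon> \<le> b / (1 + b) * \<epsilon>" using c \<epsilon> by (intro mult_right_mono) auto
      ultimately show ?thesis by simp
    qed (use c b in simp)
    have "c * \<epsilon> \<le> b / 2 * \<epsilon>" using c \<epsilon> by (intro mult_right_mono) auto
    also have "\<dots> \<le> b * ln (1 + \<epsilon>)"
    proof -
      have "1 / (1 + \<epsilon>) - 1 \<ge> ln (1 / (1 + \<epsilon>))" using \<epsilon> by (intro ln_le_minus_one) auto
      then have "ln (1 + \<epsilon>) \<ge> 1 - 1 / (1 + \<epsilon>)" using \<epsilon> by (simp add: ln_div)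
      also have "1 - 1 / (1 + \<epsilon>) = \<epsilon> / (1 + \<epsilon>)" using \<epsilon> by (simp add: field_simps)
      also have "\<epsilon> / (1 + \<epsilon>) \<ge> \<epsilon> / 2" using \<epsilon> by (intro divide_left_mono) auto
      finally have "\<epsilon> / 2 \<le> ln (1 + \<epsilon>)" .
      then show ?thesis using b by simp
    qed
    also have "\<dots> \<le> exp (b * ln (1 + \<epsilon>)) - 1" using exp_ge_add_one_self[of "b * ln (1 + \<epsilon>)"] by linarith
    also have "\<dots> = (1 + \<epsilon>) powr b - 1" using \<epsilon> by (simp add: powr_def)
    finally show "c * \<epsilon> \<le> (1 + \<epsilon>) powr b - 1" .
  qed
  then show ?thesis using c(1) by blast
qed

definition osc_kernel :: "real \<Rightarrow> real \<Rightarrow> real \<Rightarrow> real \<Rightarrow> real \<Rightarrow> real \<Rightarrow> real" where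
  "osc_kernel a \<sigma> u v w \<theta> =
    (\<integral>x. indicator {0<..} x * (x powr - \<sigma> * exp (- w * x powr a) * cos (u * x + v * x powr a + \<theta>)) \<partial>lborel)"

text \<open>The part below \<open>A\<close> is estimated without oscillation, and
  \<open>\<sigma> \<le> 1/2\<close> bounds the factor \<open>1 / (1 - \<sigma>)\<close> by 2. The
  part above is a limit of integrals over \<open>{A..B}\<close>, so the bound \<open>D\<close> may
  be checked for large \<open>B\<close> only; this is the role of \<open>B0\<close>.\<close>

lemma osc_kernel_le:
  fixes a \<sigma> u v w \<theta> A D B0 :: real
  assumes a: "a > 1" and \<sigma>: "0 < \<sigma>" "\<sigma> \<le> 1/2" and w: "w > 0" and A: "A > 0"
    and D: "\<And>B. B \<ge> B0 \<Longrightarrow> B \<ge> A \<Longrightarrow>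
      \<bar>integral {A..B} (\<lambda>x. x powr - \<sigma> * exp (- w * x powr a) * cos (u * x + v * x powr a + \<theta>))\<bar> \<le> D"
  shows "\<bar>osc_kernel a \<sigma> u v w \<theta>\<bar> \<le> 2 * A powr (1 - \<sigma>) + D"
proof -
  define F where "F x = x powr - \<sigma> * exp (- w * x powr a) * cos (u * x + v * x powr a + \<theta>)" for x
  have [measurable]: "F \<in> borel_measurable borel" unfolding F_def by measurable
  have Fle: "\<bar>F x\<bar> \<le> x powr - \<sigma> * exp (- w * x powr a)" for x
    unfolding F_def by (simp add: abs_mult mult_left_le)
  have Fle': "\<bar>F x\<bar> \<le> x powr - \<sigma>" for x
    using Fle[of x] w mult_left_mono[of "exp (- w * x powr a)" 1 "x powr - \<sigma>"] by simp
  have dom: "integrable lborel (\<lambda>x. indicator {0<..} x * (x powr - \<sigma> * exp (- w * x powr a)))"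
    by (rule integrable_powr_exp) (use a \<sigma> w in auto)
  have intF: "integrable lborel (\<lambda>x. indicator S x * F x)" if [measurable]: "S \<in> sets borel" "S \<subseteq> {0<..}" for S
    by (rule Bochner_Integration.integrable_bound[OF dom]) (use Fle that in \<open>auto simp: indicator_def\<close>)
  define J where "J n = (\<integral>x. indicator {0<..max A B0 + real n} x * F x \<partial>lborel)" for n
  have "(\<lambda>n. J n) \<longlonglongrightarrow> (\<integral>x. indicator {0<..} x * F x \<partial>lborel)"
    unfolding J_def
  proof (rule integral_dominated_convergence[OF _ _ dom])
    show "AE x in lborel. (\<lambda>n. indicator {0<..max A B0 + real n} x * F x) \<longlonglongrightarrow> indicator {0<..} x * F x"
    proof (rule AE_I2, rule tendsto_eventually)
      fix x :: real
      obtain N :: nat where "x - max A B0 \<le> real N" using real_arch_simple by blast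
      then show "\<forall>\<^sub>F n in sequentially. indicator {0<..max A B0 + real n} x * F x = indicator {0<..} x * F x"
        by (intro eventually_sequentiallyI[of N]) (auto simp: indicator_def)
    qed
    show "AE x in lborel. norm (indicator {0<..max A B0 + real n} x * F x) \<le> indicator {0<..} x * (x powr - \<sigma> * exp (- w * x powr a))" for n
      using Fle by (auto simp: indicator_def)
  qed measurable
  then have "(\<lambda>n. \<bar>J n\<bar>) \<longlonglongrightarrow> \<bar>osc_kernel a \<sigma> u v w \<theta>\<bar>"
    unfolding osc_kernel_def F_def[symmetric] by (rule tendsto_rabs)
  moreover have "\<bar>J n\<bar> \<le> 2 * A powr (1 - \<sigma>) + D" for n
  proof -
    let ?B = "max A B0 + real n"
    have "J n = (\<integral>x. indicator {0<..<A} x * F x + indicator {A..?B} x * F x \<partial>lborel)"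
      unfolding J_def using A by (intro Bochner_Integration.integral_cong) (auto simp: indicator_def)
    also have "\<dots> = (\<integral>x. indicator {0<..<A} x * F x \<partial>lborel) + (\<integral>x. indicator {A..?B} x * F x \<partial>lborel)"
      using A by (intro Bochner_Integration.integral_add intF) auto
    also have "(\<integral>x. indicator {A..?B} x * F x \<partial>lborel) = integral {A..?B} F"
      using set_borel_integral_eq_integral(2)[of "{A..?B}" F] intF[of "{A..?B}"] A
      by (simp add: set_integrable_def set_lebesgue_integral_def subset_eq)
    finally have "\<bar>J n\<bar> \<le> \<bar>\<integral>x. indicator {0<..<A} x * F x \<partial>lborel\<bar> + \<bar>integral {A..?B} F\<bar>" by simp
    moreover have "\<bar>integral {A..?B} F\<bar> \<le> D"
      unfolding F_def by (rule D) auto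
    moreover have "\<bar>\<integral>x. indicator {0<..<A} x * F x \<partial>lborel\<bar> \<le> 2 * A powr (1 - \<sigma>)"
    proof -
      have h: "((\<lambda>x. x powr - \<sigma>) has_integral A powr (- \<sigma> + 1) / (- \<sigma> + 1)) {0..A}"
        using has_integral_powr_from_0[of "- \<sigma>" A] \<sigma> A by simp
      have i: "integrable lborel (\<lambda>x. indicator {0..A} x * x powr - \<sigma>)"
        by (rule integrable_lborel_of_has_integral[OF _ _ _ h]) auto
      have "\<bar>\<integral>x. indicator {0<..<A} x * F x \<partial>lborel\<bar> \<le> (\<integral>x. indicator {0..A} x * x powr - \<sigma> \<partial>lborel)"
      proof (rule integral_abs_bound[THEN order.trans], rule integral_mono[OF _ i])
        show "integrable lborel (\<lambda>x. \<bar>indicator {0<..<A} x * F x\<bar>)"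
          by (intro integrable_abs intF) auto
        show "\<bar>indicator {0<..<A} x * F x\<bar> \<le> indicator {0..A} x * x powr - \<sigma>" for x
          using Fle'[of x] by (auto simp: indicator_def)
      qed
      also have "\<dots> = A powr (- \<sigma> + 1) / (- \<sigma> + 1)"
        using set_borel_integral_eq_integral(2)[of "{0..A}" "\<lambda>x. x powr - \<sigma>"] i integral_unique[OF h]
        by (simp add: set_integrable_def set_lebesgue_integral_def)
      also have "\<dots> \<le> A powr (1 - \<sigma>) / (1/2)"
        using \<sigma> by (simp add: add.commute) (intro divide_left_mono[of "1/2" "1 - \<sigma>" "A powr (1 - \<sigma>)", simplified]; simp)
      finally show ?thesis by simp
    qed
    ultimately show ?thesis by linarith
  qed
  ultimately show ?thesis by (intro LIMSEQ_le_const2) auto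
qed

lemma abs_integral_split:
  fixes F :: "real \<Rightarrow> real"
  assumes "F integrable_on {a..b}" "a \<le> c" "c \<le> b"
  shows "\<bar>integral {a..b} F\<bar> \<le> \<bar>integral {a..c} F\<bar> + \<bar>integral {c..b} F\<bar>"
  using Henstock_Kurzweil_Integration.integral_combine[OF assms(2,3,1)] by linarith

text \<open>For \<open>v \<ge> 0\<close> the phase derivative is at least \<open>u\<close>, and one
  van der Corput bound beyond \<open>1 / u\<close> suffices. For \<open>v < 0\<close> it vanishes at
  one point \<open>x0\<close>; a window around \<open>x0\<close> is estimated trivially and the rest
  by van der Corput. The exponential factor records the damping at \<open>x0 / 2\<close>, the left
  end of the region near the stationary point.\<close>

lemma osc_kernel_bound:
  fixes a \<sigma> :: real
  assumes a: "a > 1" and \<sigma>: "0 < \<sigma>" "\<sigma> \<le> 1/2"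
  shows "\<exists>C\<ge>0. \<forall>u v w \<theta>. u > 0 \<longrightarrow> w > 0 \<longrightarrow> \<bar>osc_kernel a \<sigma> u v w \<theta>\<bar> \<le> C * u powr (\<sigma> - 1) +
    (if v < 0 then C * (u powr (-1/2) * ((u / (a * \<bar>v\<bar>)) powr (1 / (a - 1))) powr (1/2 - \<sigma>)
      * exp (- w * ((u / (a * \<bar>v\<bar>)) powr (1 / (a - 1)) / 2) powr a)) else 0)"
proof -
  define b where "b = a - 1"
  have b: "b > 0" using a by (simp add: b_def)
  obtain c where c: "c > 0" "\<And>\<epsilon>. 0 \<le> \<epsilon> \<Longrightarrow> \<epsilon> \<le> 1 \<Longrightarrow> c * \<epsilon> \<le> 1 - (1 - \<epsilon>) powr b"
      "\<And>\<epsilon>. 0 \<le> \<epsilon> \<Longrightarrow> \<epsilon> \<le> 1 \<Longrightarrow> c * \<epsilon> \<le> (1 + \<epsilon>) powr b - 1"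
    using powr_one_plus_minus_bounds[OF b] by blast
  \<comment> \<open>Exceeds the constants of all cases below, namely 10, \<open>9 + 8 / c\<close>,
    \<open>2 + 24 / c\<close> and \<open>4 + 32 / c\<close>.\<close>
  define C where "C = 12 + 40 / c"
  have C: "C \<ge> 0" using c(1) by (simp add: C_def)
  have c40: "8 / c \<le> 40 / c" "24 / c \<le> 40 / c" "32 / c \<le> 40 / c"
    using c(1) by (intro divide_right_mono; simp)+
  have "\<bar>osc_kernel a \<sigma> u v w \<theta>\<bar> \<le> C * u powr (\<sigma> - 1) +
    (if v < 0 then C * (u powr (-1/2) * ((u / (a * \<bar>v\<bar>)) powr (1 / (a - 1))) powr (1/2 - \<sigma>)
      * exp (- w * ((u / (a * \<bar>v\<bar>)) powr (1 / (a - 1)) / 2) powr a)) else 0)"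
    if u: "u > 0" and w: "w > 0" for u v w \<theta>
  proof -
    define \<psi> where "\<psi> x = x powr - \<sigma> * exp (- w * x powr a)" for x
    define \<phi> where "\<phi> x = u * x + v * x powr a + \<theta>" for x
    define \<phi>' where "\<phi>' x = u + v * (a * x powr b)" for x
    have d\<phi>: "(\<phi> has_real_derivative \<phi>' x) (at x)" if "x > 0" for x
      unfolding \<phi>_def[abs_def] \<phi>'_def b_def
      by (auto intro!: derivative_eq_intros has_real_derivative_powr that)
    \<comment> \<open>The scale at which \<open>u * x\<close> reaches 1. The integral below it has
      the size \<open>u powr (\<sigma> - 1)\<close> that is allowed anyway.\<close>
    define A where "A = 1 / u"
    have A: "A > 0" "u * A = 1" using u by (auto simp: A_def)
    have Au: "A powr (1 - \<sigma>) = u powr (\<sigma> - 1)"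
      using u by (simp add: A_def powr_divide powr_minus_divide[symmetric])
    have A\<sigma>: "A powr - \<sigma> / u = A powr (1 - \<sigma>)"
    proof -
      have "A powr (1 - \<sigma>) = A powr 1 * A powr - \<sigma>" unfolding powr_add[symmetric] by simp
      then show ?thesis using A by (simp add: A_def)
    qed
    have \<psi>0: "\<psi> x \<ge> 0" for x by (simp add: \<psi>_def)
    have \<psi>anti: "\<psi> y \<le> \<psi> x" if "0 < x" "x \<le> y" for x y
    proof -
      have "y powr - \<sigma> \<le> x powr - \<sigma>" using that \<sigma> by (intro powr_mono2') auto
      moreover have "exp (- w * y powr a) \<le> exp (- w * x powr a)"
        using that w a by (simp add: powr_mono2)
      ultimately show ?thesis unfolding \<psi>_def by (intro mult_mono) auto
    qed
    have \<psi>le: "\<psi> x \<le> A powr - \<sigma>" if "x \<ge> A" for x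
    proof -
      have "\<psi> x \<le> \<psi> A" using that A by (intro \<psi>anti) auto
      also have "\<dots> \<le> A powr - \<sigma> * 1" unfolding \<psi>_def using w by (intro mult_left_mono) auto
      finally show ?thesis by simp
    qed
    let ?F = "\<lambda>x. \<psi> x * cos (\<phi> x)"
    have contF: "continuous_on {p..q} ?F" if "p > 0" for p q
      using that unfolding \<psi>_def \<phi>_def by (auto intro!: continuous_intros)
    have Fint: "?F integrable_on {p..q}" if "p > 0" for p q
      by (rule integrable_continuous_real[OF contF[OF that]])
    have trivial: "\<bar>integral {p..q} ?F\<bar> \<le> (q - p) * \<psi> p" if "0 < p" "p \<le> q" for p q
    proof -
      have "norm (integral {p..q} ?F) \<le> \<psi> p * (q - p)"
      proof (rule integral_bound[OF that(2) contF[OF that(1)]])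
        fix x assume "x \<in> {p..q}"
        then have "\<psi> x * \<bar>cos (\<phi> x)\<bar> \<le> \<psi> p * 1"
          using that by (intro mult_mono \<psi>anti \<psi>0) auto
        then show "norm (\<psi> x * cos (\<phi> x)) \<le> \<psi> p" using \<psi>0[of x] by (simp add: abs_mult)
      qed
      then show ?thesis by (simp add: mult.commute)
    qed
    have mono: "monotone_on {p..q} (\<le>) (\<le>) \<phi>' \<or> monotone_on {p..q} (\<le>) (\<ge>) \<phi>'" if "p > 0" for p q
    proof (cases "v \<ge> 0")
      case True
      have "monotone_on {p..q} (\<le>) (\<le>) \<phi>'"
        using True that a b by (intro monotone_onI) (auto simp: \<phi>'_def intro!: mult_left_mono powr_mono2)
      then show ?thesis ..
    next
      case False
      have "monotone_on {p..q} (\<le>) (\<ge>) \<phi>'"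
        using False that a b by (intro monotone_onI) (auto simp: \<phi>'_def intro!: mult_left_mono_neg mult_left_mono powr_mono2)
      then show ?thesis ..
    qed
    have vdC: "\<bar>integral {p..q} ?F\<bar> \<le> 8 * \<psi> p / \<mu>"
      if "0 < p" "p \<le> q" "\<mu> > 0" "(\<forall>x\<in>{p..q}. \<mu> \<le> \<phi>' x) \<or> (\<forall>x\<in>{p..q}. \<phi>' x \<le> - \<mu>)" for p q \<mu>
      by (rule van_der_Corput[where \<phi>' = \<phi>', OF that(2) _ that(3,4) mono[OF that(1)]])
         (use that(1) in \<open>auto intro: d\<phi> \<psi>0 \<psi>anti\<close>)
    have key: "\<bar>osc_kernel a \<sigma> u v w \<theta>\<bar> \<le> 2 * A powr (1 - \<sigma>) + D"
      if "\<And>B. B \<ge> B0 \<Longrightarrow> B \<ge> A \<Longrightarrow> \<bar>integral {A..B} ?F\<bar> \<le> D" for B0 D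
      by (rule osc_kernel_le[OF a \<sigma> w A(1), of B0]) (use that in \<open>simp add: \<psi>_def \<phi>_def\<close>)
    show ?thesis
    proof (cases "v < 0")
      case False
      have "\<bar>integral {A..B} ?F\<bar> \<le> 8 * A powr (1 - \<sigma>)" if "B \<ge> A" for B
      proof -
        have "\<bar>integral {A..B} ?F\<bar> \<le> 8 * \<psi> A / u"
          using A(1) that u False a by (intro vdC) (auto simp: \<phi>'_def)
        also have "\<dots> \<le> 8 * (A powr - \<sigma>) / u" using u \<psi>le[of A] by (intro divide_right_mono) auto
        finally show ?thesis using A\<sigma> by simp
      qed
      then have "\<bar>osc_kernel a \<sigma> u v w \<theta>\<bar> \<le> 2 * A powr (1 - \<sigma>) + 8 * A powr (1 - \<sigma>)"
        by (intro key) auto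
      also have "\<dots> \<le> C * A powr (1 - \<sigma>)"
        using c(1) by (simp add: C_def distrib_right)
      finally show ?thesis using False Au by simp
    next
      case True
      define x0 where "x0 = (u / (a * \<bar>v\<bar>)) powr (1 / (a - 1))"
      have x0: "x0 > 0" using u a True by (simp add: x0_def)
      have "0 < u / (a * \<bar>v\<bar>)" using u a True by (intro divide_pos_pos mult_pos_pos) auto
      then have x0b: "x0 powr b = u / (a * \<bar>v\<bar>)"
        unfolding x0_def b_def powr_powr using a u by simp
      have \<phi>'_eq: "\<phi>' x = u * (1 - (x / x0) powr b)" if "x > 0" for x
      proof -
        have "(x / x0) powr b = x powr b * (a * \<bar>v\<bar>) / u"
          using that x0 u a True by (simp add: powr_divide x0b)
        then show ?thesis using u True by (simp add: \<phi>'_def field_simps)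
      qed
      have low: "u * (c * \<epsilon>) \<le> \<phi>' x" if "0 < x" "x \<le> x0 * (1 - \<epsilon>)" "0 \<le> \<epsilon>" "\<epsilon> \<le> 1" for x \<epsilon>
      proof -
        have "(x / x0) powr b \<le> (1 - \<epsilon>) powr b"
          using that x0 b by (intro powr_mono2) (auto simp: field_simps)
        then have "c * \<epsilon> \<le> 1 - (x / x0) powr b" using c(2)[OF that(3,4)] by linarith
        then show ?thesis unfolding \<phi>'_eq[OF that(1)] using u by (intro mult_left_mono) auto
      qed
      have high: "\<phi>' x \<le> - (u * (c * \<epsilon>))" if "x0 * (1 + \<epsilon>) \<le> x" "0 \<le> \<epsilon>" "\<epsilon> \<le> 1" for x \<epsilon>
      proof -
        have x: "x > 0" using that x0 by (meson add_pos_nonneg less_le_trans mult_pos_pos zero_less_one)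
        have "(1 + \<epsilon>) powr b \<le> (x / x0) powr b"
          using that x0 b by (intro powr_mono2) (auto simp: field_simps)
        then have "u * (c * \<epsilon>) \<le> u * ((x / x0) powr b - 1)" using c(3)[OF that(2,3)] u by (intro mult_left_mono) auto
        then show ?thesis unfolding \<phi>'_eq[OF x] by (simp add: algebra_simps)
      qed
      \<comment> \<open>The size \<open>E\<close> of the damping at \<open>x0 / 2\<close> bounds it
        on the whole region to the right, and \<open>M\<close> is the resulting contribution of the
        stationary point.\<close>
      define E where "E = exp (- w * (x0 / 2) powr a)"
      define M where "M = u powr (-1/2) * x0 powr (1/2 - \<sigma>) * E"
      have M0: "M \<ge> 0" by (simp add: M_def E_def)
      have tail: "\<bar>integral {p..B} ?F\<bar> \<le> 8 / c * A powr (1 - \<sigma>)" if "p \<ge> A" "p \<ge> 2 * x0" "B \<ge> p" for p B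
      proof -
        have "\<bar>integral {p..B} ?F\<bar> \<le> 8 * \<psi> p / (u * (c * 1))"
          using that A(1) u c(1) high[of 1] by (intro vdC) auto
        also have "\<dots> \<le> 8 * (A powr - \<sigma>) / (u * (c * 1))" using u c(1) that by (intro divide_right_mono mult_left_mono \<psi>le) auto
        also have "\<dots> = 8 / c * (A powr - \<sigma> / u)" by simp
        finally show ?thesis unfolding A\<sigma> .
      qed
      have "\<bar>osc_kernel a \<sigma> u v w \<theta>\<bar> \<le> C * A powr (1 - \<sigma>) + C * M"
      proof (cases "x0 < 4 * A")
        case x0A: True
        \<comment> \<open>A stationary point this close to \<open>A\<close> needs no window:
          \<open>{A..8 * A}\<close> is estimated trivially, and beyond \<open>8 * A\<close> the
          variable exceeds \<open>2 * x0\<close>.\<close>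
        have "\<bar>integral {A..B} ?F\<bar> \<le> 7 * A powr (1 - \<sigma>) + 8 / c * A powr (1 - \<sigma>)" if "B \<ge> 8 * A" for B
        proof -
          have "\<bar>integral {A..B} ?F\<bar> \<le> \<bar>integral {A..8 * A} ?F\<bar> + \<bar>integral {8 * A..B} ?F\<bar>"
            using A(1) that by (intro abs_integral_split Fint) auto
          moreover have "\<bar>integral {A..8 * A} ?F\<bar> \<le> (8 * A - A) * \<psi> A" using A(1) by (intro trivial) auto
          moreover have "(8 * A - A) * \<psi> A \<le> 7 * A * A powr - \<sigma>" using \<psi>le[of A] A(1) by simp
          moreover have "A * A powr - \<sigma> = A powr (1 - \<sigma>)" using A\<sigma> A(1) u by (simp add: A_def)
          moreover have "\<bar>integral {8 * A..B} ?F\<bar> \<le> 8 / c * A powr (1 - \<sigma>)"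
            using A(1) that x0A by (intro tail) auto
          ultimately show ?thesis by simp
        qed
        then have "\<bar>osc_kernel a \<sigma> u v w \<theta>\<bar> \<le> 2 * A powr (1 - \<sigma>) + (7 * A powr (1 - \<sigma>) + 8 / c * A powr (1 - \<sigma>))"
          by (rule key)
        also have "\<dots> = (9 + 8 / c) * A powr (1 - \<sigma>)" by (simp add: distrib_right)
        also have "\<dots> \<le> C * A powr (1 - \<sigma>)" using c(1) by (intro mult_right_mono) (use c40 in \<open>auto simp: C_def\<close>)
        also have "\<dots> \<le> C * A powr (1 - \<sigma>) + C * M" using C M0 by simp
        finally show ?thesis .
      next
        case False
        then have ux0: "u * x0 \<ge> 4" using u by (simp add: A_def field_simps)
        \<comment> \<open>The window radius \<open>\<delta> = x0 * \<epsilon>\<close> then equals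
          \<open>1 / (u * \<epsilon>)\<close>. So the trivial bound inside the window and van der
          Corput's bound outside, where the derivative has absolute value at least
          \<open>u * (c * \<epsilon>)\<close>, are of the same size. The assumption
          \<open>u * x0 \<ge> 4\<close> gives \<open>\<epsilon> \<le> 1/2\<close>, which puts the
          window inside \<open>{x0 / 2..2 * x0}\<close>.\<close>
        define \<epsilon> where "\<epsilon> = 1 / sqrt (u * x0)"
        have sq: "sqrt (u * x0) \<ge> 2" using ux0 real_le_rsqrt[of 2 "u * x0"] by simp
        then have "sqrt (u * x0) > 0" by linarith
        then have \<epsilon>: "0 < \<epsilon>" "\<epsilon> \<le> 1/2"
          using frac_le[of 1 1 2 "sqrt (u * x0)"] sq unfolding \<epsilon>_def by (simp_all only: zero_less_divide_1_iff)
        define \<delta> where "\<delta> = x0 * \<epsilon>"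
        have \<delta>: "\<delta> > 0" "\<delta> \<le> x0 / 2" using x0 \<epsilon> by (auto simp: \<delta>_def)
        have "sqrt (u * x0) * sqrt (u * x0) = u * x0" using u x0 by simp
        then have ue: "1 / (u * \<epsilon>) = \<delta>"
          using u x0 sq by (simp add: \<delta>_def \<epsilon>_def field_simps)
        have x0\<delta>: "x0 powr - \<sigma> * \<delta> = u powr (-1/2) * x0 powr (1/2 - \<sigma>)"
        proof -
          have "\<delta> = x0 powr 1 * (u * x0) powr (-1/2)" using u x0 by (simp add: \<delta>_def \<epsilon>_def powr_minus_divide powr_half_sqrt)
          also have "\<dots> = u powr (-1/2) * (x0 powr 1 * x0 powr (-1/2))" using u x0 by (simp add: powr_mult)
          also have "x0 powr 1 * x0 powr (-1/2) = x0 powr (1/2)" unfolding powr_add[symmetric] by simp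
          finally have "x0 powr - \<sigma> * \<delta> = u powr (-1/2) * (x0 powr - \<sigma> * x0 powr (1/2))" by simp
          also have "x0 powr - \<sigma> * x0 powr (1/2) = x0 powr (1/2 - \<sigma>)" unfolding powr_add[symmetric] by simp
          finally show ?thesis .
        qed
        have \<psi>h: "\<psi> x \<le> 2 * x0 powr - \<sigma> * E" if "x \<ge> x0 / 2" for x
        proof -
          have "\<psi> x \<le> \<psi> (x0 / 2)" using that x0 by (intro \<psi>anti) auto
          also have "\<dots> = 2 powr \<sigma> * x0 powr - \<sigma> * E"
            unfolding \<psi>_def E_def using x0 by (simp add: powr_divide powr_minus_divide)
          also have "\<dots> \<le> 2 powr 1 * x0 powr - \<sigma> * E"
            using \<sigma> by (intro mult_right_mono powr_mono) (auto simp: E_def)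
          finally show ?thesis by simp
        qed
        have M\<delta>: "x0 powr - \<sigma> * E * \<delta> = M" unfolding M_def x0\<delta>[symmetric] by simp
        have near: "\<bar>integral {p..q} ?F\<bar> \<le> 16 / c * M"
          if pq: "x0 / 2 \<le> p" "p \<le> q" and ph: "(\<forall>x\<in>{p..q}. u * (c * \<epsilon>) \<le> \<phi>' x) \<or> (\<forall>x\<in>{p..q}. \<phi>' x \<le> - (u * (c * \<epsilon>)))" for p q
        proof -
          have "\<bar>integral {p..q} ?F\<bar> \<le> 8 * \<psi> p / (u * (c * \<epsilon>))"
            using pq x0 u c(1) \<epsilon> by (intro vdC ph) auto
          also have "\<dots> \<le> 8 * (2 * x0 powr - \<sigma> * E) / (u * (c * \<epsilon>))"
            using pq u c(1) \<epsilon> by (intro divide_right_mono mult_left_mono \<psi>h) auto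
          also have "\<dots> = 16 / c * (x0 powr - \<sigma> * E * (1 / (u * \<epsilon>)))" by simp
          finally show ?thesis unfolding ue M\<delta> .
        qed
        have "\<bar>integral {A..B} ?F\<bar> \<le> (16 / c * A powr (1 - \<sigma>) + 8 / c * A powr (1 - \<sigma>)) + (16 / c * M + 4 * M + 16 / c * M)" if B: "B \<ge> 2 * x0" for B
        proof -
          have pts: "A \<le> x0 / 2" "x0 / 2 \<le> x0 - \<delta>" "x0 - \<delta> \<le> x0 + \<delta>" "x0 + \<delta> \<le> 2 * x0" "2 * x0 \<le> B"
            using False \<delta> x0 B A(1) by auto
          have "\<bar>integral {A..B} ?F\<bar> \<le> \<bar>integral {A..x0 / 2} ?F\<bar> + \<bar>integral {x0 / 2..B} ?F\<bar>"
            using A(1) pts by (intro abs_integral_split Fint) auto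
          moreover have "\<bar>integral {x0 / 2..B} ?F\<bar> \<le> \<bar>integral {x0 / 2..x0 - \<delta>} ?F\<bar> + \<bar>integral {x0 - \<delta>..B} ?F\<bar>"
            using x0 pts by (intro abs_integral_split Fint) auto
          moreover have "\<bar>integral {x0 - \<delta>..B} ?F\<bar> \<le> \<bar>integral {x0 - \<delta>..x0 + \<delta>} ?F\<bar> + \<bar>integral {x0 + \<delta>..B} ?F\<bar>"
            using x0 pts by (intro abs_integral_split Fint) auto
          moreover have "\<bar>integral {x0 + \<delta>..B} ?F\<bar> \<le> \<bar>integral {x0 + \<delta>..2 * x0} ?F\<bar> + \<bar>integral {2 * x0..B} ?F\<bar>"
            using x0 \<delta> pts by (intro abs_integral_split Fint) auto
          moreover have "\<bar>integral {A..x0 / 2} ?F\<bar> \<le> 16 / c * A powr (1 - \<sigma>)"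
          proof -
            have "\<bar>integral {A..x0 / 2} ?F\<bar> \<le> 8 * \<psi> A / (u * (c * (1/2)))"
              using A(1) pts u c(1) low[of _ "1/2"] by (intro vdC) auto
            also have "\<dots> \<le> 8 * (A powr - \<sigma>) / (u * (c * (1/2)))" using u c(1) by (intro divide_right_mono mult_left_mono \<psi>le) auto
            also have "\<dots> = 16 / c * (A powr - \<sigma> / u)" by simp
            finally show ?thesis unfolding A\<sigma> .
          qed
          moreover have "\<bar>integral {x0 / 2..x0 - \<delta>} ?F\<bar> \<le> 16 / c * M"
            using pts x0 \<epsilon> low[of _ \<epsilon>] by (intro near) (auto simp: \<delta>_def algebra_simps)
          moreover have "\<bar>integral {x0 - \<delta>..x0 + \<delta>} ?F\<bar> \<le> 4 * M"
          proof -
            have "\<bar>integral {x0 - \<delta>..x0 + \<delta>} ?F\<bar> \<le> ((x0 + \<delta>) - (x0 - \<delta>)) * \<psi> (x0 - \<delta>)"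
              using pts x0 \<delta> by (intro trivial) auto
            also have "\<dots> \<le> ((x0 + \<delta>) - (x0 - \<delta>)) * (2 * x0 powr - \<sigma> * E)"
              using pts \<delta> by (intro mult_left_mono \<psi>h) auto
            also have "\<dots> = 4 * (x0 powr - \<sigma> * E * \<delta>)" by simp
            finally show ?thesis unfolding M\<delta> .
          qed
          moreover have "\<bar>integral {x0 + \<delta>..2 * x0} ?F\<bar> \<le> 16 / c * M"
            using pts x0 \<epsilon> \<delta> high[of \<epsilon>] by (intro near) (auto simp: \<delta>_def algebra_simps)
          moreover have "\<bar>integral {2 * x0..B} ?F\<bar> \<le> 8 / c * A powr (1 - \<sigma>)"
            using pts x0 by (intro tail) auto
          ultimately show ?thesis by linarith
        qed
        then have "\<bar>osc_kernel a \<sigma> u v w \<theta>\<bar> \<le> 2 * A powr (1 - \<sigma>) + ((16 / c * A powr (1 - \<sigma>) + 8 / c * A powr (1 - \<sigma>)) + (16 / c * M + 4 * M + 16 / c * M))"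
          by (rule key)
        also have "\<dots> = (2 + 24 / c) * A powr (1 - \<sigma>) + (4 + 32 / c) * M" by (simp add: field_simps)
        also have "\<dots> \<le> C * A powr (1 - \<sigma>) + C * M"
          using c40 M0 by (intro add_mono mult_right_mono) (auto simp: C_def)
        finally show ?thesis .
      qed
      then show ?thesis using True by (simp add: Au M_def E_def x0_def)
    qed
  qed
  then show ?thesis using C by blast
qed

text \<open>Makes the bound uniform in \<open>v\<close> and \<open>w\<close>. For
  \<open>\<sigma> = 1/2\<close> the stationary term is \<open>u powr (-1/2)\<close> times a factor
  at most 1. Otherwise \<open>v\<close> is expressed through \<open>x0\<close>, and the damped power
  of \<open>x0\<close> is maximised by \<open>powr_mult_exp_le\<close>.\<close>

lemma osc_kernel_integrable_bound:
  fixes a \<gamma> \<sigma> :: real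
  assumes a: "a > 1" and \<gamma>: "\<gamma> > 0" and \<sigma>: "0 < \<sigma>" "\<sigma> \<le> 1/2"
    and crit: "\<sigma> = 1/2 \<or> (\<gamma> * (a - 1) < a \<and> a * (\<gamma> - 1) < 2 * \<gamma> * \<sigma>)"
  shows "\<exists>C\<ge>0. \<exists>\<rho><1. \<forall>u v w \<theta>. u > 0 \<longrightarrow> w > 0 \<longrightarrow> \<bar>v\<bar> powr \<gamma> \<le> w \<longrightarrow>
    \<bar>osc_kernel a \<sigma> u v w \<theta>\<bar> \<le> C * (u powr (\<sigma> - 1) + u powr - \<rho>)"
proof -
  obtain C where C: "C \<ge> 0" "\<And>u v w \<theta>. u > 0 \<Longrightarrow> w > 0 \<Longrightarrow> \<bar>osc_kernel a \<sigma> u v w \<theta>\<bar> \<le> C * u powr (\<sigma> - 1) +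
    (if v < 0 then C * (u powr (-1/2) * ((u / (a * \<bar>v\<bar>)) powr (1 / (a - 1))) powr (1/2 - \<sigma>)
      * exp (- w * ((u / (a * \<bar>v\<bar>)) powr (1 / (a - 1)) / 2) powr a)) else 0)"
    using osc_kernel_bound[OF a \<sigma>] by blast
  have main: "\<exists>K\<ge>0. \<exists>\<rho><1. \<forall>u v w. u > 0 \<longrightarrow> w > 0 \<longrightarrow> v < 0 \<longrightarrow> \<bar>v\<bar> powr \<gamma> \<le> w \<longrightarrow>
    u powr (-1/2) * ((u / (a * \<bar>v\<bar>)) powr (1 / (a - 1))) powr (1/2 - \<sigma>)
      * exp (- w * ((u / (a * \<bar>v\<bar>)) powr (1 / (a - 1)) / 2) powr a) \<le> K * u powr - \<rho>"
  proof (cases "\<sigma> = 1/2")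
    case True
    have "u powr (-1/2) * ((u / (a * \<bar>v\<bar>)) powr (1 / (a - 1))) powr (1/2 - \<sigma>)
      * exp (- w * ((u / (a * \<bar>v\<bar>)) powr (1 / (a - 1)) / 2) powr a) \<le> 1 * u powr - (1/2)" if "u > 0" "w > 0" "v < 0" for u v w :: real
    proof -
      have "u powr (-1/2) * exp (- w * ((u / (a * \<bar>v\<bar>)) powr (1 / (a - 1)) / 2) powr a) \<le> u powr (-1/2) * 1"
        using that by (intro mult_left_mono) auto
      \<comment> \<open>Nonvanishing matters because \<open>x powr 0\<close> is 1 only for
        \<open>x \<noteq> 0\<close>.\<close>
      moreover have "(u / (a * \<bar>v\<bar>)) powr (1 / (a - 1)) \<noteq> 0" using that a by simp
      then have "((u / (a * \<bar>v\<bar>)) powr (1 / (a - 1))) powr (1/2 - \<sigma>) = 1"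
        unfolding True by (simp only: diff_self powr_zero_eq_one if_False)
      ultimately show ?thesis by (simp only: mult_1_left mult_1_right) simp
    qed
    then show ?thesis by (intro exI[of _ 1] conjI exI[of _ "1/2"] allI impI) auto
  next
    case False
    \<comment> \<open>The exponent of \<open>x0\<close> in the damping after
      \<open>\<bar>v\<bar>\<close> has been expressed by \<open>u\<close> and \<open>x0\<close>. Its
      positivity is the first inequality of \<open>crit\<close>.\<close>
    define \<beta> where "\<beta> = a - \<gamma> * (a - 1)"
    define \<kappa> where "\<kappa> = 1/2 - \<sigma>"
    define q where "q = \<kappa> / \<beta>"
    define c1 where "c1 = a powr - \<gamma> * 2 powr - a"
    have \<beta>: "\<beta> > 0" and \<kappa>: "\<kappa> > 0" using crit False \<sigma> by (auto simp: \<beta>_def \<kappa>_def)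
    then have q: "q > 0" by (simp add: q_def)
    have c1: "c1 > 0" using a by (simp add: c1_def)
    \<comment> \<open>The second inequality of \<open>crit\<close> in disguise; it makes the
      resulting power \<open>u powr - (1/2 + \<gamma> * q)\<close> integrable at 0.\<close>
    have "\<gamma> * \<kappa> < \<beta> / 2" using crit False by (auto simp: \<beta>_def \<kappa>_def algebra_simps)
    then have \<rho>: "1/2 + \<gamma> * q < 1" using \<beta> by (simp add: q_def field_simps)
    have "u powr (-1/2) * ((u / (a * \<bar>v\<bar>)) powr (1 / (a - 1))) powr (1/2 - \<sigma>)
      * exp (- w * ((u / (a * \<bar>v\<bar>)) powr (1 / (a - 1)) / 2) powr a) \<le> (q / c1) powr q * u powr - (1/2 + \<gamma> * q)"
      if u: "u > 0" and w: "w > 0" and v: "v < 0" and vw: "\<bar>v\<bar> powr \<gamma> \<le> w" for u v w :: real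
    proof -
      define x0 where "x0 = (u / (a * \<bar>v\<bar>)) powr (1 / (a - 1))"
      have x0: "x0 > 0" using u a v by (simp add: x0_def)
      have "0 < u / (a * \<bar>v\<bar>)" using u a v by (intro divide_pos_pos mult_pos_pos) auto
      then have "x0 powr (a - 1) = u / (a * \<bar>v\<bar>)" unfolding x0_def powr_powr using a u by simp
      then have "\<bar>v\<bar> = u / (a * x0 powr (a - 1))" using u a v x0 by (simp add: field_simps)
      also have "\<dots> = u * a powr - 1 * x0 powr - (a - 1)"
        unfolding powr_minus_divide[of x0] powr_minus_divide[of a] using a by simp
      finally have v_eq: "\<bar>v\<bar> = u * a powr - 1 * x0 powr - (a - 1)" .
      have "\<bar>v\<bar> powr \<gamma> = u powr \<gamma> * a powr - \<gamma> * x0 powr (- (a - 1) * \<gamma>)"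
        unfolding v_eq powr_mult powr_powr by simp
      then have "\<bar>v\<bar> powr \<gamma> * (x0 / 2) powr a = u powr \<gamma> * a powr - \<gamma> * (x0 powr (- (a - 1) * \<gamma>) * x0 powr a) * 2 powr - a"
        using x0 by (simp add: powr_divide powr_minus_divide)
      also have "x0 powr (- (a - 1) * \<gamma>) * x0 powr a = x0 powr \<beta>"
        unfolding powr_add[symmetric] by (simp add: \<beta>_def algebra_simps)
      finally have e: "\<bar>v\<bar> powr \<gamma> * (x0 / 2) powr a = c1 * u powr \<gamma> * x0 powr \<beta>" by (simp add: c1_def mult_ac)
      have "exp (- w * (x0 / 2) powr a) \<le> exp (- (c1 * u powr \<gamma>) * x0 powr \<beta>)"
        using mult_right_mono[OF vw, of "(x0 / 2) powr a"] e by simp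
      then have "x0 powr \<kappa> * exp (- w * (x0 / 2) powr a) \<le> x0 powr \<kappa> * exp (- (c1 * u powr \<gamma>) * x0 powr \<beta>)"
        by (intro mult_left_mono) auto
      also have "\<dots> = (x0 powr \<beta>) powr q * exp (- (c1 * u powr \<gamma>) * x0 powr \<beta>)"
        using \<beta> by (simp add: powr_powr q_def)
      also have "(x0 powr \<beta>) powr q * exp (- (c1 * u powr \<gamma>) * x0 powr \<beta>) \<le> (q / (c1 * u powr \<gamma>)) powr q"
        using x0 q c1 u by (intro powr_mult_exp_le) auto
      also have "\<dots> = (q / c1) powr q * u powr - (\<gamma> * q)"
        using q c1 u by (simp add: powr_divide powr_mult powr_powr powr_minus_divide)
      finally have "u powr (-1/2) * (x0 powr \<kappa> * exp (- w * (x0 / 2) powr a)) \<le> u powr (-1/2) * ((q / c1) powr q * u powr - (\<gamma> * q))"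
        by (intro mult_left_mono) auto
      also have "\<dots> = (q / c1) powr q * (u powr (-1/2) * u powr - (\<gamma> * q))" by simp
      also have "u powr (-1/2) * u powr - (\<gamma> * q) = u powr - (1/2 + \<gamma> * q)" unfolding powr_add[symmetric] by simp
      finally show ?thesis by (simp add: x0_def \<kappa>_def mult_ac)
    qed
    then show ?thesis using \<rho> by (intro exI[of _ "(q / c1) powr q"] conjI exI[of _ "1/2 + \<gamma> * q"] allI impI) auto
  qed
  then obtain K \<rho> where K: "K \<ge> 0" "\<rho> < 1" "\<And>u v w. u > 0 \<Longrightarrow> w > 0 \<Longrightarrow> v < 0 \<Longrightarrow> \<bar>v\<bar> powr \<gamma> \<le> w \<Longrightarrow>
    u powr (-1/2) * ((u / (a * \<bar>v\<bar>)) powr (1 / (a - 1))) powr (1/2 - \<sigma>)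
      * exp (- w * ((u / (a * \<bar>v\<bar>)) powr (1 / (a - 1)) / 2) powr a) \<le> K * u powr - \<rho>"
    by blast
  have "\<bar>osc_kernel a \<sigma> u v w \<theta>\<bar> \<le> (C + C * K) * (u powr (\<sigma> - 1) + u powr - \<rho>)"
    if u: "u > 0" and w: "w > 0" and vw: "\<bar>v\<bar> powr \<gamma> \<le> w" for u v w \<theta>
  proof -
    have "\<bar>osc_kernel a \<sigma> u v w \<theta>\<bar> \<le> C * u powr (\<sigma> - 1) + C * (K * u powr - \<rho>)"
    proof (cases "v < 0")
      case True
      show ?thesis using C(2)[OF u w, of v \<theta>] mult_left_mono[OF K(3)[OF u w True vw] C(1)] True by simp
    next
      case False
      have "0 \<le> C * (K * u powr - \<rho>)" using C(1) K(1) by simp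
      then show ?thesis using C(2)[OF u w, of v \<theta>] False by simp
    qed
    also have "\<dots> \<le> (C + C * K) * (u powr (\<sigma> - 1) + u powr - \<rho>)"
      using C(1) K(1) by (simp add: distrib_left distrib_right mult_ac)
    finally show ?thesis .
  qed
  then show ?thesis using C(1) K(1,2) by (intro exI[of _ "C + C * K"] conjI exI[of _ \<rho>] allI impI) auto
qed

section \<open>The maximal estimate\<close>

text \<open>Folding onto the half-line turns \<open>cis (D * \<xi>)\<close> into
  \<open>2 * cos (\<bar>D\<bar> * x)\<close>. The product with \<open>cis (v * x powr a)\<close>
  splits into phases with \<open>v\<close> and \<open>- v\<close>; the imaginary part is reached by
  the shift \<open>\<theta> = - pi / 2\<close>.\<close>

lemma osc_transform_le:
  fixes a \<sigma> v w D :: real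
  assumes a: "a > 1" and \<sigma>: "\<sigma> < 1" and w: "w > 0"
  shows "cmod (\<integral>\<xi>. of_real (\<bar>\<xi>\<bar> powr - \<sigma>) * (damped a w v \<xi> * cis (D * \<xi>)) \<partial>lborel)
    \<le> \<bar>osc_kernel a \<sigma> \<bar>D\<bar> v w 0\<bar> + \<bar>osc_kernel a \<sigma> \<bar>D\<bar> (- v) w 0\<bar>
      + (\<bar>osc_kernel a \<sigma> \<bar>D\<bar> v w (- pi / 2)\<bar> + \<bar>osc_kernel a \<sigma> \<bar>D\<bar> (- v) w (- pi / 2)\<bar>)"
proof -
  define F where "F \<xi> = of_real (\<bar>\<xi>\<bar> powr - \<sigma>) * (damped a w v \<xi> * cis (D * \<xi>))" for \<xi>
  have [measurable]: "F \<in> borel_measurable borel" unfolding F_def by measurable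
  have iF: "integrable lborel F"
  proof (rule Bochner_Integration.integrable_bound)
    show "integrable lborel (\<lambda>x. \<bar>x\<bar> powr - \<sigma> * exp (- w * \<bar>x\<bar> powr a))"
      by (rule integrable_abs_powr_exp) (use a \<sigma> w in auto)
  qed (auto simp: F_def norm_mult cmod_damped)
  define G where "G x = indicator {0<..} x *\<^sub>R (F x + F (- x))" for x
  have iG: "integrable lborel G"
  proof -
    have "integrable lborel (\<lambda>x. F (- x))"
      using lborel_integrable_real_affine[OF iF, of "-1" 0] by simp
    with iF show ?thesis unfolding G_def by (intro integrable_mult_indicator Bochner_Integration.integrable_add) auto
  qed
  define k where "k v' \<theta> x = indicator {0<..} x * (x powr - \<sigma> * exp (- w * x powr a) * cos (\<bar>D\<bar> * x + v' * x powr a + \<theta>))" for v' \<theta> x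
  have ik: "integrable lborel (k v' \<theta>)" for v' \<theta>
  proof (rule Bochner_Integration.integrable_bound)
    show "integrable lborel (\<lambda>x. indicator {0<..} x * (x powr - \<sigma> * exp (- w * x powr a)))"
      by (rule integrable_powr_exp) (use a \<sigma> w in auto)
    show "k v' \<theta> \<in> borel_measurable lborel" unfolding k_def by measurable
    show "AE x in lborel. norm (k v' \<theta> x) \<le> norm (indicator {0<..} x * (x powr - \<sigma> * exp (- w * x powr a)))"
      by (auto simp: k_def abs_mult indicator_def mult_left_le)
  qed
  have osc: "osc_kernel a \<sigma> \<bar>D\<bar> v' w \<theta> = (\<integral>x. k v' \<theta> x \<partial>lborel)" for v' \<theta>
    by (simp add: osc_kernel_def k_def)
  have Gx: "G x = indicator {0<..} x *\<^sub>R (2 * cos (\<bar>D\<bar> * x) * (x powr - \<sigma> * exp (- w * x powr a))) *\<^sub>R cis (v * x powr a)" for x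
  proof (cases "x > 0")
    case True
    have "cis (D * x) + cis (D * (- x)) = of_real (2 * cos (\<bar>D\<bar> * x))"
      by (simp add: complex_eq_iff abs_if)
    then have "F x + F (- x) = of_real (x powr - \<sigma>) * damped a w v x * of_real (2 * cos (\<bar>D\<bar> * x))"
      using True unfolding F_def damped_def abs_minus_cancel mult.assoc distrib_left[symmetric] by simp
    then show ?thesis using True by (simp add: G_def damped_def scaleR_conv_of_real mult_ac)
  qed (simp add: G_def)
  have "(\<integral>\<xi>. F \<xi> \<partial>lborel) = (\<integral>x. G x \<partial>lborel)"
    unfolding G_def by (rule integral_half_line[OF iF])
  moreover have "Re (\<integral>x. G x \<partial>lborel) = (\<integral>x. k v 0 x + k (- v) 0 x \<partial>lborel)"
    by (subst integral_Re[OF iG, symmetric], intro Bochner_Integration.integral_cong refl)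
       (simp add: Gx k_def cos_add cos_diff algebra_simps)
  moreover have "Im (\<integral>x. G x \<partial>lborel) = (\<integral>x. k v (- pi / 2) x - k (- v) (- pi / 2) x \<partial>lborel)"
    by (subst integral_Im[OF iG, symmetric], intro Bochner_Integration.integral_cong refl)
       (simp add: Gx k_def cos_add cos_diff sin_add sin_diff algebra_simps)
  ultimately have "Re (\<integral>\<xi>. F \<xi> \<partial>lborel) = osc_kernel a \<sigma> \<bar>D\<bar> v w 0 + osc_kernel a \<sigma> \<bar>D\<bar> (- v) w 0"
    "Im (\<integral>\<xi>. F \<xi> \<partial>lborel) = osc_kernel a \<sigma> \<bar>D\<bar> v w (- pi / 2) - osc_kernel a \<sigma> \<bar>D\<bar> (- v) w (- pi / 2)"
    unfolding osc by (simp_all add: ik)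
  then show ?thesis
    using cmod_le[of "\<integral>\<xi>. F \<xi> \<partial>lborel"] unfolding F_def[symmetric] by linarith
qed

text \<open>The operator acting on a transform \<open>g\<close> instead of a function, so that
  \<open>g\<close> can be cut off, split and summed directly on the frequency side.\<close>

definition evolution :: "real \<Rightarrow> real \<Rightarrow> (real \<Rightarrow> complex) \<Rightarrow> real \<Rightarrow> real \<Rightarrow> complex" where
  "evolution a \<gamma> g t x = (\<integral>\<xi>. g \<xi> * (damped a (t powr \<gamma>) t \<xi> * cis (x * \<xi>)) \<partial>lborel)"

lemma integrable_evolution:
  assumes [measurable]: "g \<in> borel_measurable borel" and g: "nsq g < \<infinity>" and "a > 1" "w > 0"
  shows "integrable lborel (\<lambda>\<xi>. g \<xi> * (damped a w t \<xi> * cis (x * \<xi>)))"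
proof -
  have "integrable lborel (\<lambda>\<xi>. g \<xi> * damped a w t \<xi>)"
    by (intro integrable_mult_nsq g nsq_damped) (use assms in auto)
  then show ?thesis
    by (rule Bochner_Integration.integrable_bound) (auto simp: norm_mult)
qed

lemma measurable_evolution [measurable]:
  assumes [measurable]: "g \<in> borel_measurable borel" "\<tau> \<in> borel_measurable borel"
  shows "(\<lambda>x. evolution a \<gamma> g (\<tau> x) x) \<in> borel_measurable borel"
  unfolding evolution_def damped_def by measurable

text \<open>A squared homogeneous Sobolev norm in terms of the transform. It has order
  \<open>\<sigma> / 2\<close>, so \<open>\<sigma>\<close> stands for twice the smoothness.\<close>

definition weighted_nsq :: "real \<Rightarrow> (real \<Rightarrow> complex) \<Rightarrow> ennreal" where
  "weighted_nsq \<sigma> g = (\<integral>\<^sup>+\<xi>. ennreal (\<bar>\<xi>\<bar> powr \<sigma> * (cmod (g \<xi>))\<^sup>2) \<partial>lborel)"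

lemma local_kernel_finite:
  fixes p q C R :: real
  assumes "p > -1" "q > -1" "C \<ge> 0"
  shows "(\<integral>\<^sup>+u. ennreal (indicator {-R..R} u * (C * (\<bar>u\<bar> powr p + \<bar>u\<bar> powr q))) \<partial>lborel) < \<infinity>"
proof -
  have "integrable lborel (\<lambda>x. indicator {0<..} x * (indicator {0..\<bar>R\<bar>} x * x powr p))" if "p > -1" for p :: real
  proof -
    have "integrable lborel (\<lambda>x. indicator {0..\<bar>R\<bar>} x * x powr p)"
      by (rule integrable_lborel_of_has_integral[OF _ _ _ has_integral_powr_from_0[OF that]]) auto
    then show ?thesis
      by (rule Bochner_Integration.integrable_bound) (auto simp: indicator_def)
  qed
  then have i: "integrable lborel (\<lambda>x. indicator {0..\<bar>R\<bar>} \<bar>x\<bar> * \<bar>x\<bar> powr p)" if "p > -1" for p :: real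
    using that by (intro integrable_abs_arg[of "\<lambda>x. indicator {0..\<bar>R\<bar>} x * x powr p"]) measurable
  have "integrable lborel (\<lambda>x. C * (indicator {0..\<bar>R\<bar>} \<bar>x\<bar> * \<bar>x\<bar> powr p + indicator {0..\<bar>R\<bar>} \<bar>x\<bar> * \<bar>x\<bar> powr q))"
    by (intro integrable_mult_right Bochner_Integration.integrable_add i assms)
  then have "integrable lborel (\<lambda>u. indicator {-R..R} u * (C * (\<bar>u\<bar> powr p + \<bar>u\<bar> powr q)))"
    by (rule Bochner_Integration.integrable_bound) (use assms in \<open>auto simp: indicator_def abs_mult\<close>)
  then have "(\<integral>\<^sup>+u. ennreal (norm (indicator {-R..R} u * (C * (\<bar>u\<bar> powr p + \<bar>u\<bar> powr q)))) \<partial>lborel) < \<infinity>"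
    by (simp only: integrable_iff_bounded)
  also have "(\<integral>\<^sup>+u. ennreal (norm (indicator {-R..R} u * (C * (\<bar>u\<bar> powr p + \<bar>u\<bar> powr q)))) \<partial>lborel)
    = (\<integral>\<^sup>+u. ennreal (indicator {-R..R} u * (C * (\<bar>u\<bar> powr p + \<bar>u\<bar> powr q))) \<partial>lborel)"
    using assms by (intro nn_integral_cong) (auto simp: indicator_def abs_mult)
  finally show ?thesis .
qed

text \<open>Duality: pairing the linearised operator with its own truncated conjugate
  \<open>h\<close> expresses \<open>nsq h\<close> as the integral of \<open>G * H\<close>.
  Cauchy-Schwarz, with the weight \<open>\<bar>\<xi>\<bar> powr \<sigma>\<close> on \<open>g\<close>
  and its inverse on \<open>H\<close>, bounds the square of \<open>nsq h\<close> by
  \<open>weighted_nsq \<sigma> g\<close> times the integral in \<open>TTstar_bound\<close>, itself a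
  multiple of \<open>nsq h\<close>. The final bound does not involve \<open>t0\<close>.\<close>

lemma linearised_maximal_bound:
  fixes a \<gamma> \<sigma> R C \<rho> t0 :: real
  assumes a: "a > 1" and \<gamma>: "\<gamma> > 0" and \<sigma>: "0 < \<sigma>" "\<sigma> < 1" and C: "C \<ge> 0"
    and ker: "\<And>u v w \<theta>. u > 0 \<Longrightarrow> w > 0 \<Longrightarrow> \<bar>v\<bar> powr \<gamma> \<le> w \<Longrightarrow>
      \<bar>osc_kernel a \<sigma> u v w \<theta>\<bar> \<le> C * (u powr (\<sigma> - 1) + u powr - \<rho>)"
    and g [measurable]: "g \<in> borel_measurable borel" and gf: "nsq g < \<infinity>"
    and \<tau> [measurable]: "\<tau> \<in> borel_measurable borel" and t0: "t0 > 0" "\<And>x. \<tau> x \<ge> t0"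
  shows "(\<integral>\<^sup>+x. indicator {-R..R} x * ennreal ((cmod (evolution a \<gamma> g (\<tau> x) x))\<^sup>2) \<partial>lborel)
    \<le> weighted_nsq \<sigma> g * (\<integral>\<^sup>+u. ennreal (indicator {-(2*R)..2*R} u * (4 * C * (\<bar>u\<bar> powr (\<sigma> - 1) + \<bar>u\<bar> powr - \<rho>))) \<partial>lborel)"
proof -
  \<comment> \<open>The damping common to all times \<open>\<tau> x\<close>. Taken out of
    \<open>k\<close>, it makes \<open>\<mu>\<close> and \<open>G\<close> integrable and still leaves
    \<open>cmod (k x \<xi>) \<le> 1\<close>.\<close>
  define w0 where "w0 = t0 powr \<gamma>"
  have w0: "w0 > 0" using t0 by (simp add: w0_def)
  have \<tau>w: "\<tau> x powr \<gamma> \<ge> w0" for x using t0 \<gamma> by (simp add: w0_def powr_mono2)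
  have \<tau>0: "\<tau> x > 0" for x using t0(1) t0(2)[of x] by linarith
  define \<mu> where "\<mu> \<xi> = \<bar>\<xi>\<bar> powr - \<sigma> * exp (- (2 * w0) * \<bar>\<xi>\<bar> powr a)" for \<xi>
  have \<mu>i: "integrable lborel \<mu>"
    unfolding \<mu>_def by (rule integrable_abs_powr_exp) (use a \<sigma> w0 in auto)
  have \<mu>0: "\<mu> \<xi> \<ge> 0" for \<xi> by (simp add: \<mu>_def)
  define k where "k x \<xi> = damped a (\<tau> x powr \<gamma> - w0) (\<tau> x) \<xi> * cis (x * \<xi>)" for x \<xi>
  have km [measurable]: "case_prod k \<in> borel_measurable (borel \<Otimes>\<^sub>M borel)"
    unfolding k_def damped_def case_prod_beta' by measurable
  have k1: "cmod (k x \<xi>) \<le> 1" for x \<xi>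
    using \<tau>w[of x] by (simp add: k_def norm_mult damped_le_1)
  have k_eq: "damped a (\<tau> x powr \<gamma>) (\<tau> x) \<xi> * cis (x * \<xi>) = of_real (exp (- w0 * \<bar>\<xi>\<bar> powr a)) * k x \<xi>" for x \<xi>
  proof -
    have "exp (- (\<tau> x powr \<gamma>) * \<bar>\<xi>\<bar> powr a) = exp (- w0 * \<bar>\<xi>\<bar> powr a) * exp (- (\<tau> x powr \<gamma> - w0) * \<bar>\<xi>\<bar> powr a)"
      unfolding exp_add[symmetric] by (simp add: algebra_simps)
    then show ?thesis unfolding k_def damped_def by (simp only: of_real_mult mult.assoc)
  qed
  let ?T = "\<lambda>x. evolution a \<gamma> g (\<tau> x) x"
  have T_eq: "?T x = (\<integral>\<xi>. g \<xi> * of_real (exp (- w0 * \<bar>\<xi>\<bar> powr a)) * k x \<xi> \<partial>lborel)" for x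
    unfolding evolution_def k_eq by (simp only: mult.assoc)
  define G where "G \<xi> = g \<xi> * of_real (exp (- w0 * \<bar>\<xi>\<bar> powr a))" for \<xi>
  have [measurable]: "G \<in> borel_measurable borel" unfolding G_def by measurable
  have Gi: "integrable lborel G"
  proof -
    have "damped a w0 0 = (\<lambda>\<xi>. of_real (exp (- w0 * \<bar>\<xi>\<bar> powr a)))"
      by (rule ext) (simp add: damped_def)
    then have "nsq (\<lambda>\<xi>. of_real (exp (- w0 * \<bar>\<xi>\<bar> powr a))) < \<infinity>"
      using nsq_damped[of a w0 0] a w0 by (simp only:)
    then show ?thesis unfolding G_def by (intro integrable_mult_nsq gf) measurable
  qed
  define M where "M = (\<integral>\<xi>. cmod (G \<xi>) \<partial>lborel)"
  have TM: "cmod (?T x) \<le> M" for x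
  proof -
    have "cmod (?T x) \<le> (\<integral>\<xi>. cmod (G \<xi> * k x \<xi>) \<partial>lborel)"
      unfolding T_eq G_def by (rule integral_norm_bound)
    also have "\<dots> \<le> M"
      unfolding M_def
    proof (rule integral_mono)
      have [measurable]: "k x \<in> borel_measurable borel" using measurable_Pair2[OF km, of x] by simp
      show "integrable lborel (\<lambda>\<xi>. cmod (G \<xi> * k x \<xi>))"
        by (rule Bochner_Integration.integrable_bound[OF integrable_norm[OF Gi]]) (auto simp: norm_mult k1 mult_left_le)
      show "integrable lborel (\<lambda>\<xi>. cmod (G \<xi>))" by (rule integrable_norm[OF Gi])
      show "cmod (G \<xi> * k x \<xi>) \<le> cmod (G \<xi>)" for \<xi> by (simp add: norm_mult k1 mult_left_le)
    qed
    finally show ?thesis .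
  qed
  define h where "h x = indicator {-R..R} x * cnj (?T x)" for x
  have hm [measurable]: "h \<in> borel_measurable borel" unfolding h_def by measurable
  have M0: "M \<ge> 0" unfolding M_def by (intro integral_nonneg_AE) auto
  have iind: "integrable lborel (\<lambda>x. indicator {-R..R} x * c)" for c :: real
    by (intro integrable_mult_left) (auto simp: emeasure_lborel_Icc_eq intro!: integrable_real_indicator)
  have hi: "integrable lborel h"
    by (rule Bochner_Integration.integrable_bound[OF iind[of M]]) (use TM M0 in \<open>auto simp: h_def norm_mult indicator_def\<close>)
  have hh: "(cmod (h x))\<^sup>2 = indicator {-R..R} x * (cmod (?T x))\<^sup>2" for x
    by (auto simp: h_def indicator_def norm_mult)
  have nh: "nsq h = (\<integral>\<^sup>+x. indicator {-R..R} x * ennreal ((cmod (?T x))\<^sup>2) \<partial>lborel)"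
    unfolding nsq_def hh by (intro nn_integral_cong) (auto simp: indicator_def)
  have ih2: "integrable lborel (\<lambda>x. (cmod (h x))\<^sup>2)"
    by (rule Bochner_Integration.integrable_bound[OF iind[of "M\<^sup>2"]])
       (use TM in \<open>auto simp: hh indicator_def intro!: power_mono\<close>)
  have nhf: "nsq h = ennreal (\<integral>x. (cmod (h x))\<^sup>2 \<partial>lborel)"
    unfolding nsq_def by (rule nn_integral_eq_integral[OF ih2]) simp
  \<comment> \<open>Since \<open>0 powr p = 0\<close>, the kernel formula would give the false bound
    0 on the diagonal. The trivial bound is put there instead; a single point does not change the
    integral.\<close>
  define \<kappa> where "\<kappa> u = (if u = 0 then (\<integral>\<xi>. \<mu> \<xi> \<partial>lborel) else indicator {-(2*R)..2*R} u * (4 * C * (\<bar>u\<bar> powr (\<sigma> - 1) + \<bar>u\<bar> powr - \<rho>)))" for u :: real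
  define KR where "KR = (\<integral>\<^sup>+u. ennreal (indicator {-(2*R)..2*R} u * (4 * C * (\<bar>u\<bar> powr (\<sigma> - 1) + \<bar>u\<bar> powr - \<rho>))) \<partial>lborel)"
  have \<mu>I: "(\<integral>\<xi>. \<mu> \<xi> \<partial>lborel) \<ge> 0" by (intro integral_nonneg_AE) (simp add: \<mu>0)
  have \<kappa>m [measurable]: "\<kappa> \<in> borel_measurable borel" unfolding \<kappa>_def by measurable
  have \<kappa>KR: "(\<integral>\<^sup>+u. ennreal (\<kappa> u) \<partial>lborel) = KR"
    unfolding KR_def by (intro nn_integral_cong_AE eventually_mono[OF AE_lborel_neq[of 0]]) (simp add: \<kappa>_def)
  define H where "H \<xi> = (\<integral>x. h x * k x \<xi> \<partial>lborel)" for \<xi>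
  have [measurable]: "H \<in> borel_measurable borel" unfolding H_def by measurable
  have TT: "(\<integral>\<^sup>+\<xi>. ennreal (\<mu> \<xi> * (cmod (H \<xi>))\<^sup>2) \<partial>lborel) \<le> KR * nsq h"
    unfolding H_def \<kappa>KR[symmetric]
  proof (rule TTstar_bound[OF hi km k1 \<mu>i \<mu>0 \<kappa>m])
    show "\<kappa> u \<ge> 0" for u using C \<mu>I by (simp add: \<kappa>_def indicator_def)
    fix x y assume "h x \<noteq> 0" "h y \<noteq> 0"
    then have xy: "x \<in> {-R..R}" "y \<in> {-R..R}" by (auto simp: h_def indicator_def split: if_splits)
    define w where "w = \<tau> x powr \<gamma> + \<tau> y powr \<gamma>"
    define v where "v = \<tau> x - \<tau> y"
    have w: "w > 0" unfolding w_def using \<tau>0[of x] \<tau>0[of y] by (intro add_pos_pos) auto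
    \<comment> \<open>The difference of two positive times is at most the larger one, whose damping
      alone is already part of \<open>w\<close>.\<close>
    have vw: "\<bar>v\<bar> powr \<gamma> \<le> w" "\<bar>- v\<bar> powr \<gamma> \<le> w"
    proof -
      have "\<bar>v\<bar> powr \<gamma> \<le> (max (\<tau> x) (\<tau> y)) powr \<gamma>"
        using \<tau>0[of x] \<tau>0[of y] \<gamma> by (intro powr_mono2) (auto simp: v_def)
      also have "\<dots> \<le> w" by (auto simp: w_def max_def)
      finally show "\<bar>v\<bar> powr \<gamma> \<le> w" "\<bar>- v\<bar> powr \<gamma> \<le> w" by auto
    qed
    have e: "of_real (\<mu> \<xi>) * (k x \<xi> * cnj (k y \<xi>)) = of_real (\<bar>\<xi>\<bar> powr - \<sigma>) * (damped a w v \<xi> * cis ((x - y) * \<xi>))" for \<xi>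
    proof -
      have e1: "exp (- w * \<bar>\<xi>\<bar> powr a) = exp (- (2 * w0) * \<bar>\<xi>\<bar> powr a) * (exp (- (\<tau> x powr \<gamma> - w0) * \<bar>\<xi>\<bar> powr a) * exp (- (\<tau> y powr \<gamma> - w0) * \<bar>\<xi>\<bar> powr a))"
        unfolding exp_add[symmetric] by (simp add: w_def algebra_simps)
      have e2: "cis (v * \<bar>\<xi>\<bar> powr a) * cis ((x - y) * \<xi>) = cis (\<tau> x * \<bar>\<xi>\<bar> powr a) * cis (x * \<xi>) * (cnj (cis (\<tau> y * \<bar>\<xi>\<bar> powr a)) * cnj (cis (y * \<xi>)))"
        by (simp add: cis_cnj cis_mult v_def algebra_simps)
      have "of_real (\<bar>\<xi>\<bar> powr - \<sigma>) * (damped a w v \<xi> * cis ((x - y) * \<xi>))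
        = of_real (\<bar>\<xi>\<bar> powr - \<sigma>) * of_real (exp (- w * \<bar>\<xi>\<bar> powr a)) * (cis (v * \<bar>\<xi>\<bar> powr a) * cis ((x - y) * \<xi>))"
        by (simp add: damped_def mult_ac)
      also have "\<dots> = of_real (\<mu> \<xi>) * (k x \<xi> * cnj (k y \<xi>))"
        unfolding e1 e2 \<mu>_def k_def damped_def by (simp add: mult_ac)
      finally show ?thesis ..
    qed
    show "cmod (\<integral>\<xi>. of_real (\<mu> \<xi>) * (k x \<xi> * cnj (k y \<xi>)) \<partial>lborel) \<le> \<kappa> (x - y)"
    proof (cases "x = y")
      case True
      have "cmod (\<integral>\<xi>. of_real (\<mu> \<xi>) * (k x \<xi> * cnj (k y \<xi>)) \<partial>lborel) \<le> (\<integral>\<xi>. cmod (of_real (\<mu> \<xi>) * (k x \<xi> * cnj (k y \<xi>))) \<partial>lborel)"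
        by (rule integral_norm_bound)
      also have "\<dots> \<le> (\<integral>\<xi>. \<mu> \<xi> \<partial>lborel)"
      proof (rule integral_mono_AE'[OF \<mu>i])
        have "cmod (k x \<xi>) * cmod (k y \<xi>) \<le> 1 * 1" for \<xi> by (intro mult_mono k1) auto
        then show "AE \<xi> in lborel. cmod (of_real (\<mu> \<xi>) * (k x \<xi> * cnj (k y \<xi>))) \<le> \<mu> \<xi>"
          using \<mu>0 by (auto simp: norm_mult intro!: mult_left_le)
      qed (simp add: \<mu>0)
      finally show ?thesis using True by (simp add: \<kappa>_def)
    next
      case False
      then have D: "\<bar>x - y\<bar> > 0" by simp
      have "cmod (\<integral>\<xi>. of_real (\<mu> \<xi>) * (k x \<xi> * cnj (k y \<xi>)) \<partial>lborel) \<le> 4 * C * (\<bar>x - y\<bar> powr (\<sigma> - 1) + \<bar>x - y\<bar> powr - \<rho>)"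
        unfolding e
        using osc_transform_le[OF a \<sigma>(2) w, of v "x - y"] ker[OF D w vw(1), of 0] ker[OF D w vw(2), of 0]
          ker[OF D w vw(1), of "- pi / 2"] ker[OF D w vw(2), of "- pi / 2"] by simp
      then show ?thesis using False xy by (simp add: \<kappa>_def indicator_def)
    qed
  qed
  have dual: "complex_of_real (\<integral>x. (cmod (h x))\<^sup>2 \<partial>lborel) = (\<integral>\<xi>. G \<xi> * H \<xi> \<partial>lborel)"
    and iGH: "integrable lborel (\<lambda>\<xi>. G \<xi> * H \<xi>)"
  proof -
    have [measurable]: "k x \<in> borel_measurable borel" for x using measurable_Pair2[OF km, of x] by simp
    have iGk: "integrable lborel (\<lambda>\<xi>. h x * (G \<xi> * k x \<xi>))" for x
      by (intro integrable_mult_right Bochner_Integration.integrable_bound[OF Gi]) (auto simp: norm_mult k1 mult_left_le)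
    have i: "integrable (lborel \<Otimes>\<^sub>M lborel) (\<lambda>(x, \<xi>). h x * (G \<xi> * k x \<xi>))"
    proof (rule lborel_pair.Fubini_integrable)
      show "integrable lborel (\<lambda>x. \<integral>\<xi>. norm (case (x, \<xi>) of (x, \<xi>) \<Rightarrow> h x * (G \<xi> * k x \<xi>)) \<partial>lborel)"
      proof (rule Bochner_Integration.integrable_bound[OF integrable_mult_left[OF integrable_norm[OF hi], of M]])
        have "(\<integral>\<xi>. cmod (h x * (G \<xi> * k x \<xi>)) \<partial>lborel) \<le> cmod (h x) * M" for x
        proof -
          have "(\<integral>\<xi>. cmod (h x * (G \<xi> * k x \<xi>)) \<partial>lborel) \<le> (\<integral>\<xi>. cmod (h x) * cmod (G \<xi>) \<partial>lborel)"
            by (rule integral_mono[OF integrable_norm[OF iGk] integrable_mult_right[OF integrable_norm[OF Gi]]])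
               (auto simp: norm_mult k1 intro!: mult_left_mono mult_left_le)
          then show ?thesis by (simp add: M_def)
        qed
        then show "AE x in lborel. norm (\<integral>\<xi>. norm (case (x, \<xi>) of (x, \<xi>) \<Rightarrow> h x * (G \<xi> * k x \<xi>)) \<partial>lborel) \<le> norm (cmod (h x) * M)"
          using M0 by (auto simp: abs_mult integral_nonneg_AE)
      qed measurable
    qed (use iGk in auto)
    have "complex_of_real (\<integral>x. (cmod (h x))\<^sup>2 \<partial>lborel) = (\<integral>x. h x * ?T x \<partial>lborel)"
    proof -
      have "complex_of_real ((cmod (h x))\<^sup>2) = h x * ?T x" for x
      proof (cases "x \<in> {-R..R}")
        case True
        then show ?thesis unfolding complex_norm_square by (simp add: h_def mult.commute)
      qed (simp add: h_def)
      then show ?thesis by (simp add: integral_complex_of_real[symmetric])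
    qed
    also have "\<dots> = (\<integral>x. \<integral>\<xi>. h x * (G \<xi> * k x \<xi>) \<partial>lborel \<partial>lborel)"
      unfolding T_eq G_def[symmetric] by simp
    also have "\<dots> = (\<integral>\<xi>. \<integral>x. h x * (G \<xi> * k x \<xi>) \<partial>lborel \<partial>lborel)"
      by (rule lborel_pair.Fubini_integral[OF i, symmetric])
    also have eq: "(\<lambda>\<xi>. \<integral>x. h x * (G \<xi> * k x \<xi>) \<partial>lborel) = (\<lambda>\<xi>. G \<xi> * H \<xi>)"
      by (rule ext) (simp add: H_def mult.left_commute)
    finally show "complex_of_real (\<integral>x. (cmod (h x))\<^sup>2 \<partial>lborel) = (\<integral>\<xi>. G \<xi> * H \<xi> \<partial>lborel)" .
    show "integrable lborel (\<lambda>\<xi>. G \<xi> * H \<xi>)"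
      using lborel_pair.integrable_snd[OF i] unfolding eq .
  qed
  have "nsq h = ennreal (cmod (\<integral>\<xi>. G \<xi> * H \<xi> \<partial>lborel))"
    unfolding nhf dual[symmetric] norm_of_real by (simp add: integral_nonneg_AE)
  also have "\<dots> \<le> (\<integral>\<^sup>+\<xi>. ennreal (cmod (G \<xi> * H \<xi>)) \<partial>lborel)"
    by (rule integral_norm_bound_ennreal[OF iGH])
  also have "\<dots> = (\<integral>\<^sup>+\<xi>. ennreal (\<bar>\<xi>\<bar> powr (\<sigma> / 2) * cmod (g \<xi>)) * ennreal (\<bar>\<xi>\<bar> powr (- \<sigma> / 2) * exp (- w0 * \<bar>\<xi>\<bar> powr a) * cmod (H \<xi>)) \<partial>lborel)"
  proof (rule nn_integral_cong_AE)
    show "AE \<xi> in lborel. ennreal (cmod (G \<xi> * H \<xi>)) = ennreal (\<bar>\<xi>\<bar> powr (\<sigma> / 2) * cmod (g \<xi>)) * ennreal (\<bar>\<xi>\<bar> powr (- \<sigma> / 2) * exp (- w0 * \<bar>\<xi>\<bar> powr a) * cmod (H \<xi>))"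
      using AE_lborel_neq[of 0]
    proof eventually_elim
      case (elim \<xi>)
      have "\<bar>\<xi>\<bar> powr (\<sigma> / 2) * \<bar>\<xi>\<bar> powr (- \<sigma> / 2) = 1" unfolding powr_add[symmetric] using elim by simp
      then have "cmod (G \<xi> * H \<xi>) = (\<bar>\<xi>\<bar> powr (\<sigma> / 2) * \<bar>\<xi>\<bar> powr (- \<sigma> / 2)) * (cmod (g \<xi>) * exp (- w0 * \<bar>\<xi>\<bar> powr a) * cmod (H \<xi>))"
        by (simp only: mult_1_left) (simp add: G_def norm_mult)
      also have "\<dots> = (\<bar>\<xi>\<bar> powr (\<sigma> / 2) * cmod (g \<xi>)) * (\<bar>\<xi>\<bar> powr (- \<sigma> / 2) * exp (- w0 * \<bar>\<xi>\<bar> powr a) * cmod (H \<xi>))"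
        by (simp only: mult_ac)
      finally show ?case by (simp only:) (rule ennreal_mult; simp)
    qed
  qed
  finally have "(nsq h)\<^sup>2 \<le> (\<integral>\<^sup>+\<xi>. ennreal (\<bar>\<xi>\<bar> powr (\<sigma> / 2) * cmod (g \<xi>)) * ennreal (\<bar>\<xi>\<bar> powr (- \<sigma> / 2) * exp (- w0 * \<bar>\<xi>\<bar> powr a) * cmod (H \<xi>)) \<partial>lborel)\<^sup>2"
    by (intro power_mono) auto
  also have "\<dots> \<le> (\<integral>\<^sup>+\<xi>. (ennreal (\<bar>\<xi>\<bar> powr (\<sigma> / 2) * cmod (g \<xi>)))\<^sup>2 \<partial>lborel)
      * (\<integral>\<^sup>+\<xi>. (ennreal (\<bar>\<xi>\<bar> powr (- \<sigma> / 2) * exp (- w0 * \<bar>\<xi>\<bar> powr a) * cmod (H \<xi>)))\<^sup>2 \<partial>lborel)"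
    by (rule Cauchy_Schwarz_nn_integral) measurable
  also have "(\<integral>\<^sup>+\<xi>. (ennreal (\<bar>\<xi>\<bar> powr (\<sigma> / 2) * cmod (g \<xi>)))\<^sup>2 \<partial>lborel) = weighted_nsq \<sigma> g"
    unfolding weighted_nsq_def
    by (intro nn_integral_cong) (simp add: ennreal_power power_mult_distrib power2_eq_square[of "_ powr _"] powr_add[symmetric])
  also have "(\<integral>\<^sup>+\<xi>. (ennreal (\<bar>\<xi>\<bar> powr (- \<sigma> / 2) * exp (- w0 * \<bar>\<xi>\<bar> powr a) * cmod (H \<xi>)))\<^sup>2 \<partial>lborel)
      = (\<integral>\<^sup>+\<xi>. ennreal (\<mu> \<xi> * (cmod (H \<xi>))\<^sup>2) \<partial>lborel)"
  proof (intro nn_integral_cong)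
    fix \<xi>
    have "(\<bar>\<xi>\<bar> powr (- \<sigma> / 2))\<^sup>2 = \<bar>\<xi>\<bar> powr - \<sigma>" unfolding power2_eq_square powr_add[symmetric] by simp
    moreover have "(exp (- w0 * \<bar>\<xi>\<bar> powr a))\<^sup>2 = exp (- (2 * w0) * \<bar>\<xi>\<bar> powr a)"
      unfolding power2_eq_square exp_add[symmetric] by (simp add: algebra_simps)
    ultimately show "(ennreal (\<bar>\<xi>\<bar> powr (- \<sigma> / 2) * exp (- w0 * \<bar>\<xi>\<bar> powr a) * cmod (H \<xi>)))\<^sup>2 = ennreal (\<mu> \<xi> * (cmod (H \<xi>))\<^sup>2)"
      by (subst ennreal_power) (simp_all only: \<mu>_def power_mult_distrib, simp)
  qed
  finally have "(nsq h)\<^sup>2 \<le> weighted_nsq \<sigma> g * (KR * nsq h)"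
    using TT by (meson mult_left_mono order.trans zero_le)
  then have le: "nsq h * nsq h \<le> nsq h * (weighted_nsq \<sigma> g * KR)"
    by (simp add: power2_eq_square mult_ac)
  have "nsq h \<le> weighted_nsq \<sigma> g * KR"
  \<comment> \<open>Cancelling a factor \<open>nsq h\<close> requires it to be nonzero and finite;
    finiteness is \<open>nhf\<close>.\<close>
  proof (cases "nsq h = 0")
    case False
    then show ?thesis using le nhf by (subst (asm) ennreal_mult_le_mult_iff) auto
  qed simp
  then show ?thesis unfolding nh KR_def .
qed

lemma tendsto_cis:
  fixes f :: "'a \<Rightarrow> real"
  assumes "(f \<longlongrightarrow> l) F"
  shows "((\<lambda>x. cis (f x)) \<longlongrightarrow> cis l) F"
proof -
  have "continuous_on UNIV cis" by (intro continuous_intros)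
  then have "isCont cis l" by (simp add: continuous_on_eq_continuous_at)
  then show ?thesis using assms by (rule isCont_tendsto_compose)
qed

text \<open>Continuity at positive times reduces the supremum over all \<open>t > 0\<close> to
  rational times.\<close>

lemma evolution_tendsto:
  fixes S :: "nat \<Rightarrow> real"
  assumes [measurable]: "g \<in> borel_measurable borel" and g: "nsq g < \<infinity>" and a: "a > 1"
    and t: "t > 0" and S: "S \<longlonglongrightarrow> t"
  shows "(\<lambda>n. evolution a \<gamma> g (S n) x) \<longlonglongrightarrow> evolution a \<gamma> g t x"
proof -
  \<comment> \<open>The smallest damping on \<open>{t / 2..2 * t}\<close>; it occurs at the left or
    at the right end according to the sign of \<open>\<gamma>\<close>.\<close>
  define w0 where "w0 = min ((t / 2) powr \<gamma>) ((2 * t) powr \<gamma>)"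
  have w0: "w0 > 0" using t by (simp add: w0_def)
  have low: "w0 \<le> s powr \<gamma>" if "t / 2 \<le> s" "s \<le> 2 * t" for s
  proof (cases "\<gamma> \<ge> 0")
    case True
    then have "(t / 2) powr \<gamma> \<le> s powr \<gamma>" using that t by (intro powr_mono2) auto
    then show ?thesis by (simp add: w0_def)
  next
    case False
    then have "(2 * t) powr \<gamma> \<le> s powr \<gamma>" using that t by (intro powr_mono2') auto
    then show ?thesis by (simp add: w0_def)
  qed
  have ev: "\<forall>\<^sub>F n in sequentially. t / 2 < S n \<and> S n < 2 * t"
    using order_tendstoD(1)[OF S, of "t / 2"] order_tendstoD(2)[OF S, of "2 * t"] t
    by (auto elim: eventually_elim2)
  then obtain N where N: "\<And>n. n \<ge> N \<Longrightarrow> t / 2 < S n \<and> S n < 2 * t" by (auto simp: eventually_sequentially)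
  have "(\<lambda>n. evolution a \<gamma> g (S (n + N)) x) \<longlonglongrightarrow> evolution a \<gamma> g t x"
    unfolding evolution_def
  proof (rule integral_dominated_convergence)
    show "integrable lborel (\<lambda>\<xi>. cmod (g \<xi> * (damped a w0 0 \<xi> * cis (x * \<xi>))))"
      by (intro integrable_norm integrable_evolution g a w0) measurable
    show "AE \<xi> in lborel. (\<lambda>n. g \<xi> * (damped a (S (n + N) powr \<gamma>) (S (n + N)) \<xi> * cis (x * \<xi>))) \<longlonglongrightarrow> g \<xi> * (damped a (t powr \<gamma>) t \<xi> * cis (x * \<xi>))"
    proof (rule AE_I2)
      fix \<xi>
      have S': "(\<lambda>n. S (n + N)) \<longlonglongrightarrow> t" using S by (rule LIMSEQ_ignore_initial_segment)
      have c: "(\<lambda>n. cis (S (n + N) * \<bar>\<xi>\<bar> powr a)) \<longlonglongrightarrow> cis (t * \<bar>\<xi>\<bar> powr a)"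
        by (intro tendsto_cis tendsto_intros S')
      show "(\<lambda>n. g \<xi> * (damped a (S (n + N) powr \<gamma>) (S (n + N)) \<xi> * cis (x * \<xi>))) \<longlonglongrightarrow> g \<xi> * (damped a (t powr \<gamma>) t \<xi> * cis (x * \<xi>))"
        unfolding damped_def by (intro tendsto_intros c S') (use t in auto)
    qed
    show "AE \<xi> in lborel. cmod (g \<xi> * (damped a (S (n + N) powr \<gamma>) (S (n + N)) \<xi> * cis (x * \<xi>))) \<le> cmod (g \<xi> * (damped a w0 0 \<xi> * cis (x * \<xi>)))" for n
    proof (rule AE_I2)
      fix \<xi>
      have "w0 * \<bar>\<xi>\<bar> powr a \<le> S (n + N) powr \<gamma> * \<bar>\<xi>\<bar> powr a"
        using low[of "S (n + N)"] N[of "n + N"] by (intro mult_right_mono) auto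
      then show "cmod (g \<xi> * (damped a (S (n + N) powr \<gamma>) (S (n + N)) \<xi> * cis (x * \<xi>))) \<le> cmod (g \<xi> * (damped a w0 0 \<xi> * cis (x * \<xi>)))"
        by (simp add: norm_mult cmod_damped mult_left_mono)
    qed
  qed measurable
  then show ?thesis by (rule LIMSEQ_offset)
qed

text \<open>The linearised bound is applied to times chosen among finitely many rationals. Such a
  choice has a positive lower bound, on which the estimate does not depend, and monotone convergence
  leads to the supremum over all positive rationals. The constant \<open>K\<close> is fixed before
  \<open>g\<close>.\<close>

lemma maximal_bound:
  fixes a \<gamma> \<sigma> R :: real
  assumes a: "a > 1" and \<gamma>: "\<gamma> > 0" and \<sigma>: "0 < \<sigma>" "\<sigma> \<le> 1/2"
    and crit: "\<sigma> = 1/2 \<or> (\<gamma> * (a - 1) < a \<and> a * (\<gamma> - 1) < 2 * \<gamma> * \<sigma>)"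
  shows "\<exists>K<\<infinity>. \<forall>g \<in> borel_measurable borel. nsq g < \<infinity> \<longrightarrow> (\<exists>S \<in> borel_measurable borel.
    (\<forall>t>0. \<forall>x. ennreal ((cmod (evolution a \<gamma> g t x))\<^sup>2) \<le> S x) \<and>
    (\<integral>\<^sup>+x. indicator {-R..R} x * S x \<partial>lborel) \<le> weighted_nsq \<sigma> g * K)"
proof -
  obtain C \<rho> where C: "C \<ge> 0" "\<rho> < 1" and ker: "\<And>u v w \<theta>. u > 0 \<Longrightarrow> w > 0 \<Longrightarrow> \<bar>v\<bar> powr \<gamma> \<le> w \<Longrightarrow>
    \<bar>osc_kernel a \<sigma> u v w \<theta>\<bar> \<le> C * (u powr (\<sigma> - 1) + u powr - \<rho>)"
    using osc_kernel_integrable_bound[OF a \<gamma> \<sigma> crit] by blast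
  define K where "K = (\<integral>\<^sup>+u. ennreal (indicator {-(2*R)..2*R} u * (4 * C * (\<bar>u\<bar> powr (\<sigma> - 1) + \<bar>u\<bar> powr - \<rho>))) \<partial>lborel)"
  have K: "K < \<infinity>" unfolding K_def by (rule local_kernel_finite) (use \<sigma> C in auto)
  have "\<exists>S \<in> borel_measurable borel. (\<forall>t>0. \<forall>x. ennreal ((cmod (evolution a \<gamma> g t x))\<^sup>2) \<le> S x) \<and>
    (\<integral>\<^sup>+x. indicator {-R..R} x * S x \<partial>lborel) \<le> weighted_nsq \<sigma> g * K"
    if g [measurable]: "g \<in> borel_measurable borel" and gf: "nsq g < \<infinity>" for g
  proof -
    define QQ where "QQ = {r \<in> \<rat>. r > (0::real)}"
    have QQ: "countable QQ" "QQ \<noteq> {}"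
      unfolding QQ_def using countable_rat by (auto intro: countable_subset[of _ "\<rat>"] exI[of _ 1])
    define q where "q = from_nat_into QQ"
    have q: "range q = QQ" unfolding q_def using QQ by (simp add: range_from_nat_into)
    have qpos: "q n > 0" for n using q by (auto simp: QQ_def)
    define T where "T t x = cmod (evolution a \<gamma> g t x)" for t x
    \<comment> \<open>The running maximiser: \<open>\<tau> n x\<close> is a time at which the
      evolution at \<open>x\<close> is largest among the first \<open>n + 1\<close> rationals.
      Changing it only on a strict improvement keeps it measurable in \<open>x\<close>.\<close>
    define \<tau> where "\<tau> = rec_nat (\<lambda>x. q 0) (\<lambda>n \<tau>n x. if T (\<tau>n x) x < T (q (Suc n)) x then q (Suc n) else \<tau>n x)"
    have \<tau>0: "\<tau> 0 = (\<lambda>x. q 0)" and \<tau>S: "\<tau> (Suc n) = (\<lambda>x. if T (\<tau> n x) x < T (q (Suc n)) x then q (Suc n) else \<tau> n x)" for n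
      unfolding \<tau>_def by simp_all
    have Tm: "(\<lambda>x. T (\<tau>' x) x) \<in> borel_measurable borel" if [measurable]: "\<tau>' \<in> borel_measurable borel" for \<tau>'
      unfolding T_def by measurable
    have \<tau>m [measurable]: "\<tau> n \<in> borel_measurable borel" for n
    proof (induction n)
      case (Suc n)
      note [measurable] = Suc Tm[OF Suc] Tm[of "\<lambda>_. q (Suc n)"]
      show ?case unfolding \<tau>S by measurable
    qed (simp add: \<tau>0)
    have \<tau>low: "\<exists>t0>0. \<forall>x. t0 \<le> \<tau> n x" for n
    proof (induction n)
      case 0
      then show ?case using qpos[of 0] by (auto simp: \<tau>0)
    next
      case (Suc n)
      then obtain t0 where "t0 > 0" "\<And>x. t0 \<le> \<tau> n x" by blast
      then show ?case using qpos[of "Suc n"]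
        by (intro exI[of _ "min t0 (q (Suc n))"]) (auto simp: \<tau>S min_le_iff_disj)
    qed
    define A where "A n x = ennreal ((T (\<tau> n x) x)\<^sup>2)" for n x
    have Am [measurable]: "A n \<in> borel_measurable borel" for n
      unfolding A_def using Tm[OF \<tau>m, of n] by measurable
    have Tinc: "T (\<tau> n x) x \<le> T (\<tau> (Suc n) x) x" for n x by (simp add: \<tau>S)
    have T0: "T t x \<ge> 0" for t x by (simp add: T_def)
    have Ainc: "incseq A"
      by (intro incseq_SucI le_funI) (auto simp: A_def intro!: ennreal_leI power_mono Tinc T0)
    have Aq: "ennreal ((T (q n) x)\<^sup>2) \<le> A n x" for n x
    proof (cases n)
      case 0
      then show ?thesis by (simp add: A_def \<tau>0)
    next
      case (Suc m)
      have "T (q (Suc m)) x \<le> T (\<tau> (Suc m) x) x" by (simp add: \<tau>S)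
      then show ?thesis using Suc by (auto simp: A_def intro!: ennreal_leI power_mono T0)
    qed
    define S where "S x = (SUP n. A n x)" for x
    have [measurable]: "S \<in> borel_measurable borel" unfolding S_def by measurable
    have Sq: "ennreal ((T r x)\<^sup>2) \<le> S x" if "r \<in> QQ" for r x
    proof -
      from \<open>r \<in> QQ\<close> obtain n where "r = q n" using q by blast
      then show ?thesis unfolding S_def using Aq[of n x] by (intro SUP_upper2[of n]) auto
    qed
    have St: "ennreal ((T t x)\<^sup>2) \<le> S x" if t: "t > 0" for t x
    proof -
      have "\<exists>r. \<forall>n. r n \<in> QQ \<and> \<bar>r n - t\<bar> < 1 / (real n + 1)"
      proof (rule choice, rule allI)
        fix n :: nat
        obtain r where "r \<in> \<rat>" "t < r" "r < t + 1 / (real n + 1)"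
          using Rats_dense_in_real[of t "t + 1 / (real n + 1)"] by auto
        then show "\<exists>r. r \<in> QQ \<and> \<bar>r - t\<bar> < 1 / (real n + 1)"
          using t by (intro exI[of _ r]) (auto simp: QQ_def)
      qed
      then obtain r where r: "\<And>n. r n \<in> QQ" "\<And>n. \<bar>r n - t\<bar> < 1 / (real n + 1)" by blast
      have "(\<lambda>n. 1 / (real n + 1)) \<longlonglongrightarrow> 0" by real_asymp
      then have "(\<lambda>n. r n - t) \<longlonglongrightarrow> 0"
        by (rule Lim_null_comparison[rotated]) (use r(2) in \<open>auto simp: less_imp_le\<close>)
      then have "r \<longlonglongrightarrow> t" by (simp add: LIM_zero_iff)
      then have "(\<lambda>n. evolution a \<gamma> g (r n) x) \<longlonglongrightarrow> evolution a \<gamma> g t x"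
        by (intro evolution_tendsto g gf a t)
      then have "(\<lambda>n. ennreal ((T (r n) x)\<^sup>2)) \<longlonglongrightarrow> ennreal ((T t x)\<^sup>2)"
        unfolding T_def by (intro tendsto_ennrealI tendsto_intros)
      then show ?thesis by (rule LIMSEQ_le_const2) (use Sq[OF r(1)] in blast)
    qed
    have "(\<integral>\<^sup>+x. indicator {-R..R} x * S x \<partial>lborel) = (\<integral>\<^sup>+x. (SUP n. indicator {-R..R} x * A n x) \<partial>lborel)"
      unfolding S_def by (simp add: SUP_mult_left_ennreal)
    also have "\<dots> = (SUP n. \<integral>\<^sup>+x. indicator {-R..R} x * A n x \<partial>lborel)"
      using Ainc by (intro nn_integral_monotone_convergence_SUP) (auto simp: incseq_def le_fun_def intro!: mult_left_mono)
    also have "\<dots> \<le> weighted_nsq \<sigma> g * K"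
    proof (rule SUP_least)
      fix n
      obtain t0 where t0: "t0 > 0" "\<And>x. t0 \<le> \<tau> n x" using \<tau>low by blast
      show "(\<integral>\<^sup>+x. indicator {-R..R} x * A n x \<partial>lborel) \<le> weighted_nsq \<sigma> g * K"
        unfolding A_def T_def K_def
        by (rule linearised_maximal_bound[OF a \<gamma> \<sigma>(1) _ C(1) ker g gf \<tau>m t0]) (use \<sigma> in auto)
    qed
    finally show ?thesis using St unfolding T_def by (intro bexI[of _ S]) auto
  qed
  then show ?thesis using K by (intro exI[of _ K]) auto
qed

text \<open>Dominated convergence gives the limit at every point; below, \<open>g\<close> is a
  truncated transform.\<close>

lemma evolution_tendsto_integral:
  assumes [measurable]: "g \<in> borel_measurable borel" and g: "integrable lborel g" and \<gamma>: "\<gamma> > 0"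
  shows "((\<lambda>t. evolution a \<gamma> g t x) \<longlongrightarrow> FI g (- x)) (at_right 0)"
proof (rule tendsto_at_right_sequentially[of 0 1])
  fix S :: "nat \<Rightarrow> real"
  assume S: "\<And>n. 0 < S n" "S \<longlonglongrightarrow> 0"
  show "(\<lambda>n. evolution a \<gamma> g (S n) x) \<longlonglongrightarrow> FI g (- x)"
    unfolding evolution_def FI_reflect
  proof (rule integral_dominated_convergence)
    show "integrable lborel (\<lambda>\<xi>. cmod (g \<xi>))" by (rule integrable_norm[OF g])
    show "AE \<xi> in lborel. (\<lambda>n. g \<xi> * (damped a (S n powr \<gamma>) (S n) \<xi> * cis (x * \<xi>))) \<longlonglongrightarrow> g \<xi> * cis (x * \<xi>)"
    proof (rule AE_I2)
      fix \<xi>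
      have c: "(\<lambda>n. cis (S n * \<bar>\<xi>\<bar> powr a)) \<longlonglongrightarrow> cis (0 * \<bar>\<xi>\<bar> powr a)"
        by (intro tendsto_cis tendsto_intros S)
      have p: "(\<lambda>n. S n powr \<gamma>) \<longlonglongrightarrow> 0"
        using S \<gamma> by (intro tendsto_zero_powrI[where b = \<gamma>]) (auto simp: less_imp_le)
      have "(\<lambda>n. g \<xi> * (damped a (S n powr \<gamma>) (S n) \<xi> * cis (x * \<xi>))) \<longlonglongrightarrow> g \<xi> * (of_real (exp (- 0 * \<bar>\<xi>\<bar> powr a)) * cis (0 * \<bar>\<xi>\<bar> powr a) * cis (x * \<xi>))"
        unfolding damped_def by (intro tendsto_intros c p)
      then show "(\<lambda>n. g \<xi> * (damped a (S n powr \<gamma>) (S n) \<xi> * cis (x * \<xi>))) \<longlonglongrightarrow> g \<xi> * cis (x * \<xi>)" by simp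
    qed
    show "AE \<xi> in lborel. cmod (g \<xi> * (damped a (S n powr \<gamma>) (S n) \<xi> * cis (x * \<xi>))) \<le> cmod (g \<xi>)" for n
      by (auto simp: norm_mult damped_le_1 intro!: mult_left_le)
  qed measurable
qed simp

text \<open>The transform is split into a truncation and a rest \<open>G n\<close>. The maximal
  function of the rest and the inversion error of the truncation both tend to 0 in square mean, the
  former locally. Their squares are bounded by the two summands of \<open>u n\<close>, so one almost
  everywhere statement controls both.\<close>

lemma large_smoothness_convergence:
  fixes f :: "real \<Rightarrow> complex" and a \<gamma> \<sigma> :: real
  assumes a: "a > 1" and \<gamma>: "\<gamma> > 0" and \<sigma>: "0 < \<sigma>" "\<sigma> \<le> 1/2"
    and crit: "\<sigma> = 1/2 \<or> (\<gamma> * (a - 1) < a \<and> a * (\<gamma> - 1) < 2 * \<gamma> * \<sigma>)"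
    and fm [measurable]: "f \<in> borel_measurable borel" and f: "nsq f < \<infinity>" and g: "FT f g" and gw: "weighted_nsq \<sigma> g < \<infinity>"
  shows "AE x in lborel. ((\<lambda>t. evolution a \<gamma> g t x) \<longlongrightarrow> 2 * pi * f x) (at_right 0)"
proof -
  have gm [measurable]: "g \<in> borel_measurable borel" using g by (simp add: FT_def)
  have gf: "nsq g < \<infinity>" by (rule FT_nsq_finite[OF fm f g])
  define G where "G n \<xi> = g \<xi> - trunc n g \<xi>" for n \<xi>
  have Gm [measurable]: "G n \<in> borel_measurable borel" for n unfolding G_def by measurable
  have Gle: "cmod (G n \<xi>) \<le> cmod (g \<xi>)" for n \<xi> by (auto simp: G_def trunc_def indicator_def)
  have Gf: "nsq (G n) < \<infinity>" for n using nsq_mono[OF Gle] gf by (rule le_less_trans)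
  have Gn: "(\<lambda>n. nsq (G n)) \<longlonglongrightarrow> 0"
    unfolding G_def by (rule nsq_trunc_diff_tendsto[OF gm gf])
  have Gw: "(\<lambda>n. weighted_nsq \<sigma> (G n)) \<longlonglongrightarrow> 0"
  proof -
    have "(\<lambda>n. \<integral>\<^sup>+\<xi>. ennreal (\<bar>\<xi>\<bar> powr \<sigma> * (cmod (G n \<xi>))\<^sup>2) \<partial>lborel) \<longlonglongrightarrow> (\<integral>\<^sup>+\<xi>. 0 \<partial>(lborel :: real measure))"
    proof (rule nn_integral_dominated_convergence[where w = "\<lambda>\<xi>. ennreal (\<bar>\<xi>\<bar> powr \<sigma> * (cmod (g \<xi>))\<^sup>2)"])
      show "AE x in lborel. (\<lambda>n. ennreal (\<bar>x\<bar> powr \<sigma> * (cmod (G n x))\<^sup>2)) \<longlonglongrightarrow> 0"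
      proof (intro AE_I2 tendsto_eventually)
        fix x :: real
        obtain N :: nat where "\<bar>x\<bar> \<le> real N" using real_arch_simple by blast
        then show "\<forall>\<^sub>F n in sequentially. ennreal (\<bar>x\<bar> powr \<sigma> * (cmod (G n x))\<^sup>2) = 0"
          by (intro eventually_sequentiallyI[of N]) (auto simp: G_def trunc_def indicator_def)
      qed
      show "AE x in lborel. ennreal (\<bar>x\<bar> powr \<sigma> * (cmod (G n x))\<^sup>2) \<le> ennreal (\<bar>x\<bar> powr \<sigma> * (cmod (g x))\<^sup>2)" for n
        by (auto intro!: ennreal_leI mult_left_mono power_mono Gle)
    qed (use gw in \<open>auto simp: weighted_nsq_def\<close>)
    then show ?thesis by (simp add: weighted_nsq_def)
  qed
  have "AE x in lborel. x \<in> {- real m..real m} \<longrightarrow> ((\<lambda>t. evolution a \<gamma> g t x) \<longlongrightarrow> 2 * pi * f x) (at_right 0)" for m :: nat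
  proof -
    obtain K where K: "K < \<infinity>" and Kb: "\<And>g. g \<in> borel_measurable borel \<Longrightarrow> nsq g < \<infinity> \<Longrightarrow> (\<exists>S \<in> borel_measurable borel.
      (\<forall>t>0. \<forall>x. ennreal ((cmod (evolution a \<gamma> g t x))\<^sup>2) \<le> S x) \<and>
      (\<integral>\<^sup>+x. indicator {- real m..real m} x * S x \<partial>lborel) \<le> weighted_nsq \<sigma> g * K)"
      using maximal_bound[OF a \<gamma> \<sigma> crit, of "real m"] by blast
    have "\<exists>S. \<forall>n. S n \<in> borel_measurable borel \<and> (\<forall>t>0. \<forall>x. ennreal ((cmod (evolution a \<gamma> (G n) t x))\<^sup>2) \<le> S n x) \<and>
      (\<integral>\<^sup>+x. indicator {- real m..real m} x * S n x \<partial>lborel) \<le> weighted_nsq \<sigma> (G n) * K"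
      by (rule choice, rule allI) (use Kb[OF Gm Gf] in blast)
    then obtain S where Sm [measurable]: "\<And>n. S n \<in> borel_measurable borel"
      and S1: "\<And>n t x. t > 0 \<Longrightarrow> ennreal ((cmod (evolution a \<gamma> (G n) t x))\<^sup>2) \<le> S n x"
      and S2: "\<And>n. (\<integral>\<^sup>+x. indicator {- real m..real m} x * S n x \<partial>lborel) \<le> weighted_nsq \<sigma> (G n) * K"
      by blast
    define e where "e n x = 2 * pi * f x - FI (trunc n g) (- x)" for n x
    have em [measurable]: "e n \<in> borel_measurable borel" for n unfolding e_def by measurable
    have e_le: "nsq (e n) \<le> ennreal (2 * pi) * nsq (G n)" for n
      unfolding e_def G_def by (rule FT_inversion[OF fm f g])
    define u where "u n x = indicator {- real m..real m} x * S n x + ennreal ((cmod (e n x))\<^sup>2)" for n x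
    have um [measurable]: "u n \<in> borel_measurable borel" for n unfolding u_def by measurable
    have u_le: "(\<integral>\<^sup>+x. u n x \<partial>lborel) \<le> weighted_nsq \<sigma> (G n) * K + ennreal (2 * pi) * nsq (G n)" for n
    proof -
      have "(\<integral>\<^sup>+x. u n x \<partial>lborel) = (\<integral>\<^sup>+x. indicator {- real m..real m} x * S n x \<partial>lborel) + nsq (e n)"
        unfolding u_def nsq_def by (rule nn_integral_add) measurable
      also have "\<dots> \<le> weighted_nsq \<sigma> (G n) * K + ennreal (2 * pi) * nsq (G n)"
        by (intro add_mono S2 e_le)
      finally show ?thesis .
    qed
    have "(\<lambda>n. weighted_nsq \<sigma> (G n) * K + ennreal (2 * pi) * nsq (G n)) \<longlonglongrightarrow> 0 * K + ennreal (2 * pi) * 0"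
      using K by (intro tendsto_add tendsto_mult_ennreal Gw Gn tendsto_const) auto
    then have lim0: "(\<lambda>n. weighted_nsq \<sigma> (G n) * K + ennreal (2 * pi) * nsq (G n)) \<longlonglongrightarrow> 0" by simp
    \<comment> \<open>Fatou's lemma makes the lower limit of \<open>u n\<close> vanish almost
      everywhere. At each such point some \<open>n\<close>, depending on the point and the
      tolerance, has both errors small; this replaces the choice of a subsequence.\<close>
    have "(\<integral>\<^sup>+x. liminf (\<lambda>n. u n x) \<partial>lborel) \<le> liminf (\<lambda>n. \<integral>\<^sup>+x. u n x \<partial>lborel)"
      by (rule nn_integral_liminf) measurable
    also have "\<dots> \<le> liminf (\<lambda>n. weighted_nsq \<sigma> (G n) * K + ennreal (2 * pi) * nsq (G n))"
      by (intro Liminf_mono always_eventually allI u_le)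
    also have "\<dots> = 0" using lim0 by (intro lim_imp_Liminf) auto
    finally have "(\<integral>\<^sup>+x. liminf (\<lambda>n. u n x) \<partial>lborel) = 0" by simp
    then have "AE x in lborel. liminf (\<lambda>n. u n x) = 0"
      by (subst (asm) nn_integral_0_iff_AE) auto
    then show ?thesis
    proof eventually_elim
      case (elim x)
      show ?case
      proof (intro impI tendstoI)
        fix \<epsilon> :: real
        assume xm: "x \<in> {- real m..real m}" and \<epsilon>: "\<epsilon> > 0"
        \<comment> \<open>Three errors below \<open>\<eta>\<close> each: the maximal function, the
          evolution of the truncation and the inversion error.\<close>
        define \<eta> where "\<eta> = \<epsilon> / 4"
        have \<eta>: "\<eta> > 0" using \<epsilon> by (simp add: \<eta>_def)
        have "\<exists>n. u n x < ennreal (\<eta>\<^sup>2)"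
        proof (rule ccontr)
          assume "\<nexists>n. u n x < ennreal (\<eta>\<^sup>2)"
          then have "ennreal (\<eta>\<^sup>2) \<le> liminf (\<lambda>n. u n x)"
            by (intro Liminf_bounded always_eventually allI) (auto simp: not_less)
          then show False using elim \<eta> by (auto simp: ennreal_eq_0_iff)
        qed
        then obtain n where n: "u n x < ennreal (\<eta>\<^sup>2)" by blast
        have "S n x \<le> u n x" "ennreal ((cmod (e n x))\<^sup>2) \<le> u n x"
          using xm by (auto simp: u_def)
        then have Sx: "S n x < ennreal (\<eta>\<^sup>2)" and ex: "ennreal ((cmod (e n x))\<^sup>2) < ennreal (\<eta>\<^sup>2)"
          using n by (auto intro: le_less_trans)
        have e\<eta>: "cmod (e n x) < \<eta>"
          using ex \<eta> by (subst (asm) ennreal_less_iff) (auto intro: power_less_imp_less_base)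
        have it: "integrable lborel (trunc n g)" by (rule integrable_trunc[OF gm gf])
        have "\<forall>\<^sub>F t in at_right 0. dist (evolution a \<gamma> (trunc n g) t x) (FI (trunc n g) (- x)) < \<eta>"
          by (rule tendstoD[OF evolution_tendsto_integral[OF _ it \<gamma>] \<eta>]) measurable
        moreover have "\<forall>\<^sub>F t in at_right 0. (t::real) > 0" by (rule eventually_at_right_less)
        ultimately show "\<forall>\<^sub>F t in at_right 0. dist (evolution a \<gamma> g t x) (2 * pi * f x) < \<epsilon>"
        proof eventually_elim
          case (elim t)
          have tw: "t powr \<gamma> > 0" using elim by simp
          have tf: "nsq (trunc n g) < \<infinity>" using nsq_trunc_le gf by (rule le_less_trans)
          have "evolution a \<gamma> g t x = (\<integral>\<xi>. G n \<xi> * (damped a (t powr \<gamma>) t \<xi> * cis (x * \<xi>)) + trunc n g \<xi> * (damped a (t powr \<gamma>) t \<xi> * cis (x * \<xi>)) \<partial>lborel)"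
            unfolding evolution_def by (simp add: G_def distrib_right[symmetric])
          also have "\<dots> = evolution a \<gamma> (G n) t x + evolution a \<gamma> (trunc n g) t x"
            unfolding evolution_def
            by (intro Bochner_Integration.integral_add integrable_evolution Gf tf a tw) measurable
          finally have eq: "evolution a \<gamma> g t x - 2 * pi * f x
            = evolution a \<gamma> (G n) t x + (evolution a \<gamma> (trunc n g) t x - FI (trunc n g) (- x)) - e n x"
            by (simp add: e_def)
          have "ennreal ((cmod (evolution a \<gamma> (G n) t x))\<^sup>2) < ennreal (\<eta>\<^sup>2)"
            using S1[OF elim(2), of n x] Sx by (rule le_less_trans)
          then have "cmod (evolution a \<gamma> (G n) t x) < \<eta>"
            using \<eta> by (subst (asm) ennreal_less_iff) (auto intro: power_less_imp_less_base)
          moreover have "cmod (evolution a \<gamma> (trunc n g) t x - FI (trunc n g) (- x)) < \<eta>"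
            using elim(1) by (simp add: dist_norm)
          moreover have "cmod (evolution a \<gamma> g t x - 2 * pi * f x)
            \<le> cmod (evolution a \<gamma> (G n) t x) + cmod (evolution a \<gamma> (trunc n g) t x - FI (trunc n g) (- x)) + cmod (e n x)"
            unfolding eq by (intro order.trans[OF norm_triangle_ineq4] add_right_mono norm_triangle_ineq)
          ultimately show ?case using e\<eta> \<eta> by (simp add: dist_norm \<eta>_def)
        qed
      qed
    qed
  qed
  then have "AE x in lborel. \<forall>m::nat. x \<in> {- real m..real m} \<longrightarrow> ((\<lambda>t. evolution a \<gamma> g t x) \<longlongrightarrow> 2 * pi * f x) (at_right 0)"
    unfolding AE_all_countable by blast
  then show ?thesis
  proof eventually_elim
    case (elim x)
    obtain m :: nat where "\<bar>x\<bar> \<le> real m" using real_arch_simple by blast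
    then show ?case using elim by (auto simp: abs_le_iff)
  qed
qed

section \<open>A function with divergent evolution\<close>

lemma has_vector_derivative_polar:
  fixes e \<theta> :: "real \<Rightarrow> real"
  assumes "(e has_real_derivative e') (at x within S)" "(\<theta> has_real_derivative \<theta>') (at x within S)"
  shows "((\<lambda>x. of_real (e x) * cis (\<theta> x)) has_vector_derivative
    (of_real e' * cis (\<theta> x) + of_real (e x * \<theta>') * (\<i> * cis (\<theta> x)))) (at x within S)"
  unfolding has_vector_derivative_complex_iff
  by (auto intro!: derivative_eq_intros assms simp: algebra_simps)

text \<open>The function \<open>e * cis \<theta>\<close> varies by at most
  \<open>B * (q - p)\<close>. If that is small, nothing cancels and the integral is nearly
  \<open>q - p\<close> times the initial value; against a further oscillation
  \<open>cis (L * x)\<close> one integration by parts gains \<open>1 / \<bar>L\<bar>\<close>. The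
  lower bound will be used for the packet passing through a point, the upper bound for all other
  translates.\<close>

lemma
  fixes e e' \<theta> \<theta>' :: "real \<Rightarrow> real"
  assumes pq: "p \<le> q"
    and de: "\<And>x. x \<in> {p..q} \<Longrightarrow> (e has_real_derivative e' x) (at x within {p..q})"
    and d\<theta>: "\<And>x. x \<in> {p..q} \<Longrightarrow> (\<theta> has_real_derivative \<theta>' x) (at x within {p..q})"
    and c: "continuous_on {p..q} e'" "continuous_on {p..q} \<theta>'"
    and e01: "\<And>x. x \<in> {p..q} \<Longrightarrow> 0 \<le> e x \<and> e x \<le> 1"
    and B: "\<And>x. x \<in> {p..q} \<Longrightarrow> \<bar>e' x\<bar> + \<bar>\<theta>' x\<bar> \<le> B"
  shows polar_integral_lower: "(q - p) * (e p - B * (q - p)) \<le> cmod (integral {p..q} (\<lambda>x. of_real (e x) * cis (\<theta> x)))"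
    and polar_integral_upper: "L \<noteq> 0 \<Longrightarrow> cmod (integral {p..q} (\<lambda>x. cis (L * x) * (of_real (e x) * cis (\<theta> x)))) \<le> (2 + B * (q - p)) / \<bar>L\<bar>"
proof -
  have ce: "continuous_on {p..q} e" "continuous_on {p..q} \<theta>"
    using DERIV_continuous_on[OF de] DERIV_continuous_on[OF d\<theta>] by auto
  define G where "G x = of_real (e x) * cis (\<theta> x)" for x
  define G' where "G' x = of_real (e' x) * cis (\<theta> x) + of_real (e x * \<theta>' x) * (\<i> * cis (\<theta> x))" for x
  have dG: "(G has_vector_derivative G' x) (at x within {p..q})" if "x \<in> {p..q}" for x
    unfolding G_def[abs_def] G'_def by (rule has_vector_derivative_polar[OF de[OF that] d\<theta>[OF that]])
  have cG: "continuous_on {p..q} G" unfolding G_def by (intro continuous_intros ce)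
  have cG': "continuous_on {p..q} G'" unfolding G'_def by (intro continuous_intros ce c)
  have G'B: "cmod (G' x) \<le> B" if x: "x \<in> {p..q}" for x
  proof -
    have "cmod (G' x) \<le> cmod (of_real (e' x) * cis (\<theta> x)) + cmod (of_real (e x * \<theta>' x) * (\<i> * cis (\<theta> x)))"
      unfolding G'_def by (rule norm_triangle_ineq)
    also have "\<dots> = \<bar>e' x\<bar> + \<bar>e x\<bar> * \<bar>\<theta>' x\<bar>" by (simp add: norm_mult)
    also have "\<dots> \<le> \<bar>e' x\<bar> + 1 * \<bar>\<theta>' x\<bar>" using e01[OF x] by (intro add_left_mono mult_right_mono) auto
    finally show ?thesis using B[OF x] by simp
  qed
  have B0: "B \<ge> 0" using B[of p] pq by force
  have dist: "cmod (G x - G p) \<le> B * (q - p)" if x: "x \<in> {p..q}" for x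
  proof -
    have "(G' has_integral (G x - G p)) {p..x}"
    proof (rule fundamental_theorem_of_calculus)
      show "p \<le> x" using x by simp
      show "(G has_vector_derivative G' y) (at y within {p..x})" if "y \<in> {p..x}" for y
        using dG[of y] that x by (auto intro: has_vector_derivative_within_subset)
    qed
    then have "cmod (G x - G p) = cmod (integral {p..x} G')" by (simp add: integral_unique)
    also have "\<dots> \<le> B * (x - p)"
      using x by (intro integral_bound continuous_on_subset[OF cG'] G'B) auto
    also have "\<dots> \<le> B * (q - p)" using x B0 by (intro mult_left_mono) auto
    finally show ?thesis .
  qed
  have Gi: "G integrable_on {p..q}" by (rule integrable_continuous_real[OF cG])
  have "cmod (integral {p..q} (\<lambda>x. G x - G p)) \<le> B * (q - p) * (q - p)"
    using pq by (intro integral_bound dist continuous_intros cG)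
  moreover have "integral {p..q} (\<lambda>x. G x - G p) = integral {p..q} G - (q - p) *\<^sub>R G p"
    using Gi pq by (subst Henstock_Kurzweil_Integration.integral_diff) auto
  moreover have "cmod ((q - p) *\<^sub>R G p) = (q - p) * e p" using pq e01[of p] by (simp add: G_def norm_mult)
  moreover have "cmod ((q - p) *\<^sub>R G p) \<le> cmod (integral {p..q} G) + cmod (integral {p..q} G - (q - p) *\<^sub>R G p)"
    using norm_triangle_sub[of "(q - p) *\<^sub>R G p" "integral {p..q} G"] by (simp add: norm_minus_commute)
  ultimately show "(q - p) * (e p - B * (q - p)) \<le> cmod (integral {p..q} (\<lambda>x. of_real (e x) * cis (\<theta> x)))"
    unfolding G_def[symmetric] by (simp add: algebra_simps)
  assume L: "L \<noteq> 0"
  define \<theta>L where "\<theta>L x = \<theta> x + L * x" for x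
  define H where "H x = of_real (e x) * cis (\<theta>L x)" for x
  define H' where "H' x = of_real (e' x) * cis (\<theta>L x) + of_real (e x * (\<theta>' x + L)) * (\<i> * cis (\<theta>L x))" for x
  define D where "D x = of_real (e' x) * cis (\<theta>L x) + of_real (e x * \<theta>' x) * (\<i> * cis (\<theta>L x))" for x
  have dH: "(H has_vector_derivative H' x) (at x within {p..q})" if "x \<in> {p..q}" for x
    unfolding H_def[abs_def] H'_def \<theta>L_def[abs_def]
    by (rule has_vector_derivative_polar[OF de[OF that]]) (auto intro!: derivative_eq_intros d\<theta> that)
  have cD: "continuous_on {p..q} D" unfolding D_def \<theta>L_def by (intro continuous_intros ce c)
  have HD: "\<i> * L * (cis (L * x) * (of_real (e x) * cis (\<theta> x))) = H' x - D x" for x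
    by (simp add: H'_def D_def \<theta>L_def cis_mult[symmetric] algebra_simps)
  have "(H' has_integral (H q - H p)) {p..q}"
    by (rule fundamental_theorem_of_calculus[OF pq dH])
  moreover have "(D has_integral integral {p..q} D) {p..q}"
    by (intro integrable_integral integrable_continuous_real cD)
  ultimately have "((\<lambda>x. \<i> * L * (cis (L * x) * (of_real (e x) * cis (\<theta> x)))) has_integral (H q - H p - integral {p..q} D)) {p..q}"
    unfolding HD by (rule has_integral_diff)
  then have "\<i> * L * integral {p..q} (\<lambda>x. cis (L * x) * (of_real (e x) * cis (\<theta> x))) = H q - H p - integral {p..q} D"
    by (metis integral_mult_right integral_unique)
  then have "\<bar>L\<bar> * cmod (integral {p..q} (\<lambda>x. cis (L * x) * (of_real (e x) * cis (\<theta> x)))) = cmod (H q - H p - integral {p..q} D)"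
    by (metis norm_mult norm_ii norm_of_real mult_1)
  also have "\<dots> \<le> cmod (H q) + cmod (H p) + cmod (integral {p..q} D)"
    by (intro order.trans[OF norm_triangle_ineq4] add_right_mono norm_triangle_ineq4)
  also have "cmod (integral {p..q} D) \<le> B * (q - p)"
  proof (rule integral_bound[OF pq cD])
    fix x assume x: "x \<in> {p..q}"
    have "cmod (D x) \<le> cmod (of_real (e' x) * cis (\<theta>L x)) + cmod (of_real (e x * \<theta>' x) * (\<i> * cis (\<theta>L x)))"
      unfolding D_def by (rule norm_triangle_ineq)
    also have "\<dots> = \<bar>e' x\<bar> + \<bar>e x\<bar> * \<bar>\<theta>' x\<bar>" by (simp add: norm_mult)
    also have "\<dots> \<le> \<bar>e' x\<bar> + 1 * \<bar>\<theta>' x\<bar>" using e01[OF x] by (intro add_left_mono mult_right_mono) auto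
    finally show "cmod (D x) \<le> B" using B[OF x] by simp
  qed
  also have "cmod (H q) + cmod (H p) + B * (q - p) \<le> 2 + B * (q - p)"
    using e01[of p] e01[of q] pq by (simp add: H_def norm_mult)
  finally show "cmod (integral {p..q} (\<lambda>x. cis (L * x) * (of_real (e x) * cis (\<theta> x)))) \<le> (2 + B * (q - p)) / \<bar>L\<bar>"
    using L by (simp add: field_simps)
qed

section \<open>Sums of translated wave packets\<close>

lemma harmonic_le:
  fixes M :: nat
  assumes "m \<le> M" "M \<ge> 1"
  shows "(\<Sum>i<m. 1 / (real i + 1)) \<le> 1 + ln (real M)"
proof -
  have "(\<Sum>i<Suc n. 1 / (real i + 1)) \<le> 1 + ln (real (Suc n))" for n
  proof (induction n)
    case (Suc n)
    have "ln (real (Suc n) / real (Suc (Suc n))) \<le> real (Suc n) / real (Suc (Suc n)) - 1"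
      by (rule ln_le_minus_one) simp
    also have "\<dots> = - (1 / (real (Suc n) + 1))" by (simp add: field_simps)
    finally have "1 / (real (Suc n) + 1) \<le> ln (real (Suc (Suc n))) - ln (real (Suc n))"
      by (simp add: ln_div)
    then show ?case using Suc by simp
  qed simp
  from this[of "M - 1"] have "(\<Sum>i<M. 1 / (real i + 1)) \<le> 1 + ln (real M)" using assms by simp
  moreover have "(\<Sum>i<m. 1 / (real i + 1)) \<le> (\<Sum>i<M. 1 / (real i + 1))"
    using assms by (intro sum_mono2) auto
  ultimately show ?thesis by linarith
qed

text \<open>Measures the total interaction of one translate with all the others; it is the source of
  the logarithms below.\<close>

lemma sum_inverse_dist_le:
  fixes M j :: nat
  assumes j: "j < M"
  shows "(\<Sum>i\<in>{..<M} - {j}. 1 / \<bar>real j - real i\<bar>) \<le> 2 * (1 + ln (real M))"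
proof -
  have "(\<Sum>i\<in>{..<M} - {j}. 1 / \<bar>real j - real i\<bar>) = (\<Sum>i<j. 1 / \<bar>real j - real i\<bar>) + (\<Sum>i\<in>{Suc j..<M}. 1 / \<bar>real j - real i\<bar>)"
    using j by (subst sum.union_disjoint[symmetric]) (auto intro!: sum.cong)
  also have "(\<Sum>i<j. 1 / \<bar>real j - real i\<bar>) = (\<Sum>i<j. 1 / (real i + 1))"
    by (subst sum.nat_diff_reindex[symmetric]) (auto intro!: sum.cong)
  also have "(\<Sum>i\<in>{Suc j..<M}. 1 / \<bar>real j - real i\<bar>) = (\<Sum>i<M - Suc j. 1 / (real i + 1))"
    by (rule sum.reindex_bij_witness[of _ "\<lambda>i. i + Suc j" "\<lambda>i. i - Suc j"]) auto
  finally show ?thesis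
    using harmonic_le[of j M] harmonic_le[of "M - Suc j" M] j by simp
qed

text \<open>Mean value theorem; on \<open>{N..2 * N}\<close> the factor \<open>2 powr a\<close>
  covers both signs of \<open>a - 2\<close>.\<close>

lemma powr_increment_le:
  fixes a N \<xi> :: real
  assumes a: "a > 1" and N: "N > 0" and \<xi>: "N \<le> \<xi>" "\<xi> \<le> 2 * N"
  shows "\<xi> powr (a - 1) - N powr (a - 1) \<le> (a - 1) * 2 powr a * N powr (a - 2) * (\<xi> - N)"
proof (cases "\<xi> = N")
  case False
  then have lt: "N < \<xi>" using \<xi> by simp
  have "\<exists>z>N. z < \<xi> \<and> \<xi> powr (a - 1) - N powr (a - 1) = (\<xi> - N) * ((a - 1) * z powr (a - 1 - 1))"
    by (rule MVT2[OF lt], rule has_real_derivative_powr) (use N in auto)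
  then obtain z where z: "N < z" "z < \<xi>" and eq: "\<xi> powr (a - 1) - N powr (a - 1) = (\<xi> - N) * ((a - 1) * z powr (a - 2))"
    by auto
  have "z powr (a - 2) \<le> 2 powr a * N powr (a - 2)"
  proof (cases "a \<ge> 2")
    case True
    have "z powr (a - 2) \<le> (2 * N) powr (a - 2)" using z \<xi> N True by (intro powr_mono2) auto
    also have "\<dots> = 2 powr (a - 2) * N powr (a - 2)" using N by (simp add: powr_mult)
    also have "\<dots> \<le> 2 powr a * N powr (a - 2)" by (intro mult_right_mono powr_mono) auto
    finally show ?thesis .
  next
    case False
    have "z powr (a - 2) \<le> 1 * N powr (a - 2)" using z N False by (simp add: powr_mono2')
    also have "\<dots> \<le> 2 powr a * N powr (a - 2)" using a by (intro mult_right_mono) (auto simp: ge_one_powr_ge_zero)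
    finally show ?thesis .
  qed
  then have "(\<xi> - N) * ((a - 1) * z powr (a - 2)) \<le> (\<xi> - N) * ((a - 1) * (2 powr a * N powr (a - 2)))"
    using lt a by (intro mult_left_mono) auto
  then show ?thesis unfolding eq by (simp add: mult_ac)
qed simp

text \<open>Transform of \<open>M\<close> translates, by multiples of \<open>l\<close>, of one
  packet with frequencies in \<open>{N..N + W}\<close>. The factor \<open>A / W\<close> gives each
  packet a height of order \<open>A\<close>.\<close>

definition bump :: "real \<Rightarrow> real \<Rightarrow> real \<Rightarrow> nat \<Rightarrow> real \<Rightarrow> real \<Rightarrow> complex" where
  "bump N W l M A \<xi> = of_real (A / W) * (indicator {N..N + W} \<xi> * (\<Sum>j<M. cis (- (real j * l * \<xi>))))"

lemma measurable_bump [measurable]: "bump N W l M A \<in> borel_measurable borel"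
  unfolding bump_def[abs_def] by measurable

lemma cmod_bump_le:
  assumes "A \<ge> 0" "W > 0"
  shows "cmod (bump N W l M A \<xi>) \<le> A / W * real M * indicator {N..N + W} \<xi>"
proof -
  have "cmod (\<Sum>j<M. cis (- (real j * l * \<xi>))) \<le> (\<Sum>j<M. 1)"
    by (intro sum_norm_le) simp
  then show ?thesis using assms by (auto simp: bump_def norm_mult norm_divide indicator_def intro!: divide_right_mono mult_left_mono)
qed

lemma integral_cos_le:
  fixes L :: real
  assumes "p \<le> q" "L \<noteq> 0"
  shows "integral {p..q} (\<lambda>x. cos (L * x)) \<le> 2 / \<bar>L\<bar>"
proof -
  have "((\<lambda>x. cos (L * x)) has_integral (sin (L * q) / L - sin (L * p) / L)) {p..q}"
  proof (rule fundamental_theorem_of_calculus[OF assms(1)])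
    fix x
    show "((\<lambda>x. sin (L * x) / L) has_vector_derivative cos (L * x)) (at x within {p..q})"
      unfolding has_real_derivative_iff_has_vector_derivative[symmetric]
      using assms(2) by (auto intro!: derivative_eq_intros)
  qed
  then have "integral {p..q} (\<lambda>x. cos (L * x)) = (sin (L * q) - sin (L * p)) / L"
    by (simp add: integral_unique diff_divide_distrib)
  also have "\<dots> \<le> \<bar>sin (L * q) - sin (L * p)\<bar> / \<bar>L\<bar>"
    by (metis abs_divide abs_ge_self)
  also have "\<dots> \<le> 2 / \<bar>L\<bar>"
    using abs_sin_le_one[of "L * q"] abs_sin_le_one[of "L * p"] by (intro divide_right_mono) linarith+
  finally show ?thesis .
qed

text \<open>The squared exponential sum is a double sum of cosines. The diagonal contributes
  \<open>W\<close> for each translate, and the terms off the diagonal are at most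
  \<open>2 / (l * \<bar>i - j\<bar>)\<close>; by \<open>lW\<close> they contribute at most another
  \<open>W\<close> per translate.\<close>

lemma nsq_bump_le:
  assumes A: "A \<ge> 0" and W: "W > 0" and l: "l > 0" and M: "M \<ge> 1" and lW: "4 * (1 + ln (real M)) \<le> l * W"
  shows "nsq (bump N W l M A) \<le> ennreal (2 * A\<^sup>2 * real M / W)"
proof -
  define D where "D \<xi> = (\<Sum>j<M. cis (- (real j * l * \<xi>)))" for \<xi>
  have cD: "continuous_on X D" for X unfolding D_def by (intro continuous_intros)
  have DD: "(cmod (D \<xi>))\<^sup>2 = (\<Sum>i<M. \<Sum>j<M. cos ((real j - real i) * l * \<xi>))" for \<xi>
  proof -
    have "complex_of_real ((cmod (D \<xi>))\<^sup>2) = (\<Sum>i<M. \<Sum>j<M. cis ((real j - real i) * l * \<xi>))"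
      unfolding complex_norm_square D_def cnj_sum sum_product by (simp add: cis_cnj cis_mult algebra_simps)
    from arg_cong[OF this, of Re] show ?thesis by (simp only: Re_complex_of_real Re_sum cis.sel)
  qed
  have ci: "(\<lambda>\<xi>. cos (L * \<xi>)) integrable_on {N..N + W}" for L :: real
    by (intro integrable_continuous_real continuous_intros)
  have "integral {N..N + W} (\<lambda>\<xi>. (cmod (D \<xi>))\<^sup>2) = (\<Sum>i<M. \<Sum>j<M. integral {N..N + W} (\<lambda>\<xi>. cos ((real j - real i) * l * \<xi>)))"
    unfolding DD by (simp add: integral_sum integrable_sum ci)
  also have "\<dots> \<le> (\<Sum>i<M. 2 * W)"
  proof (rule sum_mono)
    fix i assume i: "i \<in> {..<M}"
    have "(\<Sum>j<M. integral {N..N + W} (\<lambda>\<xi>. cos ((real j - real i) * l * \<xi>)))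
      = integral {N..N + W} (\<lambda>\<xi>. cos ((real i - real i) * l * \<xi>)) + (\<Sum>j\<in>{..<M} - {i}. integral {N..N + W} (\<lambda>\<xi>. cos ((real j - real i) * l * \<xi>)))"
      using i by (intro sum.remove) auto
    also have "integral {N..N + W} (\<lambda>\<xi>. cos ((real i - real i) * l * \<xi>)) = W" using W by simp
    also have "(\<Sum>j\<in>{..<M} - {i}. integral {N..N + W} (\<lambda>\<xi>. cos ((real j - real i) * l * \<xi>))) \<le> (\<Sum>j\<in>{..<M} - {i}. 2 / l * (1 / \<bar>real i - real j\<bar>))"
    proof (rule sum_mono)
      fix j assume "j \<in> {..<M} - {i}"
      then have "(real j - real i) * l \<noteq> 0" using l by auto
      from integral_cos_le[OF _ this, of N "N + W"] W
      have "integral {N..N + W} (\<lambda>\<xi>. cos ((real j - real i) * l * \<xi>)) \<le> 2 / \<bar>(real j - real i) * l\<bar>" by simp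
      also have "\<dots> = 2 / l * (1 / \<bar>real i - real j\<bar>)" using l by (simp add: abs_mult abs_minus_commute)
      finally show "integral {N..N + W} (\<lambda>\<xi>. cos ((real j - real i) * l * \<xi>)) \<le> 2 / l * (1 / \<bar>real i - real j\<bar>)" .
    qed
    also have "\<dots> = 2 / l * (\<Sum>j\<in>{..<M} - {i}. 1 / \<bar>real i - real j\<bar>)" by (simp only: sum_distrib_left)
    also have "\<dots> \<le> 2 / l * (2 * (1 + ln (real M)))"
      using l i by (intro mult_left_mono sum_inverse_dist_le) auto
    also have "\<dots> \<le> W" using lW l by (simp add: field_simps)
    finally show "(\<Sum>j<M. integral {N..N + W} (\<lambda>\<xi>. cos ((real j - real i) * l * \<xi>))) \<le> 2 * W" by simp
  qed
  finally have I: "integral {N..N + W} (\<lambda>\<xi>. (cmod (D \<xi>))\<^sup>2) \<le> real M * (2 * W)" by simp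
  have "set_integrable lborel {N..N + W} (\<lambda>\<xi>. (cmod (D \<xi>))\<^sup>2)"
    by (intro borel_integrable_atLeastAtMost' continuous_intros cD)
  then have i: "integrable lborel (\<lambda>\<xi>. indicator {N..N + W} \<xi> * (cmod (D \<xi>))\<^sup>2)"
    and eq: "(\<integral>\<xi>. indicator {N..N + W} \<xi> * (cmod (D \<xi>))\<^sup>2 \<partial>lborel) = integral {N..N + W} (\<lambda>\<xi>. (cmod (D \<xi>))\<^sup>2)"
    using set_borel_integral_eq_integral(2)[of "{N..N + W}" "\<lambda>\<xi>. (cmod (D \<xi>))\<^sup>2"]
    by (simp_all add: set_integrable_def set_lebesgue_integral_def)
  have "(cmod (bump N W l M A \<xi>))\<^sup>2 = (A / W)\<^sup>2 * (indicator {N..N + W} \<xi> * (cmod (D \<xi>))\<^sup>2)" for \<xi>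
    by (auto simp: bump_def D_def norm_mult power_mult_distrib norm_divide power_divide indicator_def)
  then have "nsq (bump N W l M A) = (\<integral>\<^sup>+\<xi>. ennreal ((A / W)\<^sup>2 * (indicator {N..N + W} \<xi> * (cmod (D \<xi>))\<^sup>2)) \<partial>lborel)"
    by (simp add: nsq_def)
  also have "\<dots> = ennreal (\<integral>\<xi>. (A / W)\<^sup>2 * (indicator {N..N + W} \<xi> * (cmod (D \<xi>))\<^sup>2) \<partial>lborel)"
    by (intro nn_integral_eq_integral integrable_mult_right i) auto
  also have "\<dots> = ennreal ((A / W)\<^sup>2 * integral {N..N + W} (\<lambda>\<xi>. (cmod (D \<xi>))\<^sup>2))"
    unfolding integral_mult_right_zero eq ..
  also have "\<dots> \<le> ennreal ((A / W)\<^sup>2 * (real M * (2 * W)))"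
    by (intro ennreal_leI mult_left_mono I) auto
  also have "(A / W)\<^sup>2 * (real M * (2 * W)) = 2 * A\<^sup>2 * real M / W"
    using W by (simp add: power2_eq_square field_simps)
  finally show ?thesis .
qed

text \<open>A packet at frequency \<open>N\<close> travels to the left at speed
  \<open>a * N powr (a - 1)\<close>. For given \<open>x\<close> a translate is selected that starts
  at a distance between \<open>l\<close> and \<open>2 * l\<close> to the right of \<open>x\<close>,
  and it is observed at the moment of its arrival.\<close>

lemma bump_evolution_lower:
  fixes a \<gamma> q c N l W A x :: real and M :: nat
  assumes a: "a > 1" and \<gamma>: "\<gamma> \<ge> 1" and q: "a - 1 \<le> q" "q < a" "a \<le> q * \<gamma>"
    and c: "c = 1 / (64 * a * 2 powr a)" and N: "N \<ge> 1" and l: "l = c * N powr (a - 1 - q)"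
    and W: "W = N powr ((2 - a + q) / 2)" and M: "1 / l + 2 \<le> real M"
    and A: "A > 0" and lW: "20 * (1 + ln (real M)) \<le> l * W" and x: "x \<in> {0..1}"
  shows "\<exists>t. c / a * N powr - q \<le> t \<and> t \<le> 2 * c / a * N powr - q \<and> A / 2 \<le> cmod (evolution a \<gamma> (bump N W l M A) t x)"
proof -
  have two: "2 powr a \<ge> 2 powr 1" using a by (intro powr_mono) auto
  have c0: "c > 0" using a by (simp add: c)
  have l0: "l > 0" using c0 N by (simp add: l)
  have W0: "W > 0" using N by (simp add: W)
  have WN: "W \<le> N"
  proof -
    have "W \<le> N powr 1" unfolding W using N q by (intro powr_mono) auto
    then show ?thesis using N by simp
  qed
  \<comment> \<open>The added 1 keeps the starting distance at least \<open>l\<close>, hence the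
    time at least \<open>c / a * N powr - q\<close>. The lacunary sum relies on this lower bound to
    damp its later terms.\<close>
  define j where "j = nat (\<lceil>x / l\<rceil> + 1)"
  have j_real: "real j = of_int \<lceil>x / l\<rceil> + 1"
  proof -
    have "0 \<le> x / l" using x l0 by simp
    then have "0 \<le> \<lceil>x / l\<rceil>" by linarith
    then show ?thesis by (simp add: j_def)
  qed
  have "x / l \<le> of_int \<lceil>x / l\<rceil>" "of_int \<lceil>x / l\<rceil> < x / l + 1" by linarith+
  then have "l * (x / l + 1) \<le> l * real j" "l * real j \<le> l * (x / l + 2)"
    using l0 unfolding j_real by (auto intro!: mult_left_mono)
  then have y: "l \<le> real j * l - x" "real j * l - x \<le> 2 * l"
    using l0 by (auto simp: algebra_simps)
  have "real j < x / l + 2" unfolding j_real by linarith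
  also have "\<dots> \<le> 1 / l + 2" using x l0 by (intro add_right_mono divide_right_mono) auto
  finally have jM: "j < M" using M by linarith
  then have M1: "M \<ge> 1" by simp
  define y where "y = real j * l - x"
  \<comment> \<open>The arrival time: the phase \<open>t * \<xi> powr a - y * \<xi>\<close> is
    stationary at \<open>\<xi> = N\<close>.\<close>
  define t where "t = y / (a * N powr (a - 1))"
  have ta: "t * (a * N powr (a - 1)) = y" using a N by (simp add: t_def)
  have lN: "l / (a * N powr (a - 1)) = c / a * N powr - q"
  proof -
    have "N powr (a - 1 - q) = N powr - q * N powr (a - 1)" unfolding powr_add[symmetric] by simp
    then show ?thesis using a N by (simp add: l)
  qed
  have aN: "a * N powr (a - 1) > 0" using a N by simp
  have t1: "c / a * N powr - q \<le> t"
    unfolding t_def lN[symmetric] y_def using y(1) aN by (intro divide_right_mono) auto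
  have "t \<le> 2 * l / (a * N powr (a - 1))"
    unfolding t_def y_def using y(2) aN by (intro divide_right_mono) auto
  also have "\<dots> = 2 * (l / (a * N powr (a - 1)))" by simp
  finally have t2: "t \<le> 2 * c / a * N powr - q" unfolding lN by simp
  have t0: "t > 0" using t1 c0 a N by (smt (verit) divide_pos_pos mult_pos_pos powr_gt_zero)
  define \<tau> where "\<tau> = 2 * c / a"
  have \<tau>0: "\<tau> > 0" using c0 a by (simp add: \<tau>_def)
  \<comment> \<open>The value of \<open>c\<close> is designed for this bound; it makes amplitude and
    phase each vary by at most \<open>1/32\<close> over the frequency window.\<close>
  have \<tau>a: "\<tau> * (a * 2 powr a) \<le> 1/32"
    using a by (simp add: \<tau>_def c)
  have \<tau>32: "\<tau> \<le> 1/32"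
  proof -
    have "\<tau> * 1 \<le> \<tau> * (a * 2 powr a)"
      using \<tau>0 a two mult_mono[of 1 a 1 "2 powr a"] by (intro mult_left_mono) auto
    then show ?thesis using \<tau>a by simp
  qed
  have tq: "t * N powr q \<le> \<tau>"
  proof -
    have "t * N powr q \<le> \<tau> * N powr - q * N powr q" using t2 by (intro mult_right_mono) (auto simp: \<tau>_def)
    also have "\<dots> = \<tau> * (N powr - q * N powr q)" by simp
    also have "N powr - q * N powr q = 1" unfolding powr_add[symmetric] using N by simp
    finally show ?thesis by simp
  qed
  have t\<gamma>: "t powr \<gamma> * N powr a \<le> \<tau>"
  proof -
    \<comment> \<open>The condition \<open>a \<le> q * \<gamma>\<close> enters here: the time is
      short enough for the damping at frequency \<open>N\<close> to be harmless.\<close>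
    have "N powr a \<le> N powr (q * \<gamma>)" using N q by (intro powr_mono) auto
    then have "t powr \<gamma> * N powr a \<le> t powr \<gamma> * (N powr q) powr \<gamma>" by (simp add: powr_powr mult_left_mono)
    also have "\<dots> = (t * N powr q) powr \<gamma>" using t0 by (simp add: powr_mult)
    also have "\<dots> \<le> \<tau> powr \<gamma>" using tq t0 \<gamma> by (intro powr_mono2) auto
    also have "\<dots> \<le> \<tau> powr 1" using \<tau>0 \<tau>32 \<gamma> by (intro powr_mono') auto
    finally show ?thesis using \<tau>0 by simp
  qed
  define e where "e \<xi> = exp (- (t powr \<gamma>) * \<xi> powr a)" for \<xi>
  define e' where "e' \<xi> = - (t powr \<gamma>) * (a * \<xi> powr (a - 1)) * exp (- (t powr \<gamma>) * \<xi> powr a)" for \<xi>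
  define \<theta> where "\<theta> \<xi> = t * \<xi> powr a - y * \<xi>" for \<xi>
  define \<theta>' where "\<theta>' \<xi> = t * (a * \<xi> powr (a - 1)) - y" for \<xi>
  have de: "(e has_real_derivative e' \<xi>) (at \<xi> within {N..N + W})" if "\<xi> \<in> {N..N + W}" for \<xi>
    unfolding e_def[abs_def] e'_def
    by (rule has_field_derivative_at_within) (use that N in \<open>auto intro!: derivative_eq_intros has_real_derivative_powr\<close>)
  have d\<theta>: "(\<theta> has_real_derivative \<theta>' \<xi>) (at \<xi> within {N..N + W})" if "\<xi> \<in> {N..N + W}" for \<xi>
    unfolding \<theta>_def[abs_def] \<theta>'_def
    by (rule has_field_derivative_at_within) (use that N in \<open>auto intro!: derivative_eq_intros has_real_derivative_powr\<close>)
  have ce: "continuous_on {N..N + W} e'" unfolding e'_def using N by (auto intro!: continuous_intros)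
  have c\<theta>: "continuous_on {N..N + W} \<theta>'" unfolding \<theta>'_def using N by (auto intro!: continuous_intros)
  have e01: "0 \<le> e \<xi> \<and> e \<xi> \<le> 1" for \<xi> by (simp add: e_def)
  have B: "\<bar>e' \<xi>\<bar> + \<bar>\<theta>' \<xi>\<bar> \<le> 1 / (8 * W)" if \<xi>: "\<xi> \<in> {N..N + W}" for \<xi>
  proof -
    have \<xi>N: "N \<le> \<xi>" "\<xi> \<le> 2 * N" "\<xi> - N \<le> W" using \<xi> WN by auto
    have "\<bar>e' \<xi>\<bar> \<le> t powr \<gamma> * (a * \<xi> powr (a - 1)) * 1"
      unfolding e'_def using a by (simp add: abs_mult mult_left_le)
    also have "\<xi> powr (a - 1) \<le> (2 * N) powr (a - 1)" using \<xi>N N a by (intro powr_mono2) auto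
    also have "(2 * N) powr (a - 1) = 2 powr (a - 1) * N powr (a - 1)" using N by (simp add: powr_mult)
    also have "\<dots> \<le> 2 powr a * N powr (a - 1)" by (intro mult_right_mono powr_mono) auto
    finally have "\<bar>e' \<xi>\<bar> \<le> t powr \<gamma> * (a * (2 powr a * N powr (a - 1)))" using a by (simp add: mult_left_mono)
    then have "\<bar>e' \<xi>\<bar> * W \<le> t powr \<gamma> * (a * (2 powr a * N powr (a - 1))) * N"
      using WN W0 N a by (intro mult_mono) auto
    also have "\<dots> = a * 2 powr a * (t powr \<gamma> * (N powr (a - 1) * N powr 1))" using N by simp
    also have "N powr (a - 1) * N powr 1 = N powr a" unfolding powr_add[symmetric] by simp
    also have "a * 2 powr a * (t powr \<gamma> * N powr a) \<le> a * 2 powr a * \<tau>"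
      using a t\<gamma> by (intro mult_left_mono) auto
    finally have b1: "\<bar>e' \<xi>\<bar> * W \<le> 1/32" using \<tau>a by (simp add: mult_ac)
    have "\<theta>' \<xi> = t * a * (\<xi> powr (a - 1) - N powr (a - 1))"
      unfolding \<theta>'_def ta[symmetric] by (simp add: algebra_simps)
    moreover have "N powr (a - 1) \<le> \<xi> powr (a - 1)" using \<xi>N N a by (intro powr_mono2) auto
    ultimately have "\<bar>\<theta>' \<xi>\<bar> = t * a * (\<xi> powr (a - 1) - N powr (a - 1))" using t0 a by (simp add: abs_mult)
    also have "\<dots> \<le> t * a * ((a - 1) * 2 powr a * N powr (a - 2) * (\<xi> - N))"
      using t0 a N \<xi>N by (intro mult_left_mono powr_increment_le) auto
    also have "\<dots> \<le> t * a * ((a - 1) * 2 powr a * N powr (a - 2) * W)"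
      using t0 a \<xi>N by (intro mult_left_mono) auto
    finally have "\<bar>\<theta>' \<xi>\<bar> * W \<le> t * a * ((a - 1) * 2 powr a * N powr (a - 2) * W) * W"
      using W0 by (intro mult_right_mono) auto
    also have "\<dots> = t * (N powr (a - 2) * W * W) * (a - 1) * (a * 2 powr a)" by (simp add: mult_ac)
    \<comment> \<open>This identity dictates \<open>W\<close>: up to constants it is the widest
      window on which the packet does not disperse at times of order
      \<open>N powr - q\<close>.\<close>
    also have "N powr (a - 2) * W * W = N powr q" unfolding W powr_add[symmetric] by (simp add: field_simps)
    also have "t * N powr q * (a - 1) * (a * 2 powr a) \<le> \<tau> * (a - 1) * (a * 2 powr a)"
      using tq a by (intro mult_right_mono) auto
    also have "\<dots> = (a - 1) / (32 * a)"
      using a by (simp add: \<tau>_def c)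
    also have "\<dots> \<le> 1/32" using a by (simp add: field_simps)
    finally have b2: "\<bar>\<theta>' \<xi>\<bar> * W \<le> 1/32" .
    have "(\<bar>e' \<xi>\<bar> + \<bar>\<theta>' \<xi>\<bar>) * W \<le> 1/8" using b1 b2 by (simp add: distrib_right)
    then show ?thesis using W0 by (simp add: field_simps)
  qed
  have NW: "N \<le> N + W" using W0 by simp
  define I where "I i = integral {N..N + W} (\<lambda>\<xi>. cis ((real j - real i) * l * \<xi>) * (of_real (e \<xi>) * cis (\<theta> \<xi>)))" for i :: nat
  \<comment> \<open>The arriving packet keeps at least three quarters of \<open>W\<close>, and all
    others together take away at most a quarter. What remains is \<open>W / 2\<close>, which the
    factor \<open>A / W\<close> turns into the height \<open>A / 2\<close>.\<close>
  have Ij: "W * (3 / 4) \<le> cmod (I j)"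
  proof -
    have "(N + W - N) * (e N - 1 / (8 * W) * (N + W - N)) \<le> cmod (integral {N..N + W} (\<lambda>\<xi>. of_real (e \<xi>) * cis (\<theta> \<xi>)))"
      by (rule polar_integral_lower[OF NW de d\<theta> ce c\<theta> e01 B])
    moreover have "I j = integral {N..N + W} (\<lambda>\<xi>. of_real (e \<xi>) * cis (\<theta> \<xi>))" by (simp add: I_def)
    moreover have "e N \<ge> 1 - 1/32"
    proof -
      have "e N \<ge> 1 + - (t powr \<gamma>) * N powr a" unfolding e_def by (rule exp_ge_add_one_self)
      then show ?thesis using t\<gamma> \<tau>32 by simp
    qed
    then have "W * (3 / 4) \<le> W * (e N - 1 / (8 * W) * W)" using W0 by (intro mult_left_mono) auto
    ultimately show ?thesis by simp
  qed
  have Ii: "cmod (I i) \<le> 17 / 8 / l * (1 / \<bar>real j - real i\<bar>)" if "i \<in> {..<M} - {j}" for i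
  proof -
    have L: "(real j - real i) * l \<noteq> 0" using that l0 by auto
    have "cmod (I i) \<le> (2 + 1 / (8 * W) * (N + W - N)) / \<bar>(real j - real i) * l\<bar>"
      unfolding I_def by (rule polar_integral_upper[OF NW de d\<theta> ce c\<theta> e01 B L])
    also have "\<dots> = 17 / 8 / l * (1 / \<bar>real j - real i\<bar>)" using l0 W0 by (simp add: abs_mult)
    finally show ?thesis .
  qed
  have "cmod (\<Sum>i\<in>{..<M} - {j}. I i) \<le> (\<Sum>i\<in>{..<M} - {j}. 17 / 8 / l * (1 / \<bar>real j - real i\<bar>))"
    by (rule sum_norm_le) (rule Ii)
  also have "\<dots> = 17 / 8 / l * (\<Sum>i\<in>{..<M} - {j}. 1 / \<bar>real j - real i\<bar>)" by (simp only: sum_distrib_left)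
  also have "\<dots> \<le> 17 / 8 / l * (2 * (1 + ln (real M)))"
    using l0 jM by (intro mult_left_mono sum_inverse_dist_le) auto
  also have "\<dots> \<le> W / 4"
  proof -
    have "ln (real M) \<ge> 0" using M1 by simp
    then have "17 * (1 + ln (real M)) \<le> l * W" using lW by simp
    then show ?thesis using l0 by (simp add: field_simps)
  qed
  finally have off: "cmod (\<Sum>i\<in>{..<M} - {j}. I i) \<le> W / 4" .
  have "(\<Sum>i<M. I i) = I j + (\<Sum>i\<in>{..<M} - {j}. I i)" using jM by (intro sum.remove) auto
  then have low: "W / 2 \<le> cmod (\<Sum>i<M. I i)"
    using Ij off norm_triangle_ineq2[of "I j" "- (\<Sum>i\<in>{..<M} - {j}. I i)"] by simp
  have "evolution a \<gamma> (bump N W l M A) t x = of_real (A / W) * (\<Sum>i<M. I i)"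
  proof -
    define h where "h \<xi> = of_real (A / W) * (\<Sum>i<M. cis ((real j - real i) * l * \<xi>) * (of_real (e \<xi>) * cis (\<theta> \<xi>)))" for \<xi>
    have c1: "continuous_on {N..N + W} e" "continuous_on {N..N + W} \<theta>"
      using DERIV_continuous_on[OF de] DERIV_continuous_on[OF d\<theta>] by auto
    have ch: "continuous_on {N..N + W} h" unfolding h_def by (intro continuous_intros c1)
    have "bump N W l M A \<xi> * (damped a (t powr \<gamma>) t \<xi> * cis (x * \<xi>)) = indicator {N..N + W} \<xi> *\<^sub>R h \<xi>" for \<xi>
    proof (cases "\<xi> \<in> {N..N + W}")
      case True
      then have \<xi>: "\<bar>\<xi>\<bar> = \<xi>" using N by auto
      have "cis (- (real i * l * \<xi>)) * (damped a (t powr \<gamma>) t \<xi> * cis (x * \<xi>)) = cis ((real j - real i) * l * \<xi>) * (of_real (e \<xi>) * cis (\<theta> \<xi>))" for i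
      proof -
        have "cis (- (real i * l * \<xi>)) * (cis (t * \<xi> powr a) * cis (x * \<xi>)) = cis ((real j - real i) * l * \<xi>) * cis (\<theta> \<xi>)"
          unfolding cis_mult by (rule arg_cong[of _ _ cis]) (simp add: \<theta>_def y_def algebra_simps)
        then have "of_real (e \<xi>) * (cis (- (real i * l * \<xi>)) * (cis (t * \<xi> powr a) * cis (x * \<xi>))) = of_real (e \<xi>) * (cis ((real j - real i) * l * \<xi>) * cis (\<theta> \<xi>))" by simp
        then show ?thesis unfolding damped_def \<xi> e_def by (simp only: mult_ac)
      qed
      then have "(\<Sum>i<M. cis (- (real i * l * \<xi>))) * (damped a (t powr \<gamma>) t \<xi> * cis (x * \<xi>)) = (\<Sum>i<M. cis ((real j - real i) * l * \<xi>) * (of_real (e \<xi>) * cis (\<theta> \<xi>)))"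
        by (simp only: sum_distrib_right)
      then show ?thesis using True by (simp add: bump_def h_def mult.assoc)
    qed (simp add: bump_def)
    then have "evolution a \<gamma> (bump N W l M A) t x = (\<integral>\<xi>. indicator {N..N + W} \<xi> *\<^sub>R h \<xi> \<partial>lborel)"
      by (simp add: evolution_def)
    also have "\<dots> = integral {N..N + W} h"
      using set_borel_integral_eq_integral(2)[OF borel_integrable_atLeastAtMost'[OF ch]]
      by (simp add: set_lebesgue_integral_def)
    also have "\<dots> = of_real (A / W) * (\<Sum>i<M. I i)"
      unfolding h_def I_def integral_mult_right
      by (subst integral_sum) (auto intro!: integrable_continuous_real continuous_intros c1)
    finally show ?thesis .
  qed
  then have "cmod (evolution a \<gamma> (bump N W l M A) t x) = A / W * cmod (\<Sum>i<M. I i)"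
    using A W0 by (simp add: norm_mult norm_divide)
  moreover have "A / W * (W / 2) \<le> A / W * cmod (\<Sum>i<M. I i)"
    using low A W0 by (intro mult_left_mono) auto
  ultimately have "A / 2 \<le> cmod (evolution a \<gamma> (bump N W l M A) t x)" using W0 by simp
  then show ?thesis using t1 t2 by blast
qed

text \<open>Power counting with \<open>l * W = c * N powr \<nu>\<close>: at most
  \<open>4 / l\<close> translates have weighted squared norm at most a constant times
  \<open>N powr (2 * s) * A\<^sup>2 / (l * W)\<close>. Half of the gap \<open>\<nu> - 2 * s\<close>
  is spent on the height, \<open>A\<^sup>2 = N powr \<eta>\<close>, and the other half makes the
  norm decay like \<open>N powr - \<eta>\<close>.\<close>

lemma bump_family:
  fixes a \<gamma> q s :: real
  assumes a: "a > 1" and \<gamma>: "\<gamma> \<ge> 1" and q: "a - 1 \<le> q" "q < a" "a \<le> q * \<gamma>"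
    and s: "s \<ge> 0" "2 * s < (a - q) / 2"
  shows "\<exists>K c1 c2 \<kappa> \<eta>. K > 0 \<and> c1 > 0 \<and> c2 > 0 \<and> \<eta> > 0 \<and>
    (\<forall>\<^sub>F N in at_top. \<exists>F \<in> borel_measurable borel. (\<forall>\<xi>. \<xi> \<notin> {N..2 * N} \<longrightarrow> F \<xi> = 0) \<and>
      (\<integral>\<^sup>+\<xi>. ennreal ((1 + \<xi>\<^sup>2) powr s * (cmod (F \<xi>))\<^sup>2) \<partial>lborel) \<le> ennreal (K * N powr - \<eta>) \<and>
      (\<integral>\<^sup>+\<xi>. ennreal (cmod (F \<xi>)) \<partial>lborel) \<le> ennreal (K * N powr \<kappa>) \<and>
      (\<forall>x\<in>{0..1}. \<exists>t. c1 * N powr - q \<le> t \<and> t \<le> c2 * N powr - q \<and> N powr (\<eta> / 2) / 2 \<le> cmod (evolution a \<gamma> F t x)))"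
proof -
  define c where "c = 1 / (64 * a * 2 powr a)"
  have c: "c > 0" "c \<le> 1"
  proof -
    show "c > 0" using a by (simp add: c_def)
    have "1 \<le> (2::real) powr a" using a by (simp add: ge_one_powr_ge_zero)
    then have "1 * 1 \<le> (64 * a) * 2 powr a" using a by (intro mult_mono) auto
    then show "c \<le> 1" using a by (simp add: c_def)
  qed
  define \<nu> where "\<nu> = (a - q) / 2"
  define \<eta> where "\<eta> = (\<nu> - 2 * s) / 2"
  have \<nu>: "\<nu> > 0" and \<eta>: "\<eta> > 0" using q s by (auto simp: \<nu>_def \<eta>_def)
  \<comment> \<open>The integral of the modulus of the transform is at most \<open>A * M\<close>,
    and \<open>M \<le> 4 / l\<close>. It bounds the evolution of the sum at all times and
    points.\<close>
  define \<kappa> where "\<kappa> = \<eta> / 2 + (q + 1 - a)"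
  define K where "K = 8 * 5 powr s / c + 4 / c"
  have K: "K > 0" using c by (simp add: K_def add_pos_pos)
  \<comment> \<open>The logarithm from the interaction of the translates is absorbed by the positive
    power \<open>\<nu>\<close>.\<close>
  have ev: "\<forall>\<^sub>F N in at_top. 20 * (1 + ln (4 / c) + ln N) \<le> c * N powr \<nu>"
    using c \<nu> by real_asymp
  have "\<forall>\<^sub>F N in at_top. \<exists>F \<in> borel_measurable borel. (\<forall>\<xi>. \<xi> \<notin> {N..2 * N} \<longrightarrow> F \<xi> = 0) \<and>
      (\<integral>\<^sup>+\<xi>. ennreal ((1 + \<xi>\<^sup>2) powr s * (cmod (F \<xi>))\<^sup>2) \<partial>lborel) \<le> ennreal (K * N powr - \<eta>) \<and>
      (\<integral>\<^sup>+\<xi>. ennreal (cmod (F \<xi>)) \<partial>lborel) \<le> ennreal (K * N powr \<kappa>) \<and>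
      (\<forall>x\<in>{0..1}. \<exists>t. c / a * N powr - q \<le> t \<and> t \<le> 2 * c / a * N powr - q \<and> N powr (\<eta> / 2) / 2 \<le> cmod (evolution a \<gamma> F t x))"
    using ev eventually_ge_at_top[of 1]
  proof eventually_elim
    case (elim N)
    then have N: "N \<ge> 1" by simp
    define l where "l = c * N powr (a - 1 - q)"
    define W where "W = N powr ((2 - a + q) / 2)"
    define M where "M = nat \<lceil>1 / l\<rceil> + 2"
    define A where "A = N powr (\<eta> / 2)"
    have l0: "l > 0" using c N by (simp add: l_def)
    have l1: "l \<le> 1"
    proof -
      have "N powr (a - 1 - q) \<le> N powr 0" using N q by (intro powr_mono) auto
      then have "c * N powr (a - 1 - q) \<le> 1 * 1" using c N by (intro mult_mono) auto
      then show ?thesis by (simp add: l_def)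
    qed
    have W0: "W > 0" using N by (simp add: W_def)
    have A0: "A > 0" using N by (simp add: A_def)
    have WN: "W \<le> N"
    proof -
      have "W \<le> N powr 1" unfolding W_def using N q by (intro powr_mono) auto
      then show ?thesis using N by simp
    qed
    have M_real: "real M = of_int \<lceil>1 / l\<rceil> + 2"
    proof -
      have "0 \<le> 1 / l" using l0 by simp
      then have "0 \<le> \<lceil>1 / l\<rceil>" by linarith
      then show ?thesis by (simp add: M_def)
    qed
    have M1: "1 / l + 2 \<le> real M" unfolding M_real by linarith
    have "real M \<le> 1 / l + 3" unfolding M_real by linarith
    also have "\<dots> \<le> 1 / l + 3 / l" using l0 l1 by (simp add: field_simps)
    finally have M4: "real M \<le> 4 / l" by simp
    have lWN: "l * W = c * N powr \<nu>"
    proof -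
      have "N powr (a - 1 - q) * W = N powr \<nu>"
        unfolding W_def powr_add[symmetric] by (simp add: \<nu>_def field_simps)
      then show ?thesis by (simp add: l_def)
    qed
    have M4': "4 / l = 4 / c * N powr (q + 1 - a)"
    proof -
      have "N powr (a - 1 - q) * N powr (q + 1 - a) = 1" unfolding powr_add[symmetric] using N by simp
      then have "l * (4 / c * N powr (q + 1 - a)) = 4" using c by (simp add: l_def)
      then show ?thesis using l0 by (simp add: field_simps)
    qed
    have Mpos: "M \<ge> 1" by (simp add: M_def)
    have lnM: "ln (real M) \<le> ln (4 / c) + ln N"
    proof -
      have "ln (real M) \<le> ln (4 / l)" using M4 Mpos l0 by (subst ln_le_cancel_iff) auto
      also have "\<dots> = ln (4 / c) + (q + 1 - a) * ln N"
        unfolding M4' using c N by (subst ln_mult_pos) (simp_all add: ln_powr)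
      also have "\<dots> \<le> ln (4 / c) + 1 * ln N" using q N by (intro add_left_mono mult_right_mono) auto
      finally show ?thesis by simp
    qed
    have lW: "20 * (1 + ln (real M)) \<le> l * W" using lnM elim(1) unfolding lWN by simp
    have lW4: "4 * (1 + ln (real M)) \<le> l * W"
    proof -
      have "ln (real M) \<ge> 0" using Mpos by simp
      then show ?thesis using lW by simp
    qed
    let ?F = "bump N W l M A"
    have F0: "?F \<xi> = 0" if "\<xi> \<notin> {N..2 * N}" for \<xi>
      using that WN by (auto simp: bump_def)
    have "(\<integral>\<^sup>+\<xi>. ennreal ((1 + \<xi>\<^sup>2) powr s * (cmod (?F \<xi>))\<^sup>2) \<partial>lborel)
      \<le> (\<integral>\<^sup>+\<xi>. ennreal ((5 * N\<^sup>2) powr s) * ennreal ((cmod (?F \<xi>))\<^sup>2) \<partial>lborel)"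
    proof (rule nn_integral_mono)
      fix \<xi>
      show "ennreal ((1 + \<xi>\<^sup>2) powr s * (cmod (?F \<xi>))\<^sup>2) \<le> ennreal ((5 * N\<^sup>2) powr s) * ennreal ((cmod (?F \<xi>))\<^sup>2)"
      proof (cases "\<xi> \<in> {N..2 * N}")
        case True
        have "\<xi>\<^sup>2 \<le> (2 * N)\<^sup>2" using True N by (intro power_mono) auto
        moreover have "1 \<le> N\<^sup>2" using N by (simp add: one_le_power)
        ultimately have "(1 + \<xi>\<^sup>2) powr s \<le> (5 * N\<^sup>2) powr s"
          using s by (intro powr_mono2) (auto simp: power_mult_distrib)
        then show ?thesis by (subst ennreal_mult[symmetric]) (auto intro!: ennreal_leI mult_right_mono)
      qed (simp add: F0)
    qed
    also have "\<dots> = ennreal ((5 * N\<^sup>2) powr s) * nsq ?F"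
      unfolding nsq_def by (rule nn_integral_cmult) measurable
    also have "\<dots> \<le> ennreal ((5 * N\<^sup>2) powr s) * ennreal (2 * A\<^sup>2 * real M / W)"
      using A0 W0 l0 Mpos lW4 by (intro mult_left_mono nsq_bump_le) auto
    also have "\<dots> = ennreal ((5 * N\<^sup>2) powr s * (2 * A\<^sup>2 * real M / W))"
      using A0 W0 by (subst ennreal_mult) auto
    also have "\<dots> \<le> ennreal (K * N powr - \<eta>)"
    proof (rule ennreal_leI)
      have N5: "(5 * N\<^sup>2) powr s = 5 powr s * N powr (2 * s)"
      proof -
        have "N\<^sup>2 = N powr 2" using N by simp
        then have "(N\<^sup>2) powr s = N powr (2 * s)" by (simp only: powr_powr)
        then show ?thesis unfolding powr_mult by simp
      qed
      have A2: "A\<^sup>2 = N powr \<eta>" unfolding A_def power2_eq_square powr_add[symmetric] by simp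
      have "2 * A\<^sup>2 * real M / W \<le> 2 * A\<^sup>2 * (4 / l) / W"
        using M4 A0 W0 by (intro divide_right_mono mult_left_mono) auto
      also have "\<dots> = 8 * N powr \<eta> / (l * W)" unfolding A2 by simp
      finally have "2 * A\<^sup>2 * real M / W \<le> 8 * N powr \<eta> / (c * N powr \<nu>)" unfolding lWN .
      then have "(5 * N\<^sup>2) powr s * (2 * A\<^sup>2 * real M / W) \<le> (5 * N\<^sup>2) powr s * (8 * N powr \<eta> / (c * N powr \<nu>))"
        by (intro mult_left_mono) auto
      also have "\<dots> = 8 * 5 powr s / c * (N powr (2 * s) * N powr \<eta> * N powr - \<nu>)"
        unfolding N5 by (simp add: powr_minus_divide)
      also have "N powr (2 * s) * N powr \<eta> * N powr - \<nu> = N powr - \<eta>"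
      proof -
        have "2 * s + \<eta> + - \<nu> = - \<eta>" by (simp add: \<eta>_def field_simps)
        then show ?thesis unfolding powr_add[symmetric] by (rule arg_cong)
      qed
      also have "8 * 5 powr s / c * N powr - \<eta> \<le> K * N powr - \<eta>"
        using c by (intro mult_right_mono) (auto simp: K_def)
      finally show "(5 * N\<^sup>2) powr s * (2 * A\<^sup>2 * real M / W) \<le> K * N powr - \<eta>" .
    qed
    finally have F1: "(\<integral>\<^sup>+\<xi>. ennreal ((1 + \<xi>\<^sup>2) powr s * (cmod (?F \<xi>))\<^sup>2) \<partial>lborel) \<le> ennreal (K * N powr - \<eta>)" .
    have "(\<integral>\<^sup>+\<xi>. ennreal (cmod (?F \<xi>)) \<partial>lborel) \<le> (\<integral>\<^sup>+\<xi>. ennreal (A / W * real M) * indicator {N..N + W} \<xi> \<partial>lborel)"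
      by (intro nn_integral_mono order.trans[OF ennreal_leI[OF cmod_bump_le]]) (use A0 W0 in \<open>auto simp: indicator_def\<close>)
    also have "\<dots> = ennreal (A / W * real M * W)"
      using A0 W0 by (simp add: nn_integral_cmult ennreal_mult[symmetric])
    also have "\<dots> \<le> ennreal (K * N powr \<kappa>)"
    proof (rule ennreal_leI)
      have "A / W * real M * W = A * real M" using W0 by simp
      also have "\<dots> \<le> A * (4 / c * N powr (q + 1 - a))" using M4 A0 unfolding M4' by (intro mult_left_mono) auto
      also have "\<dots> = 4 / c * N powr \<kappa>" unfolding A_def \<kappa>_def powr_add by simp
      also have "\<dots> \<le> K * N powr \<kappa>" using c by (intro mult_right_mono) (auto simp: K_def)
      finally show "A / W * real M * W \<le> K * N powr \<kappa>" .
    qed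
    finally have F2: "(\<integral>\<^sup>+\<xi>. ennreal (cmod (?F \<xi>)) \<partial>lborel) \<le> ennreal (K * N powr \<kappa>)" .
    have F3: "\<exists>t. c / a * N powr - q \<le> t \<and> t \<le> 2 * c / a * N powr - q \<and> N powr (\<eta> / 2) / 2 \<le> cmod (evolution a \<gamma> ?F t x)" if "x \<in> {0..1}" for x
      using bump_evolution_lower[OF a \<gamma> q c_def N l_def W_def M1 A0 lW that] by (simp add: A_def)
    show ?case using F0 F1 F2 F3 by (intro bexI[of _ ?F]) auto
  qed
  then show ?thesis using K c a \<eta>
    by (intro exI[of _ K] exI[of _ "c / a"] exI[of _ "2 * c / a"] exI[of _ \<kappa>] exI[of _ \<eta>]) simp
qed

lemma unbounded_evolution_exists:
  fixes a \<gamma> q s :: real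
  assumes a: "a > 1" and \<gamma>: "\<gamma> \<ge> 1" and q: "a - 1 \<le> q" "q < a" "a \<le> q * \<gamma>"
    and s: "s \<ge> 0" "2 * s < (a - q) / 2"
  shows "\<exists>g \<in> borel_measurable borel. (\<integral>\<^sup>+\<xi>. ennreal ((1 + \<xi>\<^sup>2) powr s * (cmod (g \<xi>))\<^sup>2) \<partial>lborel) < \<infinity> \<and>
    (\<forall>x\<in>{0..1}. \<exists>T. (\<forall>k. T k > 0) \<and> T \<longlonglongrightarrow> 0 \<and> (\<forall>k::nat. real k \<le> cmod (evolution a \<gamma> g (T k) x)))"
proof -
  define good where "good K c1 c2 \<kappa> \<eta> N F \<longleftrightarrow> F \<in> borel_measurable borel \<and> (\<forall>\<xi>. \<xi> \<notin> {N..2 * N} \<longrightarrow> F \<xi> = 0) \<and>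
      (\<integral>\<^sup>+\<xi>. ennreal ((1 + \<xi>\<^sup>2) powr s * (cmod (F \<xi>))\<^sup>2) \<partial>lborel) \<le> ennreal (K * N powr - \<eta>) \<and>
      (\<integral>\<^sup>+\<xi>. ennreal (cmod (F \<xi>)) \<partial>lborel) \<le> ennreal (K * N powr \<kappa>) \<and>
      (\<forall>x\<in>{0..1}. \<exists>t. c1 * N powr - q \<le> t \<and> t \<le> c2 * N powr - q \<and> N powr (\<eta> / 2) / 2 \<le> cmod (evolution a \<gamma> F t x))"
    for K c1 c2 \<kappa> \<eta> N :: real and F
  obtain K c1 c2 \<kappa> \<eta> where *: "K > 0 \<and> c1 > 0 \<and> c2 > 0 \<and> \<eta> > 0 \<and>
    (\<forall>\<^sub>F N in at_top. \<exists>F \<in> borel_measurable borel. (\<forall>\<xi>. \<xi> \<notin> {N..2 * N} \<longrightarrow> F \<xi> = 0) \<and>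
      (\<integral>\<^sup>+\<xi>. ennreal ((1 + \<xi>\<^sup>2) powr s * (cmod (F \<xi>))\<^sup>2) \<partial>lborel) \<le> ennreal (K * N powr - \<eta>) \<and>
      (\<integral>\<^sup>+\<xi>. ennreal (cmod (F \<xi>)) \<partial>lborel) \<le> ennreal (K * N powr \<kappa>) \<and>
      (\<forall>x\<in>{0..1}. \<exists>t. c1 * N powr - q \<le> t \<and> t \<le> c2 * N powr - q \<and> N powr (\<eta> / 2) / 2 \<le> cmod (evolution a \<gamma> F t x)))"
    using bump_family[OF a \<gamma> q s] by (elim exE) (rule that)
  then have K: "K > 0" and c12: "c1 > 0" "c2 > 0" and \<eta>: "\<eta> > 0" by simp_all
  have ev: "\<forall>\<^sub>F N in at_top. \<exists>F. good K c1 c2 \<kappa> \<eta> N F"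
    unfolding good_def Bex_def[symmetric] by (rule *[THEN conjunct2, THEN conjunct2, THEN conjunct2, THEN conjunct2])
  have q0: "q > 0" using q a by linarith
  \<comment> \<open>Demands on the next frequency \<open>r\<close>: support to the right of the
    earlier ones, summable Sobolev norms, a height exceeding the earlier contributions by
    \<open>k + 2\<close>, a contribution of at most \<open>(1/2) ^ k\<close> under the damping at
    any time used by an earlier term, and times that tend to 0. Each is satisfied by all large
    \<open>r\<close>.\<close>
  define P where "P f k r \<longleftrightarrow> r \<ge> 1 \<and> (\<exists>F. good K c1 c2 \<kappa> \<eta> r F) \<and> (\<forall>j\<in>{..<k}. 2 * f j < r) \<and>
    K * r powr - \<eta> \<le> (1/2) ^ k \<and> (real k + 2 + (\<Sum>j<k. K * f j powr \<kappa>) \<le> r powr (\<eta> / 2) / 2) \<and>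
    (\<forall>j\<in>{..<k}. K * r powr \<kappa> * exp (- ((c1 * f j powr - q) powr \<gamma>) * r powr a) \<le> (1/2) ^ k) \<and>
    c2 * r powr - q \<le> 1 / (real k + 1)" for f :: "nat \<Rightarrow> real" and k r
  have "\<exists>f. \<forall>k. P f k (f k)"
  proof (rule dependent_wellorder_choice)
    \<comment> \<open>The choice principle requires that the condition at \<open>k\<close> depend
      only on the values before \<open>k\<close>.\<close>
    show "P f k r = P f' k r" if "\<And>j. j < k \<Longrightarrow> f j = f' j" for r f f' k
    proof -
      have "(\<Sum>j<k. K * f j powr \<kappa>) = (\<Sum>j<k. K * f' j powr \<kappa>)" using that by (intro sum.cong) auto
      moreover have "(\<forall>j\<in>{..<k}. 2 * f j < r) \<longleftrightarrow> (\<forall>j\<in>{..<k}. 2 * f' j < r)" using that by simp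
      moreover have "(\<forall>j\<in>{..<k}. K * r powr \<kappa> * exp (- ((c1 * f j powr - q) powr \<gamma>) * r powr a) \<le> (1/2) ^ k)
        \<longleftrightarrow> (\<forall>j\<in>{..<k}. K * r powr \<kappa> * exp (- ((c1 * f' j powr - q) powr \<gamma>) * r powr a) \<le> (1/2) ^ k)" using that by simp
      ultimately show ?thesis by (simp only: P_def)
    qed
    fix k :: nat and f :: "nat \<Rightarrow> real"
    assume IH: "\<And>j. j < k \<Longrightarrow> P f j (f j)"
    have f1: "f j \<ge> 1" if "j < k" for j using IH[OF that] by (simp add: P_def)
    have e1: "\<forall>\<^sub>F r in at_top. K * r powr - \<eta> \<le> (1/2) ^ k"
    proof -
      have "((\<lambda>r. K * r powr - \<eta>) \<longlongrightarrow> 0) at_top" using \<eta> by real_asymp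
      from order_tendstoD(2)[OF this, of "(1/2) ^ k"] show ?thesis by (auto elim!: eventually_mono)
    qed
    have e2: "\<forall>\<^sub>F r in at_top. real k + 2 + (\<Sum>j<k. K * f j powr \<kappa>) \<le> r powr (\<eta> / 2) / 2"
    proof -
      have "filterlim (\<lambda>r::real. r powr (\<eta> / 2) / 2) at_top at_top" using \<eta> by real_asymp
      then show ?thesis unfolding filterlim_at_top by (rule spec)
    qed
    have e3: "\<forall>\<^sub>F r in at_top. \<forall>j\<in>{..<k}. K * r powr \<kappa> * exp (- ((c1 * f j powr - q) powr \<gamma>) * r powr a) \<le> (1/2) ^ k"
    proof (rule eventually_ball_finite, simp, intro ballI)
      fix j assume "j \<in> {..<k}"
      then have "f j \<ge> 1" using f1 by simp
      define w where "w = (c1 * f j powr - q) powr \<gamma>"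
      have w: "w > 0" using c12 \<open>f j \<ge> 1\<close> by (simp add: w_def)
      have "((\<lambda>r. K * r powr \<kappa> * exp (- w * r powr a)) \<longlongrightarrow> 0) at_top" using w a by real_asymp
      from order_tendstoD(2)[OF this, of "(1/2) ^ k"]
      show "\<forall>\<^sub>F r in at_top. K * r powr \<kappa> * exp (- ((c1 * f j powr - q) powr \<gamma>) * r powr a) \<le> (1/2) ^ k"
        unfolding w_def by (auto elim!: eventually_mono)
    qed
    have e4: "\<forall>\<^sub>F r in at_top. c2 * r powr - q \<le> 1 / (real k + 1)"
    proof -
      have "((\<lambda>r. c2 * r powr - q) \<longlongrightarrow> 0) at_top" using q0 by real_asymp
      from order_tendstoD(2)[OF this, of "1 / (real k + 1)"] show ?thesis by (auto elim!: eventually_mono)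
    qed
    have e5: "\<forall>\<^sub>F r in at_top. \<forall>j\<in>{..<k}. 2 * f j < r"
      by (rule eventually_ball_finite) (auto intro: eventually_gt_at_top)
    have "\<forall>\<^sub>F r in at_top. P f k r"
      using eventually_ge_at_top[of 1] ev e5 e1 e2 e3 e4
      unfolding P_def by (intro eventually_conj)
    then show "\<exists>r. P f k r" by (rule eventually_happens'[rotated]) simp
  qed
  then obtain N where PN: "\<And>k. P N k (N k)" by blast
  have N1: "N k \<ge> 1" for k using PN[of k] by (simp add: P_def)
  have Ninc: "2 * N j < N k" if "j < k" for j k using PN[of k] that by (auto simp: P_def)
  have "\<exists>F. \<forall>k. good K c1 c2 \<kappa> \<eta> (N k) (F k)"
    by (rule choice) (use PN in \<open>auto simp: P_def\<close>)
  then obtain F where F: "\<And>k. good K c1 c2 \<kappa> \<eta> (N k) (F k)" by blast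
  have Fm [measurable]: "F k \<in> borel_measurable borel" for k using F[of k] by (simp add: good_def)
  have Fsupp: "F k \<xi> = 0" if "\<xi> \<notin> {N k..2 * N k}" for k \<xi> using F[of k] that unfolding good_def by blast
  have disj: "F j \<xi> = 0" if "F k \<xi> \<noteq> 0" "j \<noteq> k" for j k \<xi>
  proof -
    have "\<xi> \<in> {N k..2 * N k}" using Fsupp that by blast
    then have "\<xi> \<notin> {N j..2 * N j}" using Ninc[of j k] Ninc[of k j] that(2) by (cases "j < k") auto
    then show ?thesis by (rule Fsupp)
  qed
  have F1: "(\<integral>\<^sup>+\<xi>. ennreal ((1 + \<xi>\<^sup>2) powr s * (cmod (F k \<xi>))\<^sup>2) \<partial>lborel) \<le> ennreal ((1/2) ^ k)" for k
  proof -
    have "(\<integral>\<^sup>+\<xi>. ennreal ((1 + \<xi>\<^sup>2) powr s * (cmod (F k \<xi>))\<^sup>2) \<partial>lborel) \<le> ennreal (K * N k powr - \<eta>)"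
      using F[of k] by (simp add: good_def)
    also have "\<dots> \<le> ennreal ((1/2) ^ k)" using PN[of k] by (intro ennreal_leI) (simp add: P_def)
    finally show ?thesis .
  qed
  have F2: "(\<integral>\<^sup>+\<xi>. ennreal (cmod (F k \<xi>)) \<partial>lborel) \<le> ennreal (K * N k powr \<kappa>)" for k
    using F[of k] by (simp add: good_def)
  \<comment> \<open>The supports are disjoint, so at each frequency at most one term of the series
    is nonzero.\<close>
  define g where "g \<xi> = (\<Sum>k. F k \<xi>)" for \<xi>
  have gm [measurable]: "g \<in> borel_measurable borel" unfolding g_def by measurable
  have geq: "g \<xi> = F k \<xi>" if "F k \<xi> \<noteq> 0" for k \<xi>
    unfolding g_def using disj[OF that] by (subst suminf_finite[of "{k}"]) auto
  have g0: "g \<xi> = 0" if "\<And>k. F k \<xi> = 0" for \<xi>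
    unfolding g_def using that by simp
  have half: "(\<Sum>k. ennreal ((1/2) ^ k)) = ennreal 2"
  proof -
    have "(\<Sum>k. ennreal ((1/2) ^ k)) = ennreal (\<Sum>k. (1/2) ^ k)"
      by (rule suminf_ennreal2[OF _ summable_geometric]) simp_all
    also have "(\<Sum>k. (1/2::real) ^ k) = 2" using suminf_geometric[of "1/2::real"] by simp
    finally show ?thesis .
  qed
  have gw: "(\<integral>\<^sup>+\<xi>. ennreal ((1 + \<xi>\<^sup>2) powr s * (cmod (g \<xi>))\<^sup>2) \<partial>lborel) < \<infinity>"
  proof -
    have "(\<integral>\<^sup>+\<xi>. ennreal ((1 + \<xi>\<^sup>2) powr s * (cmod (g \<xi>))\<^sup>2) \<partial>lborel)
      \<le> (\<integral>\<^sup>+\<xi>. (\<Sum>k. ennreal ((1 + \<xi>\<^sup>2) powr s * (cmod (F k \<xi>))\<^sup>2)) \<partial>lborel)"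
    proof (rule nn_integral_mono)
      fix \<xi>
      let ?t = "\<lambda>k. ennreal ((1 + \<xi>\<^sup>2) powr s * (cmod (F k \<xi>))\<^sup>2)"
      show "ennreal ((1 + \<xi>\<^sup>2) powr s * (cmod (g \<xi>))\<^sup>2) \<le> (\<Sum>k. ?t k)"
      proof (cases "\<exists>k. F k \<xi> \<noteq> 0")
        case True
        then obtain k where k: "F k \<xi> \<noteq> 0" by blast
        have "ennreal ((1 + \<xi>\<^sup>2) powr s * (cmod (g \<xi>))\<^sup>2) = sum ?t {k}" by (simp add: geq[OF k])
        also have "\<dots> \<le> (\<Sum>k. ?t k)" by (rule sum_le_suminf) auto
        finally show ?thesis .
      qed (simp add: g0)
    qed
    also have "\<dots> = (\<Sum>k. \<integral>\<^sup>+\<xi>. ennreal ((1 + \<xi>\<^sup>2) powr s * (cmod (F k \<xi>))\<^sup>2) \<partial>lborel)"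
      by (rule nn_integral_suminf) measurable
    also have "\<dots> \<le> (\<Sum>k. ennreal ((1/2) ^ k))" by (intro suminf_le F1) auto
    also have "\<dots> < \<infinity>" unfolding half by simp
    finally show ?thesis .
  qed
  have one_le: "1 \<le> (1 + \<xi>\<^sup>2) powr s" for \<xi> :: real using s by (simp add: ge_one_powr_ge_zero)
  have nsq_le: "nsq h \<le> (\<integral>\<^sup>+\<xi>. ennreal ((1 + \<xi>\<^sup>2) powr s * (cmod (h \<xi>))\<^sup>2) \<partial>lborel)" for h
    unfolding nsq_def
  proof (intro nn_integral_mono ennreal_leI)
    fix \<xi> show "(cmod (h \<xi>))\<^sup>2 \<le> (1 + \<xi>\<^sup>2) powr s * (cmod (h \<xi>))\<^sup>2"
      using mult_right_mono[OF one_le[of \<xi>], of "(cmod (h \<xi>))\<^sup>2"] by simp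
  qed
  have gn: "nsq g < \<infinity>" using nsq_le[of g] gw by (rule le_less_trans)
  have Fn: "nsq (F k) < \<infinity>" for k
    using order.trans[OF nsq_le F1[of k]] by (rule le_less_trans) simp
  have lower: "real k \<le> cmod (evolution a \<gamma> g t x)"
    if x: "x \<in> {0..1}" and t1: "c1 * N k powr - q \<le> t" and low: "N k powr (\<eta> / 2) / 2 \<le> cmod (evolution a \<gamma> (F k) t x)" for k t x
  proof -
    have t0: "t > 0" using t1 c12 N1[of k] by (smt (verit) mult_pos_pos powr_gt_zero)
    have tw: "t powr \<gamma> > 0" using t0 by simp
    define d where "d \<xi> = g \<xi> - F k \<xi>" for \<xi>
    have dm [measurable]: "d \<in> borel_measurable borel" unfolding d_def by measurable
    have dn: "nsq d < \<infinity>"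
      unfolding d_def using nsq_diff_le[OF gm Fm[of k]] by (rule le_less_trans) (use gn Fn[of k] in \<open>auto simp: ennreal_mult_less_top\<close>)
    \<comment> \<open>A budget for the contribution of term \<open>j\<close>: the undamped integral
      of its modulus if it is earlier, and \<open>(1/2) ^ j\<close> if it is later. The powers add
      up to 2, which is the 2 in the height condition of \<open>P\<close>.\<close>
    define b where "b j = (if j < k then K * N j powr \<kappa> else 0) + (1/2) ^ j" for j
    have b0: "b j \<ge> 0" for j using K by (simp add: b_def)
    define f where "f j \<xi> = (if j = k then 0 else cmod (F j \<xi>) * exp (- (t powr \<gamma>) * \<bar>\<xi>\<bar> powr a))" for j \<xi>
    have fm [measurable]: "f j \<in> borel_measurable borel" for j unfolding f_def by (cases "j = k") auto
    have fb: "(\<integral>\<^sup>+\<xi>. ennreal (f j \<xi>) \<partial>lborel) \<le> ennreal (b j)" for j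
    proof (cases "j < k")
      case True
      have "(\<integral>\<^sup>+\<xi>. ennreal (f j \<xi>) \<partial>lborel) \<le> (\<integral>\<^sup>+\<xi>. ennreal (cmod (F j \<xi>)) \<partial>lborel)"
        by (intro nn_integral_mono ennreal_leI) (auto simp: f_def mult_left_le)
      also have "\<dots> \<le> ennreal (K * N j powr \<kappa>)" by (rule F2)
      also have "\<dots> \<le> ennreal (b j)" using True by (intro ennreal_leI) (simp add: b_def)
      finally show ?thesis .
    next
      case False
      show ?thesis
      proof (cases "j = k")
        case True
        then show ?thesis by (simp add: f_def)
      next
        case jk: False
        with False have jk': "k < j" by simp
        define E where "E = exp (- ((c1 * N k powr - q) powr \<gamma>) * N j powr a)"
        have "(\<integral>\<^sup>+\<xi>. ennreal (f j \<xi>) \<partial>lborel) \<le> (\<integral>\<^sup>+\<xi>. ennreal (cmod (F j \<xi>)) * ennreal E \<partial>lborel)"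
        proof (rule nn_integral_mono)
          fix \<xi>
          show "ennreal (f j \<xi>) \<le> ennreal (cmod (F j \<xi>)) * ennreal E"
          proof (cases "\<xi> \<in> {N j..2 * N j}")
            case True
            have "(c1 * N k powr - q) powr \<gamma> \<le> t powr \<gamma>"
              using t1 c12 \<gamma> by (intro powr_mono2) auto
            moreover have "N j powr a \<le> \<bar>\<xi>\<bar> powr a" using True N1[of j] a by (intro powr_mono2) auto
            ultimately have "(c1 * N k powr - q) powr \<gamma> * N j powr a \<le> t powr \<gamma> * \<bar>\<xi>\<bar> powr a"
              by (intro mult_mono) auto
            then have "exp (- (t powr \<gamma>) * \<bar>\<xi>\<bar> powr a) \<le> E" by (simp add: E_def)
            then show ?thesis using jk by (subst ennreal_mult[symmetric]) (auto simp: f_def E_def intro!: ennreal_leI mult_left_mono)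
          qed (simp add: Fsupp f_def)
        qed
        also have "\<dots> = (\<integral>\<^sup>+\<xi>. ennreal (cmod (F j \<xi>)) \<partial>lborel) * ennreal E" by (rule nn_integral_multc) measurable
        also have "\<dots> \<le> ennreal (K * N j powr \<kappa>) * ennreal E" by (intro mult_right_mono F2) auto
        also have "\<dots> = ennreal (K * N j powr \<kappa> * E)" using K by (subst ennreal_mult) (auto simp: E_def)
        also have "\<dots> \<le> ennreal (b j)"
          using PN[of j] jk' unfolding P_def E_def by (intro ennreal_leI) (auto simp: b_def)
        finally show ?thesis .
      qed
    qed
    have "ennreal (cmod (evolution a \<gamma> d t x)) \<le> (\<integral>\<^sup>+\<xi>. ennreal (cmod (d \<xi> * (damped a (t powr \<gamma>) t \<xi> * cis (x * \<xi>)))) \<partial>lborel)"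
      unfolding evolution_def by (intro integral_norm_bound_ennreal integrable_evolution dn a tw) measurable
    also have "\<dots> \<le> (\<integral>\<^sup>+\<xi>. (\<Sum>j. ennreal (f j \<xi>)) \<partial>lborel)"
    proof (rule nn_integral_mono)
      fix \<xi>
      show "ennreal (cmod (d \<xi> * (damped a (t powr \<gamma>) t \<xi> * cis (x * \<xi>)))) \<le> (\<Sum>j. ennreal (f j \<xi>))"
      proof (cases "d \<xi> = 0")
        case False
        then obtain j where j: "F j \<xi> \<noteq> 0" using g0[of \<xi>] unfolding d_def by force
        then have jk: "j \<noteq> k" using False geq[of k \<xi>] by (auto simp: d_def)
        have "d \<xi> = F j \<xi>" unfolding d_def geq[OF j] using disj[OF j] jk by simp
        then have "ennreal (cmod (d \<xi> * (damped a (t powr \<gamma>) t \<xi> * cis (x * \<xi>)))) = sum (\<lambda>j. ennreal (f j \<xi>)) {j}"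
          using jk by (simp add: f_def norm_mult cmod_damped)
        also have "\<dots> \<le> (\<Sum>j. ennreal (f j \<xi>))" by (rule sum_le_suminf) auto
        finally show ?thesis .
      qed simp
    qed
    also have "\<dots> = (\<Sum>j. \<integral>\<^sup>+\<xi>. ennreal (f j \<xi>) \<partial>lborel)" by (rule nn_integral_suminf) measurable
    also have "\<dots> \<le> (\<Sum>j. ennreal (b j))" by (intro suminf_le fb) auto
    also have "\<dots> = ennreal ((\<Sum>j<k. K * N j powr \<kappa>) + 2)"
    proof -
      have "(\<lambda>j. if j < k then K * N j powr \<kappa> else 0) sums (\<Sum>j<k. K * N j powr \<kappa>)"
        using sums_If_finite_set[of "{..<k}" "\<lambda>j. K * N j powr \<kappa>"] by simp
      moreover have "(\<lambda>j. (1/2::real) ^ j) sums 2" using geometric_sums[of "1/2::real"] by simp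
      ultimately have "b sums ((\<Sum>j<k. K * N j powr \<kappa>) + 2)" unfolding b_def[abs_def] by (rule sums_add)
      then show ?thesis using b0 by (simp add: suminf_ennreal2 sums_iff)
    qed
    finally have "cmod (evolution a \<gamma> d t x) \<le> (\<Sum>j<k. K * N j powr \<kappa>) + 2"
      using K by (subst (asm) ennreal_le_iff) (auto intro!: add_nonneg_nonneg sum_nonneg)
    moreover have "evolution a \<gamma> g t x = evolution a \<gamma> (F k) t x + evolution a \<gamma> d t x"
    proof -
      have "evolution a \<gamma> g t x = (\<integral>\<xi>. F k \<xi> * (damped a (t powr \<gamma>) t \<xi> * cis (x * \<xi>)) + d \<xi> * (damped a (t powr \<gamma>) t \<xi> * cis (x * \<xi>)) \<partial>lborel)"
        unfolding evolution_def by (simp add: d_def distrib_right[symmetric])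
      then show ?thesis
        unfolding evolution_def
        by (simp add: Bochner_Integration.integral_add integrable_evolution[OF Fm Fn a tw] integrable_evolution[OF dm dn a tw])
    qed
    moreover have "real k + 2 + (\<Sum>j<k. K * N j powr \<kappa>) \<le> N k powr (\<eta> / 2) / 2" using PN[of k] by (simp add: P_def)
    ultimately show ?thesis
      using low norm_triangle_ineq2[of "evolution a \<gamma> (F k) t x" "- evolution a \<gamma> d t x"] by simp
  qed
  have "\<exists>T. (\<forall>k. T k > 0) \<and> T \<longlonglongrightarrow> 0 \<and> (\<forall>k::nat. real k \<le> cmod (evolution a \<gamma> g (T k) x))" if x: "x \<in> {0..1}" for x
  proof -
    have "\<exists>T. \<forall>k. c1 * N k powr - q \<le> T k \<and> T k \<le> c2 * N k powr - q \<and> N k powr (\<eta> / 2) / 2 \<le> cmod (evolution a \<gamma> (F k) (T k) x)"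
      by (rule choice) (use F x in \<open>auto simp: good_def\<close>)
    then obtain T where T: "\<And>k. c1 * N k powr - q \<le> T k" "\<And>k. T k \<le> c2 * N k powr - q"
      "\<And>k. N k powr (\<eta> / 2) / 2 \<le> cmod (evolution a \<gamma> (F k) (T k) x)" by blast
    have T0: "T k > 0" for k using T(1)[of k] c12 N1[of k] by (smt (verit) mult_pos_pos powr_gt_zero)
    have T1: "T k \<le> 1 / (real k + 1)" for k using T(2)[of k] PN[of k] by (simp add: P_def)
    have "(\<lambda>k. 1 / (real k + 1)) \<longlonglongrightarrow> 0" by real_asymp
    then have "T \<longlonglongrightarrow> 0"
      by (rule Lim_null_comparison[rotated]) (use T0 T1 in \<open>auto simp: less_imp_le\<close>)
    then show ?thesis using T0 lower[OF x T(1,3)] by (intro exI[of _ T]) auto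
  qed
  then show ?thesis using gw by (intro bexI[of _ g]) auto
qed

section \<open>The convergence exponent\<close>

lemma lebesgue_measurable_ex_borel:
  fixes f :: "real \<Rightarrow> complex"
  assumes f: "f \<in> borel_measurable lebesgue"
  shows "\<exists>f' \<in> borel_measurable borel. AE x in lborel. f x = f' x"
proof -
  have "(\<lambda>x. Re (f x)) \<in> borel_measurable lebesgue" "(\<lambda>x. Im (f x)) \<in> borel_measurable lebesgue"
    using f by measurable
  then obtain u v where uv: "u \<in> borel_measurable lborel" "v \<in> borel_measurable lborel"
    and AE: "AE x in lborel. Re (f x) = u x" "AE x in lborel. Im (f x) = v x"
    using completion_ex_borel_measurable_real by metis
  have "(\<lambda>x. Complex (u x) (v x)) = (\<lambda>x. of_real (u x) + \<i> * of_real (v x))"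
    by (rule ext) (simp add: complex_eq_iff)
  moreover have "(\<lambda>x. of_real (u x) + \<i> * of_real (v x)) \<in> borel_measurable borel" using uv by simp
  ultimately have "(\<lambda>x. Complex (u x) (v x)) \<in> borel_measurable borel" by simp
  moreover have "AE x in lborel. f x = Complex (u x) (v x)"
    using AE by eventually_elim (simp add: complex_eq_iff)
  ultimately show ?thesis by (intro bexI[of _ "\<lambda>x. Complex (u x) (v x)"])
qed

lemma integrable_lebesgue_iff:
  fixes f f' :: "real \<Rightarrow> real"
  assumes f': "f' \<in> borel_measurable borel" and f: "f \<in> borel_measurable lebesgue"
    and AE: "AE x in lborel. f x = f' x" and f0: "\<And>x. f' x \<ge> 0"
  shows "integrable lebesgue f \<longleftrightarrow> (\<integral>\<^sup>+x. ennreal (f' x) \<partial>lborel) < \<infinity>"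
proof -
  have "integrable lebesgue f \<longleftrightarrow> integrable lebesgue f'"
    using f f' AE_completion[OF AE] by (intro integrable_cong_AE) (auto intro: measurable_completion)
  also have "\<dots> \<longleftrightarrow> integrable lborel f'" using f' by (intro integrable_completion) simp
  also have "\<dots> \<longleftrightarrow> (\<integral>\<^sup>+x. ennreal (f' x) \<partial>lborel) < \<infinity>"
    using f' f0 by (simp add: integrable_iff_bounded)
  finally show ?thesis .
qed

lemma integral_lebesgue_eq:
  fixes f f' :: "real \<Rightarrow> complex"
  assumes f': "f' \<in> borel_measurable borel" and f: "f \<in> borel_measurable lebesgue"
    and AE: "AE x in lborel. f x = f' x"
  shows "(\<integral>x. f x \<partial>lebesgue) = (\<integral>x. f' x \<partial>lborel)"
proof -
  have "(\<integral>x. f x \<partial>lebesgue) = (\<integral>x. f' x \<partial>lebesgue)"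
    using f f' AE_completion[OF AE] by (intro integral_cong_AE) (auto intro: measurable_completion)
  also have "\<dots> = (\<integral>x. f' x \<partial>lborel)" using f' by (intro integral_completion) simp
  finally show ?thesis .
qed

lemma measurable_lebesgue_of_borel: "f \<in> borel_measurable borel \<Longrightarrow> f \<in> borel_measurable lebesgue"
  by (rule measurable_completion) simp

lemma L2_iff:
  fixes f f' :: "real \<Rightarrow> complex"
  assumes f': "f' \<in> borel_measurable borel" and f: "f \<in> borel_measurable lebesgue"
    and AE: "AE x in lborel. f x = f' x"
  shows "f \<in> L2 \<longleftrightarrow> nsq f' < \<infinity>"
proof -
  have "integrable lebesgue (\<lambda>x. (cmod (f x))\<^sup>2) \<longleftrightarrow> (\<integral>\<^sup>+x. ennreal ((cmod (f' x))\<^sup>2) \<partial>lborel) < \<infinity>"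
    using f f' AE by (intro integrable_lebesgue_iff) (auto elim: eventually_mono)
  then show ?thesis using f by (simp add: L2_def nsq_def)
qed

lemma fourier_integral_eq_FI:
  fixes f f' :: "real \<Rightarrow> complex"
  assumes f': "f' \<in> borel_measurable borel" and f: "f \<in> borel_measurable lebesgue"
    and AE: "AE x in lborel. f x = f' x"
  shows "fourier_integral (\<lambda>x. indicator {- real n..real n} x * f x) \<xi> = FI (trunc n f') \<xi>"
  unfolding fourier_integral_def FI_def
proof (rule integral_lebesgue_eq)
  show "(\<lambda>x. trunc n f' x * cis (- (x * \<xi>))) \<in> borel_measurable borel" using f' by measurable
  have "(\<lambda>x. indicator {- real n..real n} x :: complex) \<in> borel_measurable lebesgue"
    "(\<lambda>x. exp (- (\<i> * complex_of_real (x * \<xi>)))) \<in> borel_measurable lebesgue"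
    by (rule measurable_lebesgue_of_borel; measurable)+
  then show "(\<lambda>x. indicator {- real n..real n} x * f x * exp (- (\<i> * complex_of_real (x * \<xi>)))) \<in> borel_measurable lebesgue"
    using f by (intro borel_measurable_times)
  show "AE x in lborel. indicator {- real n..real n} x * f x * exp (- (\<i> * complex_of_real (x * \<xi>))) = trunc n f' x * cis (- (x * \<xi>))"
    using AE by eventually_elim (simp add: trunc_def cis_conv_exp)
qed

lemma is_L2_fourier_iff:
  fixes f f' g g' :: "real \<Rightarrow> complex"
  assumes f': "f' \<in> borel_measurable borel" and f: "f \<in> borel_measurable lebesgue"
    and AEf: "AE x in lborel. f x = f' x"
    and g': "g' \<in> borel_measurable borel" and g: "g \<in> L2" and AEg: "AE x in lborel. g x = g' x"
  shows "is_L2_fourier f g \<longleftrightarrow> FT f' g'"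
proof -
  have "(\<integral>\<^sup>+\<xi>. ennreal ((cmod (fourier_integral (\<lambda>x. indicator {- real n..real n} x * f x) \<xi> - g \<xi>))\<^sup>2) \<partial>lebesgue)
    = nsq (\<lambda>\<xi>. FI (trunc n f') \<xi> - g' \<xi>)" for n
    unfolding nn_integral_completion nsq_def fourier_integral_eq_FI[OF f' f AEf]
    using AEg by (intro nn_integral_cong_AE) (auto elim: eventually_mono)
  then show ?thesis using g g' by (simp add: is_L2_fourier_def FT_def)
qed

text \<open>\<open>fourier\<close> is an arbitrary choice among the admissible limits. The given
  \<open>g'\<close> shows that there is one, and \<open>FT_unique\<close> identifies the chosen one
  with it almost everywhere.\<close>

lemma fourier_representative:
  fixes f f' g' :: "real \<Rightarrow> complex"
  assumes f: "f \<in> L2" and f': "f' \<in> borel_measurable borel" and AEf: "AE x in lborel. f x = f' x" and FT: "FT f' g'"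
  shows "fourier f \<in> borel_measurable lebesgue" "AE \<xi> in lborel. fourier f \<xi> = g' \<xi>"
proof -
  have fm: "f \<in> borel_measurable lebesgue" using f by (simp add: L2_def)
  have nf: "nsq f' < \<infinity>" using L2_iff[OF f' fm AEf] f by simp
  have g'm: "g' \<in> borel_measurable borel" using FT by (simp add: FT_def)
  have g'L: "g' \<in> L2"
    using L2_iff[OF g'm measurable_lebesgue_of_borel[OF g'm]] FT_nsq_finite[OF f' nf FT] by simp
  have "is_L2_fourier f g'" using is_L2_fourier_iff[OF f' fm AEf g'm g'L] FT by simp
  then have F: "is_L2_fourier f (fourier f)" unfolding fourier_def by (rule someI[where P = "is_L2_fourier f"])
  then have FL: "fourier f \<in> L2" by (simp add: is_L2_fourier_def)
  then show Fm: "fourier f \<in> borel_measurable lebesgue" by (simp add: L2_def)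
  obtain h where h: "h \<in> borel_measurable borel" "AE \<xi> in lborel. fourier f \<xi> = h \<xi>"
    using lebesgue_measurable_ex_borel[OF Fm] by blast
  have "FT f' h" using is_L2_fourier_iff[OF f' fm AEf h(1) FL h(2)] F by simp
  from FT_unique[OF f' this FT] h(2) show "AE \<xi> in lborel. fourier f \<xi> = g' \<xi>"
    by eventually_elim simp
qed

text \<open>Convergence and Sobolev regularity depend on \<open>f\<close> and on the choice of its
  transform only up to null sets, so Borel representatives may be substituted.\<close>

lemma
  fixes f f' g' :: "real \<Rightarrow> complex"
  assumes f: "f \<in> L2" and f': "f' \<in> borel_measurable borel" and AEf: "AE x in lborel. f x = f' x" and FT: "FT f' g'"
  shows ae_convergent_iff: "ae_convergent a \<gamma> f \<longleftrightarrow>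
      (AE x in lborel. ((\<lambda>t. evolution a \<gamma> g' t x) \<longlongrightarrow> 2 * pi * f' x) (at_right 0))"
    and sobolev_iff: "f \<in> sobolev s \<longleftrightarrow> (\<integral>\<^sup>+\<xi>. ennreal ((1 + \<xi>\<^sup>2) powr s * (cmod (g' \<xi>))\<^sup>2) \<partial>lborel) < \<infinity>"
proof -
  note Fm = fourier_representative(1)[OF f f' AEf FT] and AEg = fourier_representative(2)[OF f f' AEf FT]
  have g'm [measurable]: "g' \<in> borel_measurable borel" using FT by (simp add: FT_def)
  have Peq: "P a \<gamma> t f x = evolution a \<gamma> g' t x" for t x
    unfolding P_def evolution_def
  proof (rule integral_lebesgue_eq)
    show "(\<lambda>\<xi>. g' \<xi> * (damped a (t powr \<gamma>) t \<xi> * cis (x * \<xi>))) \<in> borel_measurable borel" by measurable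
    have "(\<lambda>\<xi>. exp (\<i> * complex_of_real (t * \<bar>\<xi>\<bar> powr a))) \<in> borel_measurable lebesgue"
      "(\<lambda>\<xi>. complex_of_real (exp (- (t powr \<gamma>) * \<bar>\<xi>\<bar> powr a))) \<in> borel_measurable lebesgue"
      "(\<lambda>\<xi>. exp (\<i> * complex_of_real (x * \<xi>))) \<in> borel_measurable lebesgue"
      by (rule measurable_lebesgue_of_borel; measurable)+
    then show "(\<lambda>\<xi>. fourier f \<xi> * exp (\<i> * complex_of_real (t * \<bar>\<xi>\<bar> powr a)) * complex_of_real (exp (- (t powr \<gamma>) * \<bar>\<xi>\<bar> powr a))
        * exp (\<i> * complex_of_real (x * \<xi>))) \<in> borel_measurable lebesgue"
      by (intro borel_measurable_times Fm)
    show "AE \<xi> in lborel. fourier f \<xi> * exp (\<i> * complex_of_real (t * \<bar>\<xi>\<bar> powr a)) * complex_of_real (exp (- (t powr \<gamma>) * \<bar>\<xi>\<bar> powr a))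
        * exp (\<i> * complex_of_real (x * \<xi>)) = g' \<xi> * (damped a (t powr \<gamma>) t \<xi> * cis (x * \<xi>))"
      using AEg by eventually_elim (simp only: damped_def cis_conv_exp mult_ac)
  qed
  have "ae_convergent a \<gamma> f \<longleftrightarrow> (AE x in lborel. ((\<lambda>t. evolution a \<gamma> g' t x) \<longlongrightarrow> 2 * complex_of_real pi * f x) (at_right 0))"
    unfolding ae_convergent_def Peq AE_completion_iff ..
  also have "\<dots> \<longleftrightarrow> (AE x in lborel. ((\<lambda>t. evolution a \<gamma> g' t x) \<longlongrightarrow> 2 * pi * f' x) (at_right 0))"
  proof
    assume "AE x in lborel. ((\<lambda>t. evolution a \<gamma> g' t x) \<longlongrightarrow> 2 * complex_of_real pi * f x) (at_right 0)"
    with AEf show "AE x in lborel. ((\<lambda>t. evolution a \<gamma> g' t x) \<longlongrightarrow> 2 * pi * f' x) (at_right 0)"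
      by eventually_elim simp
  next
    assume "AE x in lborel. ((\<lambda>t. evolution a \<gamma> g' t x) \<longlongrightarrow> 2 * pi * f' x) (at_right 0)"
    with AEf show "AE x in lborel. ((\<lambda>t. evolution a \<gamma> g' t x) \<longlongrightarrow> 2 * complex_of_real pi * f x) (at_right 0)"
      by eventually_elim simp
  qed
  finally show "ae_convergent a \<gamma> f \<longleftrightarrow> (AE x in lborel. ((\<lambda>t. evolution a \<gamma> g' t x) \<longlongrightarrow> 2 * pi * f' x) (at_right 0))" .
  have "integrable lebesgue (\<lambda>\<xi>. (1 + \<xi>\<^sup>2) powr s * (cmod (fourier f \<xi>))\<^sup>2) \<longleftrightarrow>
    (\<integral>\<^sup>+\<xi>. ennreal ((1 + \<xi>\<^sup>2) powr s * (cmod (g' \<xi>))\<^sup>2) \<partial>lborel) < \<infinity>"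
  proof (rule integrable_lebesgue_iff)
    have Fn: "(\<lambda>\<xi>. cmod (fourier f \<xi>)) \<in> borel_measurable lebesgue" using Fm by measurable
    have "(\<lambda>\<xi>. (1 + \<xi>\<^sup>2) powr s) \<in> borel_measurable lebesgue"
      by (rule measurable_lebesgue_of_borel; measurable)
    then show "(\<lambda>\<xi>. (1 + \<xi>\<^sup>2) powr s * (cmod (fourier f \<xi>))\<^sup>2) \<in> borel_measurable lebesgue"
      by (intro borel_measurable_times borel_measurable_power Fn)
    show "AE x in lborel. (1 + x\<^sup>2) powr s * (cmod (fourier f x))\<^sup>2 = (1 + x\<^sup>2) powr s * (cmod (g' x))\<^sup>2"
      using AEg by eventually_elim simp
  qed auto
  then show "f \<in> sobolev s \<longleftrightarrow> (\<integral>\<^sup>+\<xi>. ennreal ((1 + \<xi>\<^sup>2) powr s * (cmod (g' \<xi>))\<^sup>2) \<partial>lborel) < \<infinity>"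
    using f by (simp add: sobolev_def)
qed

lemma L2_representatives:
  assumes "f \<in> L2"
  obtains f' g' where "f' \<in> borel_measurable borel" "AE x in lborel. f x = f' x" "nsq f' < \<infinity>" "FT f' g'"
proof -
  have fm: "f \<in> borel_measurable lebesgue" using assms by (simp add: L2_def)
  obtain f' where f': "f' \<in> borel_measurable borel" "AE x in lborel. f x = f' x"
    using lebesgue_measurable_ex_borel[OF fm] by blast
  have n: "nsq f' < \<infinity>" using L2_iff[OF f'(1) fm f'(2)] assms by simp
  obtain g' where "FT f' g'" using FT_exists[OF f'(1) n] by blast
  with f' n show thesis by (rule that)
qed

lemma ae_convergent_L2:
  assumes "0 < \<gamma>" "\<gamma> \<le> 1" "a > 1" and f: "f \<in> L2"
  shows "ae_convergent a \<gamma> f"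
proof -
  obtain f' g' where *: "f' \<in> borel_measurable borel" "AE x in lborel. f x = f' x" "nsq f' < \<infinity>" "FT f' g'"
    using L2_representatives[OF f] .
  show ?thesis
    unfolding ae_convergent_iff[OF f *(1,2,4)] evolution_def
    by (rule small_gamma_convergence[OF assms(3,1,2) *(1,3,4)])
qed

text \<open>\<open>\<sigma>\<close> is kept apart from \<open>2 * s\<close> so that it can be capped
  at \<open>1/2\<close> for large \<open>s\<close>. The inequality \<open>\<bar>\<xi>\<bar> powr
  \<sigma> \<le> (1 + \<xi>\<^sup>2) powr s\<close> leads from the Sobolev norm to the homogeneous
  one.\<close>

lemma ae_convergent_sobolev:
  assumes a: "a > 1" and \<gamma>: "\<gamma> > 0" and \<sigma>: "0 < \<sigma>" "\<sigma> \<le> 1/2" "\<sigma> \<le> 2 * s"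
    and crit: "\<sigma> = 1/2 \<or> (\<gamma> * (a - 1) < a \<and> a * (\<gamma> - 1) < 2 * \<gamma> * \<sigma>)"
    and f: "f \<in> sobolev s"
  shows "ae_convergent a \<gamma> f"
proof -
  have f2: "f \<in> L2" using f by (simp add: sobolev_def)
  obtain f' g' where *: "f' \<in> borel_measurable borel" "AE x in lborel. f x = f' x" "nsq f' < \<infinity>" "FT f' g'"
    using L2_representatives[OF f2] .
  have "weighted_nsq \<sigma> g' \<le> (\<integral>\<^sup>+\<xi>. ennreal ((1 + \<xi>\<^sup>2) powr s * (cmod (g' \<xi>))\<^sup>2) \<partial>lborel)"
    unfolding weighted_nsq_def
  proof (intro nn_integral_mono ennreal_leI mult_right_mono)
    fix \<xi> :: real
    have "\<bar>\<xi>\<bar> powr \<sigma> = (\<xi>\<^sup>2) powr (\<sigma> / 2)"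
    proof (cases "\<xi> = 0")
      case False
      then have "\<xi>\<^sup>2 = \<bar>\<xi>\<bar> powr 2" by simp
      then show ?thesis by (simp add: powr_powr del: powr_numeral)
    qed simp
    also have "\<dots> \<le> (1 + \<xi>\<^sup>2) powr (\<sigma> / 2)" using \<sigma> by (intro powr_mono2) auto
    also have "\<dots> \<le> (1 + \<xi>\<^sup>2) powr s" using \<sigma> by (intro powr_mono) auto
    finally show "\<bar>\<xi>\<bar> powr \<sigma> \<le> (1 + \<xi>\<^sup>2) powr s" .
  qed simp
  also have "\<dots> < \<infinity>" using f sobolev_iff[OF f2 *(1,2,4)] by simp
  finally have "weighted_nsq \<sigma> g' < \<infinity>" .
  then show ?thesis
    unfolding ae_convergent_iff[OF f2 *(1,2,4)]
    by (intro large_smoothness_convergence[OF a \<gamma> \<sigma>(1,2) crit *(1,3,4)])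
qed

text \<open>The bound on \<open>s\<close> equals \<open>(a - q) / 4\<close>. In \<open>q\<close>,
  the entry \<open>a / \<gamma>\<close> keeps the damping harmless and the entry
  \<open>a - 1\<close> keeps the spacing of the translates at most 1.\<close>

lemma not_ae_convergent_sobolev:
  assumes a: "a > 1" and \<gamma>: "\<gamma> > 1" and s: "s \<ge> 0" "s < min (1/4 * a * (1 - 1/\<gamma>)) (1/4)"
  shows "\<exists>f \<in> sobolev s. \<not> ae_convergent a \<gamma> f"
proof -
  define q where "q = max (a / \<gamma>) (a - 1)"
  have q: "a - 1 \<le> q" "q < a" "a \<le> q * \<gamma>"
  proof -
    show "a - 1 \<le> q" by (simp add: q_def)
    show "q < a" using a \<gamma> by (simp add: q_def field_simps)
    have "a / \<gamma> * \<gamma> \<le> q * \<gamma>" using \<gamma> by (intro mult_right_mono) (auto simp: q_def)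
    then show "a \<le> q * \<gamma>" using \<gamma> by simp
  qed
  have s2: "2 * s < (a - q) / 2"
    using s(2) a \<gamma> by (auto simp: q_def max_def field_simps)
  have \<gamma>1: "\<gamma> \<ge> 1" using \<gamma> by simp
  obtain g where gm: "g \<in> borel_measurable borel"
    and gw: "(\<integral>\<^sup>+\<xi>. ennreal ((1 + \<xi>\<^sup>2) powr s * (cmod (g \<xi>))\<^sup>2) \<partial>lborel) < \<infinity>"
    and T: "\<And>x. x \<in> {0..1} \<Longrightarrow> \<exists>T. (\<forall>k. T k > 0) \<and> T \<longlonglongrightarrow> 0 \<and> (\<forall>k::nat. real k \<le> cmod (evolution a \<gamma> g (T k) x))"
    using unbounded_evolution_exists[OF a \<gamma>1 q s(1) s2] by blast
  have "nsq g \<le> (\<integral>\<^sup>+\<xi>. ennreal ((1 + \<xi>\<^sup>2) powr s * (cmod (g \<xi>))\<^sup>2) \<partial>lborel)"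
    unfolding nsq_def
  proof (intro nn_integral_mono ennreal_leI)
    fix \<xi> :: real
    have "1 \<le> (1 + \<xi>\<^sup>2) powr s" using s by (simp add: ge_one_powr_ge_zero)
    then show "(cmod (g \<xi>))\<^sup>2 \<le> (1 + \<xi>\<^sup>2) powr s * (cmod (g \<xi>))\<^sup>2"
      using mult_right_mono[of 1 "(1 + \<xi>\<^sup>2) powr s" "(cmod (g \<xi>))\<^sup>2"] by simp
  qed
  then have gn: "nsq g < \<infinity>" using gw by (rule le_less_trans)
  obtain f where fm: "f \<in> borel_measurable borel" and fn: "nsq f < \<infinity>" and FT: "FT f g"
    using FT_surj[OF gm gn] by blast
  have AEf: "AE x in lborel. f x = f x" by simp
  have f2: "f \<in> L2" using L2_iff[OF fm measurable_lebesgue_of_borel[OF fm] AEf] fn by simp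
  have "f \<in> sobolev s" using sobolev_iff[OF f2 fm AEf FT] gw by simp
  moreover have "\<not> ae_convergent a \<gamma> f"
  proof
    assume "ae_convergent a \<gamma> f"
    then have AE: "AE x in lborel. ((\<lambda>t. evolution a \<gamma> g t x) \<longlongrightarrow> 2 * pi * f x) (at_right 0)"
      unfolding ae_convergent_iff[OF f2 fm AEf FT] .
    \<comment> \<open>Unboundedness along one sequence of times excludes every limit. This happens
      at each point of the unit interval, which is not a null set.\<close>
    have "\<not> ((\<lambda>t. evolution a \<gamma> g t x) \<longlongrightarrow> L) (at_right 0)" if x: "x \<in> {0..1}" for x L
    proof
      assume L: "((\<lambda>t. evolution a \<gamma> g t x) \<longlongrightarrow> L) (at_right 0)"
      obtain T where T0: "\<And>k. T k > 0" "T \<longlonglongrightarrow> 0" and big: "\<And>k::nat. real k \<le> cmod (evolution a \<gamma> g (T k) x)"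
        using T[OF x] by blast
      have "filterlim T (at_right 0) sequentially"
        using T0(2) by (auto simp: filterlim_at T0(1) T0(1)[THEN less_imp_neq, symmetric])
      from filterlim_compose[OF L this] have "(\<lambda>k. evolution a \<gamma> g (T k) x) \<longlonglongrightarrow> L" .
      then have "Bseq (\<lambda>k. evolution a \<gamma> g (T k) x)" by (intro convergent_imp_Bseq convergentI)
      then obtain B where B: "\<And>k. cmod (evolution a \<gamma> g (T k) x) \<le> B" by (auto simp: Bseq_def)
      obtain k :: nat where "B < real k" using reals_Archimedean2 by blast
      then show False using B[of k] big[of k] by linarith
    qed
    then have "AE x in lborel. x \<notin> {0..1::real}"
      using AE by (auto elim!: eventually_mono)
    then have "emeasure lborel {0..1::real} = 0"
      by (subst (asm) AE_iff_measurable[of "{0..1}"]) auto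
    then show False by simp
  qed
  ultimately show ?thesis by blast
qed

theorem theorem1p3:
  fixes a \<gamma> :: real
  assumes "\<gamma> > 0" and "a > 1"
  shows "convergence_exponents a \<gamma> \<noteq> {}
    \<and> Inf (convergence_exponents a \<gamma>) = min (1/4 * a * max 0 (1 - 1/\<gamma>)) (1/4)
    \<and> (\<gamma> \<le> 1 \<longrightarrow> (\<forall>f \<in> L2. ae_convergent a \<gamma> f))
    \<and> (\<gamma> \<ge> a / (a - 1) \<longrightarrow> (\<forall>f \<in> sobolev (1/4). ae_convergent a \<gamma> f))"
proof -
  define c where "c = min (1/4 * a * max 0 (1 - 1/\<gamma>)) (1/4)"
  have c0: "c \<ge> 0" using assms by (simp add: c_def)
  have above: "s \<in> convergence_exponents a \<gamma>" if s: "s > c" for s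
  proof -
    have "ae_convergent a \<gamma> f" if f: "f \<in> sobolev s" for f
    proof (cases "\<gamma> \<le> 1")
      case True
      then show ?thesis using f assms by (intro ae_convergent_L2) (auto simp: sobolev_def)
    next
      case False
      then have m: "max 0 (1 - 1/\<gamma>) = 1 - 1/\<gamma>" by simp
      show ?thesis
      proof (rule ae_convergent_sobolev[OF assms(2,1) _ _ _ _ f, of "min (2 * s) (1/2)"])
        show "min (2 * s) (1/2) = 1/2 \<or> \<gamma> * (a - 1) < a \<and> a * (\<gamma> - 1) < 2 * \<gamma> * min (2 * s) (1/2)"
        proof (cases "2 * s < 1/2")
          case True
          \<comment> \<open>For \<open>s < 1/4\<close> the minimum \<open>c\<close> can be below
            \<open>s\<close> only through its first entry \<open>X / 4\<close>. Then
            \<open>X < 4 * s < 1\<close>, and multiplied by \<open>\<gamma>\<close> the inequalities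
            \<open>X < 1\<close> and \<open>X < 4 * s\<close> are the two required ones.\<close>
          define X where "X = a * (1 - 1/\<gamma>)"
          have "c = min (X / 4) (1/4)" unfolding c_def m X_def by simp
          then have "X < 4 * s" "4 * s < 1" using s True by (auto simp: min_less_iff_disj)
          then have "a * (1 - 1/\<gamma>) < 4 * s" "4 * s < 1" by (simp_all only: X_def)
          then have "a * (1 - 1/\<gamma>) * \<gamma> < 4 * s * \<gamma>" "4 * s * \<gamma> < 1 * \<gamma>"
            using assms by (simp_all only: mult_less_cancel_right_pos)
          moreover have "a * (1 - 1/\<gamma>) * \<gamma> = a * (\<gamma> - 1)" using assms by (simp add: field_simps)
          ultimately show ?thesis using True by (simp add: algebra_simps)
        qed simp
      qed (use s c0 in auto)
    qed
    then show ?thesis using s c0 by (simp add: convergence_exponents_def)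
  qed
  have below: "c \<le> s" if s: "s \<in> convergence_exponents a \<gamma>" for s
  proof (rule ccontr)
    assume sc: "\<not> c \<le> s"
    have s0: "s > 0" using s by (simp add: convergence_exponents_def)
    \<comment> \<open>For \<open>\<gamma> \<le> 1\<close> the value \<open>c\<close> is 0, and no
      positive exponent lies below it.\<close>
    have \<gamma>1: "\<gamma> > 1"
    proof (rule ccontr)
      assume "\<not> \<gamma> > 1"
      then have "1 - 1/\<gamma> \<le> 0" using assms by (simp add: field_simps)
      then have "c = 0" by (simp add: c_def)
      then show False using sc s0 by simp
    qed
    then have "max 0 (1 - 1/\<gamma>) = 1 - 1/\<gamma>" by simp
    then have "s < min (1/4 * a * (1 - 1/\<gamma>)) (1/4)" using sc by (simp only: c_def not_le)
    then obtain f where "f \<in> sobolev s" "\<not> ae_convergent a \<gamma> f"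
      using not_ae_convergent_sobolev[OF assms(2) \<gamma>1 less_imp_le[OF s0]] by blast
    then show False using s by (simp add: convergence_exponents_def)
  qed
  have ne: "convergence_exponents a \<gamma> \<noteq> {}" using above[of "c + 1"] by auto
  have "Inf (convergence_exponents a \<gamma>) = c"
  proof (rule cInf_eq_non_empty[OF ne below])
    fix y assume y: "\<And>x. x \<in> convergence_exponents a \<gamma> \<Longrightarrow> y \<le> x"
    show "y \<le> c"
    proof (rule ccontr)
      assume "\<not> y \<le> c"
      then have cy: "c < (c + y) / 2" "(c + y) / 2 < y" by auto
      from y[OF above[OF cy(1)]] cy(2) show False by simp
    qed
  qed
  moreover have "ae_convergent a \<gamma> f" if "\<gamma> \<le> 1" "f \<in> L2" for f
    using that assms by (intro ae_convergent_L2)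
  \<comment> \<open>At this smoothness the weight exponent is \<open>1/2\<close>, and the stationary
    contribution \<open>u powr (-1/2)\<close> is locally integrable even without help from the
    damping.\<close>
  moreover have "ae_convergent a \<gamma> f" if "f \<in> sobolev (1/4)" for f
    by (rule ae_convergent_sobolev[OF assms(2,1) _ _ _ _ that, of "1/2"]) auto
  ultimately show ?thesis using ne unfolding c_def by blast
qed

end
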